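(* Let $(t',r',\alpha',\beta')$ and $(t'',r'',\alpha'',\beta'')$ be two continuously differentiable solutions of the free boundary problem on $T_\varepsilon$ and let $z',z''$ be the corresponding solutions of the identification equation. With $f'(v):=t'(v,v)$, $g'(v):=r'(v,v)-r_0$, $\alpha'_+(v):=\alpha'(v,v)$, $\beta'_+(v):=\beta'(v,v)$, and likewise for the double primed quantities (primes here are labels, not derivatives), suppose $$z'(v)=vy'(v),\quad f'(v)=v^2\hat f'(v),\quad g'(v)=v^2\hat g'(v),\quad \alpha'_+(v)-\alpha_i(v)=v^2\hat\alpha'_+(v),\quad \beta'_+(v)-\beta_0=v^2\hat\beta'_+(v),$$ $$z''(v)=vy''(v),\quad f''(v)=v^2\hat f''(v),\quad g''(v)=v^2\hat g''(v),\quad \alpha''_+(v)-\alpha_i(v)=v^2\hat\alpha''_+(v),\quad \beta''_+(v)-\beta_0=v^2\hat\beta''_+(v),$$ with $y',y'',\hat f',\hat f'',\hat g',\hat g'',\hat\alpha'_+,\hat\alpha''_+,\hat\beta'_+,\hat\beta''_+\in C^1[0,\varepsilon]$. Let $\hat V',\hat V''$ be given by $$V'(v)=c_{+0}+\tfrac{\kappa}{2}(1+y'(v))v+v^2\hat V'(v),\quad V'(v)=\frac{dg'/dv\,(v)}{df'/dv\,(v)},$$ $$V''(v)=c_{+0}+\tfrac{\kappa}{2}(1+y''(v))v+v^2\hat V''(v),\quad V''(v)=\frac{dg''/dv\,(v)}{df''/dv\,(v)},$$ with $\hat V',\hat V''\in C^0[0,\varepsilon]$. Then, for $\varepsilon$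 sufficiently small, the two solutions coincide.
   Context: Fluid functions. The fluid is barotropic: the pressure $p$ is a smooth, positive, increasing function of the energy density $\rho>0$, with sound speed $\eta=(dp/d\rho)^{1/2}\in(0,1)$. Put $\sigma=\exp\int\frac{d\rho}{\rho+p}$, $\tilde h=\frac{d\rho}{d\sigma}=\frac{\rho+p}{\sigma}$, $\tilde\rho=\int\frac{d\tilde h}{\eta\tilde h}$ (additive constants fixed once and for all); $\rho,p,\eta$ are regarded as smooth functions of $\tilde\rho$. The unknowns $\alpha,\beta$ (Riemann invariants) determine $\tilde\rho=\frac12(\alpha+\beta)$ and the radial fluid velocity $\mathbf v=\tanh\frac{\alpha-\beta}{2}$. As functions of $(\alpha,\beta)$ (and $r>0$): $c_\pm=\frac{\mathbf v\pm\eta}{1\pm\mathbf v\eta}$, $\tilde A=-\frac{2\mathbf v\eta}{r(1+\mathbf v\eta)}$, $\tilde B=-\frac{2\mathbf v\eta}{r(1-\mathbf v\eta)}$, $T^{tt}=\frac{\rho+p}{1-\mathbf v^2}-p$, $T^{tr}=T^{rt}=\frac{(\rho+p)\mathbf v}{1-\mathbf v^2}$, $T^{rr}=\frac{(\rho+p)\mathbf v^2}{1-\mathbf v^2}+p$. State ahead (prior maximal development near a cusp point $O$). In acoustical coordinates $(t,w)$ ($w$ constant along outgoing characteristics), with $O=(0,0)$, the functions $\alpha^\ast,\beta^\ast,r^\ast$ are smooth up to the boundary (all derivatives extend continuously) on a relative neighbourhood of $(0,0)$ in $\{w\le0,\ t\le t_\ast(w)\}\cup\{w\ge0,\ t\le\underline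 t(w)\}$ and satisfy there $\frac{\partial r^\ast}{\partial t}=c_+(\alpha^\ast,\beta^\ast)$, $\frac{\partial\alpha^\ast}{\partial t}=\tilde A(\alpha^\ast,\beta^\ast,r^\ast)$, $\frac{\partial r^\ast}{\partial w}\big(\frac{\partial\beta^\ast}{\partial t}-\tilde B(\alpha^\ast,\beta^\ast,r^\ast)\big)=(c_+-c_-)(\alpha^\ast,\beta^\ast)\frac{\partial\beta^\ast}{\partial w}$. A subscript $0$ denotes evaluation at $O$ (with $c_{\pm0}=c_\pm(\alpha_0,\beta_0)$, $\alpha_0=\alpha^\ast(0,0)$, $\beta_0=\beta^\ast(0,0)$, $r_0=r^\ast(0,0)>0$). It is assumed that $(\partial r^\ast/\partial w)_0=(\partial^2r^\ast/\partial w^2)_0=0$, $\kappa:=(\partial^2r^\ast/\partial w\partial t)_0>0$, $\lambda:=-\kappa(\partial^3r^\ast/\partial w^3)_0>0$. The singular boundary $\mathcal B$ is the curve $t=t_\ast(w)$, $w\le0$, on which $\partial r^\ast/\partial w=0$ (so $t_\ast(w)=\frac{\lambda}{2\kappa^2}w^2+O(w^3)$), while $\partial r^\ast/\partial w<0$ elsewhere in the domain away from $O$. The incoming characteristic $\underline C$ from $O$ is the curve $t=\underline t(w)$, $w\ge0$, with $\frac{d\underline t}{dw}=-\frac{\partial r^\ast/\partial w}{c_+-c_-}$ along it and $\underline t(0)=0$. The data along $\underline C$ are $h(u):=\underline t(u)$ and $\alpha_i(u):=\alpha^\ast(h(u),u)$. Free boundary problem. $T_\varepsilon=\{(u,v):0\le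 v\le u\le\varepsilon\}$. A continuously differentiable solution of the free boundary problem consists of $C^1$ functions $(t,r,\alpha,\beta)$ on $T_\varepsilon$ together with a function $z$ on $[0,\varepsilon]$ such that: (1) $\partial_v\alpha=\partial_vt\,\tilde A(\alpha,\beta,r)$, $\partial_u\beta=\partial_ut\,\tilde B(\alpha,\beta,r)$, $\partial_vr=\partial_vt\,c_+(\alpha,\beta)$, $\partial_ur=\partial_ut\,c_-(\alpha,\beta)$ in $T_\varepsilon$; (2) $t(u,0)=h(u)$, $\alpha(u,0)=\alpha_i(u)$, $r(0,0)=r_0$, $\beta(0,0)=\beta_0$; (3) with $f(v)=t(v,v)$, $g(v)=r(v,v)-r_0$, the identification equation $g(v)+r_0=r^\ast(f(v),z(v))$ holds; (4) with $\alpha_+(v)=\alpha(v,v)$, $\beta_+(v)=\beta(v,v)$, $\alpha_-(v)=\alpha^\ast(f(v),z(v))$, $\beta_-(v)=\beta^\ast(f(v),z(v))$ and $[T^{\mu\nu}]=T^{\mu\nu}(\alpha_+,\beta_+)-T^{\mu\nu}(\alpha_-,\beta_-)$, the jump conditions $[T^{tt}]V=[T^{tr}]$, $[T^{tr}]V=[T^{rr}]$ hold, where $V$ is determined by $\frac{df}{dv}V=\frac{dg}{dv}$; (5) the shock curve lies in the past of $\mathcal B$: $z(v)<0$ and $f(v)<t_\ast(z(v))$ for $v\in(0,\varepsilon]$. *)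

theory Defs
  imports "HOL-Analysis.Analysis" "HOL-Library.Landau_Symbols"
begin

section \<open>Differentiability up to the boundary\<close>

definition pd_fst :: "(real \<times> real \<Rightarrow> real) \<Rightarrow> real \<times> real \<Rightarrow> real" where
  "pd_fst f = (\<lambda>(x, y). deriv (\<lambda>s. f (s, y)) x)"

definition pd_snd :: "(real \<times> real \<Rightarrow> real) \<Rightarrow> real \<times> real \<Rightarrow> real" where
  "pd_snd f = (\<lambda>(x, y). deriv (\<lambda>s. f (x, s)) y)"

definition pd :: "nat \<Rightarrow> nat \<Rightarrow> (real \<times> real \<Rightarrow> real) \<Rightarrow> real \<times> real \<Rightarrow> real" where
  "pd i j f = (pd_fst ^^ i) ((pd_snd ^^ j) f)"

text \<open>
  \<open>C_upto k S f\<close>: \<open>f\<close> is continuous on \<open>S\<close>, of class \<open>C^k\<close> in the interior of \<open>S\<close>, and all its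
  partial derivatives of order at most \<open>k\<close> extend continuously to \<open>S\<close>.  The order of
  differentiation is immaterial by Young's theorem, since all \<open>pd i j f\<close> with \<open>i + j < k\<close> are
  (Frechet) differentiable.
\<close>
definition C_upto :: "nat \<Rightarrow> (real \<times> real) set \<Rightarrow> (real \<times> real \<Rightarrow> real) \<Rightarrow> bool" where
  "C_upto k S f \<longleftrightarrow>
     continuous_on S f \<and>
     (\<forall>i j. i + j < k \<longrightarrow> pd i j f differentiable_on interior S) \<and>
     (\<forall>i j. i + j \<le> k \<longrightarrow> (\<exists>g. continuous_on S g \<and> (\<forall>x\<in>interior S. g x = pd i j f x)))"

definition smooth_upto :: "(real \<times> real) set \<Rightarrow> (real \<times> real \<Rightarrow> real) \<Rightarrow> bool" where
  "smooth_upto S f \<longleftrightarrow> (\<forall>k. C_upto k S f)"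

text \<open>
  The value at \<open>x \<in> S\<close>, possibly a boundary point, of the continuous extension of a partial
  derivative from the interior of \<open>S\<close>.
\<close>
definition bpd :: "(real \<times> real) set \<Rightarrow> nat \<Rightarrow> nat \<Rightarrow> (real \<times> real \<Rightarrow> real) \<Rightarrow> real \<times> real \<Rightarrow> real" where
  "bpd S i j f x = Lim (at x within interior S) (pd i j f)"

text \<open>Class \<open>C^1\<close> on the closed interval \<open>[0, \<epsilon>]\<close>, with one-sided derivatives at the end points.\<close>
definition C1_interval :: "real \<Rightarrow> (real \<Rightarrow> real) \<Rightarrow> bool" where
  "C1_interval \<epsilon> f \<longleftrightarrow>
     (\<exists>D. continuous_on {0..\<epsilon>} D \<and>
          (\<forall>v\<in>{0..\<epsilon>}. (f has_real_derivative D v) (at v within {0..\<epsilon>})))"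


section \<open>The fluid\<close>

text \<open>
  \<open>pressure\<close>, \<open>sigma\<close> and \<open>rtilde\<close> are functions of the energy density \<open>\<rho> > 0\<close>.  The additive
  constants in the indefinite integrals defining \<open>sigma\<close> and \<open>rtilde\<close> are arbitrary but fixed
  by the choice of these two functions.
\<close>
record fluid =
  pressure :: "real \<Rightarrow> real"
  sigma :: "real \<Rightarrow> real"
  rtilde :: "real \<Rightarrow> real"

definition sound_speed :: "fluid \<Rightarrow> real \<Rightarrow> real" where
  "sound_speed F \<rho> = sqrt (deriv (pressure F) \<rho>)"

definition htilde :: "fluid \<Rightarrow> real \<Rightarrow> real" where
  "htilde F \<rho> = (\<rho> + pressure F \<rho>) / sigma F \<rho>"

definition barotropic :: "fluid \<Rightarrow> bool" where
  "barotropic F \<longleftrightarrow>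
     (\<forall>k. (deriv ^^ k) (pressure F) differentiable_on {0<..}) \<and>
     strict_mono_on {0<..} (pressure F) \<and>
     (\<forall>\<rho>>0. pressure F \<rho> > 0 \<and> 0 < sound_speed F \<rho> \<and> sound_speed F \<rho> < 1) \<and>
     (\<exists>I. \<forall>\<rho>>0. (I has_real_derivative 1 / (\<rho> + pressure F \<rho>)) (at \<rho>) \<and>
                 sigma F \<rho> = exp (I \<rho>)) \<and>
     (\<forall>\<rho>>0. (rtilde F has_real_derivative
               deriv (htilde F) \<rho> / (sound_speed F \<rho> * htilde F \<rho>)) (at \<rho>))"

text \<open>
  The Riemann invariants determine the fluid state only if \<open>(\<alpha> + \<beta>) / 2\<close> is a value of
  \<open>rtilde\<close>, whose range need not be all of \<open>\<real>\<close>; the radius has to be positive.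
\<close>
definition admissible :: "fluid \<Rightarrow> real \<Rightarrow> real \<Rightarrow> real \<Rightarrow> bool" where
  "admissible F \<alpha> \<beta> r \<longleftrightarrow> (\<alpha> + \<beta>) / 2 \<in> rtilde F ` {0<..} \<and> 0 < r"

definition density :: "fluid \<Rightarrow> real \<Rightarrow> real \<Rightarrow> real" where
  "density F \<alpha> \<beta> = the_inv_into {0<..} (rtilde F) ((\<alpha> + \<beta>) / 2)"

definition press :: "fluid \<Rightarrow> real \<Rightarrow> real \<Rightarrow> real" where
  "press F \<alpha> \<beta> = pressure F (density F \<alpha> \<beta>)"

definition eta :: "fluid \<Rightarrow> real \<Rightarrow> real \<Rightarrow> real" where
  "eta F \<alpha> \<beta> = sound_speed F (density F \<alpha> \<beta>)"

definition vel :: "real \<Rightarrow> real \<Rightarrow> real" where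
  "vel \<alpha> \<beta> = tanh ((\<alpha> - \<beta>) / 2)"

definition c_plus :: "fluid \<Rightarrow> real \<Rightarrow> real \<Rightarrow> real" where
  "c_plus F \<alpha> \<beta> = (vel \<alpha> \<beta> + eta F \<alpha> \<beta>) / (1 + vel \<alpha> \<beta> * eta F \<alpha> \<beta>)"

definition c_minus :: "fluid \<Rightarrow> real \<Rightarrow> real \<Rightarrow> real" where
  "c_minus F \<alpha> \<beta> = (vel \<alpha> \<beta> - eta F \<alpha> \<beta>) / (1 - vel \<alpha> \<beta> * eta F \<alpha> \<beta>)"

definition A_tilde :: "fluid \<Rightarrow> real \<Rightarrow> real \<Rightarrow> real \<Rightarrow> real" where
  "A_tilde F \<alpha> \<beta> r = - (2 * vel \<alpha> \<beta> * eta F \<alpha> \<beta>) / (r * (1 + vel \<alpha> \<beta> * eta F \<alpha> \<beta>))"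

definition B_tilde :: "fluid \<Rightarrow> real \<Rightarrow> real \<Rightarrow> real \<Rightarrow> real" where
  "B_tilde F \<alpha> \<beta> r = - (2 * vel \<alpha> \<beta> * eta F \<alpha> \<beta>) / (r * (1 - vel \<alpha> \<beta> * eta F \<alpha> \<beta>))"

definition T_tt :: "fluid \<Rightarrow> real \<Rightarrow> real \<Rightarrow> real" where
  "T_tt F \<alpha> \<beta> = (density F \<alpha> \<beta> + press F \<alpha> \<beta>) / (1 - (vel \<alpha> \<beta>)\<^sup>2) - press F \<alpha> \<beta>"

definition T_tr :: "fluid \<Rightarrow> real \<Rightarrow> real \<Rightarrow> real" where
  "T_tr F \<alpha> \<beta> = (density F \<alpha> \<beta> + press F \<alpha> \<beta>) * vel \<alpha> \<beta> / (1 - (vel \<alpha> \<beta>)\<^sup>2)"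

definition T_rr :: "fluid \<Rightarrow> real \<Rightarrow> real \<Rightarrow> real" where
  "T_rr F \<alpha> \<beta> =
     (density F \<alpha> \<beta> + press F \<alpha> \<beta>) * (vel \<alpha> \<beta>)\<^sup>2 / (1 - (vel \<alpha> \<beta>)\<^sup>2) + press F \<alpha> \<beta>"


section \<open>The state ahead\<close>

text \<open>
  Points are pairs \<open>(t, w)\<close>.  \<open>t_sing\<close> and \<open>t_char\<close> describe the singular boundary (\<open>w \<le> 0\<close>) and
  the incoming characteristic from the cusp point (\<open>w \<ge> 0\<close>).  The relative neighbourhood of the
  origin on which the state ahead is given is cut out by a square of half-width \<open>width\<close>.
\<close>
record ahead =
  alpha_ah :: "real \<times> real \<Rightarrow> real"
  beta_ah :: "real \<times> real \<Rightarrow> real"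
  r_ah :: "real \<times> real \<Rightarrow> real"
  t_sing :: "real \<Rightarrow> real"
  t_char :: "real \<Rightarrow> real"
  width :: real

definition dom_ah :: "ahead \<Rightarrow> (real \<times> real) set" where
  "dom_ah A =
     ({(t, w). w \<le> 0 \<and> t \<le> t_sing A w} \<union> {(t, w). 0 \<le> w \<and> t \<le> t_char A w})
     \<inter> {- width A <..< width A} \<times> {- width A <..< width A}"

definition alpha0 :: "ahead \<Rightarrow> real" where "alpha0 A = alpha_ah A (0, 0)"
definition beta0 :: "ahead \<Rightarrow> real" where "beta0 A = beta_ah A (0, 0)"
definition r0 :: "ahead \<Rightarrow> real" where "r0 A = r_ah A (0, 0)"

definition kappa :: "ahead \<Rightarrow> real" where
  "kappa A = bpd (dom_ah A) 1 1 (r_ah A) (0, 0)"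

definition lam :: "ahead \<Rightarrow> real" where
  "lam A = - kappa A * bpd (dom_ah A) 0 3 (r_ah A) (0, 0)"

definition alpha_i :: "ahead \<Rightarrow> real \<Rightarrow> real" where
  "alpha_i A u = alpha_ah A (t_char A u, u)"

text \<open>
  The curve \<open>t_char\<close> is an integral curve of \<open>dt/dw = - (\<partial>r/\<partial>w) / (c_plus - c_minus)\<close>, with one-sided
  derivative at the cusp point.  The asymptotic form of \<open>t_sing\<close> is forced by \<open>\<partial>r/\<partial>w = 0\<close> on the
  singular boundary and the values of the derivatives at the cusp point.
\<close>
definition state_ahead :: "fluid \<Rightarrow> ahead \<Rightarrow> bool" where
  "state_ahead F A \<longleftrightarrow>
    (let N = dom_ah A; a = alpha_ah A; b = beta_ah A; r = r_ah A;
         cp = (\<lambda>x. c_plus F (a x) (b x)); cm = (\<lambda>x. c_minus F (a x) (b x)) in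
     0 < width A \<and>
     smooth_upto N a \<and> smooth_upto N b \<and> smooth_upto N r \<and>
     (\<forall>x\<in>N. admissible F (a x) (b x) (r x)) \<and>
     (\<forall>x\<in>N. bpd N 1 0 r x = cp x \<and>
            bpd N 1 0 a x = A_tilde F (a x) (b x) (r x) \<and>
            bpd N 0 1 r x * (bpd N 1 0 b x - B_tilde F (a x) (b x) (r x))
              = (cp x - cm x) * bpd N 0 1 b x) \<and>
     bpd N 0 1 r (0, 0) = 0 \<and> bpd N 0 2 r (0, 0) = 0 \<and> 0 < kappa A \<and> 0 < lam A \<and>
     t_sing A 0 = 0 \<and> continuous_on {- width A <.. 0} (t_sing A) \<and>
     (\<lambda>w. t_sing A w - lam A / (2 * (kappa A)\<^sup>2) * w\<^sup>2) \<in> O[at_left 0](\<lambda>w. w ^ 3) \<and>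
     (\<forall>w\<le>0. (t_sing A w, w) \<in> N \<longrightarrow> bpd N 0 1 r (t_sing A w, w) = 0) \<and>
     (\<forall>(t, w)\<in>N. \<not> (w \<le> 0 \<and> t = t_sing A w) \<longrightarrow> bpd N 0 1 r (t, w) < 0) \<and>
     t_char A 0 = 0 \<and> continuous_on {0 ..< width A} (t_char A) \<and>
     (\<forall>w\<ge>0. (t_char A w, w) \<in> N \<longrightarrow>
        (t_char A has_real_derivative
           - bpd N 0 1 r (t_char A w, w) / (cp (t_char A w, w) - cm (t_char A w, w)))
        (at w within {0 ..< width A})))"


section \<open>The free boundary problem\<close>

definition T_dom :: "real \<Rightarrow> (real \<times> real) set" where
  "T_dom \<epsilon> = {(u, v). 0 \<le> v \<and> v \<le> u \<and> u \<le> \<epsilon>}"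

text \<open>
  Derivative on \<open>[0, \<epsilon>]\<close> (one-sided at the end points) of the restriction of a function on the
  triangle to the diagonal.
\<close>
definition diag_deriv :: "real \<Rightarrow> (real \<times> real \<Rightarrow> real) \<Rightarrow> real \<Rightarrow> real" where
  "diag_deriv \<epsilon> q v = vector_derivative (\<lambda>s. q (s, s)) (at v within {0..\<epsilon>})"

definition jump ::
  "(real \<Rightarrow> real \<Rightarrow> real) \<Rightarrow> ahead \<Rightarrow> (real \<times> real \<Rightarrow> real) \<Rightarrow> (real \<times> real \<Rightarrow> real) \<Rightarrow>
   (real \<times> real \<Rightarrow> real) \<Rightarrow> (real \<Rightarrow> real) \<Rightarrow> real \<Rightarrow> real" where
  "jump T A t \<alpha> \<beta> z v =
     T (\<alpha> (v, v)) (\<beta> (v, v)) - T (alpha_ah A (t (v, v), z v)) (beta_ah A (t (v, v), z v))"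

text \<open>
  The memberships in \<open>dom_ah A\<close> and the admissibility conditions say that all functions are
  evaluated inside their domains of definition.  Points of the triangle are pairs \<open>(u, v)\<close>.
\<close>
definition fb_solution ::
  "fluid \<Rightarrow> ahead \<Rightarrow> real \<Rightarrow> (real \<times> real \<Rightarrow> real) \<Rightarrow> (real \<times> real \<Rightarrow> real) \<Rightarrow>
   (real \<times> real \<Rightarrow> real) \<Rightarrow> (real \<times> real \<Rightarrow> real) \<Rightarrow> (real \<Rightarrow> real) \<Rightarrow> bool" where
  "fb_solution F A \<epsilon> t r \<alpha> \<beta> z \<longleftrightarrow>
    (let T = T_dom \<epsilon>; du = bpd T 1 0; dv = bpd T 0 1 in
     C_upto 1 T t \<and> C_upto 1 T r \<and> C_upto 1 T \<alpha> \<and> C_upto 1 T \<beta> \<and>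
     (\<forall>x\<in>T. admissible F (\<alpha> x) (\<beta> x) (r x)) \<and>
     (\<forall>x\<in>T. dv \<alpha> x = dv t x * A_tilde F (\<alpha> x) (\<beta> x) (r x) \<and>
            du \<beta> x = du t x * B_tilde F (\<alpha> x) (\<beta> x) (r x) \<and>
            dv r x = dv t x * c_plus F (\<alpha> x) (\<beta> x) \<and>
            du r x = du t x * c_minus F (\<alpha> x) (\<beta> x)) \<and>
     (\<forall>u\<in>{0..\<epsilon>}. (t_char A u, u) \<in> dom_ah A \<and>
                 t (u, 0) = t_char A u \<and> \<alpha> (u, 0) = alpha_i A u) \<and>
     r (0, 0) = r0 A \<and> \<beta> (0, 0) = beta0 A \<and>
     (\<forall>v\<in>{0..\<epsilon>}. (t (v, v), z v) \<in> dom_ah A \<and> r (v, v) = r_ah A (t (v, v), z v)) \<and>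
     (\<forall>v\<in>{0..\<epsilon>}. \<exists>V. diag_deriv \<epsilon> t v * V = diag_deriv \<epsilon> r v \<and>
        jump (T_tt F) A t \<alpha> \<beta> z v * V = jump (T_tr F) A t \<alpha> \<beta> z v \<and>
        jump (T_tr F) A t \<alpha> \<beta> z v * V = jump (T_rr F) A t \<alpha> \<beta> z v) \<and>
     (\<forall>v\<in>{0<..\<epsilon>}. z v < 0 \<and> t (v, v) < t_sing A (z v)))"

text \<open>
  The form of a solution near the cusp point, with \<open>f v = t (v, v)\<close> and \<open>g v = r (v, v) - r0\<close>.
  The shock speed is the quotient of the derivatives of \<open>g\<close> and \<open>f\<close>, which is of the form \<open>0/0\<close> at
  \<open>v = 0\<close>; hence its expansion is required for \<open>v > 0\<close> only, with \<open>Vh\<close> continuous up to \<open>v = 0\<close>.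
\<close>
definition cusp_expansion ::
  "fluid \<Rightarrow> ahead \<Rightarrow> real \<Rightarrow> (real \<times> real \<Rightarrow> real) \<Rightarrow> (real \<times> real \<Rightarrow> real) \<Rightarrow>
   (real \<times> real \<Rightarrow> real) \<Rightarrow> (real \<times> real \<Rightarrow> real) \<Rightarrow> (real \<Rightarrow> real) \<Rightarrow>
   (real \<Rightarrow> real) \<Rightarrow> (real \<Rightarrow> real) \<Rightarrow> (real \<Rightarrow> real) \<Rightarrow> (real \<Rightarrow> real) \<Rightarrow> (real \<Rightarrow> real) \<Rightarrow>
   (real \<Rightarrow> real) \<Rightarrow> bool" where
  "cusp_expansion F A \<epsilon> t r \<alpha> \<beta> z y fh gh \<alpha>h \<beta>h Vh \<longleftrightarrow>
     C1_interval \<epsilon> y \<and> C1_interval \<epsilon> fh \<and> C1_interval \<epsilon> gh \<and>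
     C1_interval \<epsilon> \<alpha>h \<and> C1_interval \<epsilon> \<beta>h \<and> continuous_on {0..\<epsilon>} Vh \<and>
     (\<forall>v\<in>{0..\<epsilon>}.
        z v = v * y v \<and>
        t (v, v) = v\<^sup>2 * fh v \<and>
        r (v, v) - r0 A = v\<^sup>2 * gh v \<and>
        \<alpha> (v, v) - alpha_i A v = v\<^sup>2 * \<alpha>h v \<and>
        \<beta> (v, v) - beta0 A = v\<^sup>2 * \<beta>h v) \<and>
     (\<forall>v\<in>{0<..\<epsilon>}.
        diag_deriv \<epsilon> t v \<noteq> 0 \<and>
        diag_deriv \<epsilon> r v / diag_deriv \<epsilon> t v =
          c_plus F (alpha0 A) (beta0 A) + kappa A / 2 * (1 + y v) * v + v\<^sup>2 * Vh v)"

end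

theory Submission
  imports Defs
begin

text \<open>
  The two solutions are compared in the supremum norm only.  For two solutions of \<open>dx = c dt\<close>, which is the
  form of each of the transport equations and, with the shock speed \<open>V\<close> for \<open>c\<close>, of the motion of the shock,
  the combination \<open>\<Delta>x - c \<Delta>t\<close> can be estimated without differentiating the differences \<open>\<Delta>x\<close>, \<open>\<Delta>t\<close>.

  The expansions of a single solution at the cusp point force \<open>z = - v + o(v)\<close> and
  \<open>f = lambda / (6 kappa\<^sup>2) v\<^sup>2 + o(v\<^sup>2)\<close>.  If \<open>|\<Delta>f| \<le> m v\<^sup>2\<close> along the shock, the transport equations bound all
  differences on \<open>T_s\<close> by a multiple of \<open>m s\<^sup>2\<close>, and the identification equation gives
  \<open>|\<Delta>z| \<le> (6 kappa\<^sup>2 / lambda + o(1)) |\<Delta>f| / v\<close>.  To first order the shock speed is \<open>c_plus\<close> at the average of the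
  two states adjacent to the shock, so \<open>|\<Delta>V| \<le> (kappa / 2 + o(1)) |\<Delta>z|\<close> up to terms of higher order.
  Integrating \<open>\<Delta>g - V \<Delta>f\<close> along the shock and using \<open>c_plus - V = (1 + o(1)) kappa v\<close> there yields
  \<open>|\<Delta>f| \<le> (1/3 + o(1)) m v\<^sup>2\<close>, and hence \<open>m = 0\<close>.
\<close>

section \<open>Strict differentiability\<close>

text \<open>The factor 1/3 is decided by leading coefficients alone. Across the shock
  \<open>c_plus\<close> differs by 2 kappa v, and ahead of it |dr/dw| is kappa times the distance
  (1/2 - 1/6) lambda / kappa^2 v^2 from the singular boundary; their quotient is the 6 kappa^2 /
  (lambda v) in \<Delta>z. Times kappa / 2 for the speed and times df/dv = lambda / (3 kappa^2) v
  this makes \<Delta>V df/dv of size kappa m v^2, whose integral kappa m v^3 / 3 is divided by kappa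
  v. Everything else has to be o(1) relative to these terms. The obstacle is regularity: solutions
  are only C^1, the state ahead is differentiable in an open region only, and the cusp point is on
  its boundary. Strict derivatives at that single point are suited to this: they control increments
  between any two nearby points with arbitrarily small relative error, are stable under composition,
  and survive the passage to boundary curves. The weight v^2 is natural since f = v^2
  \<open>fh\<close>; the best m is the maximum of |\<open>fh1\<close> - \<open>fh2\<close>|, and it
  cannot hide at v = 0 because the leading coefficient is the same for all solutions.\<close>

definition strict_deriv ::
  "('a::real_normed_vector \<Rightarrow> 'b::real_normed_vector) \<Rightarrow> ('a \<Rightarrow> 'b) \<Rightarrow> 'a \<Rightarrow> 'a set \<Rightarrow> bool" where
  "strict_deriv f f' x S \<longleftrightarrow> bounded_linear f' \<and>
     (\<forall>e>0. \<exists>d>0. \<forall>y\<in>S. \<forall>z\<in>S. norm (y - x) < d \<longrightarrow> norm (z - x) < d \<longrightarrow>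
        norm (f y - f z - f' (y - z)) \<le> e * norm (y - z))"

lemma strict_derivD:
  assumes "strict_deriv f f' x S" "0 < e"
  obtains d where "0 < d" "\<And>y z. y \<in> S \<Longrightarrow> z \<in> S \<Longrightarrow> norm (y - x) < d \<Longrightarrow> norm (z - x) < d \<Longrightarrow>
    norm (f y - f z - f' (y - z)) \<le> e * norm (y - z)"
  using assms unfolding strict_deriv_def by metis

lemma strict_deriv_linear: "strict_deriv f f' x S \<Longrightarrow> bounded_linear f'"
  by (simp add: strict_deriv_def)

lemma strict_deriv_mono:
  assumes "strict_deriv f f' x S" "T \<subseteq> S"
  shows "strict_deriv f f' x T"
  using assms unfolding strict_deriv_def by (meson subset_iff)

lemma strict_deriv_cong:
  assumes "strict_deriv f f' x S" and r: "0 < r" "\<And>y. y \<in> S \<Longrightarrow> norm (y - x) < r \<Longrightarrow> f y = g y"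
  shows "strict_deriv g f' x S"
  unfolding strict_deriv_def
proof (intro conjI allI impI)
  show "bounded_linear f'" using assms by (simp add: strict_deriv_def)
next
  fix e :: real assume "0 < e"
  then obtain d where "0 < d" and d: "\<And>y z. y \<in> S \<Longrightarrow> z \<in> S \<Longrightarrow> norm (y - x) < d \<Longrightarrow> norm (z - x) < d \<Longrightarrow>
    norm (f y - f z - f' (y - z)) \<le> e * norm (y - z)"
    using strict_derivD[OF assms(1)] by metis
  show "\<exists>d>0. \<forall>y\<in>S. \<forall>z\<in>S. norm (y - x) < d \<longrightarrow> norm (z - x) < d \<longrightarrow>
        norm (g y - g z - f' (y - z)) \<le> e * norm (y - z)"
  proof (intro exI[of _ "min d r"] conjI ballI impI)
    fix y z assume "y \<in> S" "z \<in> S" "norm (y - x) < min d r" "norm (z - x) < min d r"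
    then show "norm (g y - g z - f' (y - z)) \<le> e * norm (y - z)"
      using d[of y z] r(2)[of y] r(2)[of z] by simp
  qed (use \<open>0 < d\<close> r in auto)
qed

lemma strict_deriv_eq_deriv:
  "strict_deriv f f' x S \<Longrightarrow> (\<And>h. f' h = g' h) \<Longrightarrow> strict_deriv f g' x S"
  by (metis ext)

lemma strict_deriv_bounded_linear:
  "bounded_linear f \<Longrightarrow> strict_deriv f f x S"
  unfolding strict_deriv_def
  by (auto simp: bounded_linear.linear linear_diff intro: exI[of _ 1])

lemma strict_deriv_const: "strict_deriv (\<lambda>x. c) (\<lambda>h. 0) x S"
  unfolding strict_deriv_def by (auto intro: exI[of _ 1])

lemma strict_deriv_lipschitz:
  assumes "strict_deriv f f' x S"
  obtains d L where "0 < d" "0 < L"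
    "\<And>y z. y \<in> S \<Longrightarrow> z \<in> S \<Longrightarrow> norm (y - x) < d \<Longrightarrow> norm (z - x) < d \<Longrightarrow>
      norm (f y - f z) \<le> L * norm (y - z)"
proof -
  obtain K where K: "0 < K" "\<And>h. norm (f' h) \<le> norm h * K"
    using bounded_linear.pos_bounded[OF strict_deriv_linear[OF assms]] by blast
  obtain d where d: "0 < d" "\<And>y z. y \<in> S \<Longrightarrow> z \<in> S \<Longrightarrow> norm (y - x) < d \<Longrightarrow> norm (z - x) < d \<Longrightarrow>
    norm (f y - f z - f' (y - z)) \<le> 1 * norm (y - z)"
    using strict_derivD[OF assms, of 1] by auto
  have "norm (f y - f z) \<le> (K + 1) * norm (y - z)"
    if "y \<in> S" "z \<in> S" "norm (y - x) < d" "norm (z - x) < d" for y z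
    using d(2)[OF that] K(2)[of "y - z"] norm_triangle_sub[of "f y - f z" "f' (y - z)"]
    by (simp add: algebra_simps)
  with that[of d "K + 1"] d(1) K(1) show thesis by auto
qed

lemma strict_deriv_continuous:
  assumes "strict_deriv f f' x S" "x \<in> S" "0 < e"
  obtains d where "0 < d" "\<And>y. y \<in> S \<Longrightarrow> norm (y - x) < d \<Longrightarrow> norm (f y - f x) < e"
proof -
  obtain d L where *: "0 < d" "0 < L"
    "\<And>y z. y \<in> S \<Longrightarrow> z \<in> S \<Longrightarrow> norm (y - x) < d \<Longrightarrow> norm (z - x) < d \<Longrightarrow>
      norm (f y - f z) \<le> L * norm (y - z)"
    using strict_deriv_lipschitz[OF assms(1)] by metis
  have "norm (f y - f x) < e" if "y \<in> S" "norm (y - x) < min d (e / L)" for y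
  proof -
    have "norm (f y - f x) \<le> L * norm (y - x)"
      using *(3)[of y x] that assms(2) *(1) by auto
    also have "\<dots> < e" using that *(2) by (simp add: field_simps)
    finally show ?thesis .
  qed
  with that[of "min d (e / L)"] * assms(3) show thesis by auto
qed

lemma strict_deriv_tendsto:
  assumes "strict_deriv f f' x S" "x \<in> S"
  shows "(f \<longlongrightarrow> f x) (at x within S)"
  unfolding tendsto_iff eventually_at dist_norm
  by (metis assms strict_deriv_continuous)

lemma strict_deriv_has_derivative:
  assumes "strict_deriv f f' x S" "x \<in> S"
  shows "(f has_derivative f') (at x within S)"
  unfolding has_derivative_within_alt
proof (intro conjI allI impI)
  show "bounded_linear f'" using assms by (simp add: strict_deriv_def)
next
  fix e :: real assume "0 < e"
  then show "\<exists>d>0. \<forall>y\<in>S. norm (y - x) < d \<longrightarrow> norm (f y - f x - f' (y - x)) \<le> e * norm (y - x)"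
    using strict_derivD[OF assms(1)] assms(2) by (metis norm_zero diff_self)
qed

text \<open>Stated with a limit \<open>y0\<close> in place of \<open>f x\<close>, so that the base
  point may lie outside \<open>S\<close>: in \<open>kappa_alpha\<close> it is the cusp point and
  \<open>S\<close> an open square touching it. The error splits into that of \<open>g\<close>,
  multiplied by the Lipschitz constant of \<open>f\<close>, and \<open>g'\<close> applied to the
  error of \<open>f\<close>.\<close>

lemma strict_deriv_compose_lim:
  assumes g: "strict_deriv g g' y0 UNIV" and f: "strict_deriv f f' x S"
    and lim: "\<And>e. 0 < e \<Longrightarrow> \<exists>d>0. \<forall>y\<in>S. norm (y - x) < d \<longrightarrow> norm (f y - y0) < e"
  shows "strict_deriv (\<lambda>y. g (f y)) (\<lambda>h. g' (f' h)) x S"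
  unfolding strict_deriv_def
proof (intro conjI allI impI)
  show "bounded_linear (\<lambda>h. g' (f' h))"
    using bounded_linear_compose strict_deriv_linear[OF g] strict_deriv_linear[OF f] by blast
next
  fix e :: real assume e: "0 < e"
  obtain K where K: "0 < K" "\<And>h. norm (g' h) \<le> norm h * K"
    using bounded_linear.pos_bounded[OF strict_deriv_linear[OF g]] by blast
  obtain d1 L where L: "0 < d1" "0 < L" "\<And>y z. y \<in> S \<Longrightarrow> z \<in> S \<Longrightarrow> norm (y - x) < d1 \<Longrightarrow>
      norm (z - x) < d1 \<Longrightarrow> norm (f y - f z) \<le> L * norm (y - z)"
    using strict_deriv_lipschitz[OF f] by metis
  have "0 < e / (2 * L)" "0 < e / (2 * K)" using e L K by auto
  obtain d2 where d2: "0 < d2" "\<And>y z. norm (y - y0) < d2 \<Longrightarrow> norm (z - y0) < d2 \<Longrightarrow>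
    norm (g y - g z - g' (y - z)) \<le> e / (2 * L) * norm (y - z)"
    using strict_derivD[OF g \<open>0 < e / (2 * L)\<close>] by (metis UNIV_I)
  obtain d3 where d3: "0 < d3" "\<And>y z. y \<in> S \<Longrightarrow> z \<in> S \<Longrightarrow> norm (y - x) < d3 \<Longrightarrow> norm (z - x) < d3 \<Longrightarrow>
    norm (f y - f z - f' (y - z)) \<le> e / (2 * K) * norm (y - z)"
    using strict_derivD[OF f \<open>0 < e / (2 * K)\<close>] by metis
  obtain d4 where d4: "0 < d4" "\<And>y. y \<in> S \<Longrightarrow> norm (y - x) < d4 \<Longrightarrow> norm (f y - y0) < d2"
    using lim[OF d2(1)] by metis
  have "norm (g (f y) - g (f z) - g' (f' (y - z))) \<le> e * norm (y - z)"
    if yz: "y \<in> S" "z \<in> S" "norm (y - x) < min d1 (min d3 d4)" "norm (z - x) < min d1 (min d3 d4)"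
    for y z
  proof -
    have lin: "g' (f y - f z) - g' (f' (y - z)) = g' (f y - f z - f' (y - z))"
      using strict_deriv_linear[OF g] by (simp add: bounded_linear.linear linear_diff)
    have "norm (g (f y) - g (f z) - g' (f y - f z)) \<le> e / (2 * L) * norm (f y - f z)"
      using d2(2) d4(2) yz by auto
    also have "\<dots> \<le> e / (2 * L) * (L * norm (y - z))"
      using L(3)[of y z] yz e L(2) by (intro mult_left_mono) auto
    also have "\<dots> = e / 2 * norm (y - z)" using L(2) by simp
    finally have 1: "norm (g (f y) - g (f z) - g' (f y - f z)) \<le> e / 2 * norm (y - z)" .
    have "norm (g' (f y - f z - f' (y - z))) \<le> e / (2 * K) * norm (y - z) * K"
      using K d3(2)[of y z] yz by (smt (verit) min_less_iff_conj mult_right_mono)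
    also have "\<dots> = e / 2 * norm (y - z)" using K(1) by simp
    finally have 2: "norm (g' (f y - f z - f' (y - z))) \<le> e / 2 * norm (y - z)" .
    have "g (f y) - g (f z) - g' (f' (y - z)) =
      (g (f y) - g (f z) - g' (f y - f z)) + g' (f y - f z - f' (y - z))"
      using lin by (simp add: algebra_simps)
    then show ?thesis using 1 2 norm_triangle_ineq
      by (smt (verit) field_sum_of_halves mult.commute distrib_left)
  qed
  then show "\<exists>d>0. \<forall>y\<in>S. \<forall>z\<in>S. norm (y - x) < d \<longrightarrow> norm (z - x) < d \<longrightarrow>
        norm (g (f y) - g (f z) - g' (f' (y - z))) \<le> e * norm (y - z)"
    using L(1) d3(1) d4(1) by (intro exI[of _ "min d1 (min d3 d4)"]) auto
qed

lemma strict_deriv_compose: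
  assumes g: "strict_deriv g g' (f x) UNIV" and f: "strict_deriv f f' x S" and "x \<in> S"
  shows "strict_deriv (\<lambda>y. g (f y)) (\<lambda>h. g' (f' h)) x S"
  using strict_deriv_continuous[OF f \<open>x \<in> S\<close>] by (intro strict_deriv_compose_lim[OF g f]) metis

lemma strict_deriv_Pair:
  assumes f: "strict_deriv f f' x S" and g: "strict_deriv g g' x S"
  shows "strict_deriv (\<lambda>y. (f y, g y)) (\<lambda>h. (f' h, g' h)) x S"
  unfolding strict_deriv_def
proof (intro conjI allI impI)
  show "bounded_linear (\<lambda>h. (f' h, g' h))"
    using bounded_linear_Pair strict_deriv_linear[OF g] strict_deriv_linear[OF f] by blast
next
  fix e :: real assume e: "0 < e"
  then have "0 < e / 2" by simp
  obtain d1 where d1: "0 < d1" "\<And>y z. y \<in> S \<Longrightarrow> z \<in> S \<Longrightarrow> norm (y - x) < d1 \<Longrightarrow> norm (z - x) < d1 \<Longrightarrow>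
    norm (f y - f z - f' (y - z)) \<le> e / 2 * norm (y - z)"
    using strict_derivD[OF f \<open>0 < e / 2\<close>] by metis
  obtain d2 where d2: "0 < d2" "\<And>y z. y \<in> S \<Longrightarrow> z \<in> S \<Longrightarrow> norm (y - x) < d2 \<Longrightarrow> norm (z - x) < d2 \<Longrightarrow>
    norm (g y - g z - g' (y - z)) \<le> e / 2 * norm (y - z)"
    using strict_derivD[OF g \<open>0 < e / 2\<close>] by metis
  have "norm ((f y, g y) - (f z, g z) - (f' (y - z), g' (y - z))) \<le> e * norm (y - z)"
    if "y \<in> S" "z \<in> S" "norm (y - x) < min d1 d2" "norm (z - x) < min d1 d2" for y z
    using d1(2)[of y z] d2(2)[of y z] that norm_Pair_le[of "f y - f z - f' (y - z)" "g y - g z - g' (y - z)"]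
    by (auto simp: )
  then show "\<exists>d>0. \<forall>y\<in>S. \<forall>z\<in>S. norm (y - x) < d \<longrightarrow> norm (z - x) < d \<longrightarrow>
        norm ((f y, g y) - (f z, g z) - (f' (y - z), g' (y - z))) \<le> e * norm (y - z)"
    using d1(1) d2(1) by (intro exI[of _ "min d1 d2"]) auto
qed

lemma strict_deriv_add:
  fixes f g :: "'a::real_normed_vector \<Rightarrow> 'b::real_normed_vector"
  assumes "strict_deriv f f' x S" "strict_deriv g g' x S" "x \<in> S"
  shows "strict_deriv (\<lambda>y. f y + g y) (\<lambda>h. f' h + g' h) x S"
  using strict_deriv_compose[of "\<lambda>p. fst p + snd p" "\<lambda>p. fst p + snd p" "\<lambda>y. (f y, g y)",
      OF strict_deriv_bounded_linear strict_deriv_Pair[OF assms(1,2)] assms(3)]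
  by (simp add: bounded_linear_add bounded_linear_fst bounded_linear_snd)

lemma strict_deriv_diff:
  fixes f g :: "'a::real_normed_vector \<Rightarrow> 'b::real_normed_vector"
  assumes "strict_deriv f f' x S" "strict_deriv g g' x S" "x \<in> S"
  shows "strict_deriv (\<lambda>y. f y - g y) (\<lambda>h. f' h - g' h) x S"
  using strict_deriv_compose[of "\<lambda>p. fst p - snd p" "\<lambda>p. fst p - snd p" "\<lambda>y. (f y, g y)",
      OF strict_deriv_bounded_linear strict_deriv_Pair[OF assms(1,2)] assms(3)]
  by (simp add: bounded_linear_sub bounded_linear_fst bounded_linear_snd)

lemma strict_deriv_mult_pair:
  fixes p :: "real \<times> real"
  shows "strict_deriv (\<lambda>q. fst q * snd q) (\<lambda>h. fst p * snd h + fst h * snd p) p UNIV"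
  unfolding strict_deriv_def
proof (intro conjI allI impI)
  show "bounded_linear (\<lambda>h. fst p * snd h + fst h * snd p)"
    by (intro bounded_linear_add bounded_linear_const_mult bounded_linear_mult_const
        bounded_linear_fst bounded_linear_snd)
next
  fix e :: real assume e: "0 < e"
  have "norm (fst y * snd y - fst z * snd z - (fst p * snd (y - z) + fst (y - z) * snd p))
      \<le> e * norm (y - z)"
    if "norm (y - p) < e / 2" "norm (z - p) < e / 2" for y z
  proof -
    have 0: "\<bar>fst (y - p)\<bar> < e / 2" "\<bar>snd (z - p)\<bar> < e / 2"
      using le_less_trans[OF norm_fst_le[of "fst (y - p)" "snd (y - p)"]]
        le_less_trans[OF norm_snd_le[of "snd (z - p)" "fst (z - p)"]] that
      unfolding prod.collapse real_norm_def by blast+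
    \<comment> \<open>The remainder is bilinear: in each summand one factor is bounded by a distance
      to \<open>p\<close>, the other by the increment.\<close>
    have "fst y * snd y - fst z * snd z - (fst p * snd (y - z) + fst (y - z) * snd p) =
      fst (y - p) * snd (y - z) + fst (y - z) * snd (z - p)"
      by (simp add: algebra_simps)
    also have "norm \<dots> \<le> \<bar>fst (y - p)\<bar> * \<bar>snd (y - z)\<bar> + \<bar>fst (y - z)\<bar> * \<bar>snd (z - p)\<bar>"
      by (metis abs_mult abs_triangle_ineq real_norm_def)
    also have "\<dots> \<le> e / 2 * norm (y - z) + norm (y - z) * (e / 2)"
    proof -
      have "\<bar>fst (y - z)\<bar> \<le> norm (y - z)" "\<bar>snd (y - z)\<bar> \<le> norm (y - z)"
        using norm_fst_le[of "fst (y - z)" "snd (y - z)"] norm_snd_le[of "snd (y - z)" "fst (y - z)"]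
        unfolding prod.collapse real_norm_def by blast+
      then show ?thesis using 0 e by (intro add_mono mult_mono) auto
    qed
    finally show ?thesis by simp
  qed
  then show "\<exists>d>0. \<forall>y\<in>UNIV. \<forall>z\<in>UNIV. norm (y - p) < d \<longrightarrow> norm (z - p) < d \<longrightarrow>
    norm (fst y * snd y - fst z * snd z - (fst p * snd (y - z) + fst (y - z) * snd p)) \<le> e * norm (y - z)"
    using e by (intro exI[of _ "e / 2"]) auto
qed

lemma strict_deriv_mult:
  fixes f g :: "'a::real_normed_vector \<Rightarrow> real"
  assumes "strict_deriv f f' x S" "strict_deriv g g' x S" "x \<in> S"
  shows "strict_deriv (\<lambda>y. f y * g y) (\<lambda>h. f x * g' h + f' h * g x) x S"
  using strict_deriv_compose[OF strict_deriv_mult_pair[of "(f x, g x)"] strict_deriv_Pair[OF assms(1,2)] assms(3)]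
  by simp

text \<open>The mean value inequality is applied to \<open>f\<close> minus its linear part at
  \<open>x\<close>, whose derivative is small near \<open>x\<close> by continuity of
  \<open>f'\<close> at this one point. Working within \<open>I\<close> covers one-sided derivatives
  at an end point.\<close>

lemma strict_deriv_real:
  fixes f :: "real \<Rightarrow> real"
  assumes "convex I" and d: "\<And>x. x \<in> I \<Longrightarrow> (f has_real_derivative f' x) (at x within I)"
    and "continuous (at x within I) f'"
  shows "strict_deriv f (\<lambda>h. f' x * h) x I"
  unfolding strict_deriv_def
proof (intro conjI allI impI)
  show "bounded_linear (\<lambda>h. f' x * h)" by (rule bounded_linear_mult_right)
next
  fix e :: real assume e: "0 < e"
  then obtain \<delta> where \<delta>: "0 < \<delta>" "\<And>y. y \<in> I \<Longrightarrow> dist y x < \<delta> \<Longrightarrow> dist (f' y) (f' x) < e"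
    using assms(3) unfolding continuous_within_eps_delta by metis
  have "norm (f y - f z - f' x * (y - z)) \<le> e * norm (y - z)"
    if "y \<in> I" "z \<in> I" "norm (y - x) < \<delta>" "norm (z - x) < \<delta>" for y z
  proof -
    have "norm ((f y - f' x * y) - (f z - f' x * z)) \<le> e * norm (y - z)"
    proof (rule field_differentiable_bound[where S = "I \<inter> ball x \<delta>" and f' = "\<lambda>w. f' w - f' x"])
      show "convex (I \<inter> ball x \<delta>)" using assms(1) by (intro convex_Int) auto
      fix w assume w: "w \<in> I \<inter> ball x \<delta>"
      have "(f has_real_derivative f' w) (at w within I \<inter> ball x \<delta>)"
        using d[of w] w DERIV_subset by blast
      then show "((\<lambda>w. f w - f' x * w) has_field_derivative f' w - f' x) (at w within I \<inter> ball x \<delta>)"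
        by (auto intro!: derivative_eq_intros)
      show "norm (f' w - f' x) \<le> e" using \<delta>(2)[of w] w by (simp add: dist_commute dist_real_def)
    qed (use that in \<open>auto simp: dist_norm norm_minus_commute\<close>)
    then show ?thesis by (simp add: algebra_simps)
  qed
  then show "\<exists>d>0. \<forall>y\<in>I. \<forall>z\<in>I. norm (y - x) < d \<longrightarrow> norm (z - x) < d \<longrightarrow>
        norm (f y - f z - f' x * (y - z)) \<le> e * norm (y - z)"
    using \<delta>(1) by (intro exI[of _ \<delta>]) auto
qed

lemma strict_deriv_realI:
  fixes f :: "real \<Rightarrow> real"
  assumes "open I" "x \<in> I" and d: "\<And>x. x \<in> I \<Longrightarrow> (f has_real_derivative f' x) (at x)"
    and "isCont f' x"
  shows "strict_deriv f (\<lambda>h. f' x * h) x UNIV"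
proof -
  obtain r where r: "0 < r" "ball x r \<subseteq> I" using assms(1,2) openE by blast
  have s: "strict_deriv f (\<lambda>h. f' x * h) x (ball x r)"
  proof (rule strict_deriv_real)
    fix w assume "w \<in> ball x r"
    then have "w \<in> I" using r(2) by blast
    then show "(f has_real_derivative f' w) (at w within ball x r)"
      using d has_field_derivative_at_within by blast
  next
    show "continuous (at x within ball x r) f'"
      using assms(4) by (rule continuous_at_imp_continuous_at_within)
  qed (rule convex_ball)
  show ?thesis unfolding strict_deriv_def
  proof (intro conjI allI impI)
    fix e :: real assume "0 < e"
    then obtain d where "0 < d" and d: "\<And>y z. y \<in> ball x r \<Longrightarrow> z \<in> ball x r \<Longrightarrow> norm (y - x) < d \<Longrightarrow> norm (z - x) < d \<Longrightarrow>
      norm (f y - f z - f' x * (y - z)) \<le> e * norm (y - z)"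
      using strict_derivD[OF s] by metis
    then show "\<exists>d>0. \<forall>y\<in>UNIV. \<forall>z\<in>UNIV. norm (y - x) < d \<longrightarrow> norm (z - x) < d \<longrightarrow>
        norm (f y - f z - f' x * (y - z)) \<le> e * norm (y - z)"
      using r(1) by (intro exI[of _ "min d r"]) (auto simp: dist_norm norm_minus_commute)
  qed (rule bounded_linear_mult_right)
qed

lemma strict_deriv_real_compose:
  fixes \<phi> :: "real \<Rightarrow> real" and f :: "'a::real_normed_vector \<Rightarrow> real"
  assumes "open I" "f x \<in> I" "\<And>y. y \<in> I \<Longrightarrow> (\<phi> has_real_derivative \<phi>' y) (at y)" "isCont \<phi>' (f x)"
    "strict_deriv f f' x S" "x \<in> S"
  shows "strict_deriv (\<lambda>y. \<phi> (f y)) (\<lambda>h. \<phi>' (f x) * f' h) x S"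
  using strict_deriv_compose[OF strict_deriv_realI[OF assms(1-4)] assms(5,6)] .

lemma strict_deriv_inverse:
  fixes f :: "'a::real_normed_vector \<Rightarrow> real"
  assumes "strict_deriv f f' x S" "x \<in> S" "f x \<noteq> 0"
  shows "strict_deriv (\<lambda>y. inverse (f y)) (\<lambda>h. - (inverse (f x) ^ 2) * f' h) x S"
  by (rule strict_deriv_real_compose[where I = "- {0}"])
    (use assms in \<open>auto intro!: derivative_eq_intros continuous_intros simp: power2_eq_square\<close>)

lemma strict_deriv_divide:
  fixes f g :: "'a::real_normed_vector \<Rightarrow> real"
  assumes "strict_deriv f f' x S" "strict_deriv g g' x S" "x \<in> S" "g x \<noteq> 0"
  shows "strict_deriv (\<lambda>y. f y / g y) (\<lambda>h. f x * (- (inverse (g x) ^ 2) * g' h) + f' h * inverse (g x)) x S"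
  using strict_deriv_mult[OF assms(1) strict_deriv_inverse[OF assms(2-4)] assms(3)]
  by (simp add: divide_inverse)

lemma strict_deriv_exp:
  fixes f :: "'a::real_normed_vector \<Rightarrow> real"
  assumes "strict_deriv f f' x S" "x \<in> S"
  shows "strict_deriv (\<lambda>y. exp (f y)) (\<lambda>h. exp (f x) * f' h) x S"
  by (rule strict_deriv_real_compose[where I = UNIV])
    (use assms in \<open>auto intro!: derivative_eq_intros continuous_intros\<close>)

lemma strict_deriv_sqrt:
  fixes f :: "'a::real_normed_vector \<Rightarrow> real"
  assumes "strict_deriv f f' x S" "x \<in> S" "0 < f x"
  shows "strict_deriv (\<lambda>y. sqrt (f y)) (\<lambda>h. inverse (sqrt (f x)) / 2 * f' h) x S"
  by (rule strict_deriv_real_compose[where I = "{0<..}"])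
    (use assms in \<open>auto intro!: derivative_eq_intros continuous_intros DERIV_real_sqrt\<close>)

lemma strict_deriv_unique:
  assumes "strict_deriv f f' x UNIV" "strict_deriv f f'' x UNIV"
  shows "f' = f''"
  using assms strict_deriv_has_derivative has_derivative_unique by blast

section \<open>A mean value inequality\<close>

text \<open>Only local bounds of the difference quotient are used, so \<open>w\<close> need not be differentiable.\<close>
lemma local_bound_imp_bound:
  fixes w G G' :: "real \<Rightarrow> real"
  assumes "a \<le> b"
    and G: "\<And>x. x \<in> {a..b} \<Longrightarrow> (G has_real_derivative G' x) (at x within {a..b})"
    and w: "\<And>x e. x \<in> {a..b} \<Longrightarrow> 0 < e \<Longrightarrow>
      \<exists>d>0. \<forall>y\<in>{a..b}. \<bar>y - x\<bar> < d \<longrightarrow> \<bar>w y - w x\<bar> \<le> (G' x + e) * \<bar>y - x\<bar>"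
  shows "\<bar>w b - w a\<bar> \<le> G b - G a"
proof -
  have "\<bar>w b - w a\<bar> \<le> G b - G a + e * (b - a)" if e: "0 < e" for e
  proof -
   have "a \<le> a \<longrightarrow> b \<le> b \<longrightarrow> \<bar>w b - w a\<bar> \<le> G b - G a + e * (b - a)"
   \<comment> \<open>With the slack \<open>e\<close> the bound is additive over adjacent intervals,
     so bisection reduces it to short intervals around a point \<open>x\<close>, where it is
     assembled from the pieces to the right and to the left of \<open>x\<close>.\<close>
   proof (rule Bolzano[where P = "\<lambda>p q. a \<le> p \<longrightarrow> q \<le> b \<longrightarrow> \<bar>w q - w p\<bar> \<le> G q - G p + e * (q - p)", OF \<open>a \<le> b\<close>], intro impI)
    fix p q r assume "a \<le> p \<longrightarrow> q \<le> b \<longrightarrow> \<bar>w q - w p\<bar> \<le> G q - G p + e * (q - p)"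
      "a \<le> q \<longrightarrow> r \<le> b \<longrightarrow> \<bar>w r - w q\<bar> \<le> G r - G q + e * (r - q)" "p \<le> q" "q \<le> r" "a \<le> p" "r \<le> b"
    then have "\<bar>w q - w p\<bar> \<le> G q - G p + e * (q - p)" "\<bar>w r - w q\<bar> \<le> G r - G q + e * (r - q)"
      by auto
    moreover have "e * (r - p) = e * (q - p) + e * (r - q)" by (simp add: algebra_simps)
    ultimately show "\<bar>w r - w p\<bar> \<le> G r - G p + e * (r - p)" by linarith
   next
    fix x assume x: "a \<le> x" "x \<le> b"
    have "0 < e / 2" using e by simp
    obtain d1 where d1: "0 < d1" "\<And>y. y \<in> {a..b} \<Longrightarrow> \<bar>y - x\<bar> < d1 \<Longrightarrow> \<bar>w y - w x\<bar> \<le> (G' x + e / 2) * \<bar>y - x\<bar>"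
      using w[of x "e / 2"] x e by auto
    have "(G has_derivative (*) (G' x)) (at x within {a..b})"
      using G[of x] x by (simp add: has_field_derivative_def)
    then obtain d2 where d2: "0 < d2" "\<And>y. y \<in> {a..b} \<Longrightarrow> \<bar>y - x\<bar> < d2 \<Longrightarrow>
       \<bar>G y - G x - G' x * (y - x)\<bar> \<le> e / 2 * \<bar>y - x\<bar>"
      using \<open>0 < e / 2\<close> unfolding has_derivative_within_alt real_norm_def by metis
    have r: "\<bar>w q - w x\<bar> \<le> G q - G x + e * (q - x)" if "x \<le> q" "q \<le> b" "q - x < min d1 d2" for q
    proof -
      have eq: "\<bar>q - x\<bar> = q - x" using that by simp
      have "\<bar>w q - w x\<bar> \<le> (G' x + e / 2) * (q - x)" using d1(2)[of q] that x eq by auto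
      moreover have "\<bar>G q - G x - G' x * (q - x)\<bar> \<le> e / 2 * (q - x)" using d2(2)[of q] that x eq by auto
      moreover have "(G' x + e / 2) * (q - x) = G' x * (q - x) + e / 2 * (q - x)" "e * (q - x) = e / 2 * (q - x) + e / 2 * (q - x)"
        by (simp_all add: algebra_simps)
      ultimately show ?thesis by linarith
    qed
    have l: "\<bar>w x - w q\<bar> \<le> G x - G q + e * (x - q)" if "q \<le> x" "a \<le> q" "x - q < min d1 d2" for q
    proof -
      have eq: "\<bar>q - x\<bar> = x - q" using that by simp
      have "\<bar>w q - w x\<bar> \<le> (G' x + e / 2) * (x - q)" using d1(2)[of q] that x eq by auto
      moreover have "\<bar>G q - G x - G' x * (q - x)\<bar> \<le> e / 2 * (x - q)" using d2(2)[of q] that x eq by auto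
      moreover have "(G' x + e / 2) * (x - q) = - (G' x * (q - x)) + e / 2 * (x - q)" "e * (x - q) = e / 2 * (x - q) + e / 2 * (x - q)"
        by (simp_all add: algebra_simps)
      ultimately show ?thesis by linarith
    qed
    have "\<bar>w q - w p\<bar> \<le> G q - G p + e * (q - p)"
      if "a \<le> p" "p \<le> x" "x \<le> q" "q \<le> b" "q - p < min d1 d2" for p q
    proof -
      have "e * (q - p) = e * (q - x) + e * (x - p)" by (simp add: algebra_simps)
      then show ?thesis using r[of q] l[of p] that by linarith
    qed
    then show "\<exists>d>0. \<forall>p q. p \<le> x \<and> x \<le> q \<and> q - p < d \<longrightarrow> a \<le> p \<longrightarrow> q \<le> b \<longrightarrow> \<bar>w q - w p\<bar> \<le> G q - G p + e * (q - p)"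
      using d1(1) d2(1) by (intro exI[of _ "min d1 d2"]) auto
   qed
   then show ?thesis by simp
  qed
  then have *: "\<bar>w b - w a\<bar> - (G b - G a) \<le> e * (b - a)" if "0 < e" for e
    using that by fastforce
  have "\<bar>w b - w a\<bar> - (G b - G a) \<le> 0 + e" if "0 < e" for e
  proof -
    have "e / (1 + (b - a)) * (b - a) \<le> e" using that assms(1) by (simp add: field_simps)
    then show ?thesis using *[of "e / (1 + (b - a))"] that assms(1) by auto
  qed
  then show ?thesis using field_le_epsilon[of "\<bar>w b - w a\<bar> - (G b - G a)" 0] by auto
qed

text \<open>
  The difference of two solutions of \<open>dx = c dt\<close> satisfies \<open>d(\<Delta>x - c1 \<Delta>t) = \<Delta>c dt2 - \<Delta>t dc1\<close>, in which no
  derivative of a difference occurs.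
\<close>
lemma transport_bound:
  fixes x1 x2 t1 t2 c1 c2 G :: "real \<Rightarrow> real"
  assumes "a \<le> b"
    and t1: "\<And>s. s \<in> {a..b} \<Longrightarrow> (t1 has_real_derivative t1' s) (at s within {a..b})"
    and t2: "\<And>s. s \<in> {a..b} \<Longrightarrow> (t2 has_real_derivative t2' s) (at s within {a..b})"
    and x1: "\<And>s. s \<in> {a..b} \<Longrightarrow> (x1 has_real_derivative c1 s * t1' s) (at s within {a..b})"
    and x2: "\<And>s. s \<in> {a..b} \<Longrightarrow> (x2 has_real_derivative c2 s * t2' s) (at s within {a..b})"
    and L: "\<And>s s'. s \<in> {a..b} \<Longrightarrow> s' \<in> {a..b} \<Longrightarrow> \<bar>c1 s' - c1 s\<bar> \<le> L * \<bar>s' - s\<bar>"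
    and G: "\<And>s. s \<in> {a..b} \<Longrightarrow> (G has_real_derivative G' s) (at s within {a..b})"
    and bd: "\<And>s. s \<in> {a..b} \<Longrightarrow> \<bar>c1 s - c2 s\<bar> * \<bar>t2' s\<bar> + L * \<bar>t1 s - t2 s\<bar> \<le> G' s"
  shows "\<bar>(x1 b - x2 b - c1 b * (t1 b - t2 b)) - (x1 a - x2 a - c1 a * (t1 a - t2 a))\<bar> \<le> G b - G a"
proof (rule local_bound_imp_bound[OF \<open>a \<le> b\<close> G])
  fix s e :: real assume s: "s \<in> {a..b}" and e: "0 < e"
  define L' where "L' = \<bar>L\<bar> + 1"
  have L': "L' > 0" "L \<le> L'" by (auto simp: L'_def)
  \<comment> \<open>With the speed frozen at \<open>s\<close> the combination is differentiable at
    \<open>s\<close>, with derivative \<open>k\<close>. The change of \<open>c1\<close>, which is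
    only Lipschitz, multiplies \<open>t1 - t2\<close> and costs \<open>L\<close> times its
    size.\<close>
  define k where "k = (c1 s - c2 s) * t2' s"
  have "((\<lambda>y. x1 y - x2 y - c1 s * (t1 y - t2 y)) has_real_derivative k) (at s within {a..b})"
    unfolding k_def by (auto intro!: derivative_eq_intros t1 t2 x1 x2 s simp: algebra_simps)
  then have D: "((\<lambda>y. x1 y - x2 y - c1 s * (t1 y - t2 y)) has_derivative (*) k) (at s within {a..b})"
    by (simp add: has_field_derivative_def)
  obtain d1 where d1: "0 < d1" "\<And>y. y \<in> {a..b} \<Longrightarrow> \<bar>y - s\<bar> < d1 \<Longrightarrow>
      \<bar>x1 y - x2 y - c1 s * (t1 y - t2 y) - (x1 s - x2 s - c1 s * (t1 s - t2 s)) - k * (y - s)\<bar> \<le> e / 2 * \<bar>y - s\<bar>"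
    using D e unfolding has_derivative_within_alt real_norm_def by (metis half_gt_zero)
  have "continuous (at s within {a..b}) (\<lambda>y. t1 y - t2 y)"
    using t1[OF s] t2[OF s] by (intro continuous_intros) (auto intro: DERIV_continuous)
  then obtain d2 where d2: "0 < d2" "\<And>y. y \<in> {a..b} \<Longrightarrow> \<bar>y - s\<bar> < d2 \<Longrightarrow>
      \<bar>(t1 y - t2 y) - (t1 s - t2 s)\<bar> < e / (2 * L')"
    using e L' unfolding continuous_within_eps_delta dist_real_def by (metis divide_pos_pos zero_less_mult_iff zero_less_numeral)
  have "\<bar>(x1 y - x2 y - c1 y * (t1 y - t2 y)) - (x1 s - x2 s - c1 s * (t1 s - t2 s))\<bar> \<le> (G' s + e) * \<bar>y - s\<bar>"
    if y: "y \<in> {a..b}" "\<bar>y - s\<bar> < min d1 d2" for y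
  proof -
    define T where "T = \<bar>t1 s - t2 s\<bar>"
    have "\<bar>(c1 y - c1 s) * (t1 y - t2 y)\<bar> = \<bar>c1 y - c1 s\<bar> * \<bar>t1 y - t2 y\<bar>"
      by (simp add: abs_mult)
    also have "\<dots> \<le> (L * \<bar>y - s\<bar>) * (T + e / (2 * L'))"
      using L[OF s, of y] d2(2)[of y] y unfolding T_def by (intro mult_mono) auto
    also have "\<dots> = (L * T + L / L' * (e / 2)) * \<bar>y - s\<bar>" by (simp add: algebra_simps)
    also have "\<dots> \<le> (L * T + e / 2) * \<bar>y - s\<bar>"
    proof -
      have "L / L' * (e / 2) \<le> 1 * (e / 2)" using L' e by (intro mult_right_mono) auto
      then show ?thesis by (intro mult_right_mono) auto
    qed
    finally have 1: "\<bar>(c1 y - c1 s) * (t1 y - t2 y)\<bar> \<le> (L * T + e / 2) * \<bar>y - s\<bar>" .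
    have 2: "\<bar>k * (y - s)\<bar> = \<bar>c1 s - c2 s\<bar> * \<bar>t2' s\<bar> * \<bar>y - s\<bar>"
      by (simp add: k_def abs_mult)
    have 3: "(\<bar>c1 s - c2 s\<bar> * \<bar>t2' s\<bar> + L * T) * \<bar>y - s\<bar> \<le> G' s * \<bar>y - s\<bar>"
      using bd[OF s] unfolding T_def by (intro mult_right_mono) auto
    have 4: "\<bar>x1 y - x2 y - c1 s * (t1 y - t2 y) - (x1 s - x2 s - c1 s * (t1 s - t2 s)) - k * (y - s)\<bar> \<le> e / 2 * \<bar>y - s\<bar>"
      using d1(2) y by auto
    have "(x1 y - x2 y - c1 y * (t1 y - t2 y)) - (x1 s - x2 s - c1 s * (t1 s - t2 s)) =
      (x1 y - x2 y - c1 s * (t1 y - t2 y) - (x1 s - x2 s - c1 s * (t1 s - t2 s)) - k * (y - s))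
      + k * (y - s) - (c1 y - c1 s) * (t1 y - t2 y)" by (simp add: algebra_simps)
    also have "\<bar>\<dots>\<bar> \<le> e / 2 * \<bar>y - s\<bar> + \<bar>c1 s - c2 s\<bar> * \<bar>t2' s\<bar> * \<bar>y - s\<bar> + (L * T + e / 2) * \<bar>y - s\<bar>"
    proof -
      have tri: "\<bar>p + q - r\<bar> \<le> \<bar>p\<bar> + \<bar>q\<bar> + \<bar>r\<bar>" for p q r :: real by linarith
      show ?thesis by (rule order_trans[OF tri add_mono[OF add_mono[OF 4 eq_refl[OF 2]] 1]])
    qed
    also have "\<dots> = (\<bar>c1 s - c2 s\<bar> * \<bar>t2' s\<bar> + L * T) * \<bar>y - s\<bar> + e * \<bar>y - s\<bar>"
      by (simp add: algebra_simps)
    also have "\<dots> \<le> (G' s + e) * \<bar>y - s\<bar>" using 3 by (simp add: algebra_simps)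
    finally show ?thesis .
  qed
  then show "\<exists>d>0. \<forall>y\<in>{a..b}. \<bar>y - s\<bar> < d \<longrightarrow>
     \<bar>(x1 y - x2 y - c1 y * (t1 y - t2 y)) - (x1 s - x2 s - c1 s * (t1 s - t2 s))\<bar> \<le> (G' s + e) * \<bar>y - s\<bar>"
    using d1(1) d2(1) by (intro exI[of _ "min d1 d2"]) auto
qed

section \<open>Averages over segments: difference quotients that stay regular on the
  diagonal\<close>

definition avg :: "(real \<Rightarrow> real) \<Rightarrow> real \<Rightarrow> real \<Rightarrow> real" where
  "avg \<phi> x y = integral {0..1} (\<lambda>s. \<phi> (y + s * (x - y)))"

lemma convex_real_between:
  fixes x y s :: real
  assumes "convex I" "x \<in> I" "y \<in> I" "0 \<le> s" "s \<le> 1"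
  shows "y + s * (x - y) \<in> I"
proof -
  have "y + s * (x - y) = (1 - s) *\<^sub>R y + s *\<^sub>R x" by (simp add: algebra_simps)
  then show ?thesis using convexD_alt[OF assms(1,3,2,4,5)] by simp
qed

lemma avg_integrand_continuous:
  fixes \<phi> :: "real \<Rightarrow> real"
  assumes "convex I" "continuous_on I \<phi>" "x \<in> I" "y \<in> I"
  shows "continuous_on {0..1} (\<lambda>s. \<phi> (y + s * (x - y)))"
  by (rule continuous_on_compose2[OF assms(2)])
    (auto intro!: continuous_intros convex_real_between assms)

lemma avg_same [simp]: "avg \<phi> x x = \<phi> x"
  by (simp add: avg_def)

lemma avg_pos:
  fixes \<phi> :: "real \<Rightarrow> real"
  assumes "convex I" "continuous_on I \<phi>" "x \<in> I" "y \<in> I" and pos: "\<And>x. x \<in> I \<Longrightarrow> 0 < \<phi> x"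
  shows "0 < avg \<phi> x y"
proof -
  have c: "continuous_on {0..1} (\<lambda>s. \<phi> (y + s * (x - y)))"
    by (rule avg_integrand_continuous[OF assms(1-4)])
  obtain s0 where s0: "s0 \<in> {0..1}" "\<And>s. s \<in> {0..1} \<Longrightarrow> \<phi> (y + s0 * (x - y)) \<le> \<phi> (y + s * (x - y))"
    using continuous_attains_inf[OF compact_Icc _ c] by auto
  have "0 < \<phi> (y + s0 * (x - y))"
    using s0(1) by (intro pos convex_real_between assms) auto
  also have "\<dots> = integral {0..1} (\<lambda>s::real. \<phi> (y + s0 * (x - y)))" by simp
  also have "\<dots> \<le> avg \<phi> x y"
    unfolding avg_def using s0(2) c by (intro integral_le integrable_continuous_real) auto
  finally show ?thesis .
qed

lemma avg_diff:
  fixes \<phi> \<psi> :: "real \<Rightarrow> real"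
  assumes "convex I" "continuous_on I \<phi>" "continuous_on I \<psi>" "x \<in> I" "y \<in> I"
  shows "avg (\<lambda>z. \<phi> z - \<psi> z) x y = avg \<phi> x y - avg \<psi> x y"
  unfolding avg_def using assms
  by (intro integral_diff integrable_continuous_real avg_integrand_continuous)

lemma avg_quotient:
  assumes I: "convex I" "open I" and d: "\<And>x. x \<in> I \<Longrightarrow> (\<phi> has_real_derivative \<phi>' x) (at x)"
    and c: "continuous_on I \<phi>'" and xy: "x \<in> I" "y \<in> I"
  shows "\<phi> x - \<phi> y = avg \<phi>' x y * (x - y)"
proof -
  have "((\<lambda>s. \<phi>' (y + s * (x - y)) * (x - y)) has_integral
      (\<phi> (y + 1 * (x - y)) - \<phi> (y + 0 * (x - y)))) {0..1}"
  proof (rule fundamental_theorem_of_calculus)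
    fix s :: real assume "s \<in> {0..1}"
    then have "y + s * (x - y) \<in> I" using convex_real_between I(1) xy by auto
    then have "(\<phi> has_real_derivative \<phi>' (y + s * (x - y))) (at (y + s * (x - y)))" by (rule d)
    moreover have "((\<lambda>s. y + s * (x - y)) has_real_derivative (x - y)) (at s within {0..1})"
      by (auto intro!: derivative_eq_intros)
    ultimately have "((\<lambda>s. \<phi> (y + s * (x - y))) has_real_derivative \<phi>' (y + s * (x - y)) * (x - y)) (at s within {0..1})"
      by (rule DERIV_chain2)
    then show "((\<lambda>s. \<phi> (y + s * (x - y))) has_vector_derivative \<phi>' (y + s * (x - y)) * (x - y)) (at s within {0..1})"
      by (simp add: has_real_derivative_iff_has_vector_derivative)
  qed simp
  from integral_unique[OF this]
  have "integral {0..1} (\<lambda>s. \<phi>' (y + s * (x - y)) * (x - y)) = \<phi> x - \<phi> y"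
    by simp
  then show ?thesis by (simp add: avg_def)
qed

lemma norm_components_less:
  fixes p :: "real \<times> real"
  assumes "norm (p - q) < c"
  shows "\<bar>fst p - fst q\<bar> < c" "\<bar>snd p - snd q\<bar> < c"
proof -
  have "p - q = (fst p - fst q, snd p - snd q)" by (simp add: prod_eq_iff)
  then show "\<bar>fst p - fst q\<bar> < c" "\<bar>snd p - snd q\<bar> < c"
    using assms le_less_trans[OF norm_fst_le[of "fst p - fst q" "snd p - snd q"]]
      le_less_trans[OF norm_snd_le[of "snd p - snd q" "fst p - fst q"]]
    by simp_all
qed

text \<open>Both end points get weight 1/2, the mean of \<open>s\<close> and of \<open>1 - s\<close>
  over the unit interval. The remainder of \<phi> has to be bounded between \<open>zp s\<close> and
  \<open>zq s\<close>, two points that in general both differ from \<open>x0\<close>; this is what a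
  strict derivative provides.\<close>

lemma strict_deriv_avg:
  assumes I: "convex I" "open I" "x0 \<in> I" and c: "continuous_on I \<phi>"
    and \<phi>: "strict_deriv \<phi> (\<lambda>h. k * h) x0 UNIV"
  shows "strict_deriv (\<lambda>p. avg \<phi> (fst p) (snd p)) (\<lambda>h. k * (fst h + snd h) / 2) (x0, x0) UNIV"
  unfolding strict_deriv_def
proof (intro conjI allI impI)
  show "bounded_linear (\<lambda>h. k * (fst h + snd h) / 2)"
    by (intro bounded_linear_const_mult bounded_linear_add bounded_linear_divide[THEN bounded_linear_compose]
        bounded_linear_fst bounded_linear_snd)
next
  fix e :: real assume e: "0 < e"
  obtain d where d: "0 < d" "\<And>y z. norm (y - x0) < d \<Longrightarrow> norm (z - x0) < d \<Longrightarrow> norm (\<phi> y - \<phi> z - k * (y - z)) \<le> e * norm (y - z)"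
    using strict_derivD[OF \<phi> e] by (metis UNIV_I)
  obtain r where r: "0 < r" "ball x0 r \<subseteq> I" using openE[OF I(2,3)] by blast
  have "norm (avg \<phi> (fst p) (snd p) - avg \<phi> (fst q) (snd q) - k * (fst (p - q) + snd (p - q)) / 2) \<le> e * norm (p - q)"
    if p: "norm (p - (x0, x0)) < min d r" and q: "norm (q - (x0, x0)) < min d r" for p q
  proof -
    have near: "fst p \<in> ball x0 (min d r)" "snd p \<in> ball x0 (min d r)" "fst q \<in> ball x0 (min d r)" "snd q \<in> ball x0 (min d r)"
      using norm_components_less[OF p] norm_components_less[OF q] by (auto simp: dist_real_def)
    have inI: "fst p \<in> I" "snd p \<in> I" "fst q \<in> I" "snd q \<in> I"
      using near r(2) by auto
    define zp where "zp s = snd p + s * (fst p - snd p)" for s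
    define zq where "zq s = snd q + s * (fst q - snd q)" for s
    have cp: "continuous_on {0..1} (\<lambda>s. \<phi> (zp s))" and cq: "continuous_on {0..1} (\<lambda>s. \<phi> (zq s))"
      unfolding zp_def zq_def using avg_integrand_continuous[OF I(1) c] inI by auto
    have cz: "continuous_on {0..1} zp" "continuous_on {0..1} zq"
      unfolding zp_def zq_def by (auto intro!: continuous_intros)
    have lin: "integral {0..1} (\<lambda>s. b + s * (a - b)) = (a + b) / 2" for a b :: real
    proof -
      have "((\<lambda>s. b + s * (a - b)) has_integral ((1 * b + 1\<^sup>2 / 2 * (a - b)) - (0 * b + 0\<^sup>2 / 2 * (a - b)))) {0..1}"
        by (rule fundamental_theorem_of_calculus)
          (auto intro!: derivative_eq_intros simp flip: has_real_derivative_iff_has_vector_derivative)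
      then show ?thesis by (auto dest!: integral_unique simp: field_simps)
    qed
    \<comment> \<open>The linear part is also written as an integral over the two segments, so that
      a single integral of the strict remainder is left.\<close>
    have "avg \<phi> (fst p) (snd p) - avg \<phi> (fst q) (snd q) - k * (fst (p - q) + snd (p - q)) / 2 =
      integral {0..1} (\<lambda>s. \<phi> (zp s)) - integral {0..1} (\<lambda>s. \<phi> (zq s)) - k * (integral {0..1} zp - integral {0..1} zq)"
      unfolding avg_def zp_def zq_def lin by (simp add: algebra_simps add_divide_distrib diff_divide_distrib)
    also have "\<dots> = integral {0..1} (\<lambda>s. \<phi> (zp s) - \<phi> (zq s) - k * (zp s - zq s))"
      using cp cq cz by (simp add: integral_diff integrable_continuous_real continuous_intros)
    also have "norm \<dots> \<le> e * norm (p - q) * (1 - 0)"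
    proof (rule integral_bound)
      show "continuous_on {0..1} (\<lambda>s. \<phi> (zp s) - \<phi> (zq s) - k * (zp s - zq s))"
        using cp cq cz by (intro continuous_intros)
      fix s :: real assume s: "s \<in> {0..1}"
      show "norm (\<phi> (zp s) - \<phi> (zq s) - k * (zp s - zq s)) \<le> e * norm (p - q)"
      proof -
        have "zp s \<in> ball x0 (min d r)" "zq s \<in> ball x0 (min d r)"
          unfolding zp_def zq_def using near s by (auto intro!: convex_real_between convex_ball simp del: mem_ball)
        then have 1: "norm (\<phi> (zp s) - \<phi> (zq s) - k * (zp s - zq s)) \<le> e * norm (zp s - zq s)"
          by (intro d(2)) (auto simp: dist_real_def)
        have "zp s - zq s = (1 - s) * snd (p - q) + s * fst (p - q)"
          by (simp add: zp_def zq_def algebra_simps)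
        also have "\<bar>\<dots>\<bar> \<le> (1 - s) * \<bar>snd (p - q)\<bar> + s * \<bar>fst (p - q)\<bar>"
          using s abs_triangle_ineq[of "(1 - s) * snd (p - q)" "s * fst (p - q)"] by (simp add: abs_mult)
        also have "\<dots> \<le> (1 - s) * norm (p - q) + s * norm (p - q)"
          using s norm_fst_le[of "fst (p - q)" "snd (p - q)"] norm_snd_le[of "snd (p - q)" "fst (p - q)"]
          unfolding prod.collapse real_norm_def by (intro add_mono mult_left_mono) auto
        finally have "norm (zp s - zq s) \<le> norm (p - q)" by (simp add: algebra_simps)
        then show "norm (\<phi> (zp s) - \<phi> (zq s) - k * (zp s - zq s)) \<le> e * norm (p - q)"
          using 1 e by (meson mult_left_mono order_trans less_imp_le)
      qed
    qed simp
    finally show ?thesis by simp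
  qed
  then show "\<exists>d>0. \<forall>y\<in>UNIV. \<forall>z\<in>UNIV. norm (y - (x0, x0)) < d \<longrightarrow> norm (z - (x0, x0)) < d \<longrightarrow>
      norm (avg \<phi> (fst y) (snd y) - avg \<phi> (fst z) (snd z) - k * (fst (y - z) + snd (y - z)) / 2) \<le> e * norm (y - z)"
    using d(1) r(1) by (intro exI[of _ "min d r"]) auto
qed

section \<open>Functions that are smooth up to the boundary of a region\<close>

text \<open>\<open>bpd\<close> is a \<open>Lim\<close>, which carries information only over a
  nontrivial filter. By \<open>lim\<close> every point of \<open>S\<close> is approached from the
  interior, and \<open>Lim\<close> is then the value of the continuous extension.\<close>

lemma bpd_extension:
  assumes C: "C_upto k S \<phi>" and ij: "i + j \<le> k" and lim: "\<And>x. x \<in> S \<Longrightarrow> at x within interior S \<noteq> bot"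
  shows "continuous_on S (bpd S i j \<phi>)" "\<And>x. x \<in> interior S \<Longrightarrow> bpd S i j \<phi> x = pd i j \<phi> x"
proof -
  obtain g where g: "continuous_on S g" "\<And>x. x \<in> interior S \<Longrightarrow> g x = pd i j \<phi> x"
    using C ij unfolding C_upto_def by blast
  have eq: "bpd S i j \<phi> x = g x" if "x \<in> S" for x
  proof -
    have "(g \<longlongrightarrow> g x) (at x within S)" using g(1) that by (simp add: continuous_on_def)
    then have "(g \<longlongrightarrow> g x) (at x within interior S)"
      by (rule tendsto_within_subset) (rule interior_subset)
    moreover have "\<forall>\<^sub>F y in at x within interior S. g y = pd i j \<phi> y"
      using g(2) by (auto simp: eventually_at_filter)
    ultimately have "(pd i j \<phi> \<longlongrightarrow> g x) (at x within interior S)"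
      using Lim_transform_eventually by blast
    then show ?thesis unfolding bpd_def by (intro tendsto_Lim lim that)
  qed
  show "continuous_on S (bpd S i j \<phi>)" using g(1) eq by (simp cong: continuous_on_cong)
  show "bpd S i j \<phi> x = pd i j \<phi> x" if "x \<in> interior S" for x
    using that eq g(2) interior_subset by (metis subsetD)
qed

lemma has_derivative_partials:
  fixes \<phi> :: "real \<times> real \<Rightarrow> real"
  assumes "\<phi> differentiable (at x)"
  shows "(\<phi> has_derivative (\<lambda>h. pd_fst \<phi> x * fst h + pd_snd \<phi> x * snd h)) (at x)"
    "((\<lambda>s. \<phi> (s, snd x)) has_real_derivative pd_fst \<phi> x) (at (fst x))"
    "((\<lambda>s. \<phi> (fst x, s)) has_real_derivative pd_snd \<phi> x) (at (snd x))"
proof -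
  obtain D where D: "(\<phi> has_derivative D) (at x)" using assms by (auto simp: differentiable_def)
  have lin: "linear D" using D by (rule has_derivative_linear)
  have D1: "D (h, 0) = D (1, 0) * h" "D (0, h) = D (0, 1) * h" for h
    using linear_cmul[OF lin, of h "(1, 0)"] linear_cmul[OF lin, of h "(0, 1)"] by auto
  have "((\<lambda>s. (s, snd x)) has_derivative (\<lambda>h. (h, 0))) (at (fst x))"
    by (auto intro!: derivative_eq_intros)
  from has_derivative_compose[OF this, of \<phi> D]
  have "((\<lambda>s. \<phi> (s, snd x)) has_derivative (\<lambda>h. D (h, 0))) (at (fst x))" using D by simp
  moreover have "((\<lambda>s. (fst x, s)) has_derivative (\<lambda>h. (0, h))) (at (snd x))"
    by (auto intro!: derivative_eq_intros)
  from has_derivative_compose[OF this, of \<phi> D]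
  have "((\<lambda>s. \<phi> (fst x, s)) has_derivative (\<lambda>h. D (0, h))) (at (snd x))" using D by simp
  moreover have "(\<lambda>h. D (h, 0)) = (*) (D (1, 0))" "(\<lambda>h. D (0, h)) = (*) (D (0, 1))"
    by (rule ext, rule D1)+
  ultimately have 1: "((\<lambda>s. \<phi> (s, snd x)) has_real_derivative D (1, 0)) (at (fst x))"
    and 2: "((\<lambda>s. \<phi> (fst x, s)) has_real_derivative D (0, 1)) (at (snd x))"
    unfolding has_field_derivative_def by simp_all
  have pd: "pd_fst \<phi> x = D (1, 0)" "pd_snd \<phi> x = D (0, 1)"
    using DERIV_imp_deriv[OF 1] DERIV_imp_deriv[OF 2] by (simp_all add: pd_fst_def pd_snd_def case_prod_unfold)
  have "D h = D (1, 0) * fst h + D (0, 1) * snd h" for h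
    using linear_add[OF lin, of "(fst h, 0)" "(0, snd h)"] D1(1)[of "fst h"] D1(2)[of "snd h"] by simp
  then have "D = (\<lambda>h. pd_fst \<phi> x * fst h + pd_snd \<phi> x * snd h)"
    unfolding pd by (rule ext)
  then show "(\<phi> has_derivative (\<lambda>h. pd_fst \<phi> x * fst h + pd_snd \<phi> x * snd h)) (at x)" using D by simp
  show "((\<lambda>s. \<phi> (s, snd x)) has_real_derivative pd_fst \<phi> x) (at (fst x))"
    "((\<lambda>s. \<phi> (fst x, s)) has_real_derivative pd_snd \<phi> x) (at (snd x))"
    using 1 2 pd by simp_all
qed

lemma C_upto_differentiable:
  assumes "C_upto k S \<phi>" "i + j < k" "x \<in> interior S"
  shows "pd i j \<phi> differentiable (at x)"
  using assms differentiable_on_eq_differentiable_at[OF open_interior] unfolding C_upto_def by blast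

lemma C_upto_has_derivative:
  assumes C: "C_upto k S \<phi>" and k: "1 \<le> k" and lim: "\<And>x. x \<in> S \<Longrightarrow> at x within interior S \<noteq> bot"
    and x: "x \<in> interior S"
  shows "(\<phi> has_derivative (\<lambda>h. bpd S 1 0 \<phi> x * fst h + bpd S 0 1 \<phi> x * snd h)) (at x)"
  using has_derivative_partials(1)[OF C_upto_differentiable[OF C _ x, of 0 0]] k
    bpd_extension(2)[OF C _ lim x, of 1 0] bpd_extension(2)[OF C _ lim x, of 0 1]
  by (simp add: pd_def)

text \<open>In \<open>pd i j\<close> the derivatives in the second variable are taken first. One
  more derivative in the first variable can therefore be put on any \<open>pd i j\<close>, one in
  the second variable only on \<open>pd 0 j\<close>. The single exchange of order needed later is
  made by \<open>mixed_derivatives_eq\<close>.\<close>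

lemma C_upto_has_partial:
  assumes C: "C_upto k S \<phi>" and lim: "\<And>x. x \<in> S \<Longrightarrow> at x within interior S \<noteq> bot"
    and x: "(t, w) \<in> interior S"
  shows "i + j < k \<Longrightarrow> ((\<lambda>s. bpd S i j \<phi> (s, w)) has_real_derivative bpd S (Suc i) j \<phi> (t, w)) (at t)"
    "j < k \<Longrightarrow> ((\<lambda>s. bpd S 0 j \<phi> (t, s)) has_real_derivative bpd S 0 (Suc j) \<phi> (t, w)) (at w)"
proof -
  have nh: "\<forall>\<^sub>F s in nhds t. (s, w) \<in> interior S" "\<forall>\<^sub>F s in nhds w. (t, s) \<in> interior S"
  proof -
    have "((\<lambda>s. (s, w)) \<longlongrightarrow> (t, w)) (nhds t)" "((\<lambda>s. (t, s)) \<longlongrightarrow> (t, w)) (nhds w)"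
      by (intro tendsto_intros filterlim_ident)+
    then show "\<forall>\<^sub>F s in nhds t. (s, w) \<in> interior S" "\<forall>\<^sub>F s in nhds w. (t, s) \<in> interior S"
      using x topological_tendstoD[OF _ open_interior] by blast+
  qed
  show "((\<lambda>s. bpd S i j \<phi> (s, w)) has_real_derivative bpd S (Suc i) j \<phi> (t, w)) (at t)" if "i + j < k"
  proof -
    have eq: "\<forall>\<^sub>F s in nhds t. bpd S i j \<phi> (s, w) = pd i j \<phi> (s, w)"
      using nh(1) by eventually_elim (use bpd_extension(2)[OF C _ lim] that in auto)
    have "((\<lambda>s. pd i j \<phi> (s, w)) has_real_derivative pd (Suc i) j \<phi> (t, w)) (at t)"
      using has_derivative_partials(2)[OF C_upto_differentiable[OF C that x]] by (simp add: pd_def)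
    moreover have "bpd S (Suc i) j \<phi> (t, w) = pd (Suc i) j \<phi> (t, w)"
      using bpd_extension(2)[OF C _ lim x] that by auto
    ultimately show ?thesis using DERIV_cong_ev[OF refl eq refl] by simp
  qed
  show "((\<lambda>s. bpd S 0 j \<phi> (t, s)) has_real_derivative bpd S 0 (Suc j) \<phi> (t, w)) (at w)" if "j < k"
  proof -
    have eq: "\<forall>\<^sub>F s in nhds w. bpd S 0 j \<phi> (t, s) = pd 0 j \<phi> (t, s)"
      using nh(2) by eventually_elim (use bpd_extension(2)[OF C _ lim] that in auto)
    have "((\<lambda>s. pd 0 j \<phi> (t, s)) has_real_derivative pd 0 (Suc j) \<phi> (t, w)) (at w)"
      using has_derivative_partials(3)[OF C_upto_differentiable[OF C _ x, of 0 j]] that by (simp add: pd_def)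
    moreover have "bpd S 0 (Suc j) \<phi> (t, w) = pd 0 (Suc j) \<phi> (t, w)"
      using bpd_extension(2)[OF C _ lim x] that by auto
    ultimately show ?thesis using DERIV_cong_ev[OF refl eq refl] by simp
  qed
qed

text \<open>Convexity keeps the segment between two points of \<open>C\<close> inside the region of
  differentiability, so the mean value inequality applies to \<phi> minus its candidate linear part.
  The point \<open>x0\<close> itself is outside \<open>C\<close>; it enters through the limits of
  the partial derivatives.\<close>

lemma strict_deriv_convex:
  fixes \<phi> :: "real \<times> real \<Rightarrow> real"
  assumes "convex C" "x0 \<notin> C"
    and der: "\<And>x. x \<in> C \<Longrightarrow> (\<phi> has_derivative (\<lambda>h. a x * fst h + b x * snd h)) (at x)"
    and lim: "(a \<longlongrightarrow> a0) (at x0 within C)" "(b \<longlongrightarrow> b0) (at x0 within C)"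
  shows "strict_deriv \<phi> (\<lambda>h. a0 * fst h + b0 * snd h) x0 C"
  unfolding strict_deriv_def
proof (intro conjI allI impI)
  show "bounded_linear (\<lambda>h. a0 * fst h + b0 * snd h)"
    by (intro bounded_linear_add bounded_linear_const_mult bounded_linear_fst bounded_linear_snd)
next
  fix e :: real assume e: "0 < e"
  then have "0 < e / 2" by simp
  then have "\<forall>\<^sub>F x in at x0 within C. dist (a x) a0 < e / 2 \<and> dist (b x) b0 < e / 2"
    by (intro eventually_conj tendstoD lim)
  then obtain d where d: "0 < d" "\<And>x. x \<in> C \<Longrightarrow> dist x x0 < d \<Longrightarrow> dist (a x) a0 < e / 2 \<and> dist (b x) b0 < e / 2"
    using assms(2) unfolding eventually_at by metis
  have "norm (\<phi> y - \<phi> z - (a0 * fst (y - z) + b0 * snd (y - z))) \<le> e * norm (y - z)"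
    if "y \<in> C" "z \<in> C" "norm (y - x0) < d" "norm (z - x0) < d" for y z
  proof -
    have "norm ((\<phi> y - (a0 * fst y + b0 * snd y)) - (\<phi> z - (a0 * fst z + b0 * snd z))) \<le> e * norm (y - z)"
    proof (rule differentiable_bound[where S = "C \<inter> ball x0 d" and f' = "\<lambda>x h. (a x - a0) * fst h + (b x - b0) * snd h"])
      show "convex (C \<inter> ball x0 d)" using assms(1) by (intro convex_Int) auto
      fix x assume x: "x \<in> C \<inter> ball x0 d"
      then have "(\<phi> has_derivative (\<lambda>h. a x * fst h + b x * snd h)) (at x within C \<inter> ball x0 d)"
        using der has_derivative_at_withinI by blast
      then show "((\<lambda>x. \<phi> x - (a0 * fst x + b0 * snd x)) has_derivative (\<lambda>h. (a x - a0) * fst h + (b x - b0) * snd h))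
          (at x within C \<inter> ball x0 d)"
        by (auto intro!: derivative_eq_intros simp: algebra_simps)
      have ab: "\<bar>a x - a0\<bar> < e / 2" "\<bar>b x - b0\<bar> < e / 2"
        using d(2)[of x] x by (auto simp: dist_real_def dist_commute)
      show "onorm (\<lambda>h. (a x - a0) * fst h + (b x - b0) * snd h) \<le> e"
      proof (rule onorm_bound)
        fix h :: "real \<times> real"
        have h: "\<bar>fst h\<bar> \<le> norm h" "\<bar>snd h\<bar> \<le> norm h"
          using norm_fst_le[of "fst h" "snd h"] norm_snd_le[of "snd h" "fst h"] by simp_all
        have "norm ((a x - a0) * fst h + (b x - b0) * snd h) \<le> \<bar>a x - a0\<bar> * \<bar>fst h\<bar> + \<bar>b x - b0\<bar> * \<bar>snd h\<bar>"
          by (metis abs_mult abs_triangle_ineq real_norm_def)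
        also have "\<dots> \<le> e / 2 * norm h + e / 2 * norm h"
          using ab h e by (intro add_mono mult_mono) auto
        finally show "norm ((a x - a0) * fst h + (b x - b0) * snd h) \<le> e * norm h" by simp
      qed (use e in simp)
    qed (use that in \<open>auto simp: dist_norm norm_minus_commute\<close>)
    then show ?thesis by (simp add: algebra_simps)
  qed
  then show "\<exists>d>0. \<forall>y\<in>C. \<forall>z\<in>C. norm (y - x0) < d \<longrightarrow> norm (z - x0) < d \<longrightarrow>
      norm (\<phi> y - \<phi> z - (a0 * fst (y - z) + b0 * snd (y - z))) \<le> e * norm (y - z)"
    using d(1) by blast
qed

text \<open>Schwarz's theorem at the corner of a quadrant, with asymmetric information: the
  t-derivative \<open>m\<close> of the w-derivative has a limit at the corner, whereas the
  t-derivative \<open>a\<close> is only known to have increments in \<open>w\<close> that are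
  asymptotically linear with slope \<open>M'\<close>.\<close>

lemma mixed_derivatives_eq:
  fixes \<phi> a b m :: "real \<Rightarrow> real \<Rightarrow> real"
  assumes "0 < \<delta>"
    and a: "\<And>t w. - \<delta> < t \<Longrightarrow> t < 0 \<Longrightarrow> - \<delta> < w \<Longrightarrow> w < 0 \<Longrightarrow> ((\<lambda>s. \<phi> s w) has_real_derivative a t w) (at t)"
    and b: "\<And>t w. - \<delta> < t \<Longrightarrow> t < 0 \<Longrightarrow> - \<delta> < w \<Longrightarrow> w < 0 \<Longrightarrow> (\<phi> t has_real_derivative b t w) (at w)"
    and m: "\<And>t w. - \<delta> < t \<Longrightarrow> t < 0 \<Longrightarrow> - \<delta> < w \<Longrightarrow> w < 0 \<Longrightarrow> ((\<lambda>s. b s w) has_real_derivative m t w) (at t)"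
    and M: "\<And>e. 0 < e \<Longrightarrow> \<exists>d>0. \<forall>t w. - d < t \<longrightarrow> t < 0 \<longrightarrow> - d < w \<longrightarrow> w < 0 \<longrightarrow> \<bar>m t w - M\<bar> \<le> e"
    and M': "\<And>e. 0 < e \<Longrightarrow> \<exists>d>0. \<forall>t w w'. - d < t \<longrightarrow> t < 0 \<longrightarrow> - d < w \<longrightarrow> w < 0 \<longrightarrow> - d < w' \<longrightarrow> w' < 0 \<longrightarrow>
        \<bar>a t w - a t w' - M' * (w - w')\<bar> \<le> e * \<bar>w - w'\<bar>"
  shows "M = M'"
proof -
  have "\<bar>M - M'\<bar> \<le> 2 * e" if e: "0 < e" for e
  proof -
    obtain d1 where d1: "0 < d1" "\<And>t w. - d1 < t \<Longrightarrow> t < 0 \<Longrightarrow> - d1 < w \<Longrightarrow> w < 0 \<Longrightarrow> \<bar>m t w - M\<bar> \<le> e"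
      using M[OF e] by metis
    obtain d2 where d2: "0 < d2" "\<And>t w w'. - d2 < t \<Longrightarrow> t < 0 \<Longrightarrow> - d2 < w \<Longrightarrow> w < 0 \<Longrightarrow> - d2 < w' \<Longrightarrow> w' < 0 \<Longrightarrow>
        \<bar>a t w - a t w' - M' * (w - w')\<bar> \<le> e * \<bar>w - w'\<bar>"
      using M'[OF e] by metis
    define k where "k = min \<delta> (min d1 d2) / 3"
    have k: "0 < k" "2 * k < \<delta>" "2 * k < d1" "2 * k < d2" using assms(1) d1 d2 by (auto simp: k_def min_def)
    \<comment> \<open>The second difference of \<phi> over the square with side from -2k to -k is
      evaluated twice: here through increments of \<open>a\<close> in \<open>w\<close>, below
      through \<open>b\<close> and then \<open>m\<close>. Comparing the two yields \<open>M'\<close>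
      and \<open>M\<close> up to the error \<open>e\<close>.\<close>
    have "\<exists>\<xi>>-2*k. \<xi> < -k \<and> (\<phi> (-k) (-k) - \<phi> (-k) (-2*k)) - (\<phi> (-2*k) (-k) - \<phi> (-2*k) (-2*k)) =
        (-k - (-2*k)) * (a \<xi> (-k) - a \<xi> (-2*k))"
      by (rule MVT2[where f = "\<lambda>s. \<phi> s (-k) - \<phi> s (-2*k)"])
        (use k in \<open>auto intro!: DERIV_diff a\<close>)
    then obtain \<xi> where \<xi>: "-2*k < \<xi>" "\<xi> < -k"
      "(\<phi> (-k) (-k) - \<phi> (-k) (-2*k)) - (\<phi> (-2*k) (-k) - \<phi> (-2*k) (-2*k)) = k * (a \<xi> (-k) - a \<xi> (-2*k))"
      by auto
    have "\<exists>\<zeta>>-2*k. \<zeta> < -k \<and> (\<phi> (-k) (-k) - \<phi> (-2*k) (-k)) - (\<phi> (-k) (-2*k) - \<phi> (-2*k) (-2*k)) =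
        (-k - (-2*k)) * (b (-k) \<zeta> - b (-2*k) \<zeta>)"
      by (rule MVT2[where f = "\<lambda>s. \<phi> (-k) s - \<phi> (-2*k) s"])
        (use k in \<open>auto intro!: DERIV_diff b\<close>)
    then obtain \<zeta> where \<zeta>: "-2*k < \<zeta>" "\<zeta> < -k"
      "(\<phi> (-k) (-k) - \<phi> (-2*k) (-k)) - (\<phi> (-k) (-2*k) - \<phi> (-2*k) (-2*k)) = k * (b (-k) \<zeta> - b (-2*k) \<zeta>)"
      by auto
    have "\<exists>\<theta>>-2*k. \<theta> < -k \<and> b (-k) \<zeta> - b (-2*k) \<zeta> = (-k - (-2*k)) * m \<theta> \<zeta>"
      by (rule MVT2[where f = "\<lambda>s. b s \<zeta>"]) (use k \<zeta> in \<open>auto intro!: m\<close>)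
    then obtain \<theta> where \<theta>: "-2*k < \<theta>" "\<theta> < -k" "b (-k) \<zeta> - b (-2*k) \<zeta> = k * m \<theta> \<zeta>" by auto
    have "k * (a \<xi> (-k) - a \<xi> (-2*k)) = k * (k * m \<theta> \<zeta>)"
      using \<xi>(3) \<zeta>(3) unfolding \<theta>(3) by linarith
    then have eq: "a \<xi> (-k) - a \<xi> (-2*k) = k * m \<theta> \<zeta>" using k by simp
    have "\<bar>a \<xi> (-k) - a \<xi> (-2*k) - M' * (-k - (-2*k))\<bar> \<le> e * \<bar>-k - (-2*k)\<bar>"
      using k \<xi> by (intro d2(2)) auto
    then have "\<bar>k * m \<theta> \<zeta> - M' * k\<bar> \<le> e * k" using k eq by simp
    moreover have "k * m \<theta> \<zeta> - M' * k = k * (m \<theta> \<zeta> - M')" by (simp add: algebra_simps)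
    ultimately have "\<bar>m \<theta> \<zeta> - M'\<bar> \<le> e" using k by (simp add: abs_mult)
    moreover have "\<bar>m \<theta> \<zeta> - M\<bar> \<le> e" using k \<zeta> \<theta> by (intro d1(2)) auto
    ultimately show ?thesis by linarith
  qed
  from this[of "\<bar>M - M'\<bar> / 4"] show ?thesis by (cases "M = M'") auto
qed

text \<open>The curve may run in the boundary of \<open>S\<close>, where \<phi> need not have a
  derivative. Shifted by \<delta> times (\<open>e1\<close>, \<open>e2\<close>) it lies in the
  interior, where chain rule and mean value inequality give a bound uniform in \<delta>; continuity
  of \<phi> on \<open>S\<close> then permits \<delta> to tend to 0.\<close>

lemma strict_deriv_along_boundary:
  fixes \<phi> a b :: "real \<times> real \<Rightarrow> real"
  assumes cont: "continuous_on S \<phi>" "continuous_on S a" "continuous_on S b"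
    and der: "\<And>x. x \<in> interior S \<Longrightarrow> (\<phi> has_derivative (\<lambda>h. a x * fst h + b x * snd h)) (at x)"
    and I: "convex I" "s0 \<in> I"
    and g: "\<And>s. s \<in> I \<Longrightarrow> (\<gamma>1 has_real_derivative g1 s) (at s within I)"
      "\<And>s. s \<in> I \<Longrightarrow> (\<gamma>2 has_real_derivative g2 s) (at s within I)"
      "continuous (at s0 within I) g1" "continuous (at s0 within I) g2"
    and S: "\<And>s. s \<in> I \<Longrightarrow> (\<gamma>1 s, \<gamma>2 s) \<in> S"
    and shift: "0 < \<delta>0" "\<And>s \<delta>. s \<in> I \<Longrightarrow> 0 < \<delta> \<Longrightarrow> \<delta> < \<delta>0 \<Longrightarrow> (\<gamma>1 s + \<delta> * e1, \<gamma>2 s + \<delta> * e2) \<in> interior S"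
  shows "strict_deriv (\<lambda>s. \<phi> (\<gamma>1 s, \<gamma>2 s))
    (\<lambda>h. (a (\<gamma>1 s0, \<gamma>2 s0) * g1 s0 + b (\<gamma>1 s0, \<gamma>2 s0) * g2 s0) * h) s0 I"
  unfolding strict_deriv_def
proof (intro conjI allI impI)
  show "bounded_linear (\<lambda>h. (a (\<gamma>1 s0, \<gamma>2 s0) * g1 s0 + b (\<gamma>1 s0, \<gamma>2 s0) * g2 s0) * h)"
    by (rule bounded_linear_mult_right)
next
  fix e :: real assume e: "0 < e"
  \<comment> \<open>Curve parameter and shift are combined into one point of the strip
    \<open>K\<close>, so that a limit at \<open>p0\<close> controls both at once; this is the source
    of the uniformity in \<delta>.\<close>
  define \<Gamma> where "\<Gamma> p = (\<gamma>1 (fst p) + snd p * e1, \<gamma>2 (fst p) + snd p * e2)" for p :: "real \<times> real"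
  define K where "K = {p. fst p \<in> I \<and> 0 \<le> snd p \<and> snd p < \<delta>0}"
  define p0 where "p0 = (s0, 0::real)"
  define F0 where "F0 = a (\<gamma>1 s0, \<gamma>2 s0) * g1 s0 + b (\<gamma>1 s0, \<gamma>2 s0) * g2 s0"
  have \<Gamma>0: "\<Gamma> p0 = (\<gamma>1 s0, \<gamma>2 s0)" by (simp add: \<Gamma>_def p0_def)
  have KS: "\<Gamma> p \<in> S" if "p \<in> K" for p
  proof (cases "snd p = 0")
    case True
    then show ?thesis using that S by (simp add: K_def \<Gamma>_def)
  next
    case False
    then have "\<Gamma> p \<in> interior S" using that shift(2) by (simp add: K_def \<Gamma>_def)
    then show ?thesis using interior_subset by blast
  qed
  have tf: "((\<lambda>p. u (fst p)) \<longlongrightarrow> u s0) (at p0 within K)" if u: "continuous (at s0 within I) u" for u :: "real \<Rightarrow> real"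
  proof -
    have "continuous (at p0 within K) (\<lambda>p. u (fst p))"
    proof (rule continuous_within_compose2[where g = u and f = fst])
      show "continuous (at p0 within K) fst" by (intro continuous_intros)
      have "fst ` K \<subseteq> I" by (auto simp: K_def)
      then show "continuous (at (fst p0) within fst ` K) u"
        using continuous_within_subset[OF u] by (simp add: p0_def)
    qed
    then show ?thesis by (simp add: continuous_within p0_def)
  qed
  have c\<gamma>: "continuous (at s0 within I) \<gamma>1" "continuous (at s0 within I) \<gamma>2"
    using g I DERIV_continuous by blast+
  have ts: "(snd \<longlongrightarrow> (0::real)) (at p0 within K)"
    using tendsto_snd[OF tendsto_ident_at, of p0 K] by (simp add: p0_def)
  have t\<Gamma>: "(\<Gamma> \<longlongrightarrow> (\<gamma>1 s0, \<gamma>2 s0)) (at p0 within K)"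
  proof -
    have "(\<Gamma> \<longlongrightarrow> (\<gamma>1 s0 + 0 * e1, \<gamma>2 s0 + 0 * e2)) (at p0 within K)"
      unfolding \<Gamma>_def by (intro tendsto_intros tf c\<gamma> ts)
    then show ?thesis by simp
  qed
  have evS: "\<forall>\<^sub>F p in at p0 within K. \<Gamma> p \<in> S"
    using KS by (auto simp: eventually_at_filter)
  have ta: "((\<lambda>p. u (\<Gamma> p)) \<longlongrightarrow> u (\<gamma>1 s0, \<gamma>2 s0)) (at p0 within K)" if "continuous_on S u" for u :: "real \<times> real \<Rightarrow> real"
    by (rule continuous_on_tendsto_compose[OF that t\<Gamma> S[OF I(2)] evS])
  define F where "F p = a (\<Gamma> p) * g1 (fst p) + b (\<Gamma> p) * g2 (fst p)" for p
  have "(F \<longlongrightarrow> F0) (at p0 within K)"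
    unfolding F_def F0_def by (intro tendsto_intros ta tf cont g)
  then obtain d where d: "0 < d" "\<And>p. p \<in> K \<Longrightarrow> p \<noteq> p0 \<Longrightarrow> dist p p0 < d \<Longrightarrow> \<bar>F p - F0\<bar> < e"
    using e unfolding tendsto_iff eventually_at dist_real_def by metis
  have shifted: "\<bar>\<phi> (\<Gamma> (y, \<delta>)) - \<phi> (\<Gamma> (z, \<delta>)) - F0 * (y - z)\<bar> \<le> e * \<bar>y - z\<bar>"
    if yz: "y \<in> I" "z \<in> I" "\<bar>y - s0\<bar> < d / 2" "\<bar>z - s0\<bar> < d / 2" and \<delta>: "0 < \<delta>" "\<delta> < min \<delta>0 (d / 2)" for y z \<delta>
  proof -
    have "norm ((\<phi> (\<Gamma> (y, \<delta>)) - F0 * y) - (\<phi> (\<Gamma> (z, \<delta>)) - F0 * z)) \<le> e * norm (y - z)"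
    proof (rule field_differentiable_bound[where S = "I \<inter> ball s0 (d / 2)" and f' = "\<lambda>s. F (s, \<delta>) - F0"])
      show "convex (I \<inter> ball s0 (d / 2))" using I(1) by (intro convex_Int) auto
      fix s assume s: "s \<in> I \<inter> ball s0 (d / 2)"
      let ?N = "at s within (I \<inter> ball s0 (d / 2))"
      have int: "\<Gamma> (s, \<delta>) \<in> interior S" using shift(2)[of s \<delta>] s \<delta> by (simp add: \<Gamma>_def)
      have "(\<gamma>1 has_real_derivative g1 s) ?N" "(\<gamma>2 has_real_derivative g2 s) ?N"
        using g(1,2)[of s] s DERIV_subset by blast+
      then have "((\<lambda>s. \<gamma>1 s + \<delta> * e1) has_derivative (\<lambda>h. g1 s * h)) ?N"
        "((\<lambda>s. \<gamma>2 s + \<delta> * e2) has_derivative (\<lambda>h. g2 s * h)) ?N"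
        by (auto intro!: derivative_eq_intros simp: has_field_derivative_def)
      then have "((\<lambda>s. \<Gamma> (s, \<delta>)) has_derivative (\<lambda>h. (g1 s * h, g2 s * h))) ?N"
        unfolding \<Gamma>_def by (simp add: has_derivative_Pair)
      from has_derivative_compose[OF this der[OF int]]
      have "((\<lambda>s. \<phi> (\<Gamma> (s, \<delta>))) has_derivative (\<lambda>h. F (s, \<delta>) * h)) ?N"
        by (simp add: F_def algebra_simps)
      then have "((\<lambda>s. \<phi> (\<Gamma> (s, \<delta>))) has_real_derivative F (s, \<delta>)) ?N"
        by (simp add: has_field_derivative_def)
      then show "((\<lambda>s. \<phi> (\<Gamma> (s, \<delta>)) - F0 * s) has_real_derivative F (s, \<delta>) - F0) ?N"
        by (auto intro!: derivative_eq_intros)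
      have "dist (s, \<delta>) p0 \<le> \<bar>s - s0\<bar> + \<bar>\<delta>\<bar>"
        using sqrt_sum_squares_le_sum_abs[of "s - s0" \<delta>] by (simp add: p0_def dist_Pair_Pair dist_real_def)
      also have "\<dots> < d" using s \<delta> by (auto simp: dist_real_def abs_minus_commute[of s s0])
      finally show "norm (F (s, \<delta>) - F0) \<le> e"
        using d(2)[of "(s, \<delta>)"] s \<delta> by (auto simp: K_def p0_def)
    qed (use yz in \<open>auto simp: dist_real_def abs_minus_commute[of s0]\<close>)
    then show ?thesis by (simp add: algebra_simps)
  qed
  have "norm (\<phi> (\<gamma>1 y, \<gamma>2 y) - \<phi> (\<gamma>1 z, \<gamma>2 z) - F0 * (y - z)) \<le> e * norm (y - z)"
    if yz: "y \<in> I" "z \<in> I" "\<bar>y - s0\<bar> < d / 2" "\<bar>z - s0\<bar> < d / 2" for y z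
  proof -
    have lim: "((\<lambda>\<delta>. \<phi> (\<Gamma> (s, \<delta>))) \<longlongrightarrow> \<phi> (\<gamma>1 s, \<gamma>2 s)) (at_right 0)" if "s \<in> I" for s
    proof (rule continuous_on_tendsto_compose[OF cont(1)])
      have "((\<lambda>\<delta>. \<Gamma> (s, \<delta>)) \<longlongrightarrow> (\<gamma>1 s + 0 * e1, \<gamma>2 s + 0 * e2)) (at_right 0)"
        unfolding \<Gamma>_def fst_conv snd_conv by (intro tendsto_intros)
      then show "((\<lambda>\<delta>. \<Gamma> (s, \<delta>)) \<longlongrightarrow> (\<gamma>1 s, \<gamma>2 s)) (at_right 0)" by simp
      show "\<forall>\<^sub>F \<delta> in at_right 0. \<Gamma> (s, \<delta>) \<in> S"
        using eventually_at_right_less[of 0] eventually_at_right_real[OF shift(1)]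
        by eventually_elim (use KS that in \<open>auto simp: K_def\<close>)
    qed (use S that in auto)
    have "((\<lambda>\<delta>. \<bar>\<phi> (\<Gamma> (y, \<delta>)) - \<phi> (\<Gamma> (z, \<delta>)) - F0 * (y - z)\<bar>) \<longlongrightarrow>
       \<bar>\<phi> (\<gamma>1 y, \<gamma>2 y) - \<phi> (\<gamma>1 z, \<gamma>2 z) - F0 * (y - z)\<bar>) (at_right 0)"
      by (intro tendsto_intros lim yz)
    moreover have "\<forall>\<^sub>F \<delta> in at_right 0. \<bar>\<phi> (\<Gamma> (y, \<delta>)) - \<phi> (\<Gamma> (z, \<delta>)) - F0 * (y - z)\<bar> \<le> e * \<bar>y - z\<bar>"
      using eventually_at_right_real[of 0 "min \<delta>0 (d / 2)"] shift(1) d(1)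
      by (auto elim!: eventually_mono intro!: shifted yz)
    ultimately have "\<bar>\<phi> (\<gamma>1 y, \<gamma>2 y) - \<phi> (\<gamma>1 z, \<gamma>2 z) - F0 * (y - z)\<bar> \<le> e * \<bar>y - z\<bar>"
      by (rule tendsto_upperbound) (rule trivial_limit_at_right_real)
    then show ?thesis by simp
  qed
  then show "\<exists>d>0. \<forall>y\<in>I. \<forall>z\<in>I. norm (y - s0) < d \<longrightarrow> norm (z - s0) < d \<longrightarrow>
     norm (\<phi> (\<gamma>1 y, \<gamma>2 y) - \<phi> (\<gamma>1 z, \<gamma>2 z) - (a (\<gamma>1 s0, \<gamma>2 s0) * g1 s0 + b (\<gamma>1 s0, \<gamma>2 s0) * g2 s0) * (y - z)) \<le> e * norm (y - z)"
    unfolding F0_def[symmetric] using d(1) by (intro exI[of _ "d / 2"]) auto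
qed

text \<open>For most fluid functions only the local Lipschitz bound matters. Forgetting the value of
  the derivative turns the calculus into introduction rules that apply to composite
  formulas.\<close>

definition strict_diff :: "('a::real_normed_vector \<Rightarrow> 'b::real_normed_vector) \<Rightarrow> 'a \<Rightarrow> 'a set \<Rightarrow> bool" where
  "strict_diff f x S \<longleftrightarrow> (\<exists>f'. strict_deriv f f' x S)"

lemma strict_diff_const: "strict_diff (\<lambda>x. c) x S"
  unfolding strict_diff_def by (metis strict_deriv_const)

lemma strict_diff_bounded_linear: "bounded_linear f \<Longrightarrow> strict_diff f x S"
  unfolding strict_diff_def by (metis strict_deriv_bounded_linear)

lemma strict_diff_compose:
  "strict_diff g (f x) UNIV \<Longrightarrow> strict_diff f x S \<Longrightarrow> x \<in> S \<Longrightarrow> strict_diff (\<lambda>y. g (f y)) x S"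
  unfolding strict_diff_def by (metis strict_deriv_compose)

lemma strict_diff_Pair:
  "strict_diff f x S \<Longrightarrow> strict_diff g x S \<Longrightarrow> strict_diff (\<lambda>y. (f y, g y)) x S"
  unfolding strict_diff_def by (metis strict_deriv_Pair)

lemma strict_diff_arith:
  fixes f g :: "'a::real_normed_vector \<Rightarrow> real"
  assumes "strict_diff f x S" "strict_diff g x S" "x \<in> S"
  shows strict_diff_add: "strict_diff (\<lambda>y. f y + g y) x S"
    and strict_diff_diff: "strict_diff (\<lambda>y. f y - g y) x S"
    and strict_diff_mult: "strict_diff (\<lambda>y. f y * g y) x S"
    and strict_diff_divide: "g x \<noteq> 0 \<Longrightarrow> strict_diff (\<lambda>y. f y / g y) x S"
proof -
  obtain f' g' where fg: "strict_deriv f f' x S" "strict_deriv g g' x S"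
    using assms by (auto simp: strict_diff_def)
  show "strict_diff (\<lambda>y. f y + g y) x S" "strict_diff (\<lambda>y. f y - g y) x S" "strict_diff (\<lambda>y. f y * g y) x S"
    "g x \<noteq> 0 \<Longrightarrow> strict_diff (\<lambda>y. f y / g y) x S"
    unfolding strict_diff_def
    using strict_deriv_add[OF fg assms(3)] strict_deriv_diff[OF fg assms(3)] strict_deriv_mult[OF fg assms(3)]
      strict_deriv_divide[OF fg assms(3)] by blast+
qed

lemma strict_diff_real_compose:
  fixes f :: "'a::real_normed_vector \<Rightarrow> real"
  assumes "open I" "f x \<in> I" "\<And>y. y \<in> I \<Longrightarrow> (\<phi> has_real_derivative \<phi>' y) (at y)" "continuous_on I \<phi>'"
    "strict_diff f x S" "x \<in> S"
  shows "strict_diff (\<lambda>y. \<phi> (f y)) x S"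
proof -
  have "isCont \<phi>' (f x)" using assms(1,2,4) continuous_on_eq_continuous_at by blast
  then show ?thesis using assms strict_deriv_real_compose[of I f x \<phi> \<phi>'] unfolding strict_diff_def by metis
qed

lemma strict_diff_exp: "strict_diff f x S \<Longrightarrow> x \<in> S \<Longrightarrow> strict_diff (\<lambda>y. exp (f y :: real)) x S"
  unfolding strict_diff_def by (metis strict_deriv_exp)

lemma strict_diff_sqrt: "strict_diff f x S \<Longrightarrow> x \<in> S \<Longrightarrow> 0 < f x \<Longrightarrow> strict_diff (\<lambda>y. sqrt (f y)) x S"
  unfolding strict_diff_def by (metis strict_deriv_sqrt)

lemmas strict_diff_intros = strict_diff_const strict_diff_Pair strict_diff_arith strict_diff_exp strict_diff_sqrt

lemma strict_diff_fst: "strict_diff f x S \<Longrightarrow> x \<in> S \<Longrightarrow> strict_diff (\<lambda>y. fst (f y)) x S"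
  using strict_diff_compose[OF strict_diff_bounded_linear[OF bounded_linear_fst]] .

lemma strict_diff_snd: "strict_diff f x S \<Longrightarrow> x \<in> S \<Longrightarrow> strict_diff (\<lambda>y. snd (f y)) x S"
  using strict_diff_compose[OF strict_diff_bounded_linear[OF bounded_linear_snd]] .

lemma strict_diff_ident: "strict_diff (\<lambda>y. y) x S"
  by (rule strict_diff_bounded_linear[OF bounded_linear_ident])

lemmas strict_diff_intros' = strict_diff_intros strict_diff_fst strict_diff_snd strict_diff_ident

lemma strict_diff_lipschitz:
  assumes "strict_diff f x S"
  obtains d L where "0 < d" "0 < L"
    "\<And>y z. y \<in> S \<Longrightarrow> z \<in> S \<Longrightarrow> norm (y - x) < d \<Longrightarrow> norm (z - x) < d \<Longrightarrow>
      norm (f y - f z) \<le> L * norm (y - z)"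
  using assms strict_deriv_lipschitz unfolding strict_diff_def by metis

section \<open>The fluid functions\<close>

locale barotropic_fluid =
  fixes F :: fluid
  assumes barotropic: "barotropic F"
begin

abbreviation "p \<equiv> pressure F"
abbreviation "J \<equiv> rtilde F ` {0<..}"
text \<open>The fluid state in the variable \<open>rtilde\<close>: density \<open>dens\<close>,
  sound speed \<open>hh\<close>, pressure \<open>pr\<close>, and \<open>ee\<close>, the sum \<rho> +
  p.\<close>

definition "dens = the_inv_into {0<..} (rtilde F)"
definition "hh x = sound_speed F (dens x)"
definition "pr x = p (dens x)"
definition "ee x = dens x + pr x"

lemma pressure_deriv:
  assumes "0 < \<rho>"
  shows "((deriv ^^ k) p has_real_derivative (deriv ^^ Suc k) p \<rho>) (at \<rho>)"
proof -
  have "(deriv ^^ k) p differentiable_on {0<..}" using barotropic by (simp add: barotropic_def)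
  then have "(deriv ^^ k) p differentiable (at \<rho>)"
    using assms by (simp add: differentiable_on_eq_differentiable_at)
  then show ?thesis by (simp add: DERIV_deriv_iff_real_differentiable)
qed

lemma sound_speed: "0 < \<rho> \<Longrightarrow> 0 < sound_speed F \<rho>" "0 < \<rho> \<Longrightarrow> sound_speed F \<rho> < 1"
  "0 < \<rho> \<Longrightarrow> 0 < p \<rho>"
  using barotropic by (auto simp: barotropic_def)

lemma sound_speed_sq: "0 < \<rho> \<Longrightarrow> (sound_speed F \<rho>)\<^sup>2 = deriv p \<rho>" "0 < \<rho> \<Longrightarrow> 0 < deriv p \<rho>"
  using sound_speed(1)[of \<rho>] by (auto simp: sound_speed_def)

lemma sound_speed_deriv:
  assumes "0 < \<rho>"
  shows "(sound_speed F has_real_derivative deriv (deriv p) \<rho> * (inverse (sound_speed F \<rho>) / 2)) (at \<rho>)"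
  unfolding sound_speed_def
  using DERIV_chain2[where f = sqrt and g = "deriv p", OF DERIV_real_sqrt[OF sound_speed_sq(2)[OF assms]]]
    pressure_deriv[OF assms, of 1]
  by (simp add: mult.commute)

lemma pressure_deriv_cont:
  "continuous_on {0<..} ((deriv ^^ k) p)"
  using pressure_deriv[of _ k] DERIV_isCont by (force intro: continuous_at_imp_continuous_on)

text \<open>The logarithmic derivative of \<open>sigma\<close> is 1 / (\<rho> + p), which cancels
  the 1 in 1 + p' and leaves p' / \<open>sigma\<close> as derivative of \<open>htilde\<close>. As p'
  is the square of the sound speed, one factor of it cancels in the quotient defining
  \<open>rtilde\<close>.\<close>

lemma rtilde_deriv:
  assumes "0 < \<rho>"
  shows "(rtilde F has_real_derivative sound_speed F \<rho> / (\<rho> + p \<rho>)) (at \<rho>)"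
proof -
  obtain I where I: "\<And>\<rho>. 0 < \<rho> \<Longrightarrow> (I has_real_derivative 1 / (\<rho> + p \<rho>)) (at \<rho>)" "\<And>\<rho>. 0 < \<rho> \<Longrightarrow> sigma F \<rho> = exp (I \<rho>)"
    using barotropic unfolding barotropic_def by metis
  have pos: "0 < \<rho> + p \<rho>" using sound_speed(3)[OF assms] assms by simp
  have "((\<lambda>\<rho>. (\<rho> + p \<rho>) / exp (I \<rho>)) has_real_derivative
      ((1 + deriv p \<rho>) * exp (I \<rho>) - (\<rho> + p \<rho>) * (exp (I \<rho>) * (1 / (\<rho> + p \<rho>)))) / (exp (I \<rho>) * exp (I \<rho>))) (at \<rho>)"
    using pressure_deriv[OF assms, of 0] I(1)[OF assms]
    by (auto intro!: derivative_eq_intros)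
  also have "((1 + deriv p \<rho>) * exp (I \<rho>) - (\<rho> + p \<rho>) * (exp (I \<rho>) * (1 / (\<rho> + p \<rho>)))) / (exp (I \<rho>) * exp (I \<rho>))
    = deriv p \<rho> / exp (I \<rho>)"
  proof -
    have "(\<rho> + p \<rho>) * (exp (I \<rho>) * (1 / (\<rho> + p \<rho>))) = exp (I \<rho>)" using pos by simp
    then show ?thesis by (simp add: algebra_simps)
  qed
  finally have "(htilde F has_real_derivative deriv p \<rho> / exp (I \<rho>)) (at \<rho>)"
    by (rule has_field_derivative_transform_within_open[where S = "{0<..}"]) (use assms I in \<open>auto simp: htilde_def\<close>)
  then have "deriv (htilde F) \<rho> / (sound_speed F \<rho> * htilde F \<rho>) = sound_speed F \<rho> / (\<rho> + p \<rho>)"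
  proof -
    have "(a * a / E) / (a * (e / E)) = a / e" if "0 < a" "0 < E" "0 < e" for a E e :: real
      using that by (simp add: field_simps)
    from this[OF sound_speed(1)[OF assms] _ pos, of "exp (I \<rho>)"] show ?thesis
      using \<open>(htilde F has_real_derivative deriv p \<rho> / exp (I \<rho>)) (at \<rho>)\<close> sound_speed_sq(1)[OF assms, symmetric] assms
      by (simp add: DERIV_imp_deriv htilde_def I power2_eq_square)
  qed
  then show ?thesis using barotropic assms by (auto simp: barotropic_def)
qed

lemma rtilde_strict_mono: "strict_mono_on {0<..} (rtilde F)"
proof (rule strict_mono_onI)
  fix r s :: real assume "r \<in> {0<..}" "s \<in> {0<..}" "r < s"
  then show "rtilde F r < rtilde F s"
    by (intro DERIV_pos_imp_increasing[OF \<open>r < s\<close>])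
      (metis rtilde_deriv sound_speed(1,3) add_pos_pos divide_pos_pos greaterThan_iff less_le_trans)
qed

lemma rtilde_inj: "inj_on (rtilde F) {0<..}"
  using rtilde_strict_mono by (rule strict_mono_on_imp_inj_on)

lemma rtilde_cont: "continuous_on {0<..} (rtilde F)"
  using rtilde_deriv DERIV_isCont by (force intro: continuous_at_imp_continuous_on)

lemma J_open: "open J"
  by (rule invariance_of_domain[OF rtilde_cont _ rtilde_inj]) simp

lemma J_convex: "convex J"
  using connected_continuous_image[OF rtilde_cont] by (simp add: is_interval_connected_1 is_interval_convex)

lemma dens: "x \<in> J \<Longrightarrow> 0 < dens x" "x \<in> J \<Longrightarrow> rtilde F (dens x) = x" "0 < \<rho> \<Longrightarrow> dens (rtilde F \<rho>) = \<rho>"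
  using the_inv_into_into[OF rtilde_inj, of x "{0<..}"] f_the_inv_into_f[OF rtilde_inj, of x]
    the_inv_into_f_f[OF rtilde_inj, of \<rho>]
  unfolding dens_def by auto

lemma hh: "x \<in> J \<Longrightarrow> 0 < hh x" "x \<in> J \<Longrightarrow> hh x < 1" and pr: "x \<in> J \<Longrightarrow> 0 < pr x"
  and ee: "x \<in> J \<Longrightarrow> 0 < ee x"
  using sound_speed dens(1) by (auto simp: hh_def pr_def ee_def add_pos_pos)

lemma dens_deriv: assumes "x \<in> J" shows "(dens has_real_derivative ee x / hh x) (at x)"
proof -
  let ?D = "sound_speed F (dens x) / (dens x + p (dens x))"
  have pos: "0 < ?D" using hh(1)[OF assms] ee[OF assms] by (simp add: hh_def ee_def pr_def)
  have "(dens has_derivative (*) (inverse ?D)) (at (rtilde F (dens x)))"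
  proof (rule has_derivative_inverse_strong[where S = "{0<..}" and f = "rtilde F" and x = "dens x" and f' = "(*) ?D"])
    show "(rtilde F has_derivative (*) ?D) (at (dens x))"
      using rtilde_deriv[OF dens(1)[OF assms]] by (simp add: has_field_derivative_def)
    have "(*) D \<circ> (*) (inverse D) = id" if "0 < D" for D :: real
      using that by (simp add: fun_eq_iff)
    from this[OF pos] show "(*) ?D \<circ> (*) (inverse ?D) = id" .
  qed (use dens assms rtilde_cont in auto)
  then show ?thesis using assms dens(2) by (simp add: has_field_derivative_def hh_def ee_def pr_def)
qed

lemma pr_deriv: assumes "x \<in> J" shows "(pr has_real_derivative ee x * hh x) (at x)"
proof -
  have "(pr has_real_derivative deriv p (dens x) * (ee x / hh x)) (at x)"
    unfolding pr_def using DERIV_chain2[OF pressure_deriv[of _ 0, simplified] dens_deriv] dens(1) assms by auto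
  moreover have "deriv p (dens x) = hh x * hh x"
    using sound_speed_sq(1)[OF dens(1)[OF assms]] by (simp add: hh_def power2_eq_square)
  ultimately show ?thesis using hh(1)[OF assms] by (simp add: mult.commute)
qed

lemma ee_deriv: assumes "x \<in> J" shows "(ee has_real_derivative ee x / hh x + ee x * hh x) (at x)"
  unfolding ee_def[abs_def] using DERIV_add[OF dens_deriv[OF assms] pr_deriv[OF assms]] by (simp add: ee_def)

definition "hh' x = deriv (deriv p) (dens x) * (inverse (hh x) / 2) * (ee x / hh x)"

lemma hh_deriv: assumes "x \<in> J" shows "(hh has_real_derivative hh' x) (at x)"
  unfolding hh_def hh'_def using DERIV_chain2[OF sound_speed_deriv dens_deriv] dens(1) assms by (auto simp: hh_def)

lemma fluid_cont: "continuous_on J dens" "continuous_on J pr" "continuous_on J ee" "continuous_on J hh" "continuous_on J hh'"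
proof -
  show 1: "continuous_on J dens" "continuous_on J pr" "continuous_on J ee" "continuous_on J hh"
    by (meson dens_deriv pr_deriv ee_deriv hh_deriv DERIV_isCont continuous_at_imp_continuous_on)+
  have "continuous_on J (\<lambda>x. deriv (deriv p) (dens x))"
  proof (rule continuous_on_compose2[OF _ 1(1)])
    show "continuous_on {0<..} (deriv (deriv p))" using pressure_deriv_cont[of 2] by (simp add: eval_nat_numeral)
  qed (use dens(1) in auto)
  then show "continuous_on J hh'"
    unfolding hh'_def[abs_def] by (intro continuous_intros 1) (auto simp: hh less_imp_neq[symmetric])
qed

lemma strict_diff_fluid:
  fixes f :: "'a::real_normed_vector \<Rightarrow> real"
  assumes "f x \<in> J" "strict_diff f x S" "x \<in> S"
  shows "strict_diff (\<lambda>y. dens (f y)) x S" "strict_diff (\<lambda>y. pr (f y)) x S" "strict_diff (\<lambda>y. ee (f y)) x S"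
    "strict_diff (\<lambda>y. hh (f y)) x S"
proof -
  have nz: "hh x \<noteq> 0" if "x \<in> J" for x using hh(1)[OF that] by simp
  show "strict_diff (\<lambda>y. dens (f y)) x S"
    by (rule strict_diff_real_compose[OF J_open assms(1) dens_deriv _ assms(2,3)])
      (auto intro!: continuous_intros fluid_cont simp: nz)
  show "strict_diff (\<lambda>y. pr (f y)) x S"
    by (rule strict_diff_real_compose[OF J_open assms(1) pr_deriv _ assms(2,3)])
      (auto intro!: continuous_intros fluid_cont simp: nz)
  show "strict_diff (\<lambda>y. ee (f y)) x S"
    by (rule strict_diff_real_compose[OF J_open assms(1) ee_deriv _ assms(2,3)])
      (auto intro!: continuous_intros fluid_cont simp: nz)
  show "strict_diff (\<lambda>y. hh (f y)) x S"
    by (rule strict_diff_real_compose[OF J_open assms(1) hh_deriv _ assms(2,3)])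
      (auto intro!: continuous_intros fluid_cont simp: nz)
qed

lemma strict_diff_vel:
  fixes f g :: "'a::real_normed_vector \<Rightarrow> real"
  assumes "strict_diff f x S" "strict_diff g x S" "x \<in> S"
  shows "strict_diff (\<lambda>y. vel (f y) (g y)) x S"
  unfolding vel_def
  by (rule strict_diff_real_compose[where I = UNIV and \<phi>' = "\<lambda>y. 1 - tanh y ^ 2"])
    (use assms in \<open>auto intro!: derivative_eq_intros continuous_intros strict_diff_intros simp: cosh_real_nonzero\<close>)

abbreviation mean :: "real \<times> real \<Rightarrow> real" where "mean U \<equiv> (fst U + snd U) / 2"

lemma fluid_eqs: "density F \<alpha> \<beta> = dens ((\<alpha> + \<beta>) / 2)" "press F \<alpha> \<beta> = pr ((\<alpha> + \<beta>) / 2)"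
  "eta F \<alpha> \<beta> = hh ((\<alpha> + \<beta>) / 2)"
  by (simp_all add: density_def dens_def press_def pr_def eta_def hh_def)

lemma vel_bounds: "-1 < vel \<alpha> \<beta>" "vel \<alpha> \<beta> < 1"
  by (auto simp: vel_def tanh_real_gt_neg1 tanh_real_lt_1)

lemma char_denoms:
  assumes "(\<alpha> + \<beta>) / 2 \<in> J"
  shows "0 < 1 + vel \<alpha> \<beta> * eta F \<alpha> \<beta>" "0 < 1 - vel \<alpha> \<beta> * eta F \<alpha> \<beta>"
proof -
  have "\<bar>vel \<alpha> \<beta> * eta F \<alpha> \<beta>\<bar> < 1"
    using vel_bounds[of \<alpha> \<beta>] hh[OF assms] mult_strict_mono[of "\<bar>vel \<alpha> \<beta>\<bar>" 1 "hh ((\<alpha> + \<beta>) / 2)" 1]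
    by (auto simp: fluid_eqs abs_mult)
  then show "0 < 1 + vel \<alpha> \<beta> * eta F \<alpha> \<beta>" "0 < 1 - vel \<alpha> \<beta> * eta F \<alpha> \<beta>" by auto
qed

lemma strict_diff_char:
  assumes "mean U \<in> J"
  shows "strict_diff (\<lambda>U. c_plus F (fst U) (snd U)) U UNIV" "strict_diff (\<lambda>U. c_minus F (fst U) (snd U)) U UNIV"
proof -
  have nz: "1 + vel (fst U) (snd U) * eta F (fst U) (snd U) \<noteq> 0" "1 - vel (fst U) (snd U) * eta F (fst U) (snd U) \<noteq> 0"
    using char_denoms[OF assms] by auto
  have e: "strict_diff (\<lambda>U. eta F (fst U) (snd U)) U UNIV"
    unfolding fluid_eqs by (intro strict_diff_fluid assms strict_diff_intros') auto
  show "strict_diff (\<lambda>U. c_plus F (fst U) (snd U)) U UNIV" "strict_diff (\<lambda>U. c_minus F (fst U) (snd U)) U UNIV"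
    unfolding c_plus_def c_minus_def by (intro strict_diff_intros' strict_diff_vel e nz UNIV_I)+
qed

lemma strict_diff_source:
  assumes "mean U \<in> J" "r \<noteq> 0"
  shows "strict_diff (\<lambda>q. A_tilde F (fst (fst q)) (snd (fst q)) (snd q)) (U, r) UNIV"
    "strict_diff (\<lambda>q. B_tilde F (fst (fst q)) (snd (fst q)) (snd q)) (U, r) UNIV"
proof -
  have nz: "1 + vel (fst U) (snd U) * eta F (fst U) (snd U) \<noteq> 0" "1 - vel (fst U) (snd U) * eta F (fst U) (snd U) \<noteq> 0"
    using char_denoms[OF assms(1)] by auto
  have e: "strict_diff (\<lambda>q. eta F (fst (fst q)) (snd (fst q))) (U, r) UNIV"
    unfolding fluid_eqs by (intro strict_diff_fluid strict_diff_intros') (use assms in auto)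
  have eq: "A_tilde F \<alpha> \<beta> r = (0 - 2 * vel \<alpha> \<beta> * eta F \<alpha> \<beta>) / (r * (1 + vel \<alpha> \<beta> * eta F \<alpha> \<beta>))"
    "B_tilde F \<alpha> \<beta> r = (0 - 2 * vel \<alpha> \<beta> * eta F \<alpha> \<beta>) / (r * (1 - vel \<alpha> \<beta> * eta F \<alpha> \<beta>))" for \<alpha> \<beta> r
    by (simp_all add: A_tilde_def B_tilde_def)
  show "strict_diff (\<lambda>q. A_tilde F (fst (fst q)) (snd (fst q)) (snd q)) (U, r) UNIV"
    "strict_diff (\<lambda>q. B_tilde F (fst (fst q)) (snd (fst q)) (snd q)) (U, r) UNIV"
    unfolding eq by (intro strict_diff_intros' strict_diff_vel e UNIV_I; use nz assms(2) in simp)+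
qed

lemma char_less:
  assumes "(\<alpha> + \<beta>) / 2 \<in> J"
  shows "c_minus F \<alpha> \<beta> < c_plus F \<alpha> \<beta>"
proof -
  define v e where "v = vel \<alpha> \<beta>" and "e = eta F \<alpha> \<beta>"
  have b: "0 < 1 + v * e" "0 < 1 - v * e" "0 < e" "v\<^sup>2 < 1"
    using char_denoms[OF assms] hh(1)[OF assms] vel_bounds[of \<alpha> \<beta>] by (auto simp: v_def e_def fluid_eqs abs_square_less_1)
  have "(v + e) * (1 - v * e) - (v - e) * (1 + v * e) = 2 * e * (1 - v\<^sup>2)" by (simp add: algebra_simps power2_eq_square)
  also have "\<dots> > 0" using b by simp
  finally show ?thesis unfolding c_plus_def c_minus_def v_def[symmetric] e_def[symmetric]
    using b by (simp add: divide_less_eq less_divide_eq mult.commute)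
qed

end

section \<open>The jump conditions\<close>

context barotropic_fluid
begin

text \<open>
  Written with \<open>avg\<close> instead of difference quotients, the jump relations remain regular where the two states
  coincide.
\<close>
definition "R_avg U W = avg (\<lambda>x. ee x / hh x) (mean U) (mean W)"
definition "S_avg U W = avg (\<lambda>x. ee x * hh x) (mean U) (mean W)"
text \<open>The factor between the jump of (\<alpha> + \<beta>) / 2 and the hyperbolic sine of the
  rapidity jump. Its square arises from \<open>a * b = d * d\<close> in
  \<open>jump_conditions\<close> after division by the square of the first of these jumps.\<close>

definition "K_jump U W = sqrt (R_avg U W * S_avg U W / (ee (mean U) * ee (mean W)))"
text \<open>This is (1 + V) / (1 - V), that is \<open>a / d\<close> in
  \<open>jump_conditions\<close>, with the jump of (\<alpha> + \<beta>) / 2 cancelled from numerator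
  and denominator; the cancellation keeps it meaningful for coinciding states.\<close>

definition "shock_ratio U W =
  exp ((fst U - snd U + (fst W - snd W)) / 2) *
    ((R_avg U W + S_avg U W) * cosh ((fst U - fst W - (snd U - snd W)) / 2) +
     (ee (mean U) + ee (mean W)) * K_jump U W) / (R_avg U W - S_avg U W)"
definition "shock_speed U W = (shock_ratio U W - 1) / (shock_ratio U W + 1)"

lemma J_fun_cont: "continuous_on J (\<lambda>x. ee x / hh x)" "continuous_on J (\<lambda>x. ee x * hh x)"
  using hh(1) by (auto intro!: continuous_intros fluid_cont simp: less_imp_neq[symmetric])

lemma avg_jump:
  assumes "mean U \<in> J" "mean W \<in> J"
  shows "dens (mean U) - dens (mean W) = R_avg U W * (mean U - mean W)"
    "pr (mean U) - pr (mean W) = S_avg U W * (mean U - mean W)"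
    "0 < R_avg U W" "0 < S_avg U W" "S_avg U W < R_avg U W"
proof -
  note J = J_convex J_open
  show "dens (mean U) - dens (mean W) = R_avg U W * (mean U - mean W)"
    unfolding R_avg_def by (rule avg_quotient[OF J dens_deriv J_fun_cont(1) assms])
  show "pr (mean U) - pr (mean W) = S_avg U W * (mean U - mean W)"
    unfolding S_avg_def by (rule avg_quotient[OF J pr_deriv J_fun_cont(2) assms])
  show "0 < R_avg U W" "0 < S_avg U W"
    unfolding R_avg_def S_avg_def
    by (rule avg_pos[OF J(1) J_fun_cont(1) assms] avg_pos[OF J(1) J_fun_cont(2) assms]; simp add: ee hh)+
  have "0 < avg (\<lambda>x. ee x / hh x - ee x * hh x) (mean U) (mean W)"
  proof (rule avg_pos[OF J(1) _ assms])
    fix x assume x: "x \<in> J"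
    have "hh x * hh x < 1" using hh[OF x] mult_strict_mono[of "hh x" 1 "hh x" 1] by simp
    then have "ee x * (hh x * hh x) < ee x * 1" using ee[OF x] by (intro mult_strict_left_mono)
    then show "0 < ee x / hh x - ee x * hh x" using hh(1)[OF x] by (simp add: field_simps)
  qed (intro continuous_intros J_fun_cont)
  then show "S_avg U W < R_avg U W"
    unfolding R_avg_def S_avg_def using avg_diff[OF J(1) J_fun_cont assms] by simp
qed

text \<open>For distinct means \<open>R_avg\<close> and \<open>S_avg\<close> are difference
  quotients and hence symmetric; for equal means there is nothing to exchange. The remaining
  ingredients are sums, products and the even function \<open>cosh\<close>.\<close>

lemma shock_speed_sym:
  assumes "mean U \<in> J" "mean W \<in> J"
  shows "shock_speed U W = shock_speed W U"
proof -
  have RS: "R_avg U W = R_avg W U" "S_avg U W = S_avg W U"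
  proof -
    have "R_avg U W * (mean U - mean W) = R_avg W U * (mean U - mean W)"
      "S_avg U W * (mean U - mean W) = S_avg W U * (mean U - mean W)"
      using avg_jump(1,2)[OF assms] avg_jump(1,2)[OF assms(2,1)]
        mult_minus_right[of "R_avg W U" "mean U - mean W"] mult_minus_right[of "S_avg W U" "mean U - mean W"]
      unfolding minus_diff_eq by linarith+
    then show "R_avg U W = R_avg W U" "S_avg U W = S_avg W U"
      by (cases "mean U = mean W"; simp only: R_avg_def S_avg_def mult_cancel_right right_minus_eq simp_thms)+
  qed
  have K: "K_jump U W = K_jump W U" unfolding K_jump_def RS mult.commute[of "ee (mean U)"] ..
  have c: "cosh ((fst U - fst W - (snd U - snd W)) / 2) = cosh ((fst W - fst U - (snd W - snd U)) / 2)"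
  proof -
    have "(fst U - fst W - (snd U - snd W)) / 2 = - ((fst W - fst U - (snd W - snd U)) / 2)"
      unfolding minus_divide_left by simp
    then show ?thesis by (metis cosh_minus)
  qed
  show ?thesis
    unfolding shock_speed_def shock_ratio_def RS K c add.commute[of "fst U - snd U"] add.commute[of "ee (mean U)"] ..
qed

lemma K_jump_same: assumes "mean U \<in> J" shows "K_jump U U = 1"
  using ee[OF assms] hh(1)[OF assms] by (simp add: K_jump_def R_avg_def S_avg_def)

lemma vel_exp: "vel \<alpha> \<beta> = (exp (\<alpha> - \<beta>) - 1) / (exp (\<alpha> - \<beta>) + 1)"
  unfolding vel_def tanh_real_altdef
proof -
  have "exp (- 2 * ((\<alpha> - \<beta>) / 2)) = 1 / exp (\<alpha> - \<beta>)"
  proof -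
    have "- 2 * ((\<alpha> - \<beta>) / 2) = - (\<alpha> - \<beta>)" by simp
    then show ?thesis unfolding inverse_eq_divide[symmetric] exp_minus[symmetric] by (rule arg_cong)
  qed
  then show "(1 - exp (- 2 * ((\<alpha> - \<beta>) / 2))) / (1 + exp (- 2 * ((\<alpha> - \<beta>) / 2))) = (exp (\<alpha> - \<beta>) - 1) / (exp (\<alpha> - \<beta>) + 1)"
  proof -
    have "(1 - 1 / X) / (1 + 1 / X) = (X - 1) / (X + 1)" if "0 < X" for X :: real
    proof -
      have "1 - 1 / X = (X - 1) / X" "1 + 1 / X = (X + 1) / X" using that by (simp_all add: field_simps)
      then show ?thesis using that by simp
    qed
    from this[OF exp_gt_zero, of "\<alpha> - \<beta>"] show ?thesis
      unfolding \<open>exp (- 2 * ((\<alpha> - \<beta>) / 2)) = 1 / exp (\<alpha> - \<beta>)\<close> .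
  qed
qed

text \<open>For coinciding states the ratio becomes X (1 + h) / (1 - h), where X is (1 + v) / (1 -
  v) for the fluid velocity v. Such factors multiply under relativistic addition of velocities, and
  \<open>c_plus\<close> is the sum of v and the sound speed h in this sense.\<close>

lemma shock_speed_same:
  assumes J: "mean U \<in> J"
  shows "shock_speed U U = c_plus F (fst U) (snd U)"
proof -
  define X e h where "X = exp (fst U - snd U)" and "e = ee (mean U)" and "h = hh (mean U)"
  have pos: "0 < X" "0 < e" "0 < h" "h < 1" using ee[OF J] hh[OF J] by (auto simp: X_def e_def h_def)
  have "h * h < 1" using pos mult_strict_mono[of h 1 h 1] by simp
  have "shock_ratio U U = X * (e / h + e * h + (e + e)) / (e / h - e * h)"
    by (simp add: shock_ratio_def R_avg_def S_avg_def K_jump_same[OF J] X_def e_def h_def)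
  also have "\<dots> = X * ((1 + h) * (1 + h) * (e / h)) / ((1 - h) * (1 + h) * (e / h))"
    using pos by (simp add: field_simps)
  also have "\<dots> = X * (1 + h) / (1 - h)" using pos by simp
  finally have r: "shock_ratio U U = X * (1 + h) / (1 - h)" .
  have 1: "shock_speed U U = (X * (1 + h) - (1 - h)) / (X * (1 + h) + (1 - h))"
  proof -
    have "(a / b - 1) / (a / b + 1) = (a - b) / (a + b)" if "0 < a" "0 < b" for a b :: real
    proof -
      have "a / b - 1 = (a - b) / b" "a / b + 1 = (a + b) / b" using that by (simp_all add: field_simps)
      then show ?thesis using that by simp
    qed
    from this[of "X * (1 + h)" "1 - h"] show ?thesis unfolding shock_speed_def r using pos by simp
  qed
  have X1: "X + 1 > 0" using pos by simp
  have "c_plus F (fst U) (snd U) = ((X - 1) / (X + 1) + h) / (1 + (X - 1) / (X + 1) * h)"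
    by (simp add: c_plus_def vel_exp X_def fluid_eqs h_def)
  also have "(X - 1) / (X + 1) + h = (X * (1 + h) - (1 - h)) / (X + 1)"
    using X1 by (simp add: field_simps)
  also have "1 + (X - 1) / (X + 1) * h = (X * (1 + h) + (1 - h)) / (X + 1)"
    using X1 by (simp add: field_simps)
  finally show ?thesis using X1 1 by simp
qed

lemma strict_diff_avg_mean:
  assumes J: "mean U \<in> J" and c: "continuous_on J \<phi>" and \<phi>: "strict_diff \<phi> (mean U) UNIV"
  shows "strict_diff (\<lambda>q. avg \<phi> (mean (fst q)) (mean (snd q))) (U, U) UNIV"
proof -
  obtain \<phi>' where \<phi>': "strict_deriv \<phi> \<phi>' (mean U) UNIV" using \<phi> by (auto simp: strict_diff_def)
  then have "\<phi>' = (\<lambda>h. \<phi>' 1 * h)"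
    using strict_deriv_linear[OF \<phi>'] real_bounded_linear by (metis mult_1 mult.commute)
  then have "strict_deriv (\<lambda>p. avg \<phi> (fst p) (snd p)) (\<lambda>h. \<phi>' 1 * (fst h + snd h) / 2) (mean U, mean U) UNIV"
    using strict_deriv_avg[OF J_convex J_open J c, of "\<phi>' 1"] \<phi>' by simp
  then have "strict_diff (\<lambda>p. avg \<phi> (fst p) (snd p)) (mean U, mean U) UNIV"
    unfolding strict_diff_def by blast
  moreover have "strict_diff (\<lambda>q. (mean (fst q), mean (snd q))) (U, U) UNIV"
    by (intro strict_diff_intros' UNIV_I) simp_all
  ultimately show ?thesis
    using strict_diff_compose[where f = "\<lambda>q. (mean (fst q), mean (snd q))" and g = "\<lambda>p. avg \<phi> (fst p) (snd p)"
        and x = "(U, U)" and S = UNIV] by simp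
qed

lemma strict_diff_jump:
  assumes J: "mean U \<in> J"
  shows "strict_diff (\<lambda>q. K_jump (fst q) (snd q)) (U, U) UNIV"
    "strict_diff (\<lambda>q. shock_speed (fst q) (snd q)) (U, U) UNIV"
proof -
  have id: "strict_diff (\<lambda>x::real. x) (mean U) UNIV" by (rule strict_diff_ident)
  have nz: "hh (mean U) \<noteq> 0" "ee (mean U) \<noteq> 0" using hh(1)[OF J] ee[OF J] by auto
  note fl = strict_diff_fluid[where f = "\<lambda>x. x", OF J id UNIV_I]
  have R: "strict_diff (\<lambda>q. R_avg (fst q) (snd q)) (U, U) UNIV"
    unfolding R_avg_def
    by (rule strict_diff_avg_mean[OF J J_fun_cont(1)], rule strict_diff_divide[OF fl(3,4) UNIV_I nz(1)])
  have S: "strict_diff (\<lambda>q. S_avg (fst q) (snd q)) (U, U) UNIV"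
    unfolding S_avg_def
    by (rule strict_diff_avg_mean[OF J J_fun_cont(2)], rule strict_diff_mult[OF fl(3,4) UNIV_I])
  have e: "strict_diff (\<lambda>q. ee (mean (fst q))) (U, U) UNIV" "strict_diff (\<lambda>q. ee (mean (snd q))) (U, U) UNIV"
    by (intro strict_diff_fluid strict_diff_intros' UNIV_I; use J in simp)+
  note RS = avg_jump(3-5)[OF J J]
  have K: "strict_diff (\<lambda>q. K_jump (fst q) (snd q)) (U, U) UNIV"
    unfolding K_jump_def
    by (intro strict_diff_intros R S e UNIV_I; use RS nz ee[OF J] in simp)
  then show "strict_diff (\<lambda>q. K_jump (fst q) (snd q)) (U, U) UNIV" .
  have ch: "strict_diff (\<lambda>q. cosh ((fst (fst q) - fst (snd q) - (snd (fst q) - snd (snd q))) / 2)) (U, U) UNIV"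
    by (rule strict_diff_real_compose[where I = UNIV and \<phi>' = sinh])
      (auto intro!: derivative_eq_intros continuous_intros strict_diff_intros')
  have r: "strict_diff (\<lambda>q. shock_ratio (fst q) (snd q)) (U, U) UNIV"
    unfolding shock_ratio_def
    by (intro strict_diff_intros' R S e K ch UNIV_I; use RS in simp)
  have "0 < shock_ratio U U"
    unfolding shock_ratio_def using RS ee[OF J] K_jump_same[OF J]
    by (intro divide_pos_pos mult_pos_pos add_pos_pos) auto
  then show "strict_diff (\<lambda>q. shock_speed (fst q) (snd q)) (U, U) UNIV"
    unfolding shock_speed_def
    by (intro strict_diff_intros r UNIV_I) simp
qed

text \<open>
  The speed is symmetric in the two states and equals \<open>c_plus\<close> when they coincide, so its derivative at
  coinciding states is that of \<open>c_plus\<close> at the average.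
\<close>
lemma strict_deriv_shock_speed:
  assumes J: "mean U \<in> J" and D: "strict_deriv (\<lambda>U. c_plus F (fst U) (snd U)) D U UNIV"
  shows "strict_deriv (\<lambda>q. shock_speed (fst q) (snd q)) (\<lambda>h. D (fst h + snd h) / 2) (U, U) UNIV"
proof -
  obtain V' where V': "strict_deriv (\<lambda>q. shock_speed (fst q) (snd q)) V' (U, U) UNIV"
    using strict_diff_jump(2)[OF J] by (auto simp: strict_diff_def)
  have lin: "linear V'" using strict_deriv_linear[OF V'] by (simp add: bounded_linear.linear)
  have "continuous_on UNIV (mean :: real \<times> real \<Rightarrow> real)" by (intro continuous_intros) simp
  then have "open (mean -` J)" using J_open open_vimage by blast
  then obtain r where "0 < r" "ball U r \<subseteq> mean -` J"
    using J openE[of "mean -` J" U] by blast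
  then have r: "0 < r" "\<And>W. dist W U < r \<Longrightarrow> mean W \<in> J"
    by (auto simp: dist_commute subset_iff)
  have near: "dist (fst q) U < r" "dist (snd q) U < r" if "norm (q - (U, U)) < r" for q :: "(real \<times> real) \<times> (real \<times> real)"
  proof -
    have "norm (fst q - U, snd q - U) < r" using that by (cases q) simp
    then show "dist (fst q) U < r" "dist (snd q) U < r"
      using le_less_trans[OF norm_fst_le] le_less_trans[OF norm_snd_le] unfolding dist_norm by blast+
  qed
  have "strict_deriv (\<lambda>q. shock_speed (fst (snd q, fst q)) (snd (snd q, fst q))) (\<lambda>h. V' (snd h, fst h)) (U, U) UNIV"
  proof -
    have s: "strict_deriv (\<lambda>q. (snd q, fst q)) (\<lambda>q. (snd q, fst q)) (U, U) UNIV"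
      by (intro strict_deriv_bounded_linear bounded_linear_Pair bounded_linear_fst bounded_linear_snd)
    show ?thesis
      using strict_deriv_compose[OF _ s UNIV_I, of "\<lambda>q. shock_speed (fst q) (snd q)" V'] V' by simp
  qed
  then have "strict_deriv (\<lambda>q. shock_speed (fst q) (snd q)) (\<lambda>h. V' (snd h, fst h)) (U, U) UNIV"
  proof (rule strict_deriv_cong[OF _ r(1)])
    fix q :: "(real \<times> real) \<times> (real \<times> real)" assume q: "norm (q - (U, U)) < r"
    show "shock_speed (fst (snd q, fst q)) (snd (snd q, fst q)) = shock_speed (fst q) (snd q)"
      unfolding fst_conv snd_conv using near[OF q] by (intro shock_speed_sym r(2))
  qed
  then have sym: "V' h = V' (snd h, fst h)" for h
    using fun_cong[OF strict_deriv_unique[OF V'], of _ h] by blast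
  have "strict_deriv (\<lambda>W. shock_speed (fst (W, W)) (snd (W, W))) (\<lambda>h. V' (h, h)) U UNIV"
  proof -
    have s: "strict_deriv (\<lambda>W. (W, W)) (\<lambda>W. (W, W)) U UNIV"
      by (intro strict_deriv_bounded_linear bounded_linear_Pair bounded_linear_ident)
    show ?thesis
      using strict_deriv_compose[OF _ s UNIV_I, of "\<lambda>q. shock_speed (fst q) (snd q)" V'] V' by simp
  qed
  then have "strict_deriv (\<lambda>U. c_plus F (fst U) (snd U)) (\<lambda>h. V' (h, h)) U UNIV"
  proof (rule strict_deriv_cong[OF _ r(1)])
    fix W :: "real \<times> real" assume W: "norm (W - U) < r"
    show "shock_speed (fst (W, W)) (snd (W, W)) = c_plus F (fst W) (snd W)"
      unfolding fst_conv snd_conv using W by (intro shock_speed_same r(2)) (simp only: dist_norm)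
  qed
  then have diag: "V' (h, h) = D h" for h
    using fun_cong[OF strict_deriv_unique[OF D], of _ h] by simp
  \<comment> \<open>A vector plus its swap lies on the diagonal, where the derivative is
    \<open>D\<close>; by symmetry both contribute equally.\<close>
  have "V' h = D (fst h + snd h) / 2" for h
  proof -
    have "V' h + V' h = V' h + V' (snd h, fst h)" using sym[of h] by simp
    also have "\<dots> = V' (fst h + snd h, fst h + snd h)"
      by (simp add: linear_add[OF lin, symmetric] plus_prod_def add.commute)
    finally show ?thesis using diag by simp
  qed
  then show ?thesis by (rule strict_deriv_eq_deriv[OF V'])
qed

text \<open>Null components of the stress tensor of a perfect fluid: in the rest frame the first two
  equal \<rho> + p, and the boost to the velocity of the fluid multiplies them by X and 1 / X. The
  third combination is invariant under boosts and equals \<rho> - p.\<close>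

lemma stress_null:
  assumes "mean U \<in> J"
  defines "X \<equiv> exp (fst U - snd U)" and "e \<equiv> ee (mean U)"
  shows "T_tt F (fst U) (snd U) + 2 * T_tr F (fst U) (snd U) + T_rr F (fst U) (snd U) = e * X"
    "T_tt F (fst U) (snd U) - 2 * T_tr F (fst U) (snd U) + T_rr F (fst U) (snd U) = e / X"
    "T_tt F (fst U) (snd U) - T_rr F (fst U) (snd U) = dens (mean U) - pr (mean U)"
proof -
  have X: "0 < X" by (simp add: X_def)
  define v where "v = vel (fst U) (snd U)"
  have v: "v = (X - 1) / (X + 1)" by (simp add: v_def vel_exp X_def)
  have vb: "0 < 1 - v" "0 < 1 + v" using vel_bounds by (auto simp: v_def add.commute less_diff_eq algebra_simps) (smt (verit) vel_bounds)
  have vv: "1 - v\<^sup>2 = (1 - v) * (1 + v)" by (simp add: power2_eq_square algebra_simps)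
  have Xv: "X = (1 + v) / (1 - v)" unfolding v using X by (simp add: field_simps)
  have T: "T_tt F (fst U) (snd U) = e / (1 - v\<^sup>2) - pr (mean U)"
    "T_tr F (fst U) (snd U) = e * v / (1 - v\<^sup>2)"
    "T_rr F (fst U) (snd U) = e * v\<^sup>2 / (1 - v\<^sup>2) + pr (mean U)"
    by (simp_all add: T_tt_def T_tr_def T_rr_def fluid_eqs v_def e_def ee_def)
  have "T_tt F (fst U) (snd U) + 2 * T_tr F (fst U) (snd U) + T_rr F (fst U) (snd U) = e * ((1 + v) * (1 + v)) / (1 - v\<^sup>2)"
    unfolding T by (simp add: add_divide_distrib algebra_simps power2_eq_square)
  also have "\<dots> = e * X" unfolding Xv vv using vb by simp
  finally show "T_tt F (fst U) (snd U) + 2 * T_tr F (fst U) (snd U) + T_rr F (fst U) (snd U) = e * X" .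
  have "T_tt F (fst U) (snd U) - 2 * T_tr F (fst U) (snd U) + T_rr F (fst U) (snd U) = e * ((1 - v) * (1 - v)) / (1 - v\<^sup>2)"
    unfolding T by (simp add: add_divide_distrib diff_divide_distrib algebra_simps power2_eq_square)
  also have "\<dots> = e / X" unfolding Xv vv using vb by simp
  finally show "T_tt F (fst U) (snd U) - 2 * T_tr F (fst U) (snd U) + T_rr F (fst U) (snd U) = e / X" .
  have "T_tt F (fst U) (snd U) - T_rr F (fst U) (snd U) = e * (1 - v\<^sup>2) / (1 - v\<^sup>2) - 2 * pr (mean U)"
    unfolding T by (simp add: diff_divide_distrib algebra_simps)
  then show "T_tt F (fst U) (snd U) - T_rr F (fst U) (snd U) = dens (mean U) - pr (mean U)"
    unfolding vv using vb by (simp add: e_def ee_def)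
qed

text \<open>
  In terms of the null components \<open>a\<close>, \<open>b\<close>, \<open>d\<close> of the jump the conditions read \<open>a (1 - V) = d (1 + V)\<close>
  and \<open>b (1 + V) = d (1 - V)\<close>.  Eliminating \<open>V\<close> gives \<open>a b = d\<^sup>2\<close>, which is a relation between the jump of the
  rapidity and those of the density and the pressure.
\<close>
lemma jump_conditions:
  assumes J: "mean U \<in> J" "mean W \<in> J"
    and tt: "(T_tt F (fst U) (snd U) - T_tt F (fst W) (snd W)) * V = T_tr F (fst U) (snd U) - T_tr F (fst W) (snd W)"
    and tr: "(T_tr F (fst U) (snd U) - T_tr F (fst W) (snd W)) * V = T_rr F (fst U) (snd U) - T_rr F (fst W) (snd W)"
    and V: "\<bar>V\<bar> < 1"
    and sgn: "0 < (mean U - mean W) * (fst U - snd U - (fst W - snd W))"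
  shows "V = shock_speed U W"
    "sinh ((fst U - snd U - (fst W - snd W)) / 2) = (mean U - mean W) * K_jump U W"
proof -
  define x where "x = mean U - mean W"
  define X Y where "X = exp (fst U - snd U)" and "Y = exp (fst W - snd W)"
  define e1 e2 where "e1 = ee (mean U)" and "e2 = ee (mean W)"
  define R S K where "R = R_avg U W" and "S = S_avg U W" and "K = K_jump U W"
  define th where "th = (fst U - snd U - (fst W - snd W)) / 2"
  define Z where "Z = exp ((fst U - snd U + (fst W - snd W)) / 2)"
  define a b d where "a = e1 * X - e2 * Y" and "b = e1 / X - e2 / Y"
    and "d = dens (mean U) - pr (mean U) - (dens (mean W) - pr (mean W))"
  have pos: "0 < e1" "0 < e2" "0 < R" "0 < S" "S < R" "0 < X" "0 < Y" "0 < Z"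
    using ee J avg_jump(3-5)[OF J] by (auto simp: e1_def e2_def R_def S_def X_def Y_def Z_def)
  have XZ: "X = Z * exp th" "Y = Z * exp (- th)"
    by (auto simp: X_def Y_def Z_def th_def simp flip: exp_add) (simp_all add: field_simps)
  note quot = avg_jump(1,2)[OF J, folded x_def R_def S_def]
  have dR: "d = (R - S) * x" unfolding d_def left_diff_distrib using quot by linarith
  have eR: "e1 - e2 = (R + S) * x" unfolding e1_def e2_def ee_def distrib_right using quot by linarith
  have sg: "0 < x * th" using sgn unfolding x_def[symmetric] th_def by simp
  then have x0: "x \<noteq> 0" by auto
  have d0: "d \<noteq> 0" using x0 pos by (simp add: dR)
  note n1 = stress_null[OF J(1), folded X_def e1_def] and n2 = stress_null[OF J(2), folded Y_def e2_def]
  have aT: "a = (T_tt F (fst U) (snd U) - T_tt F (fst W) (snd W)) + 2 * (T_tr F (fst U) (snd U) - T_tr F (fst W) (snd W))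
     + (T_rr F (fst U) (snd U) - T_rr F (fst W) (snd W))"
    and bT: "b = (T_tt F (fst U) (snd U) - T_tt F (fst W) (snd W)) - 2 * (T_tr F (fst U) (snd U) - T_tr F (fst W) (snd W))
     + (T_rr F (fst U) (snd U) - T_rr F (fst W) (snd W))"
    and dT: "d = (T_tt F (fst U) (snd U) - T_tt F (fst W) (snd W)) - (T_rr F (fst U) (snd U) - T_rr F (fst W) (snd W))"
    unfolding a_def b_def d_def n1[symmetric] n2[symmetric] by simp_all
  have aV: "a * (1 - V) = d * (1 + V)"
    unfolding aT dT using tt tr by (simp add: algebra_simps)
  have bV: "b * (1 + V) = d * (1 - V)"
    unfolding bT dT using tt tr by (simp add: algebra_simps)
  have Vpos: "0 < 1 - V" "0 < 1 + V" using V by auto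
  have "(a * b) * ((1 - V) * (1 + V)) = (d * d) * ((1 - V) * (1 + V))"
    using arg_cong2[OF aV bV, of "(*)"] by (simp add: algebra_simps)
  then have ab: "a * b = d * d" using Vpos by simp
  define q q' where "q = exp th" and "q' = exp (- th)"
  have qq: "q * q' = 1" by (simp add: q_def q'_def exp_minus)
  have "2 * sinh th = q - q'" by (simp add: q_def q'_def sinh_field_def)
  then have "(2 * sinh th)\<^sup>2 = (q - q')\<^sup>2" by simp
  then have sq: "q * q + q' * q' = 2 + 4 * (sinh th)\<^sup>2"
    using qq by (simp add: power2_eq_square algebra_simps)
  have a': "a = Z * (e1 * q - e2 * q')"
    unfolding a_def XZ q_def q'_def by (simp add: algebra_simps)
  have b': "b = (e1 * q' - e2 * q) / Z"
  proof -
    have "1 / X = q' / Z" "1 / Y = q / Z" unfolding XZ q_def q'_def by (simp_all add: exp_minus field_simps)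
    moreover have "b = e1 * (1 / X) - e2 * (1 / Y)" by (simp add: b_def)
    ultimately show ?thesis by (simp add: diff_divide_distrib)
  qed
  have "a * b = (e1 * q - e2 * q') * (e1 * q' - e2 * q)"
    unfolding a' b' using pos by simp
  also have "\<dots> = (e1 * e1 + e2 * e2) * (q * q') - e1 * e2 * (q * q + q' * q')"
    by (simp add: algebra_simps)
  finally have "a * b = (e1 * e1 + e2 * e2) * (q * q') - e1 * e2 * (q * q + q' * q')" .
  then have "a * b = e1 * e1 + e2 * e2 - e1 * e2 * (2 + 4 * (sinh th)\<^sup>2)"
    unfolding qq sq by simp
  also have "\<dots> = (e1 - e2) * (e1 - e2) - 4 * (e1 * e2) * (sinh th)\<^sup>2" by (simp add: algebra_simps)
  finally have "4 * (e1 * e2) * (sinh th)\<^sup>2 = (e1 - e2) * (e1 - e2) - d * d" using ab by simp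
  also have "\<dots> = 4 * (x\<^sup>2 * (R * S))" unfolding dR eR by (simp add: algebra_simps power2_eq_square)
  finally have sq: "(sinh th)\<^sup>2 = x\<^sup>2 * (R * S / (e1 * e2))" using pos by (simp add: field_simps)
  have Ksq: "K\<^sup>2 = R * S / (e1 * e2)" and K: "0 < K"
    using pos by (auto simp: K_def K_jump_def R_def S_def e1_def e2_def)
  have "(sinh th)\<^sup>2 = (x * K)\<^sup>2" using sq Ksq by (simp add: power_mult_distrib)
  \<comment> \<open>The hypothesis \<open>sgn\<close> selects the root: \<open>sinh th\<close> has
    the sign of \<open>th\<close>, which is that of \<open>x\<close>, and \<open>K\<close> is
    positive.\<close>
  then have "sinh th = x * K \<or> sinh th = - (x * K)" by (simp add: power2_eq_iff)
  moreover have "0 < sinh th * x"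
    using sg by (auto simp: zero_less_mult_iff sinh_real_pos_iff sinh_real_neg_iff)
  moreover have "0 < (x * x) * K" using x0 K by (auto simp: zero_less_mult_iff neq_iff)
  ultimately have sh: "sinh th = x * K"
    by (auto simp: mult_ac)
  then show "sinh ((fst U - snd U - (fst W - snd W)) / 2) = (mean U - mean W) * K_jump U W"
    by (simp add: th_def x_def K_def)
  \<comment> \<open>After the substitution of the jumps every term of \<open>a\<close> carries the
    factor \<open>x\<close>, as \<open>d\<close> does, so that \<open>x\<close> drops out of
    \<open>a / d\<close>.\<close>
  have "a = Z * ((e1 - e2) * cosh th + (e1 + e2) * sinh th)"
    unfolding a_def XZ by (simp add: sinh_field_def cosh_field_def field_simps)
  also have "\<dots> = Z * ((R + S) * cosh th + (e1 + e2) * K) * x"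
    unfolding eR sh by (simp add: algebra_simps)
  finally have a: "a = Z * ((R + S) * cosh th + (e1 + e2) * K) * x" .
  have th': "(fst U - fst W - (snd U - snd W)) / 2 = th" by (simp add: th_def algebra_simps)
  have ratio: "shock_ratio U W = a / d"
    unfolding shock_ratio_def th' a dR using x0 by (simp add: R_def S_def K_def Z_def e1_def e2_def)
  have "a / d = (1 + V) / (1 - V)" using aV d0 Vpos by (simp add: field_simps)
  then have "a / d - 1 = 2 * V / (1 - V)" "a / d + 1 = 2 / (1 - V)"
    using Vpos by (simp_all add: field_simps)
  then show "V = shock_speed U W"
    unfolding shock_speed_def ratio using Vpos by simp
qed

end

section \<open>The state ahead near the cusp point\<close>

lemma eventually_at_left_neg: "\<forall>\<^sub>F x in at_left (0::real). x < 0"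
  by (simp add: eventually_at_filter)

locale ahead_state = barotropic_fluid +
  fixes A :: ahead
  assumes state: "state_ahead F A"
begin

abbreviation "N \<equiv> dom_ah A"
abbreviation "W \<equiv> width A"
abbreviation "a \<equiv> alpha_ah A"
abbreviation "b \<equiv> beta_ah A"
abbreviation "r \<equiv> r_ah A"
abbreviation "cp x \<equiv> c_plus F (a x) (b x)"
abbreviation "cm x \<equiv> c_minus F (a x) (b x)"
abbreviation "\<kappa> \<equiv> kappa A"
abbreviation "\<Lambda> \<equiv> lam A"
abbreviation "U0 \<equiv> (alpha0 A, beta0 A)"
abbreviation "O2 \<equiv> (0::real, 0::real)"
abbreviation "D i j f \<equiv> bpd (dom_ah A) i j f"
abbreviation "aw0 \<equiv> D 0 1 a O2"
text \<open>The singular boundary and the characteristic, glued at the cusp point into one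
  continuous graph; the domain becomes the part of a square that lies on or below it.\<close>

definition "\<tau> w = (if w \<le> 0 then t_sing A w else t_char A w)"
definition "cp0 = c_plus F (alpha0 A) (beta0 A)"
definition "cm0 = c_minus F (alpha0 A) (beta0 A)"

lemma ahead:
  "0 < W" "smooth_upto N a" "smooth_upto N b" "smooth_upto N r"
  "x \<in> N \<Longrightarrow> admissible F (a x) (b x) (r x)"
  "x \<in> N \<Longrightarrow> D 1 0 r x = cp x"
  "x \<in> N \<Longrightarrow> D 1 0 a x = A_tilde F (a x) (b x) (r x)"
  "x \<in> N \<Longrightarrow> D 0 1 r x * (D 1 0 b x - B_tilde F (a x) (b x) (r x)) = (cp x - cm x) * D 0 1 b x"
  "D 0 1 r O2 = 0" "D 0 2 r O2 = 0" "0 < \<kappa>" "0 < \<Lambda>"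
  "t_sing A 0 = 0" "continuous_on {- W <.. 0} (t_sing A)"
  "(\<lambda>w. t_sing A w - \<Lambda> / (2 * \<kappa>\<^sup>2) * w\<^sup>2) \<in> O[at_left 0](\<lambda>w. w ^ 3)"
  "w \<le> 0 \<Longrightarrow> (t_sing A w, w) \<in> N \<Longrightarrow> D 0 1 r (t_sing A w, w) = 0"
  "(t, w) \<in> N \<Longrightarrow> \<not> (w \<le> 0 \<and> t = t_sing A w) \<Longrightarrow> D 0 1 r (t, w) < 0"
  "t_char A 0 = 0" "continuous_on {0 ..< W} (t_char A)"
  "0 \<le> w \<Longrightarrow> (t_char A w, w) \<in> N \<Longrightarrow> (t_char A has_real_derivative
      - D 0 1 r (t_char A w, w) / (cp (t_char A w, w) - cm (t_char A w, w))) (at w within {0 ..< W})"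
  using state unfolding state_ahead_def Let_def by blast+

lemma tau_0: "\<tau> 0 = 0" by (simp add: \<tau>_def ahead)

lemma tau_cont: "continuous_on {- W<..<W} \<tau>"
proof -
  have "continuous_on ({- W<..0} \<union> {0..<W}) \<tau>"
    unfolding \<tau>_def
  proof (rule continuous_on_cases_local)
    show "closedin (top_of_set ({- W<..0} \<union> {0..<W})) {- W<..0}"
      by (auto simp: closedin_closed intro!: exI[of _ "{..0}"])
    show "closedin (top_of_set ({- W<..0} \<union> {0..<W})) {0..<W}"
      by (auto simp: closedin_closed intro!: exI[of _ "{0..}"])
  qed (use ahead(13,14,18,19) in auto)
  moreover have "{- W<..0} \<union> {0..<W} = {- W<..<W}" using ahead(1) by auto
  ultimately show ?thesis by simp
qed

lemma N_eq: "N = {(t, w). t \<le> \<tau> w \<and> \<bar>t\<bar> < W \<and> \<bar>w\<bar> < W}"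
  unfolding dom_ah_def \<tau>_def by (auto simp: ahead split: if_splits)

lemma interior_N: "interior N = {(t, w). t < \<tau> w \<and> \<bar>t\<bar> < W \<and> \<bar>w\<bar> < W}" (is "_ = ?I")
proof (rule interior_unique)
  show "?I \<subseteq> N" by (auto simp: N_eq)
  have c: "continuous_on ({- W<..<W} \<times> {- W<..<W}) (\<lambda>p. \<tau> (snd p) - fst p)"
    by (intro continuous_intros continuous_on_compose2[OF tau_cont]) auto
  have "?I = ({- W<..<W} \<times> {- W<..<W}) \<inter> (\<lambda>p. \<tau> (snd p) - fst p) -` {0<..}" by auto
  also have "open \<dots>"
    by (rule continuous_on_open_vimage[THEN iffD1, rule_format, OF _ c, unfolded Int_commute[of "_ -` _"]])
      (auto intro: open_Times)
  finally show "open ?I" .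
next
  fix T assume T: "T \<subseteq> N" "open T"
  show "T \<subseteq> ?I"
  proof
    fix x assume x: "x \<in> T"
    obtain t w where [simp]: "x = (t, w)" by (cases x)
    obtain e where e: "0 < e" "ball x e \<subseteq> T" using T(2) x openE by blast
    have "(t + e / 2, w) \<in> ball x e" using e(1) by (simp add: dist_Pair_Pair dist_real_def)
    then have "(t + e / 2, w) \<in> N" "(t, w) \<in> N" using e T x by auto
    then show "x \<in> ?I" using e(1) by (auto simp: N_eq)
  qed
qed

text \<open>Decreasing \<open>t\<close> leads from every point of the domain into the interior. The
  form with (-1, 0) is the one in which \<open>strict_deriv_along_boundary\<close> asks for a shift
  direction.\<close>

lemma shift_N: "(t, w) \<in> N \<Longrightarrow> 0 < \<delta> \<Longrightarrow> \<delta> < W + t \<Longrightarrow> (t + \<delta> * (-1), w + \<delta> * 0) \<in> interior N"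
  unfolding interior_N by (auto simp: N_eq)

lemma limpt_N: assumes "x \<in> N" shows "at x within interior N \<noteq> bot"
proof -
  obtain t w where x: "x = (t, w)" by (cases x)
  have "x islimpt interior N"
    unfolding islimpt_approachable
  proof (intro allI impI)
    fix e :: real assume e: "0 < e"
    define \<delta> where "\<delta> = min (e / 2) ((W + t) / 2)"
    have "0 < W + t" using assms by (auto simp: x N_eq)
    then have \<delta>: "0 < \<delta>" "\<delta> < e" "\<delta> < W + t" using e unfolding \<delta>_def by (simp_all add: min_less_iff_disj)
    then show "\<exists>x'\<in>interior N. x' \<noteq> x \<and> dist x' x < e"
      using shift_N[of t w \<delta>] assms by (intro bexI[of _ "(t - \<delta>, w)"]) (auto simp: x dist_Pair_Pair dist_real_def)
  qed
  then show ?thesis by (simp add: trivial_limit_within)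
qed

lemma O_in_N: "O2 \<in> N" by (auto simp: N_eq tau_0 ahead)

lemma D_cont: "smooth_upto N f \<Longrightarrow> continuous_on N (D i j f)"
  by (rule bpd_extension(1)[where k = "i + j"]) (auto simp: smooth_upto_def limpt_N)

lemma f_cont: "smooth_upto N f \<Longrightarrow> continuous_on N f"
  unfolding smooth_upto_def C_upto_def by blast

lemma D_deriv:
  assumes "smooth_upto N f" "(t, w) \<in> interior N"
  shows "((\<lambda>s. D i j f (s, w)) has_real_derivative D (Suc i) j f (t, w)) (at t)"
    "((\<lambda>s. D 0 j f (t, s)) has_real_derivative D 0 (Suc j) f (t, w)) (at w)"
    "(f has_derivative (\<lambda>h. D 1 0 f (t, w) * fst h + D 0 1 f (t, w) * snd h)) (at (t, w))"
proof -
  have C: "C_upto k N f" for k using assms(1) by (simp add: smooth_upto_def)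
  show "((\<lambda>s. D i j f (s, w)) has_real_derivative D (Suc i) j f (t, w)) (at t)"
    by (rule C_upto_has_partial(1)[OF C limpt_N assms(2), of _ _ "Suc (i + j)"]) auto
  show "((\<lambda>s. D 0 j f (t, s)) has_real_derivative D 0 (Suc j) f (t, w)) (at w)"
    by (rule C_upto_has_partial(2)[OF C limpt_N assms(2), of _ "Suc j"]) auto
  show "(f has_derivative (\<lambda>h. D 1 0 f (t, w) * fst h + D 0 1 f (t, w) * snd h)) (at (t, w))"
    by (rule C_upto_has_derivative[OF C[of 1] _ limpt_N assms(2)]) auto
qed

lemma f_deriv:
  assumes "smooth_upto N f" "(t, w) \<in> interior N"
  shows "((\<lambda>s. f (s, w)) has_real_derivative D 1 0 f (t, w)) (at t)"
    "((\<lambda>s. f (t, s)) has_real_derivative D 0 1 f (t, w)) (at w)"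
  using has_derivative_partials(2,3)[of f "(t, w)"] bpd_extension(2)[of 1 N f, OF _ _ limpt_N assms(2)]
    C_upto_differentiable[of 1 N f 0 0, OF _ _ assms(2)] assms(1)
  by (simp_all add: smooth_upto_def pd_def)

abbreviation "FN \<equiv> at O2 within N"

lemma D_tendsto: "smooth_upto N f \<Longrightarrow> (D i j f \<longlongrightarrow> D i j f O2) FN"
  and f_tendsto: "smooth_upto N f \<Longrightarrow> (f \<longlongrightarrow> f O2) FN"
  using D_cont f_cont O_in_N unfolding continuous_on_def by blast+

lemma U0_J: "mean U0 \<in> J"
  using ahead(5)[OF O_in_N] by (simp add: admissible_def alpha0_def beta0_def)

lemma r0_pos: "0 < r0 A"
  using ahead(5)[OF O_in_N] by (simp add: admissible_def r0_def)

lemma cm0_less: "cm0 < cp0" unfolding cm0_def cp0_def using char_less U0_J by simp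

lemma char_tendsto: "(cp \<longlongrightarrow> cp0) FN" "(cm \<longlongrightarrow> cm0) FN"
proof -
  have U: "((\<lambda>x. (a x, b x)) \<longlongrightarrow> U0) FN"
    unfolding alpha0_def beta0_def by (intro tendsto_intros f_tendsto ahead)
  obtain f' g' where fg: "strict_deriv (\<lambda>U. c_plus F (fst U) (snd U)) f' U0 UNIV"
      "strict_deriv (\<lambda>U. c_minus F (fst U) (snd U)) g' U0 UNIV"
    using strict_diff_char[OF U0_J] unfolding strict_diff_def by blast
  have "isCont (\<lambda>U. c_plus F (fst U) (snd U)) U0" "isCont (\<lambda>U. c_minus F (fst U) (snd U)) U0"
    using strict_deriv_tendsto[OF fg(1)] strict_deriv_tendsto[OF fg(2)] by (simp_all add: isCont_def)
  from isCont_tendsto_compose[OF this(1) U] isCont_tendsto_compose[OF this(2) U]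
  show "(cp \<longlongrightarrow> cp0) FN" "(cm \<longlongrightarrow> cm0) FN" by (simp_all add: cp0_def cm0_def)
qed

lemma bw0: "D 0 1 b O2 = 0"
proof -
  have "(cp O2 - cm O2) * D 0 1 b O2 = 0" using ahead(8)[OF O_in_N] ahead(9) by simp
  then show ?thesis using cm0_less by (simp add: cp0_def cm0_def alpha0_def beta0_def)
qed

lemma tau_tendsto: "(\<tau> \<longlongrightarrow> 0) (at 0)"
proof -
  have "isCont \<tau> 0" using tau_cont ahead(1) by (auto simp: continuous_on_eq_continuous_at)
  then show ?thesis by (simp add: isCont_def tau_0)
qed

text \<open>Because \<open>\<tau>\<close> tends to 0, the set 0 \<le> t \<le>
  \<open>\<tau> w\<close> shrinks to the cusp point as w does. All the asymptotics of the state
  ahead are stated uniformly over such slivers, in which the shock will be seen to lie.\<close>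

lemma near_N:
  assumes "\<forall>\<^sub>F x in FN. P x"
  shows "\<forall>\<^sub>F w in at 0. \<forall>t. 0 \<le> t \<longrightarrow> t \<le> \<tau> w \<longrightarrow> P (t, w)"
proof -
  obtain d where d: "0 < d" "\<And>x. x \<in> N \<Longrightarrow> x \<noteq> O2 \<Longrightarrow> dist x O2 < d \<Longrightarrow> P x"
    using assms by (auto simp: eventually_at)
  define m where "m = min W (d / 2)"
  have m: "0 < m" "m \<le> W" "m \<le> d / 2" using ahead(1) d by (auto simp: m_def)
  have "\<forall>\<^sub>F w in at 0. dist (\<tau> w) 0 < m" using tau_tendsto m(1) by (rule tendstoD)
  moreover have "\<forall>\<^sub>F w in at (0::real). dist w 0 < m" using tendstoD[OF tendsto_ident_at m(1)] .
  moreover have "\<forall>\<^sub>F w in at (0::real). w \<noteq> 0" by (simp add: eventually_at_filter)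
  ultimately show ?thesis
  proof eventually_elim
    case (elim w)
    show ?case
    proof (intro allI impI)
      fix t assume t: "0 \<le> t" "t \<le> \<tau> w"
      have "dist (t, w) O2 \<le> \<bar>t\<bar> + \<bar>w\<bar>"
        using sqrt_sum_squares_le_sum_abs[of t w] by (simp add: dist_Pair_Pair dist_real_def)
      also have "\<dots> < d" using t elim m by auto
      finally show "P (t, w)" using d(2)[of "(t, w)"] t elim m by (auto simp: N_eq)
    qed
  qed
qed

lemma near_int: "\<forall>\<^sub>F w in at 0. \<forall>t. 0 \<le> t \<longrightarrow> t < \<tau> w \<longrightarrow> (t, w) \<in> interior N"
proof -
  have "\<forall>\<^sub>F w in at 0. dist (\<tau> w) 0 < W" using tau_tendsto ahead(1) by (rule tendstoD)
  moreover have "\<forall>\<^sub>F w in at (0::real). dist w 0 < W" using tendstoD[OF tendsto_ident_at ahead(1)] .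
  ultimately show ?thesis by eventually_elim (auto simp: interior_N)
qed

subsection \<open>The singular boundary and the characteristic\<close>

lemma tau_left: "((\<lambda>w. \<tau> w / w\<^sup>2) \<longlongrightarrow> \<Lambda> / (2 * \<kappa>\<^sup>2)) (at_left 0)"
proof -
  obtain C where C: "0 < C" "\<forall>\<^sub>F w in at_left 0. norm (t_sing A w - \<Lambda> / (2 * \<kappa>\<^sup>2) * w\<^sup>2) \<le> C * norm (w ^ 3)"
    using landau_o.bigE[OF ahead(15)] by blast
  have "((\<lambda>w. \<tau> w / w\<^sup>2 - \<Lambda> / (2 * \<kappa>\<^sup>2)) \<longlongrightarrow> 0) (at_left 0)"
  proof (rule Lim_null_comparison)
    show "((\<lambda>w::real. C * \<bar>w\<bar>) \<longlongrightarrow> 0) (at_left 0)"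
      by (auto intro!: tendsto_eq_intros)
    show "\<forall>\<^sub>F w in at_left 0. norm (\<tau> w / w\<^sup>2 - \<Lambda> / (2 * \<kappa>\<^sup>2)) \<le> C * \<bar>w\<bar>"
      using C(2) eventually_at_left_neg
    proof (eventually_elim, goal_cases)
      case (1 w)
      then have w: "w < 0" by simp
      have "\<tau> w / w\<^sup>2 - \<Lambda> / (2 * \<kappa>\<^sup>2) = (t_sing A w - \<Lambda> / (2 * \<kappa>\<^sup>2) * w\<^sup>2) / w\<^sup>2"
        using w by (simp add: \<tau>_def diff_divide_distrib)
      also have "norm \<dots> \<le> C * norm (w ^ 3) / w\<^sup>2"
        using 1(1) by (simp add: divide_right_mono)
      also have "norm (w ^ 3) = \<bar>w\<bar> * w\<^sup>2" by (simp add: power3_eq_cube power2_eq_square abs_mult)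
      also have "C * (\<bar>w\<bar> * w\<^sup>2) / w\<^sup>2 = C * \<bar>w\<bar>" using w by simp
      finally show ?case .
    qed
  qed
  then show ?thesis by (simp add: LIM_zero_iff)
qed

lemma tau_left_pos: "\<forall>\<^sub>F w in at_left 0. 0 < \<tau> w"
proof -
  have "0 < \<Lambda> / (2 * \<kappa>\<^sup>2)" using ahead by simp
  from order_tendstoD(1)[OF tau_left this] show ?thesis
    by eventually_elim (auto simp: zero_less_divide_iff)
qed

definition "h = t_char A"
definition "h' w = - D 0 1 r (h w, w) / (cp (h w, w) - cm (h w, w))"

lemma h_0: "h 0 = 0" by (simp add: h_def ahead)

lemma h'_0: "h' 0 = 0" using ahead(9) by (simp add: h'_def h_0)

lemma tau_right: "0 < w \<Longrightarrow> \<tau> w = h w" by (simp add: \<tau>_def h_def)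

lemma h_in_N: "\<forall>\<^sub>F w in at_right 0. (h w, w) \<in> N"
proof -
  have "\<forall>\<^sub>F w in at 0. dist (\<tau> w) 0 < W" using tau_tendsto ahead(1) by (rule tendstoD)
  then have "\<forall>\<^sub>F w in at_right 0. dist (\<tau> w) 0 < W" by (simp add: eventually_at_split)
  then show ?thesis using eventually_at_right_real[OF ahead(1)]
    by eventually_elim (auto simp: N_eq tau_right)
qed

lemma h_deriv: assumes "0 \<le> w" "(h w, w) \<in> N"
  shows "(h has_real_derivative h' w) (at w within {0..<W})" "0 < w \<Longrightarrow> (h has_real_derivative h' w) (at w)"
proof -
  show 1: "(h has_real_derivative h' w) (at w within {0..<W})"
    using ahead(20)[OF assms(1)] assms(2) by (simp add: h_def h'_def)
  show "(h has_real_derivative h' w) (at w)" if "0 < w"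
  proof -
    have "w < W" using assms(2) by (auto simp: N_eq)
    have "(h has_real_derivative h' w) (at w within {0<..<W})" using 1 by (rule DERIV_subset) auto
    then show ?thesis using that \<open>w < W\<close> by (simp add: at_within_open[of w "{0<..<W}"])
  qed
qed

lemma cp_cm_N: "x \<in> N \<Longrightarrow> cm x < cp x"
  using ahead(5)[of x] char_less by (simp add: admissible_def)

text \<open>Off the singular boundary the w-derivative of \<open>r\<close> is negative, so the
  characteristic rises strictly to the right of the cusp point. The mean value form with
  \<open>h s < h w\<close> prepares the bootstrap in \<open>h_small\<close>.\<close>

lemma h_pos: "\<forall>\<^sub>F w in at_right 0. 0 < h w \<and> 0 < h' w"
  and h_mvt: "\<forall>\<^sub>F w in at_right 0. \<exists>s. 0 < s \<and> s < w \<and> h w = w * h' s \<and> h s < h w"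
proof -
  obtain w0 where w0: "0 < w0" "\<And>w. 0 < w \<Longrightarrow> w < w0 \<Longrightarrow> (h w, w) \<in> N"
    using h_in_N by (auto simp: eventually_at_right_field)
  define w1 where "w1 = min w0 W"
  have w1: "0 < w1" using w0 ahead by (simp add: w1_def)
  have h'p: "0 < h' w" if "0 < w" "w < w1" for w
  proof -
    have "(h w, w) \<in> N" using w0 that by (simp add: w1_def)
    then show ?thesis using ahead(17)[of "h w" w] cp_cm_N[of "(h w, w)"] that by (simp add: h'_def divide_less_0_iff)
  qed
  have dh: "(h has_real_derivative h' w) (at w)" if "0 < w" "w < w1" for w
    using h_deriv(2)[of w] w0 that by (simp add: w1_def)
  have ch: "continuous_on {0..w} h" if "w < w1" for w
    unfolding h_def by (rule continuous_on_subset[OF ahead(19)]) (use that in \<open>auto simp: w1_def\<close>)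
  have mvt: "\<exists>s. u < s \<and> s < w \<and> h w - h u = (w - u) * h' s" if "0 \<le> u" "u < w" "w < w1" for u w
  proof -
    have "\<exists>l z. u < z \<and> z < w \<and> DERIV h z :> l \<and> h w - h u = (w - u) * l"
    proof (rule MVT)
      show "continuous_on {u..w} h" using ch[OF that(3)] that by (auto intro: continuous_on_subset)
      show "\<And>x. u < x \<Longrightarrow> x < w \<Longrightarrow> h differentiable (at x)"
        using dh that by (meson le_less_trans less_trans real_differentiable_def)
    qed (use that in auto)
    then obtain l z where "u < z" "z < w" "DERIV h z :> l" "h w - h u = (w - u) * l" by blast
    moreover have "l = h' z" using dh[of z] calculation that by (meson DERIV_unique le_less_trans less_trans)
    ultimately show ?thesis by blast
  qed
  have inc: "h u < h w" if u: "0 \<le> u" "u < w" "w < w1" for u w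
  proof -
    obtain s where "u < s" "s < w" "h w - h u = (w - u) * h' s" using mvt[OF u] by blast
    moreover have "0 < (w - u) * h' s" using h'p[of s] calculation u by (intro mult_pos_pos) auto
    ultimately show ?thesis by linarith
  qed
  show "\<forall>\<^sub>F w in at_right 0. 0 < h w \<and> 0 < h' w"
    using eventually_at_right_real[OF w1] by eventually_elim (use inc[of 0] h'p h_0 in auto)
  show "\<forall>\<^sub>F w in at_right 0. \<exists>s. 0 < s \<and> s < w \<and> h w = w * h' s \<and> h s < h w"
    using eventually_at_right_real[OF w1]
  proof eventually_elim
    case (elim w)
    then obtain s where "0 < s" "s < w" "h w - h 0 = (w - 0) * h' s" using mvt[of 0 w] by auto
    then show ?case using inc[of s w] elim by (intro exI[of _ s]) (auto simp: h_0)
  qed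
qed

lemma tau_in_N: "\<forall>\<^sub>F w in at_left 0. (\<tau> w, w) \<in> N"
proof -
  have "\<forall>\<^sub>F w in at 0. dist (\<tau> w) 0 < W" using tau_tendsto ahead(1) by (rule tendstoD)
  moreover have "\<forall>\<^sub>F w in at (0::real). dist w 0 < W" using tendstoD[OF tendsto_ident_at ahead(1)] .
  ultimately have "\<forall>\<^sub>F w in at 0. (\<tau> w, w) \<in> N"
    by eventually_elim (auto simp: N_eq)
  then show ?thesis by (simp add: eventually_at_split)
qed

lemma near_left:
  assumes "\<forall>\<^sub>F x in FN. P x"
  shows "\<forall>\<^sub>F w in at_left 0. \<forall>t. 0 \<le> t \<longrightarrow> t \<le> \<tau> w \<longrightarrow> P (t, w)"
  using near_N[OF assms] by (simp add: eventually_at_split)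

lemma near_right:
  assumes "\<forall>\<^sub>F x in FN. P x"
  shows "\<forall>\<^sub>F w in at_right 0. \<forall>t. 0 \<le> t \<longrightarrow> t \<le> h w \<longrightarrow> P (t, w)"
proof -
  have "\<forall>\<^sub>F w in at_right 0. \<forall>t. 0 \<le> t \<longrightarrow> t \<le> \<tau> w \<longrightarrow> P (t, w)"
    using near_N[OF assms] by (simp add: eventually_at_split)
  then show ?thesis using eventually_at_right_less[of 0]
    by eventually_elim (simp add: tau_right)
qed

lemma int_left: "\<forall>\<^sub>F w in at_left 0. \<forall>t. 0 \<le> t \<longrightarrow> t < \<tau> w \<longrightarrow> (t, w) \<in> interior N"
  using near_int by (simp add: eventually_at_split)

lemma int_right: "\<forall>\<^sub>F w in at_right 0. \<forall>t. 0 \<le> t \<longrightarrow> t < h w \<longrightarrow> (t, w) \<in> interior N"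
proof -
  have "\<forall>\<^sub>F w in at_right 0. \<forall>t. 0 \<le> t \<longrightarrow> t < \<tau> w \<longrightarrow> (t, w) \<in> interior N"
    using near_int by (simp add: eventually_at_split)
  then show ?thesis using eventually_at_right_less[of 0]
    by eventually_elim (simp add: tau_right)
qed

lemma axis_int: "\<forall>\<^sub>F w in at 0. (0, w) \<in> interior N"
proof -
  have "\<forall>\<^sub>F w in at_right 0. (0, w) \<in> interior N"
    using int_right h_pos by eventually_elim auto
  moreover have "\<forall>\<^sub>F w in at_left 0. (0, w) \<in> interior N"
    using int_left tau_left_pos by eventually_elim auto
  ultimately show ?thesis by (simp add: eventually_at_split)
qed

lemma axis_tendsto:
  assumes "(g \<longlongrightarrow> l) FN"
  shows "((\<lambda>w. g (0, w)) \<longlongrightarrow> l) (at 0)"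
proof (rule topological_tendstoI)
  fix S assume "open S" "l \<in> S"
  then have "\<forall>\<^sub>F x in FN. g x \<in> S" using assms topological_tendstoD by blast
  from near_N[OF this] axis_int show "\<forall>\<^sub>F w in at 0. g (0, w) \<in> S"
    by eventually_elim (auto simp: interior_N less_imp_le)
qed

lemma www: "D 0 3 r O2 = - \<Lambda> / \<kappa>"
  using ahead(11) by (simp add: lam_def)

lemma axis_deriv:
  assumes "smooth_upto N f"
  shows "\<forall>\<^sub>F w in at 0. ((\<lambda>s. D 0 j f (0, s)) has_real_derivative D 0 (Suc j) f (0, w)) (at w)"
  using axis_int by eventually_elim (rule D_deriv(2)[OF assms])

text \<open>The cusp point is a boundary point, so no Taylor formula is available there. The axis t
  = 0 is interior except at that point, and repeated use of l'Hopital's rule along it recovers the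
  Taylor coefficients of \<open>r\<close> in w one order after the other.\<close>

lemma rww_axis: "((\<lambda>w. D 0 2 r (0, w) / w) \<longlongrightarrow> - \<Lambda> / \<kappa>) (at 0)"
  by (rule lhopital[where f' = "\<lambda>w. D 0 3 r (0, w)" and g' = "\<lambda>w. 1"])
    (use axis_deriv[OF ahead(4), of 2] axis_tendsto[OF D_tendsto[OF ahead(4)], of 0 2]
      axis_tendsto[OF D_tendsto[OF ahead(4)], of 0 3] ahead(10) www
     in \<open>auto simp: eventually_at_filter numeral_3_eq_3 numeral_2_eq_2 intro!: derivative_eq_intros tendsto_eq_intros\<close>)

lemma rw_axis: "((\<lambda>w. D 0 1 r (0, w) / w\<^sup>2) \<longlongrightarrow> - \<Lambda> / (2 * \<kappa>)) (at 0)"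
proof (rule lhopital[where f' = "\<lambda>w. D 0 2 r (0, w)" and g' = "\<lambda>w. 2 * w"])
  show "((\<lambda>w. D 0 1 r (0, w)) \<longlongrightarrow> 0) (at 0)"
    using axis_tendsto[OF D_tendsto[OF ahead(4)], of 0 1] ahead(9) by simp
  show "\<forall>\<^sub>F w in at 0. ((\<lambda>w. D 0 1 r (0, w)) has_real_derivative D 0 2 r (0, w)) (at w)"
    using axis_deriv[OF ahead(4), of 1] by (simp add: numeral_2_eq_2)
  have "((\<lambda>w. D 0 2 r (0, w) / w / 2) \<longlongrightarrow> - \<Lambda> / \<kappa> / 2) (at 0)"
    by (intro tendsto_intros rww_axis) simp
  then show "((\<lambda>w. D 0 2 r (0, w) / (2 * w)) \<longlongrightarrow> - \<Lambda> / (2 * \<kappa>)) (at 0)"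
    by (simp add: mult.commute)
qed (auto simp: eventually_at_filter intro!: always_eventually derivative_eq_intros tendsto_eq_intros)

lemma r_axis: "((\<lambda>w. (r (0, w) - r0 A) / w ^ 3) \<longlongrightarrow> - \<Lambda> / (6 * \<kappa>)) (at 0)"
proof (rule lhopital[where f' = "\<lambda>w. D 0 1 r (0, w)" and g' = "\<lambda>w. 3 * w\<^sup>2"])
  have "((\<lambda>w. r (0, w) - r O2) \<longlongrightarrow> r O2 - r O2) (at 0)"
    by (intro tendsto_intros axis_tendsto f_tendsto ahead)
  then show "((\<lambda>w. r (0, w) - r0 A) \<longlongrightarrow> 0) (at 0)" by (simp add: r0_def)
  show "\<forall>\<^sub>F w in at 0. ((\<lambda>w. r (0, w) - r0 A) has_real_derivative D 0 1 r (0, w)) (at w)"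
    using axis_int by eventually_elim (auto intro!: derivative_eq_intros f_deriv(2)[OF ahead(4)])
  have "((\<lambda>w. D 0 1 r (0, w) / w\<^sup>2 / 3) \<longlongrightarrow> - \<Lambda> / (2 * \<kappa>) / 3) (at 0)"
    by (intro tendsto_intros rw_axis) simp
  then show "((\<lambda>w. D 0 1 r (0, w) / (3 * w\<^sup>2)) \<longlongrightarrow> - \<Lambda> / (6 * \<kappa>)) (at 0)"
    by (simp add: mult.commute)
qed (auto simp: eventually_at_filter intro!: always_eventually derivative_eq_intros tendsto_eq_intros)

lemma kappa_eq: "\<kappa> = D 1 1 r O2" by (simp add: kappa_def)

text \<open>Along vertical lines the w-derivative of \<open>r\<close> changes at a rate close to
  \<kappa>. On the right it is compared with the axis; on the left with the singular boundary, where
  it vanishes, so that it is -\<kappa> times the distance to that boundary up to small relative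
  error.\<close>

lemma rw_vertical:
  assumes e: "0 < e"
  shows "\<forall>\<^sub>F w in at_right 0. \<bar>D 0 1 r (h w, w) - D 0 1 r (0, w)\<bar> \<le> (\<kappa> + e) * h w"
    "\<forall>\<^sub>F w in at_left 0. \<forall>t. 0 \<le> t \<longrightarrow> t < \<tau> w \<longrightarrow> \<bar>D 0 1 r (t, w) + \<kappa> * (\<tau> w - t)\<bar> \<le> e * (\<tau> w - t)"
proof -
  have ev: "\<forall>\<^sub>F x in FN. dist (D 1 1 r x) \<kappa> < e"
    using tendstoD[OF D_tendsto[OF ahead(4), of 1 1] e] by (simp add: kappa_eq)
  have mvt: "\<exists>s. t < s \<and> s < t' \<and> D 0 1 r (t', w) - D 0 1 r (t, w) = (t' - t) * D 1 1 r (s, w)"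
    if "t < t'" "0 \<le> t" "\<And>s. 0 \<le> s \<Longrightarrow> s < t' \<Longrightarrow> (s, w) \<in> interior N" "(t', w) \<in> N" for t t' w
  proof -
    have d: "((\<lambda>s. D 0 1 r (s, w)) has_real_derivative D 1 1 r (s, w)) (at s)" if "t \<le> s" "s < t'" for s
      using D_deriv(1)[OF ahead(4), of s w 0 1] that \<open>0 \<le> t\<close> \<open>\<And>s. 0 \<le> s \<Longrightarrow> s < t' \<Longrightarrow> (s, w) \<in> interior N\<close> by simp
    have "continuous_on {t..t'} (\<lambda>s. D 0 1 r (s, w))"
    proof (rule continuous_on_compose2[OF D_cont[OF ahead(4)]])
      show "(\<lambda>s. (s, w)) ` {t..t'} \<subseteq> N"
      proof (clarify)
        fix s assume "s \<in> {t..t'}"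
        then show "(s, w) \<in> N"
          using that(2) that(3)[of s] that(4) interior_subset[of N] by (cases "s = t'") auto
      qed
    qed (intro continuous_intros)
    then have "\<exists>l s. t < s \<and> s < t' \<and> DERIV (\<lambda>s. D 0 1 r (s, w)) s :> l \<and>
        D 0 1 r (t', w) - D 0 1 r (t, w) = (t' - t) * l"
      by (rule MVT[OF \<open>t < t'\<close>]) (rule real_differentiable_def[THEN iffD2], rule exI, rule d; simp)
    then obtain l s where s: "t < s" "s < t'" "DERIV (\<lambda>s. D 0 1 r (s, w)) s :> l"
      "D 0 1 r (t', w) - D 0 1 r (t, w) = (t' - t) * l" by blast
    moreover have "l = D 1 1 r (s, w)" using DERIV_unique[OF s(3) d] s by simp
    ultimately show ?thesis by blast
  qed
  show "\<forall>\<^sub>F w in at_right 0. \<bar>D 0 1 r (h w, w) - D 0 1 r (0, w)\<bar> \<le> (\<kappa> + e) * h w"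
    using near_right[OF ev] int_right h_pos h_in_N
  proof eventually_elim
    case (elim w)
    obtain s where s: "0 < s" "s < h w" "D 0 1 r (h w, w) - D 0 1 r (0, w) = (h w - 0) * D 1 1 r (s, w)"
      using mvt[of 0 "h w" w] elim by auto
    have "dist (D 1 1 r (s, w)) \<kappa> < e" using elim(1) s by auto
    then have "\<bar>D 1 1 r (s, w)\<bar> \<le> \<kappa> + e" using ahead(11) unfolding dist_real_def by linarith
    then show ?case unfolding s(3) using elim(3) by (simp add: abs_mult mult.commute mult_left_mono)
  qed
  show "\<forall>\<^sub>F w in at_left 0. \<forall>t. 0 \<le> t \<longrightarrow> t < \<tau> w \<longrightarrow> \<bar>D 0 1 r (t, w) + \<kappa> * (\<tau> w - t)\<bar> \<le> e * (\<tau> w - t)"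
    using near_left[OF ev] int_left eventually_at_left_neg tau_in_N
  proof eventually_elim
    case (elim w)
    show ?case
    proof (intro allI impI)
    fix t assume t: "0 \<le> t" "t < \<tau> w"
    note elim = elim t
    have tau: "\<tau> w = t_sing A w" using elim by (simp add: \<tau>_def)
    have tN: "(\<tau> w, w) \<in> N" by fact
    obtain s where s: "t < s" "s < \<tau> w" "D 0 1 r (\<tau> w, w) - D 0 1 r (t, w) = (\<tau> w - t) * D 1 1 r (s, w)"
      using mvt[of t "\<tau> w" w] elim tN by auto
    have "D 0 1 r (\<tau> w, w) = 0" using ahead(16)[of w] elim tN tau by auto
    then have "D 0 1 r (t, w) + \<kappa> * (\<tau> w - t) = (\<tau> w - t) * (\<kappa> - D 1 1 r (s, w))"
      using s(3) by (simp add: algebra_simps)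
    also have "\<bar>\<dots>\<bar> = (\<tau> w - t) * \<bar>\<kappa> - D 1 1 r (s, w)\<bar>" using elim by (simp add: abs_mult)
    also have "\<dots> \<le> (\<tau> w - t) * e"
    proof (intro mult_left_mono)
      have "dist (D 1 1 r (s, w)) \<kappa> < e" using elim(1) s t by auto
      then show "\<bar>\<kappa> - D 1 1 r (s, w)\<bar> \<le> e" unfolding dist_real_def by linarith
    qed (use elim in auto)
    finally show "\<bar>D 0 1 r (t, w) + \<kappa> * (\<tau> w - t)\<bar> \<le> e * (\<tau> w - t)" by (simp add: mult.commute)
    qed
  qed
qed

text \<open>The equation for the characteristic bounds \<open>h'\<close> by a multiple of w^2 + h,
  with \<open>h\<close> itself on the right. Through \<open>h_mvt\<close> this becomes h \<le> M w^3
  + M w h, and for M w \<le> 1/2 the last term is absorbed. Once h = o(w^2) is known, the derivative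
  of \<open>r\<close> on the characteristic has the same asymptotics as on the axis.\<close>

lemma h_small: "((\<lambda>w. h w / w\<^sup>2) \<longlongrightarrow> 0) (at_right 0)"
  and h'_asym: "((\<lambda>w. h' w / w\<^sup>2) \<longlongrightarrow> \<Lambda> / (2 * \<kappa> * (cp0 - cm0))) (at_right 0)"
proof -
  define c0 where "c0 = cp0 - cm0"
  have c0: "0 < c0" using cm0_less by (simp add: c0_def)
  have r_ax: "((\<lambda>w. D 0 1 r (0, w) / w\<^sup>2) \<longlongrightarrow> - \<Lambda> / (2 * \<kappa>)) (at_right 0)"
    using rw_axis by (rule filterlim_mono) (auto intro: at_le)
  define B where "B = \<Lambda> / (2 * \<kappa>) + 1"
  have "0 < \<Lambda> / (2 * \<kappa>)" using ahead by simp
  then have B: "0 < B" "- B < - \<Lambda> / (2 * \<kappa>)" by (auto simp: B_def)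
  have ch: "((\<lambda>w. cp (h w, w) - cm (h w, w)) \<longlongrightarrow> c0) (at_right 0)"
  proof (rule tendstoI)
    fix e :: real assume e: "0 < e"
    have "\<forall>\<^sub>F x in FN. dist (cp x - cm x) c0 < e"
      unfolding c0_def by (rule tendstoD[OF _ e]) (intro tendsto_intros char_tendsto)
    from near_right[OF this] h_pos show "\<forall>\<^sub>F w in at_right 0. dist (cp (h w, w) - cm (h w, w)) c0 < e"
      by eventually_elim auto
  qed
  have lower: "\<forall>\<^sub>F w in at_right 0. c0 / 2 < cp (h w, w) - cm (h w, w)"
    using order_tendstoD(1)[OF ch, of "c0 / 2"] c0 by simp
  have "\<forall>\<^sub>F w in at_right 0. - B < D 0 1 r (0, w) / w\<^sup>2"
    by (rule order_tendstoD(1)[OF r_ax B(2)])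
  then have h'bd: "\<forall>\<^sub>F w in at_right 0. h' w \<le> 2 / c0 * (B * w\<^sup>2 + 2 * \<kappa> * h w)"
    using rw_vertical(1)[OF ahead(11)] lower h_pos eventually_at_right_less[of 0]
  proof eventually_elim
    case (elim w)
    have "- D 0 1 r (h w, w) \<le> - D 0 1 r (0, w) + (\<kappa> + \<kappa>) * h w" using elim(2) by linarith
    also have "- D 0 1 r (0, w) \<le> B * w\<^sup>2" using elim by (simp add: field_simps)
    finally have 1: "- D 0 1 r (h w, w) \<le> B * w\<^sup>2 + 2 * \<kappa> * h w" by simp
    have 2: "0 \<le> B * w\<^sup>2 + 2 * \<kappa> * h w" using B elim ahead(11) by simp
    have "h' w \<le> (B * w\<^sup>2 + 2 * \<kappa> * h w) / (cp (h w, w) - cm (h w, w))"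
      unfolding h'_def using 1 elim c0 by (intro divide_right_mono) auto
    also have "\<dots> \<le> (B * w\<^sup>2 + 2 * \<kappa> * h w) / (c0 / 2)"
      using 2 elim c0 by (intro divide_left_mono mult_pos_pos) auto
    finally show ?case by (simp add: mult.commute)
  qed
  define M where "M = 2 / c0 * (B + 2 * \<kappa> + 1)"
  have M: "0 < M" using c0 B ahead(11) by (auto simp: M_def intro!: divide_pos_pos add_pos_pos)
  obtain w0 where w0: "0 < w0" "\<And>w. 0 < w \<Longrightarrow> w < w0 \<Longrightarrow> h' w \<le> 2 / c0 * (B * w\<^sup>2 + 2 * \<kappa> * h w)"
    using h'bd by (auto simp: eventually_at_right_field)
  have "0 < 1 / (2 * M)" using M by simp
  have hb: "\<forall>\<^sub>F w in at_right 0. h w \<le> 2 * M * w ^ 3"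
    using h_mvt h_pos eventually_at_right_real[OF w0(1)] eventually_at_right_real[OF \<open>0 < 1 / (2 * M)\<close>]
  proof eventually_elim
    case (elim w)
    then obtain s where s: "0 < s" "s < w" "h w = w * h' s" "h s < h w" by auto
    have w: "0 < w" "w < w0" using elim by auto
    have "h' s \<le> 2 / c0 * (B * s\<^sup>2 + 2 * \<kappa> * h s)" using w0(2)[of s] s w by auto
    also have "\<dots> \<le> 2 / c0 * ((B + 2 * \<kappa> + 1) * w\<^sup>2 + (B + 2 * \<kappa> + 1) * h w)"
    proof (intro mult_left_mono add_mono)
      have "B * s\<^sup>2 \<le> B * w\<^sup>2" using s B by (intro mult_left_mono power_mono) auto
      also have "\<dots> \<le> (B + 2 * \<kappa> + 1) * w\<^sup>2" using ahead(11) by (intro mult_right_mono) auto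
      finally show "B * s\<^sup>2 \<le> (B + 2 * \<kappa> + 1) * w\<^sup>2" .
      have "2 * \<kappa> * h s \<le> 2 * \<kappa> * h w" using s ahead(11) by (intro mult_left_mono) auto
      also have "\<dots> \<le> (B + 2 * \<kappa> + 1) * h w" using elim B by (intro mult_right_mono) auto
      finally show "2 * \<kappa> * h s \<le> (B + 2 * \<kappa> + 1) * h w" .
    qed (use c0 in auto)
    also have "\<dots> = M * (w\<^sup>2 + h w)" by (simp add: M_def algebra_simps add_divide_distrib)
    finally have "w * h' s \<le> w * (M * (w\<^sup>2 + h w))" using w by simp
    then have 1: "h w \<le> M * w ^ 3 + (M * w) * h w"
      using s(3) by (simp add: algebra_simps power3_eq_cube power2_eq_square)
    have "M * w \<le> 1 / 2" using elim(4) M by (simp add: field_simps)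
    then have "(M * w) * h w \<le> 1 / 2 * h w" using elim by (intro mult_right_mono) auto
    then show ?case using 1 by simp
  qed
  show hs: "((\<lambda>w. h w / w\<^sup>2) \<longlongrightarrow> 0) (at_right 0)"
  proof (rule Lim_null_comparison)
    show "((\<lambda>w. 2 * M * w) \<longlongrightarrow> 0) (at_right 0)" by (auto intro!: tendsto_eq_intros)
    show "\<forall>\<^sub>F w in at_right 0. norm (h w / w\<^sup>2) \<le> 2 * M * w"
      using hb h_pos eventually_at_right_less[of 0]
      by eventually_elim (simp add: field_simps power3_eq_cube power2_eq_square)
  qed
  have "((\<lambda>w. D 0 1 r (h w, w) / w\<^sup>2) \<longlongrightarrow> - \<Lambda> / (2 * \<kappa>)) (at_right 0)"
  proof -
    have "((\<lambda>w. D 0 1 r (h w, w) / w\<^sup>2 - D 0 1 r (0, w) / w\<^sup>2) \<longlongrightarrow> 0) (at_right 0)"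
    proof (rule Lim_null_comparison)
      show "((\<lambda>w. 2 * \<kappa> * (h w / w\<^sup>2)) \<longlongrightarrow> 0) (at_right 0)" using tendsto_mult_left[OF hs, of "2 * \<kappa>"] by simp
      show "\<forall>\<^sub>F w in at_right 0. norm (D 0 1 r (h w, w) / w\<^sup>2 - D 0 1 r (0, w) / w\<^sup>2) \<le> 2 * \<kappa> * (h w / w\<^sup>2)"
        using rw_vertical(1)[OF ahead(11)] eventually_at_right_less[of 0]
      proof eventually_elim
        case (elim w)
        have "norm (D 0 1 r (h w, w) / w\<^sup>2 - D 0 1 r (0, w) / w\<^sup>2) = \<bar>D 0 1 r (h w, w) - D 0 1 r (0, w)\<bar> / w\<^sup>2"
          by (simp add: diff_divide_distrib[symmetric])
        also have "\<dots> \<le> ((\<kappa> + \<kappa>) * h w) / w\<^sup>2" using elim by (intro divide_right_mono) auto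
        finally show ?case by simp
      qed
    qed
    from tendsto_add[OF this r_ax] show ?thesis by simp
  qed
  then have "((\<lambda>w. - (D 0 1 r (h w, w) / w\<^sup>2) / (cp (h w, w) - cm (h w, w))) \<longlongrightarrow> - (- \<Lambda> / (2 * \<kappa>)) / c0) (at_right 0)"
    using c0 by (intro tendsto_divide[OF tendsto_minus ch]) auto
  then show "((\<lambda>w. h' w / w\<^sup>2) \<longlongrightarrow> \<Lambda> / (2 * \<kappa> * (cp0 - cm0))) (at_right 0)"
    by (simp add: h'_def c0_def mult.commute)
qed

lemma h_asym: "((\<lambda>w. h w / w ^ 3) \<longlongrightarrow> \<Lambda> / (6 * \<kappa> * (cp0 - cm0))) (at_right 0)"
proof (rule lhopital_right_0[where f' = h' and g' = "\<lambda>w. 3 * w\<^sup>2"])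
  have "(h \<longlongrightarrow> h 0) (at 0 within {0..<W})"
    using ahead(1,19) unfolding continuous_on_def h_def by auto
  then have "(h \<longlongrightarrow> 0) (at 0 within {0..W / 2})"
    unfolding h_0 by (rule tendsto_within_subset) (use ahead(1) in auto)
  then show "(h \<longlongrightarrow> 0) (at_right 0)"
    using at_within_Icc_at_right[of 0 "W / 2"] ahead(1) by simp
  show "\<forall>\<^sub>F w in at_right 0. (h has_real_derivative h' w) (at w)"
    using h_in_N eventually_at_right_less[of 0] by eventually_elim (simp add: h_deriv)
  have "((\<lambda>w. h' w / w\<^sup>2 / 3) \<longlongrightarrow> \<Lambda> / (2 * \<kappa> * (cp0 - cm0)) / 3) (at_right 0)"
    by (intro tendsto_intros h'_asym) simp
  then show "((\<lambda>w. h' w / (3 * w\<^sup>2)) \<longlongrightarrow> \<Lambda> / (6 * \<kappa> * (cp0 - cm0))) (at_right 0)"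
    by (simp add: mult.commute mult.left_commute)
qed (auto simp: eventually_at_filter intro!: always_eventually derivative_eq_intros tendsto_eq_intros)

subsection \<open>The state near the cusp point\<close>

lemma axis_strict:
  assumes "smooth_upto N f"
  obtains \<delta> where "0 < \<delta>" "strict_deriv (\<lambda>w. f (0, w)) (\<lambda>h. D 0 1 f O2 * h) 0 {-\<delta>..\<delta>}"
proof -
  obtain d where d: "0 < d" "\<And>w. w \<noteq> 0 \<Longrightarrow> \<bar>w\<bar> < d \<Longrightarrow> (0, w) \<in> interior N"
    using axis_int by (auto simp: eventually_at dist_real_def)
  have inN: "(0, w) \<in> N" if "\<bar>w\<bar> \<le> d / 2" for w
    using d(2)[of w] d(1) that O_in_N interior_subset[of N] by (cases "w = 0") auto
  have "strict_deriv (\<lambda>s. f (0, s)) (\<lambda>h. (D 1 0 f (0, 0) * 0 + D 0 1 f (0, 0) * 1) * h) 0 {-(d/2)..d/2}"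
  proof (rule strict_deriv_along_boundary[where S = N and ?e1.0 = "-1" and ?e2.0 = 0 and ?\<delta>0.0 = W and ?\<gamma>1.0 = "\<lambda>s. 0"
        and ?\<gamma>2.0 = "\<lambda>s. s" and ?g1.0 = "\<lambda>s. 0" and ?g2.0 = "\<lambda>s. 1"])
    show "\<And>x. x \<in> interior N \<Longrightarrow> (f has_derivative (\<lambda>h. D 1 0 f x * fst h + D 0 1 f x * snd h)) (at x)"
      using D_deriv(3)[OF assms] by auto
    show "\<And>s \<delta>. s \<in> {-(d/2)..d/2} \<Longrightarrow> 0 < \<delta> \<Longrightarrow> \<delta> < W \<Longrightarrow> (0 + \<delta> * - 1, s + \<delta> * 0) \<in> interior N"
    proof -
      fix s \<delta> :: real assume s: "s \<in> {-(d/2)..d/2}" "0 < \<delta>" "\<delta> < W"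
      then have "(0, s) \<in> N" by (intro inN) auto
      from shift_N[OF this s(2)] s(3) show "(0 + \<delta> * - 1, s + \<delta> * 0) \<in> interior N" by simp
    qed
  qed (use inN d ahead(1) f_cont[OF assms] D_cont[OF assms] in \<open>auto intro!: derivative_eq_intros\<close>)
  then show thesis using that[of "d / 2"] d(1) by simp
qed

text \<open>In the sliver t is below \<open>\<tau> w\<close>, which is of order w^2, so the
  t-derivative contributes only at second order and the expansion along the axis holds uniformly in
  t.\<close>

lemma near_cusp:
  assumes f: "smooth_upto N f" and e: "0 < e"
  shows "\<forall>\<^sub>F w in at_left 0. \<forall>t. 0 \<le> t \<longrightarrow> t < \<tau> w \<longrightarrow> \<bar>f (t, w) - f O2 - D 0 1 f O2 * w\<bar> \<le> e * \<bar>w\<bar>"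
proof -
  obtain \<delta> where \<delta>: "0 < \<delta>" "strict_deriv (\<lambda>w. f (0, w)) (\<lambda>h. D 0 1 f O2 * h) 0 {-\<delta>..\<delta>}"
    using axis_strict[OF f] .
  have "0 < e / 2" using e by simp
  obtain d where d: "0 < d" "\<And>y z. y \<in> {-\<delta>..\<delta>} \<Longrightarrow> z \<in> {-\<delta>..\<delta>} \<Longrightarrow> norm (y - 0) < d \<Longrightarrow> norm (z - 0) < d \<Longrightarrow>
    norm (f (0, y) - f (0, z) - D 0 1 f O2 * (y - z)) \<le> e / 2 * norm (y - z)"
    using strict_derivD[OF \<delta>(2) \<open>0 < e / 2\<close>] by metis
  have m: "- min d \<delta> < 0" using d(1) \<delta>(1) by simp
  have ax: "\<forall>\<^sub>F w in at_left 0. \<bar>f (0, w) - f O2 - D 0 1 f O2 * w\<bar> \<le> e / 2 * \<bar>w\<bar>"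
    using eventually_at_left_real[OF m]
  proof eventually_elim
    case (elim w)
    then have "w \<in> {-\<delta>..\<delta>}" "norm (w - 0) < d" using \<delta>(1) d(1) by (auto simp: min_def split: if_splits)
    then show ?case using d(2)[of w 0] \<delta>(1) d(1) by simp
  qed
  define T where "T = \<bar>D 1 0 f O2\<bar> + 1"
  have T: "0 < T" by (simp add: T_def)
  have ev: "\<forall>\<^sub>F x in FN. \<bar>D 1 0 f x\<bar> < T"
    using order_tendstoD(2)[OF tendsto_rabs[OF D_tendsto[OF f]], of _ _ T] by (simp add: T_def)
  have "((\<lambda>w. \<tau> w / w\<^sup>2 * w) \<longlongrightarrow> \<Lambda> / (2 * \<kappa>\<^sup>2) * 0) (at_left 0)"
    by (intro tendsto_intros tau_left)
  then have "\<forall>\<^sub>F w in at_left 0. dist (\<tau> w / w\<^sup>2 * w) 0 < e / (2 * T)"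
    using e T by (intro tendstoD) auto
  then have tb: "\<forall>\<^sub>F w in at_left 0. T * \<tau> w \<le> e / 2 * \<bar>w\<bar>"
    using tau_left_pos eventually_at_left_neg
  proof eventually_elim
    case (elim w)
    have "\<bar>\<tau> w / w\<^sup>2 * w\<bar> = \<tau> w / \<bar>w\<bar>" using elim by (simp add: abs_mult power2_eq_square)
    then have "\<tau> w / \<bar>w\<bar> < e / (2 * T)" using elim(1) by simp
    then show ?case using elim T by (simp add: field_simps)
  qed
  show ?thesis using ax tb near_left[OF ev] int_left
  proof eventually_elim
    case (elim w)
    show ?case
    proof (intro allI impI)
    fix t assume t: "0 \<le> t" "t < \<tau> w"
    note elim = elim t
    have "norm (f (t, w) - f (0, w)) \<le> T * norm (t - 0)"
    proof (rule field_differentiable_bound[where S = "{0..t}" and f' = "\<lambda>s. D 1 0 f (s, w)"])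
      fix s assume "s \<in> {0..t}"
      then show "((\<lambda>s. f (s, w)) has_real_derivative D 1 0 f (s, w)) (at s within {0..t})" "norm (D 1 0 f (s, w)) \<le> T"
        using elim f_deriv(1)[OF f, of s w] by (auto intro: has_field_derivative_at_within less_imp_le)
    qed (use elim in auto)
    also have "\<dots> \<le> T * \<tau> w" using elim T by (intro mult_left_mono) auto
    finally have "\<bar>f (t, w) - f (0, w)\<bar> \<le> e / 2 * \<bar>w\<bar>" using elim(2) by simp
    moreover have "e * \<bar>w\<bar> = e / 2 * \<bar>w\<bar> + e / 2 * \<bar>w\<bar>" by simp
    ultimately show "\<bar>f (t, w) - f O2 - D 0 1 f O2 * w\<bar> \<le> e * \<bar>w\<bar>" using elim(1) by linarith
    qed
  qed
qed

definition "Dc = (SOME D. strict_deriv (\<lambda>U. c_plus F (fst U) (snd U)) D U0 UNIV)"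

lemma Dc: "strict_deriv (\<lambda>U. c_plus F (fst U) (snd U)) Dc U0 UNIV"
  unfolding Dc_def using strict_diff_char(1)[OF U0_J] unfolding strict_diff_def by (rule someI_ex)

lemma Dc_linear: "linear Dc"
  using strict_deriv_linear[OF Dc] by (simp add: bounded_linear.linear)

lemma Dc_eq: "Dc k = Dc (1, 0) * fst k + Dc (0, 1) * snd k"
proof -
  have "Dc k = Dc (fst k *\<^sub>R (1, 0) + snd k *\<^sub>R (0, 1))" by simp
  also have "\<dots> = fst k *\<^sub>R Dc (1, 0) + snd k *\<^sub>R Dc (0, 1)"
    using linear_add[OF Dc_linear] linear_cmul[OF Dc_linear] by metis
  finally show ?thesis by (simp add: mult.commute)
qed

text \<open>
  Since \<open>\<partial>r/\<partial>t = c_plus\<close>, exchanging the order of differentiation expresses \<open>kappa\<close> by the derivative of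
  \<open>\<alpha>\<close> at the cusp point; that of \<open>\<beta>\<close> vanishes there.
\<close>
lemma kappa_alpha: "\<kappa> = Dc (1, 0) * aw0"
proof -
  obtain d0 where d0: "0 < d0" "\<And>w. w \<noteq> 0 \<Longrightarrow> \<bar>w\<bar> < d0 \<Longrightarrow> (0, w) \<in> interior N"
    using axis_int by (auto simp: eventually_at dist_real_def)
  define d where "d = min d0 W"
  have d: "0 < d" using d0 ahead(1) by (simp add: d_def)
  \<comment> \<open>Below the axis all points close to the cusp are interior, so a square in t < 0,
    w < 0 serves as a convex set on which the partial derivatives exist and have limits at its
    corner.\<close>
  define C where "C = {-d<..<0} \<times> {-d<..<0}"
  have C: "(t, w) \<in> interior N" if "- d < t" "t < 0" "- d < w" "w < 0" for t w
  proof -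
    have "\<bar>w\<bar> < d0" "\<bar>t\<bar> < W" "\<bar>w\<bar> < W" using that by (auto simp: d_def min_def split: if_splits)
    then show ?thesis using d0(2)[of w] that by (auto simp: interior_N)
  qed
  have CN: "C \<subseteq> N" using C interior_subset by (fastforce simp: C_def)
  have strict: "strict_deriv f (\<lambda>h. D 1 0 f O2 * fst h + D 0 1 f O2 * snd h) O2 C" if f: "smooth_upto N f" for f
  proof (rule strict_deriv_convex)
    show "convex C" unfolding C_def by (intro convex_Times) auto
    show "O2 \<notin> C" by (simp add: C_def)
    fix x assume "x \<in> C"
    then have "x \<in> interior N" using C by (auto simp: C_def)
    then show "(f has_derivative (\<lambda>h. D 1 0 f x * fst h + D 0 1 f x * snd h)) (at x)"
      using D_deriv(3)[OF f, of "fst x" "snd x"] by simp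
  qed (use D_tendsto[OF f] CN in \<open>auto intro: tendsto_within_subset\<close>)
  have sU: "strict_deriv (\<lambda>x. (a x, b x))
      (\<lambda>h. (D 1 0 a O2 * fst h + D 0 1 a O2 * snd h, D 1 0 b O2 * fst h + D 0 1 b O2 * snd h)) O2 C"
    by (intro strict_deriv_Pair strict ahead)
  have sc: "strict_deriv (\<lambda>x. c_plus F (fst (a x, b x)) (snd (a x, b x)))
      (\<lambda>h. Dc (D 1 0 a O2 * fst h + D 0 1 a O2 * snd h, D 1 0 b O2 * fst h + D 0 1 b O2 * snd h)) O2 C"
  proof (rule strict_deriv_compose_lim[OF Dc sU])
    fix e :: real assume e: "0 < e"
    have "((\<lambda>x. (a x, b x)) \<longlongrightarrow> U0) FN"
      unfolding alpha0_def beta0_def by (intro tendsto_intros f_tendsto ahead)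
    then have "\<forall>\<^sub>F x in FN. dist (a x, b x) U0 < e" using e by (rule tendstoD)
    then obtain d where "0 < d" "\<And>x. x \<in> N \<Longrightarrow> x \<noteq> O2 \<Longrightarrow> dist x O2 < d \<Longrightarrow> dist (a x, b x) U0 < e"
      unfolding eventually_at by metis
    moreover have "O2 \<notin> C" by (simp add: C_def)
    ultimately show "\<exists>d>0. \<forall>y\<in>C. norm (y - O2) < d \<longrightarrow> norm ((a y, b y) - U0) < e"
      using CN by (metis dist_norm subsetD)
  qed
  have "D 1 1 r O2 = Dc (D 0 1 a O2, D 0 1 b O2)"
  proof (rule mixed_derivatives_eq[where \<phi> = "\<lambda>t w. r (t, w)" and a = "\<lambda>t w. cp (t, w)" and b = "\<lambda>t w. D 0 1 r (t, w)"
        and m = "\<lambda>t w. D 1 1 r (t, w)", OF d])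
    fix t w assume tw: "- d < t" "t < 0" "- d < w" "w < 0"
    note int = C[OF tw]
    then have "(t, w) \<in> N" using interior_subset by blast
    then show "((\<lambda>s. r (s, w)) has_real_derivative cp (t, w)) (at t)"
      using f_deriv(1)[OF ahead(4) int] ahead(6)[of "(t, w)"] by simp
    show "((\<lambda>w. r (t, w)) has_real_derivative D 0 1 r (t, w)) (at w)" by (rule f_deriv(2)[OF ahead(4) int])
    show "((\<lambda>s. D 0 1 r (s, w)) has_real_derivative D 1 1 r (t, w)) (at t)"
      using D_deriv(1)[OF ahead(4) int, of 0 1] by simp
  next
    fix e :: real assume e: "0 < e"
    obtain d1 where d1: "0 < d1" "\<And>x. x \<in> N \<Longrightarrow> x \<noteq> O2 \<Longrightarrow> dist x O2 < d1 \<Longrightarrow> dist (D 1 1 r x) (D 1 1 r O2) < e"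
      using tendstoD[OF D_tendsto[OF ahead(4), of 1 1] e] unfolding eventually_at by metis
    obtain d2 where d2: "0 < d2" "\<And>x y. x \<in> C \<Longrightarrow> y \<in> C \<Longrightarrow> norm (x - O2) < d2 \<Longrightarrow> norm (y - O2) < d2 \<Longrightarrow>
      norm (cp x - cp y - Dc (D 1 0 a O2 * fst (x - y) + D 0 1 a O2 * snd (x - y), D 1 0 b O2 * fst (x - y) + D 0 1 b O2 * snd (x - y))) \<le> e * norm (x - y)"
      using strict_derivD[OF sc e] unfolding fst_conv snd_conv by metis
    have nrm: "norm ((t, w) - O2) < 2 * k" if "\<bar>t\<bar> < k" "\<bar>w\<bar> < k" for t w k
      using norm_Pair_le[of t w] that by simp
    define k where "k = min d (min d1 d2 / 2)"
    have k: "0 < k" "k \<le> d" "2 * k \<le> d1" "2 * k \<le> d2" using d d1(1) d2(1) by (auto simp: k_def)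
    show "\<exists>d>0. \<forall>t w. - d < t \<longrightarrow> t < 0 \<longrightarrow> - d < w \<longrightarrow> w < 0 \<longrightarrow> \<bar>D 1 1 r (t, w) - D 1 1 r O2\<bar> \<le> e"
    proof (intro exI[of _ k] conjI allI impI)
      fix t w assume tw: "- k < t" "t < 0" "- k < w" "w < 0"
      have "(t, w) \<in> N" using CN tw k by (auto simp: C_def)
      moreover have "dist (t, w) O2 < d1" using nrm[of t k w] tw k by (simp add: dist_norm)
      ultimately show "\<bar>D 1 1 r (t, w) - D 1 1 r O2\<bar> \<le> e"
        using d1(2)[of "(t, w)"] tw by (simp add: dist_real_def)
    qed (use k in auto)
    show "\<exists>d>0. \<forall>t w w'. - d < t \<longrightarrow> t < 0 \<longrightarrow> - d < w \<longrightarrow> w < 0 \<longrightarrow> - d < w' \<longrightarrow> w' < 0 \<longrightarrow>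
        \<bar>cp (t, w) - cp (t, w') - Dc (D 0 1 a O2, D 0 1 b O2) * (w - w')\<bar> \<le> e * \<bar>w - w'\<bar>"
    proof (intro exI[of _ k] conjI allI impI)
      fix t w w' assume tw: "- k < t" "t < 0" "- k < w" "w < 0" "- k < w'" "w' < 0"
      have "(t, w) \<in> C" "(t, w') \<in> C" using tw k by (auto simp: C_def)
      moreover have "norm ((t, w) - O2) < d2" "norm ((t, w') - O2) < d2"
        using nrm[of t k w] nrm[of t k w'] tw k by auto
      ultimately have "norm (cp (t, w) - cp (t, w') - Dc (D 0 1 a O2 * (w - w'), D 0 1 b O2 * (w - w'))) \<le> e * norm (w - w')"
        using d2(2)[of "(t, w)" "(t, w')"] by simp
      then show "\<bar>cp (t, w) - cp (t, w') - Dc (D 0 1 a O2, D 0 1 b O2) * (w - w')\<bar> \<le> e * \<bar>w - w'\<bar>"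
        using Dc_eq[of "(D 0 1 a O2 * (w - w'), D 0 1 b O2 * (w - w'))"] Dc_eq[of "(D 0 1 a O2, D 0 1 b O2)"]
        by (simp add: algebra_simps)
    qed (use k in auto)
  qed
  then show ?thesis using Dc_eq[of "(aw0, D 0 1 b O2)"] bw0 by (simp add: kappa_eq)
qed

lemma aw0_nonzero: "aw0 \<noteq> 0" using kappa_alpha ahead(11) by auto

text \<open>To first order \<beta> is constant and \<alpha> moves at the rate \<open>aw0\<close>, so
  the derivative \<open>Dc\<close> of \<open>c_plus\<close> only sees its first component, and by
  \<open>kappa_alpha\<close> the resulting slope is \<kappa>.\<close>

lemma near_cusp_cp:
  assumes e: "0 < e"
  shows "\<forall>\<^sub>F w in at_left 0. \<forall>t. 0 \<le> t \<longrightarrow> t < \<tau> w \<longrightarrow> \<bar>cp (t, w) - cp0 - \<kappa> * w\<bar> \<le> e * \<bar>w\<bar>"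
proof -
  obtain K where K: "0 < K" "\<And>h. norm (Dc h) \<le> norm h * K"
    using bounded_linear.pos_bounded[OF strict_deriv_linear[OF Dc]] by blast
  define M where "M = \<bar>aw0\<bar> + 2"
  have M: "0 < M" by (simp add: M_def)
  define e1 where "e1 = e / (2 * M)"
  define e2 where "e2 = min 1 (e / (4 * K))"
  have e1: "0 < e1" "e1 * M = e / 2" and e2: "0 < e2" "e2 \<le> 1" "2 * K * e2 \<le> e / 2"
    using e M K by (auto simp: e1_def e2_def min_def field_simps)
  obtain d where d: "0 < d" "\<And>y. norm (y - U0) < d \<Longrightarrow>
    norm (c_plus F (fst y) (snd y) - c_plus F (alpha0 A) (beta0 A) - Dc (y - U0)) \<le> e1 * norm (y - U0)"
    using strict_derivD[OF Dc e1(1)] by (metis UNIV_I cancel_comm_monoid_add_class.diff_cancel fst_conv norm_zero snd_conv)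
  have "0 < d / M" using d M by simp
  then have md: "- (d / M) < 0" by simp
  show ?thesis
    using near_cusp[OF ahead(2) e2(1)] near_cusp[OF ahead(3) e2(1)] eventually_at_left_real[OF md]
  proof eventually_elim
    case (elim w)
    show ?case
    proof (intro allI impI)
    fix t assume t: "0 \<le> t" "t < \<tau> w"
    note elim = elim t
    define y where "y = (a (t, w), b (t, w))"
    have al: "\<bar>a (t, w) - alpha0 A - aw0 * w\<bar> \<le> e2 * \<bar>w\<bar>" and be: "\<bar>b (t, w) - beta0 A\<bar> \<le> e2 * \<bar>w\<bar>"
      using elim bw0 by (auto simp: alpha0_def beta0_def)
    have e2w: "e2 * \<bar>w\<bar> \<le> 1 * \<bar>w\<bar>" using e2 by (intro mult_right_mono) auto
    have "\<bar>a (t, w) - alpha0 A\<bar> \<le> (\<bar>aw0\<bar> + 1) * \<bar>w\<bar>"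
    proof -
      have "(\<bar>aw0\<bar> + 1) * \<bar>w\<bar> = \<bar>aw0 * w\<bar> + \<bar>w\<bar>" by (simp add: algebra_simps abs_mult)
      then show ?thesis using al e2w by linarith
    qed
    then have ny: "norm (y - U0) \<le> M * \<bar>w\<bar>"
      using norm_Pair_le[of "a (t, w) - alpha0 A" "b (t, w) - beta0 A"] be e2w by (simp add: y_def M_def algebra_simps)
    also have "\<dots> < d" using elim M by (simp add: field_simps abs_if)
    finally have "norm (cp (t, w) - cp0 - Dc (y - U0)) \<le> e1 * norm (y - U0)"
      using d(2)[of y] by (simp add: y_def cp0_def)
    also have "\<dots> \<le> e1 * (M * \<bar>w\<bar>)" using ny e1 by (intro mult_left_mono) auto
    also have "\<dots> = e / 2 * \<bar>w\<bar>" using e1(2) by (simp add: mult.assoc[symmetric])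
    finally have 1: "\<bar>cp (t, w) - cp0 - Dc (y - U0)\<bar> \<le> e / 2 * \<bar>w\<bar>" by simp
    have "Dc (y - U0) - \<kappa> * w = Dc (y - U0 - (aw0 * w, 0))"
      using linear_diff[OF Dc_linear, of "y - U0" "(aw0 * w, 0)"] Dc_eq[of "(aw0 * w, 0)"] kappa_alpha by simp
    also have "norm \<dots> \<le> norm (y - U0 - (aw0 * w, 0)) * K" by (rule K(2))
    also have "\<dots> \<le> (e2 * \<bar>w\<bar> + e2 * \<bar>w\<bar>) * K"
      using norm_Pair_le[of "a (t, w) - alpha0 A - aw0 * w" "b (t, w) - beta0 A"] al be K(1)
      by (intro mult_right_mono) (auto simp: y_def)
    also have "\<dots> = (2 * K * e2) * \<bar>w\<bar>" by simp
    also have "\<dots> \<le> e / 2 * \<bar>w\<bar>" using e2 by (intro mult_right_mono) auto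
    finally have "\<bar>Dc (y - U0) - \<kappa> * w\<bar> \<le> e / 2 * \<bar>w\<bar>" by simp
    moreover have "e * \<bar>w\<bar> = e / 2 * \<bar>w\<bar> + e / 2 * \<bar>w\<bar>" by simp
    ultimately show "\<bar>cp (t, w) - cp0 - \<kappa> * w\<bar> \<le> e * \<bar>w\<bar>" using 1 by linarith
    qed
  qed
qed

text \<open>The third equation of the state ahead is solved for the w-derivative of \<beta>: it is
  that of \<open>r\<close> times a bounded factor, since \<open>cp - cm\<close> stays away from 0.
  So it degenerates near the singular boundary together with that of \<open>r\<close>.\<close>

lemma bw_bound: "\<exists>C>0. \<forall>\<^sub>F x in FN. \<bar>D 0 1 b x\<bar> \<le> C * \<bar>D 0 1 r x\<bar>"
proof -
  obtain g' where g': "strict_deriv (\<lambda>q. B_tilde F (fst (fst q)) (snd (fst q)) (snd q)) g' (U0, r0 A) UNIV"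
    using strict_diff_source(2)[OF U0_J, of "r0 A"] r0_pos unfolding strict_diff_def by auto
  have q: "((\<lambda>x. ((a x, b x), r x)) \<longlongrightarrow> (U0, r0 A)) FN"
    unfolding alpha0_def beta0_def r0_def by (intro tendsto_intros f_tendsto ahead)
  have "isCont (\<lambda>q. B_tilde F (fst (fst q)) (snd (fst q)) (snd q)) (U0, r0 A)"
    using strict_deriv_tendsto[OF g'] by (simp add: isCont_def)
  from isCont_tendsto_compose[OF this q]
  have B: "((\<lambda>x. B_tilde F (a x) (b x) (r x)) \<longlongrightarrow> B_tilde F (alpha0 A) (beta0 A) (r0 A)) FN" by simp
  define l where "l = D 1 0 b O2 - B_tilde F (alpha0 A) (beta0 A) (r0 A)"
  have "((\<lambda>x. \<bar>D 1 0 b x - B_tilde F (a x) (b x) (r x)\<bar>) \<longlongrightarrow> \<bar>l\<bar>) FN"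
    unfolding l_def by (intro tendsto_intros B D_tendsto ahead)
  then have 1: "\<forall>\<^sub>F x in FN. \<bar>D 1 0 b x - B_tilde F (a x) (b x) (r x)\<bar> < \<bar>l\<bar> + 1"
    by (rule order_tendstoD(2)) simp
  define c0 where "c0 = cp0 - cm0"
  have c0: "0 < c0" using cm0_less by (simp add: c0_def)
  have "((\<lambda>x. cp x - cm x) \<longlongrightarrow> c0) FN" unfolding c0_def by (intro tendsto_intros char_tendsto)
  then have 2: "\<forall>\<^sub>F x in FN. c0 / 2 < cp x - cm x" by (rule order_tendstoD(1)) (use c0 in simp)
  have 3: "\<forall>\<^sub>F x in FN. x \<in> N" by (simp add: eventually_at_filter)
  have "\<forall>\<^sub>F x in FN. \<bar>D 0 1 b x\<bar> \<le> 2 * (\<bar>l\<bar> + 1) / c0 * \<bar>D 0 1 r x\<bar>"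
    using 1 2 3
  proof eventually_elim
    case (elim x)
    have "c0 / 2 * \<bar>D 0 1 b x\<bar> \<le> (cp x - cm x) * \<bar>D 0 1 b x\<bar>" using elim by (intro mult_right_mono) auto
    also have "\<dots> = \<bar>D 0 1 r x\<bar> * \<bar>D 1 0 b x - B_tilde F (a x) (b x) (r x)\<bar>"
      using arg_cong[OF ahead(8)[OF elim(3)], of abs] elim(2) c0 by (simp add: abs_mult)
    also have "\<dots> \<le> \<bar>D 0 1 r x\<bar> * (\<bar>l\<bar> + 1)" using elim by (intro mult_left_mono) auto
    finally show ?case using c0 by (simp add: field_simps)
  qed
  moreover have "0 < 2 * (\<bar>l\<bar> + 1) / c0" using c0 by simp
  ultimately show ?thesis by blast
qed

end

section \<open>Functions on the triangle\<close>

lemma T_dom_convex: "convex (T_dom \<epsilon>)"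
proof -
  have "T_dom \<epsilon> = {x. inner (0, 1) x \<ge> 0} \<inter> {x. inner (1, -1) x \<ge> 0} \<inter> {x. inner (1, 0) x \<le> \<epsilon>}"
    by (auto simp: T_dom_def inner_prod_def)
  then show ?thesis by (simp only: convex_Int convex_halfspace_ge convex_halfspace_le)
qed

lemma T_dom_compact: "compact (T_dom \<epsilon>)"
proof -
  have "T_dom \<epsilon> = {x. inner (0, 1) x \<ge> 0} \<inter> {x. inner (1, -1) x \<ge> 0} \<inter> {x. inner (1, 0) x \<le> \<epsilon>}"
    by (auto simp: T_dom_def inner_prod_def)
  then have "closed (T_dom \<epsilon>)"
    by (simp only: closed_Int closed_halfspace_ge closed_halfspace_le)
  moreover have "T_dom \<epsilon> \<subseteq> {0..\<epsilon>} \<times> {0..\<epsilon>}" by (auto simp: T_dom_def)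
  then have "bounded (T_dom \<epsilon>)" by (rule bounded_subset[OF compact_imp_bounded[OF compact_Times[OF compact_Icc compact_Icc]]])
  ultimately show ?thesis by (simp add: compact_eq_bounded_closed)
qed

lemma interior_T_dom: "interior (T_dom \<epsilon>) = {(u, v). 0 < v \<and> v < u \<and> u < \<epsilon>}" (is "_ = ?I")
proof (rule interior_unique)
  show "?I \<subseteq> T_dom \<epsilon>" by (auto simp: T_dom_def)
  have "?I = {x. 0 < snd x} \<inter> {x. snd x < fst x} \<inter> {x. fst x < \<epsilon>}" by auto
  moreover have "open \<dots>" by (intro open_Int open_Collect_less continuous_intros)
  ultimately show "open ?I" by simp
next
  fix T assume T: "T \<subseteq> T_dom \<epsilon>" "open T"
  show "T \<subseteq> ?I"
  proof
    fix x assume x: "x \<in> T"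
    obtain u v where [simp]: "x = (u, v)" by (cases x)
    obtain e where e: "0 < e" "ball x e \<subseteq> T" using T(2) x openE by blast
    have "(u + e / 2, v) \<in> ball x e" "(u - e / 2, v) \<in> ball x e" "(u, v - e / 2) \<in> ball x e"
      using e(1) by (simp_all add: dist_Pair_Pair dist_real_def)
    then have "(u + e / 2, v) \<in> T_dom \<epsilon>" "(u - e / 2, v) \<in> T_dom \<epsilon>" "(u, v - e / 2) \<in> T_dom \<epsilon>"
      using e T by auto
    then show "x \<in> ?I" using e(1) by (auto simp: T_dom_def)
  qed
qed

lemma limpt_T:
  assumes "0 < \<epsilon>" "x \<in> T_dom \<epsilon>"
  shows "at x within interior (T_dom \<epsilon>) \<noteq> bot"
proof -
  have "(2 * \<epsilon> / 3, \<epsilon> / 3) \<in> interior (T_dom \<epsilon>)" using assms(1) by (simp add: interior_T_dom)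
  then have "closure (interior (T_dom \<epsilon>)) = closure (T_dom \<epsilon>)"
    by (intro convex_closure_interior T_dom_convex) auto
  then have "x \<in> closure (interior (T_dom \<epsilon>))" using assms(2) closure_subset by blast
  then have "x islimpt interior (T_dom \<epsilon>)"
    using interior_limit_point[of x "interior (T_dom \<epsilon>)"] by (auto simp: closure_def)
  then show ?thesis by (simp add: trivial_limit_within)
qed

text \<open>The direction (2, 1) points inward from the edges v = 0 and u = v at once. It crosses
  the edge u = \<epsilon>, which is why derivatives along curves are only taken on smaller
  triangles, with s < \<epsilon>.\<close>

lemma T_shift:
  assumes "(u, v) \<in> T_dom s" "0 < \<delta>" "\<delta> < (\<epsilon> - s) / 2"
  shows "(u + \<delta> * 2, v + \<delta> * 1) \<in> interior (T_dom \<epsilon>)"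
  unfolding interior_T_dom using assms by (auto simp: T_dom_def)

lemma T_curve:
  assumes "0 < \<epsilon>" "s < \<epsilon>" and C: "C_upto 1 (T_dom \<epsilon>) f" and I: "convex I" "x \<in> I"
    and \<gamma>: "\<And>x. x \<in> I \<Longrightarrow> (c1 + k1 * x, c2 + k2 * x) \<in> T_dom s"
  shows "((\<lambda>x. f (c1 + k1 * x, c2 + k2 * x)) has_real_derivative
    bpd (T_dom \<epsilon>) 1 0 f (c1 + k1 * x, c2 + k2 * x) * k1 + bpd (T_dom \<epsilon>) 0 1 f (c1 + k1 * x, c2 + k2 * x) * k2) (at x within I)"
proof -
  have "strict_deriv (\<lambda>x. f (c1 + k1 * x, c2 + k2 * x))
    (\<lambda>h. (bpd (T_dom \<epsilon>) 1 0 f (c1 + k1 * x, c2 + k2 * x) * k1 + bpd (T_dom \<epsilon>) 0 1 f (c1 + k1 * x, c2 + k2 * x) * k2) * h) x I"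
  proof (rule strict_deriv_along_boundary[where S = "T_dom \<epsilon>" and ?\<delta>0.0 = "(\<epsilon> - s) / 2" and ?e1.0 = 2 and ?e2.0 = 1
      and ?\<gamma>1.0 = "\<lambda>x. c1 + k1 * x" and ?\<gamma>2.0 = "\<lambda>x. c2 + k2 * x" and ?g1.0 = "\<lambda>x. k1" and ?g2.0 = "\<lambda>x. k2"])
    show "continuous_on (T_dom \<epsilon>) f" using C by (simp add: C_upto_def)
    show "continuous_on (T_dom \<epsilon>) (bpd (T_dom \<epsilon>) 1 0 f)" "continuous_on (T_dom \<epsilon>) (bpd (T_dom \<epsilon>) 0 1 f)"
      by (rule bpd_extension(1)[OF C _ limpt_T[OF assms(1)]]; simp)+
    show "\<And>x. x \<in> interior (T_dom \<epsilon>) \<Longrightarrow> (f has_derivative (\<lambda>h. bpd (T_dom \<epsilon>) 1 0 f x * fst h + bpd (T_dom \<epsilon>) 0 1 f x * snd h)) (at x)"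
      by (rule C_upto_has_derivative[OF C _ limpt_T[OF assms(1)]]) auto
    show "\<And>x. x \<in> I \<Longrightarrow> (c1 + k1 * x, c2 + k2 * x) \<in> T_dom \<epsilon>"
      using \<gamma> assms(2) by (force simp: T_dom_def)
    show "\<And>x \<delta>. x \<in> I \<Longrightarrow> 0 < \<delta> \<Longrightarrow> \<delta> < (\<epsilon> - s) / 2 \<Longrightarrow> (c1 + k1 * x + \<delta> * 2, c2 + k2 * x + \<delta> * 1) \<in> interior (T_dom \<epsilon>)"
      using T_shift[OF \<gamma>] by blast
  qed (use I assms(2) in \<open>auto intro!: derivative_eq_intros\<close>)
  from strict_deriv_has_derivative[OF this I(2)] show ?thesis
    by (simp add: has_field_derivative_def)
qed

lemma T_v:
  assumes "0 < \<epsilon>" "C_upto 1 (T_dom \<epsilon>) f" "u < \<epsilon>" "v \<in> {0..u}"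
  shows "((\<lambda>x. f (u, x)) has_real_derivative bpd (T_dom \<epsilon>) 0 1 f (u, v)) (at v within {0..u})"
  using T_curve[OF assms(1,3,2), of "{0..u}" v u 0 0 1] assms(4) by (simp add: T_dom_def)

lemma T_u:
  assumes "0 < \<epsilon>" "C_upto 1 (T_dom \<epsilon>) f" "s < \<epsilon>" "0 \<le> v" "u \<in> {v..s}"
  shows "((\<lambda>x. f (x, v)) has_real_derivative bpd (T_dom \<epsilon>) 1 0 f (u, v)) (at u within {v..s})"
  using T_curve[OF assms(1,3,2), of "{v..s}" u 0 1 v 0] assms(4,5) by (simp add: T_dom_def)

lemma T_diag:
  assumes "0 < \<epsilon>" "C_upto 1 (T_dom \<epsilon>) f" "s < \<epsilon>" "v \<in> {0..s}"
  shows "((\<lambda>x. f (x, x)) has_real_derivative bpd (T_dom \<epsilon>) 1 0 f (v, v) + bpd (T_dom \<epsilon>) 0 1 f (v, v)) (at v within {0..s})"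
  using T_curve[OF assms(1,3,2), of "{0..s}" v 0 1 0 1] assms(4) by (simp add: T_dom_def)

lemma DERIV_within_unique:
  fixes f :: "real \<Rightarrow> real"
  assumes "(f has_real_derivative d1) (at x within S)" "(f has_real_derivative d2) (at x within S)" "at x within S \<noteq> bot"
  shows "d1 = d2"
  using assms vector_derivative_unique_within unfolding has_real_derivative_iff_has_vector_derivative by blast

lemma at_within_Icc_nontrivial: "a < b \<Longrightarrow> x \<in> {a..b} \<Longrightarrow> at x within {a..b::real} \<noteq> bot"
  by (simp add: trivial_limit_within islimpt_Icc)

lemma T_small:
  fixes g :: "real \<times> real \<Rightarrow> real"
  assumes "0 < \<epsilon>" "continuous_on (T_dom \<epsilon>) g" "0 < e"
  shows "\<forall>\<^sub>F s in at_right 0. \<forall>x\<in>T_dom s. \<bar>g x - g (0, 0)\<bar> < e"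
proof -
  have "(0, 0) \<in> T_dom \<epsilon>" using assms(1) by (simp add: T_dom_def)
  then obtain d where d: "0 < d" "\<And>x. x \<in> T_dom \<epsilon> \<Longrightarrow> dist x (0, 0) < d \<Longrightarrow> dist (g x) (g (0, 0)) < e"
    using assms(2,3) unfolding continuous_on_iff by metis
  have "0 < min \<epsilon> (d / 2)" using assms(1) d(1) by simp
  from eventually_at_right_real[OF this] show ?thesis
  proof eventually_elim
    case (elim s)
    show ?case
    proof
      fix x assume x: "x \<in> T_dom s"
      obtain u v where [simp]: "x = (u, v)" by (cases x)
      have "dist x (0, 0) \<le> \<bar>u\<bar> + \<bar>v\<bar>"
        using sqrt_sum_squares_le_sum_abs[of u v] by (simp add: dist_Pair_Pair dist_real_def)
      also have "\<dots> < d" using x elim by (auto simp: T_dom_def)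
      finally have "dist x (0, 0) < d" .
      moreover have "x \<in> T_dom \<epsilon>" using x elim by (auto simp: T_dom_def)
      ultimately show "\<bar>g x - g (0, 0)\<bar> < e" using d(2) by (simp add: dist_real_def)
    qed
  qed
qed

lemma T_small_limit:
  fixes g :: "real \<times> real \<Rightarrow> real"
  assumes "0 < \<epsilon>" "continuous_on (T_dom \<epsilon>) g"
  shows "((\<lambda>v. g (v, v)) \<longlongrightarrow> g (0, 0)) (at_right 0)" "((\<lambda>v. g (v, 0)) \<longlongrightarrow> g (0, 0)) (at_right 0)"
proof -
  have ev: "\<forall>\<^sub>F s in at_right 0. dist (g (s, s)) (g (0, 0)) < e \<and> dist (g (s, 0)) (g (0, 0)) < e" if "0 < e" for e
    using T_small[OF assms that] eventually_at_right_less[of 0]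
    by eventually_elim (auto simp: T_dom_def dist_real_def)
  show "((\<lambda>v. g (v, v)) \<longlongrightarrow> g (0, 0)) (at_right 0)" "((\<lambda>v. g (v, 0)) \<longlongrightarrow> g (0, 0)) (at_right 0)"
    by (rule tendstoI, drule ev, erule eventually_mono, blast)+
qed

lemma mvt_bound:
  fixes f :: "real \<Rightarrow> real"
  assumes "\<And>x. x \<in> {a..b} \<Longrightarrow> (f has_real_derivative f' x) (at x within {a..b})"
    "\<And>x. x \<in> {a..b} \<Longrightarrow> \<bar>f' x\<bar> \<le> B" "x \<in> {a..b}" "y \<in> {a..b}"
  shows "\<bar>f x - f y\<bar> \<le> B * \<bar>x - y\<bar>"
  using field_differentiable_bound[of "{a..b}" f f' B x y] assms by auto

section \<open>One solution\<close>

locale cusp_solution = ahead_state +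
  fixes eps :: real and tf rf af bf :: "real \<times> real \<Rightarrow> real"
    and zf yf fh gh ah bh Vh :: "real \<Rightarrow> real"
  assumes eps: "0 < eps"
    and sol: "fb_solution F A eps tf rf af bf zf"
    and cusp: "cusp_expansion F A eps tf rf af bf zf yf fh gh ah bh Vh"
begin

abbreviation "TE \<equiv> T_dom eps"
abbreviation "Du f \<equiv> bpd (T_dom eps) 1 0 f"
abbreviation "Dv f \<equiv> bpd (T_dom eps) 0 1 f"
definition "Q x = ((af x, bf x), rf x)"
definition "cpT x = c_plus F (af x) (bf x)"
definition "cmT x = c_minus F (af x) (bf x)"
definition "AT x = A_tilde F (af x) (bf x) (rf x)"
definition "BT x = B_tilde F (af x) (bf x) (rf x)"
abbreviation "Q0 \<equiv> ((alpha0 A, beta0 A), r0 A)"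

lemma sol_facts:
  "C_upto 1 TE tf" "C_upto 1 TE rf" "C_upto 1 TE af" "C_upto 1 TE bf"
  "x \<in> TE \<Longrightarrow> admissible F (af x) (bf x) (rf x)"
  "x \<in> TE \<Longrightarrow> Dv af x = Dv tf x * AT x"
  "x \<in> TE \<Longrightarrow> Du bf x = Du tf x * BT x"
  "x \<in> TE \<Longrightarrow> Dv rf x = Dv tf x * cpT x"
  "x \<in> TE \<Longrightarrow> Du rf x = Du tf x * cmT x"
  "u \<in> {0..eps} \<Longrightarrow> (h u, u) \<in> N" "u \<in> {0..eps} \<Longrightarrow> tf (u, 0) = h u"
  "u \<in> {0..eps} \<Longrightarrow> af (u, 0) = alpha_i A u"
  "rf (0, 0) = r0 A" "bf (0, 0) = beta0 A"
  "v \<in> {0..eps} \<Longrightarrow> (tf (v, v), zf v) \<in> N" "v \<in> {0..eps} \<Longrightarrow> rf (v, v) = r (tf (v, v), zf v)"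
  "v \<in> {0..eps} \<Longrightarrow> \<exists>V. diag_deriv eps tf v * V = diag_deriv eps rf v \<and>
        jump (T_tt F) A tf af bf zf v * V = jump (T_tr F) A tf af bf zf v \<and>
        jump (T_tr F) A tf af bf zf v * V = jump (T_rr F) A tf af bf zf v"
  "v \<in> {0<..eps} \<Longrightarrow> zf v < 0" "v \<in> {0<..eps} \<Longrightarrow> tf (v, v) < t_sing A (zf v)"
  using sol unfolding fb_solution_def Let_def AT_def BT_def cpT_def cmT_def h_def by blast+

lemma cusp_facts:
  "C1_interval eps yf" "C1_interval eps fh" "C1_interval eps gh" "C1_interval eps ah" "C1_interval eps bh"
  "continuous_on {0..eps} Vh"
  "v \<in> {0..eps} \<Longrightarrow> zf v = v * yf v"
  "v \<in> {0..eps} \<Longrightarrow> tf (v, v) = v\<^sup>2 * fh v"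
  "v \<in> {0..eps} \<Longrightarrow> rf (v, v) - r0 A = v\<^sup>2 * gh v"
  "v \<in> {0..eps} \<Longrightarrow> af (v, v) - alpha_i A v = v\<^sup>2 * ah v"
  "v \<in> {0..eps} \<Longrightarrow> bf (v, v) - beta0 A = v\<^sup>2 * bh v"
  "v \<in> {0<..eps} \<Longrightarrow> diag_deriv eps tf v \<noteq> 0"
  "v \<in> {0<..eps} \<Longrightarrow> diag_deriv eps rf v / diag_deriv eps tf v = cp0 + \<kappa> / 2 * (1 + yf v) * v + v\<^sup>2 * Vh v"
  using cusp unfolding cusp_expansion_def cp0_def by blast+

lemma O_in_T: "(0, 0) \<in> TE" using eps by (simp add: T_dom_def)

lemma T_cont: "C_upto 1 TE f \<Longrightarrow> continuous_on TE f" "C_upto 1 TE f \<Longrightarrow> continuous_on TE (Du f)"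
  "C_upto 1 TE f \<Longrightarrow> continuous_on TE (Dv f)"
  using bpd_extension(1)[of 1 TE f, OF _ _ limpt_T[OF eps]] by (simp_all add: C_upto_def)

lemma tf_0: "tf (0, 0) = 0" using sol_facts(11)[of 0] eps by (simp add: h_0)
lemma af_0: "af (0, 0) = alpha0 A" using sol_facts(12)[of 0] eps by (simp add: alpha_i_def alpha0_def ahead)

lemma half_eps: "0 < eps / 2" "eps / 2 < eps" using eps by auto

lemma square_deriv_0:
  assumes "C1_interval eps k"
  shows "((\<lambda>v. c + v\<^sup>2 * k v) has_real_derivative 0) (at 0 within {0..eps / 2})"
proof -
  obtain K where "(k has_real_derivative K) (at 0 within {0..eps})"
    using assms eps unfolding C1_interval_def by (metis atLeastAtMost_iff less_imp_le order_refl)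
  then have "(k has_real_derivative K) (at 0 within {0..eps / 2})"
    by (rule DERIV_subset) (use eps in auto)
  then show ?thesis by (auto intro!: derivative_eq_intros)
qed

text \<open>The edge gives \<open>h'\<close> = 0 for the u-derivative of t, and the quadratic form
  of t on the diagonal then kills its v-derivative. The equations of the problem, and the quadratic
  form of \<beta> - \<beta>0 on the diagonal, pass this on. Every v-derivative of the unknowns
  vanishes at the corner, while the u-derivative of \<alpha> does not appear here: on the edge v = 0
  it is \<open>aw0\<close>.\<close>

lemma derivs_0: "Du tf (0, 0) = 0" "Dv tf (0, 0) = 0" "Du bf (0, 0) = 0" "Dv bf (0, 0) = 0" "Dv af (0, 0) = 0" "Dv rf (0, 0) = 0"
proof -
  have nb: "at 0 within {0..eps / 2} \<noteq> bot" using at_within_Icc_nontrivial[of 0 "eps / 2" 0] eps by simp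
  have "W > 0" "(h 0, 0) \<in> N" using sol_facts(10)[of 0] eps ahead(1) by auto
  have "eps < W" using sol_facts(10)[of eps] eps by (auto simp: N_eq)
  have "(h has_real_derivative 0) (at 0 within {0..eps / 2})"
  proof (rule DERIV_subset)
    show "(h has_real_derivative 0) (at 0 within {0..<W})"
      using h_deriv(1)[of 0] \<open>(h 0, 0) \<in> N\<close> h'_0 by simp
  qed (use \<open>eps < W\<close> eps in auto)
  moreover have "((\<lambda>x. tf (x, 0)) has_real_derivative Du tf (0, 0)) (at 0 within {0..eps / 2})"
    by (rule T_u[OF eps sol_facts(1) half_eps(2)]) (use eps in auto)
  then have "(h has_real_derivative Du tf (0, 0)) (at 0 within {0..eps / 2})"
    by (rule has_field_derivative_transform_within[where d = 1]) (use sol_facts(11) eps in auto)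
  ultimately show 1: "Du tf (0, 0) = 0" using DERIV_within_unique nb by blast
  have "((\<lambda>x. tf (x, x)) has_real_derivative Du tf (0, 0) + Dv tf (0, 0)) (at 0 within {0..eps / 2})"
    by (rule T_diag[OF eps sol_facts(1) half_eps(2)]) (use eps in auto)
  then have "((\<lambda>v. 0 + v\<^sup>2 * fh v) has_real_derivative Du tf (0, 0) + Dv tf (0, 0)) (at 0 within {0..eps / 2})"
    by (rule has_field_derivative_transform_within[where d = 1]) (use cusp_facts(8) eps in auto)
  with square_deriv_0[OF cusp_facts(2)] have "Du tf (0, 0) + Dv tf (0, 0) = 0" using DERIV_within_unique nb by blast
  then show 2: "Dv tf (0, 0) = 0" using 1 by simp
  show 3: "Du bf (0, 0) = 0" "Dv af (0, 0) = 0" "Dv rf (0, 0) = 0" using 1 2 sol_facts(6-8)[OF O_in_T] by auto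
  have "((\<lambda>x. bf (x, x)) has_real_derivative Du bf (0, 0) + Dv bf (0, 0)) (at 0 within {0..eps / 2})"
    by (rule T_diag[OF eps sol_facts(4) half_eps(2)]) (use eps in auto)
  then have "((\<lambda>v. beta0 A + v\<^sup>2 * bh v) has_real_derivative Du bf (0, 0) + Dv bf (0, 0)) (at 0 within {0..eps / 2})"
    by (rule has_field_derivative_transform_within[where d = 1]) (use cusp_facts(11) eps in \<open>auto simp: algebra_simps\<close>)
  with square_deriv_0[OF cusp_facts(5)] have "Du bf (0, 0) + Dv bf (0, 0) = 0" using DERIV_within_unique nb by blast
  then show "Dv bf (0, 0) = 0" using 3 by simp
qed

lemma Q_near: assumes "0 < e" shows "\<forall>\<^sub>F s in at_right 0. \<forall>x\<in>T_dom s. norm (Q x - Q0) < e"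
proof -
  have e: "0 < e / 3" using assms by simp
  show ?thesis
    using T_small[OF eps T_cont(1)[OF sol_facts(2)] e] T_small[OF eps T_cont(1)[OF sol_facts(3)] e] T_small[OF eps T_cont(1)[OF sol_facts(4)] e]
  proof eventually_elim
    case (elim s)
    show ?case
    proof
      fix x assume x: "x \<in> T_dom s"
      have "norm (Q x - Q0) \<le> norm (af x - alpha0 A, bf x - beta0 A) + \<bar>rf x - r0 A\<bar>"
        unfolding Q_def using norm_Pair_le[of "(af x - alpha0 A, bf x - beta0 A)" "rf x - r0 A"] by simp
      also have "\<dots> \<le> \<bar>af x - alpha0 A\<bar> + \<bar>bf x - beta0 A\<bar> + \<bar>rf x - r0 A\<bar>"
        using norm_Pair_le[of "af x - alpha0 A" "bf x - beta0 A"] by simp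
      also have "\<dots> < e / 3 + e / 3 + e / 3"
        using elim x by (intro add_strict_mono) (auto simp: af_0 sol_facts)
      finally show "norm (Q x - Q0) < e" by simp
    qed
  qed
qed

lemma Q_diff_norm: "norm (Q x - Q y) \<le> \<bar>af x - af y\<bar> + \<bar>bf x - bf y\<bar> + \<bar>rf x - rf y\<bar>"
proof -
  have "norm (Q x - Q y) \<le> norm (af x - af y, bf x - bf y) + \<bar>rf x - rf y\<bar>"
    unfolding Q_def using norm_Pair_le[of "(af x - af y, bf x - bf y)" "rf x - rf y"] by simp
  also have "\<dots> \<le> \<bar>af x - af y\<bar> + \<bar>bf x - bf y\<bar> + \<bar>rf x - rf y\<bar>"
    using norm_Pair_le[of "af x - af y" "bf x - bf y"] by simp
  finally show ?thesis .
qed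

text \<open>The v-derivatives vanish at the corner by \<open>derivs_0\<close>, so on small triangles
  the Lipschitz constant in v can be made as small as desired.\<close>

lemma G_lipschitz_v:
  fixes G :: "(real \<times> real) \<times> real \<Rightarrow> real"
  assumes G: "strict_diff G Q0 UNIV" and e: "0 < e"
  shows "\<forall>\<^sub>F s in at_right 0. \<forall>u v v'. (u, v) \<in> T_dom s \<longrightarrow> (u, v') \<in> T_dom s \<longrightarrow> \<bar>G (Q (u, v)) - G (Q (u, v'))\<bar> \<le> e * \<bar>v - v'\<bar>"
proof -
  obtain d L where dL: "0 < d" "0 < L" "\<And>y z. norm (y - Q0) < d \<Longrightarrow> norm (z - Q0) < d \<Longrightarrow> norm (G y - G z) \<le> L * norm (y - z)"
    using strict_diff_lipschitz[OF G] by (metis UNIV_I)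
  define e' where "e' = e / (3 * L)"
  have e': "0 < e'" "L * (3 * e') = e" using e dL by (auto simp: e'_def)
  show ?thesis
    using Q_near[OF dL(1)] T_small[OF eps T_cont(3)[OF sol_facts(2)] e'(1)] T_small[OF eps T_cont(3)[OF sol_facts(3)] e'(1)]
      T_small[OF eps T_cont(3)[OF sol_facts(4)] e'(1)] eventually_at_right_real[OF eps]
  proof eventually_elim
    case (elim s)
    show ?case
    proof (intro allI impI)
      fix u v v' assume uv: "(u, v) \<in> T_dom s" "(u, v') \<in> T_dom s"
      then have u: "u < eps" "v \<in> {0..u}" "v' \<in> {0..u}" "\<And>x. x \<in> {0..u} \<Longrightarrow> (u, x) \<in> T_dom s"
        using elim by (auto simp: T_dom_def)
      have k: "\<bar>f (u, v) - f (u, v')\<bar> \<le> e' * \<bar>v - v'\<bar>" if f: "C_upto 1 TE f" "\<forall>x\<in>T_dom s. \<bar>Dv f x - Dv f (0, 0)\<bar> < e'" "Dv f (0, 0) = 0" for f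
      proof (rule mvt_bound[where a = 0 and b = u and f' = "\<lambda>x. Dv f (u, x)"])
        show "\<And>x. x \<in> {0..u} \<Longrightarrow> ((\<lambda>x. f (u, x)) has_real_derivative Dv f (u, x)) (at x within {0..u})"
          by (rule T_v[OF eps f(1) u(1)])
        show "\<And>x. x \<in> {0..u} \<Longrightarrow> \<bar>Dv f (u, x)\<bar> \<le> e'" using f u(4) by (metis diff_zero less_imp_le)
      qed (use u in auto)
      have "\<bar>G (Q (u, v)) - G (Q (u, v'))\<bar> \<le> L * norm (Q (u, v) - Q (u, v'))"
        using dL(3) elim(1) uv by auto
      also have "\<dots> \<le> L * (e' * \<bar>v - v'\<bar> + e' * \<bar>v - v'\<bar> + e' * \<bar>v - v'\<bar>)"
      proof (intro mult_left_mono order_trans[OF Q_diff_norm] add_mono)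
        show "\<bar>af (u, v) - af (u, v')\<bar> \<le> e' * \<bar>v - v'\<bar>" by (rule k[OF sol_facts(3) elim(3) derivs_0(5)])
        show "\<bar>bf (u, v) - bf (u, v')\<bar> \<le> e' * \<bar>v - v'\<bar>" by (rule k[OF sol_facts(4) elim(4) derivs_0(4)])
        show "\<bar>rf (u, v) - rf (u, v')\<bar> \<le> e' * \<bar>v - v'\<bar>" by (rule k[OF sol_facts(2) elim(2) derivs_0(6)])
      qed (use dL in auto)
      also have "\<dots> = (L * (3 * e')) * \<bar>v - v'\<bar>" by (simp add: algebra_simps)
      finally show "\<bar>G (Q (u, v)) - G (Q (u, v'))\<bar> \<le> e * \<bar>v - v'\<bar>" by (simp only: e'(2))
    qed
  qed
qed

text \<open>In the u-direction the constant is merely bounded, because \<alpha> varies at first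
  order along the edge v = 0. Its contributions have to be made small by other means, such as a
  factor s.\<close>

lemma G_lipschitz_u:
  fixes G :: "(real \<times> real) \<times> real \<Rightarrow> real"
  assumes G: "strict_diff G Q0 UNIV"
  shows "\<exists>M>0. \<forall>\<^sub>F s in at_right 0. \<forall>u u' v. (u, v) \<in> T_dom s \<longrightarrow> (u', v) \<in> T_dom s \<longrightarrow> \<bar>G (Q (u, v)) - G (Q (u', v))\<bar> \<le> M * \<bar>u - u'\<bar>"
proof -
  obtain d L where dL: "0 < d" "0 < L" "\<And>y z. norm (y - Q0) < d \<Longrightarrow> norm (z - Q0) < d \<Longrightarrow> norm (G y - G z) \<le> L * norm (y - z)"
    using strict_diff_lipschitz[OF G] by (metis UNIV_I)
  define B where "B = \<bar>Du rf (0, 0)\<bar> + \<bar>Du af (0, 0)\<bar> + \<bar>Du bf (0, 0)\<bar> + 1"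
  have B: "0 < B" by (simp add: B_def)
  have "\<forall>\<^sub>F s in at_right 0. \<forall>u u' v. (u, v) \<in> T_dom s \<longrightarrow> (u', v) \<in> T_dom s \<longrightarrow> \<bar>G (Q (u, v)) - G (Q (u', v))\<bar> \<le> (L * (3 * B)) * \<bar>u - u'\<bar>"
    using Q_near[OF dL(1)] T_small[OF eps T_cont(2)[OF sol_facts(2)] zero_less_one] T_small[OF eps T_cont(2)[OF sol_facts(3)] zero_less_one]
      T_small[OF eps T_cont(2)[OF sol_facts(4)] zero_less_one] eventually_at_right_real[OF eps]
  proof eventually_elim
    case (elim s)
    show ?case
    proof (intro allI impI)
      fix u u' v assume uv: "(u, v) \<in> T_dom s" "(u', v) \<in> T_dom s"
      then have u: "s < eps" "0 \<le> v" "u \<in> {v..s}" "u' \<in> {v..s}" "\<And>x. x \<in> {v..s} \<Longrightarrow> (x, v) \<in> T_dom s"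
        using elim by (auto simp: T_dom_def)
      have k: "\<bar>f (u, v) - f (u', v)\<bar> \<le> B * \<bar>u - u'\<bar>" if f: "C_upto 1 TE f" "\<forall>x\<in>T_dom s. \<bar>Du f x - Du f (0, 0)\<bar> < 1" "\<bar>Du f (0, 0)\<bar> + 1 \<le> B" for f
      proof (rule mvt_bound[where a = v and b = s and f' = "\<lambda>x. Du f (x, v)"])
        show "\<And>x. x \<in> {v..s} \<Longrightarrow> ((\<lambda>x. f (x, v)) has_real_derivative Du f (x, v)) (at x within {v..s})"
          by (rule T_u[OF eps f(1) u(1,2)])
        fix x assume "x \<in> {v..s}"
        then have "\<bar>Du f (x, v) - Du f (0, 0)\<bar> < 1" using f(2) u(5) by blast
        then show "\<bar>Du f (x, v)\<bar> \<le> B" using f(3) by linarith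
      qed (use u in auto)
      have "\<bar>G (Q (u, v)) - G (Q (u', v))\<bar> \<le> L * norm (Q (u, v) - Q (u', v))"
        using dL(3) elim(1) uv by auto
      also have "\<dots> \<le> L * (B * \<bar>u - u'\<bar> + B * \<bar>u - u'\<bar> + B * \<bar>u - u'\<bar>)"
      proof (intro mult_left_mono order_trans[OF Q_diff_norm] add_mono)
        show "\<bar>af (u, v) - af (u', v)\<bar> \<le> B * \<bar>u - u'\<bar>" by (rule k[OF sol_facts(3) elim(3)]) (simp add: B_def)
        show "\<bar>bf (u, v) - bf (u', v)\<bar> \<le> B * \<bar>u - u'\<bar>" by (rule k[OF sol_facts(4) elim(4)]) (simp add: B_def)
        show "\<bar>rf (u, v) - rf (u', v)\<bar> \<le> B * \<bar>u - u'\<bar>" by (rule k[OF sol_facts(2) elim(2)]) (simp add: B_def)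
      qed (use dL in auto)
      also have "\<dots> = (L * (3 * B)) * \<bar>u - u'\<bar>" by (simp add: algebra_simps)
      finally show "\<bar>G (Q (u, v)) - G (Q (u', v))\<bar> \<le> (L * (3 * B)) * \<bar>u - u'\<bar>" .
    qed
  qed
  then show ?thesis using dL B by (intro exI[of _ "L * (3 * B)"]) simp
qed

lemma G_near:
  fixes G :: "(real \<times> real) \<times> real \<Rightarrow> real"
  assumes G: "strict_diff G Q0 UNIV" and e: "0 < e"
  shows "\<forall>\<^sub>F s in at_right 0. \<forall>x\<in>T_dom s. \<bar>G (Q x) - G Q0\<bar> < e"
proof -
  obtain G' where G': "strict_deriv G G' Q0 UNIV" using G by (auto simp: strict_diff_def)
  obtain d where d: "0 < d" "\<And>y. norm (y - Q0) < d \<Longrightarrow> norm (G y - G Q0) < e"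
    using strict_deriv_continuous[OF G' UNIV_I e] by (metis UNIV_I)
  from Q_near[OF d(1)] show ?thesis by eventually_elim (use d(2) in auto)
qed

lemma strict_diff_G:
  "strict_diff (\<lambda>q. c_plus F (fst (fst q)) (snd (fst q))) Q0 UNIV"
  "strict_diff (\<lambda>q. c_minus F (fst (fst q)) (snd (fst q))) Q0 UNIV"
  "strict_diff (\<lambda>q. A_tilde F (fst (fst q)) (snd (fst q)) (snd q)) Q0 UNIV"
  "strict_diff (\<lambda>q. B_tilde F (fst (fst q)) (snd (fst q)) (snd q)) Q0 UNIV"
proof -
  have f: "strict_diff fst (U0, r0 A) UNIV" by (rule strict_diff_bounded_linear[OF bounded_linear_fst])
  show "strict_diff (\<lambda>q. c_plus F (fst (fst q)) (snd (fst q))) Q0 UNIV"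
    "strict_diff (\<lambda>q. c_minus F (fst (fst q)) (snd (fst q))) Q0 UNIV"
    using strict_diff_compose[of _ fst "(U0, r0 A)" UNIV, OF _ f UNIV_I] strict_diff_char[OF U0_J] by simp_all
  show "strict_diff (\<lambda>q. A_tilde F (fst (fst q)) (snd (fst q)) (snd q)) Q0 UNIV"
    "strict_diff (\<lambda>q. B_tilde F (fst (fst q)) (snd (fst q)) (snd q)) Q0 UNIV"
    using strict_diff_source[OF U0_J] r0_pos by auto
qed

lemmas cpT_v = G_lipschitz_v[OF strict_diff_G(1), unfolded Q_def fst_conv snd_conv, folded cpT_def]
lemmas AT_v = G_lipschitz_v[OF strict_diff_G(3), unfolded Q_def fst_conv snd_conv, folded AT_def]
lemmas cmT_u = G_lipschitz_u[OF strict_diff_G(2), unfolded Q_def fst_conv snd_conv, folded cmT_def]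
lemmas BT_u = G_lipschitz_u[OF strict_diff_G(4), unfolded Q_def fst_conv snd_conv, folded BT_def]
lemmas cpT_near = G_near[OF strict_diff_G(1), unfolded Q_def fst_conv snd_conv, folded cpT_def cp0_def]
lemmas cmT_near = G_near[OF strict_diff_G(2), unfolded Q_def fst_conv snd_conv, folded cmT_def cm0_def]

end

section \<open>One-sided limits and strict derivatives at 0\<close>

lemma eventually_at_right_all_le:
  assumes "\<forall>\<^sub>F s in at_right (0::real). P s"
  shows "\<forall>\<^sub>F s in at_right 0. \<forall>u. 0 < u \<longrightarrow> u \<le> s \<longrightarrow> P u"
proof -
  obtain b where "0 < b" "\<And>u. 0 < u \<Longrightarrow> u < b \<Longrightarrow> P u"
    using assms by (auto simp: eventually_at_right_field)
  then show ?thesis by (auto simp: eventually_at_right_field intro!: exI[of _ b])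
qed

lemma at_0_within_Icc: "0 < s \<Longrightarrow> at 0 within {0..s} = at_right (0::real)"
  by (rule at_within_Icc_at_right)

lemma strict_deriv_quotient:
  fixes f :: "real \<Rightarrow> real"
  assumes "strict_deriv f (\<lambda>k. c * k) 0 {0..s}" "0 < s"
  shows "((\<lambda>v. (f v - f 0) / v) \<longlongrightarrow> c) (at_right 0)"
proof -
  have "(f has_derivative (*) c) (at 0 within {0..s})"
    using strict_deriv_has_derivative[OF assms(1)] assms(2) by simp
  then have "(f has_real_derivative c) (at 0 within {0..s})" by (simp add: has_field_derivative_def)
  then show ?thesis by (simp add: has_field_derivative_iff at_0_within_Icc[OF assms(2)])
qed

lemma C1_interval_props:
  assumes "C1_interval \<epsilon> k"
  obtains D where "continuous_on {0..\<epsilon>} D" "\<And>v. v \<in> {0..\<epsilon>} \<Longrightarrow> (k has_real_derivative D v) (at v within {0..\<epsilon>})"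
    "continuous_on {0..\<epsilon>} k"
proof -
  obtain D where D: "continuous_on {0..\<epsilon>} D" "\<And>v. v \<in> {0..\<epsilon>} \<Longrightarrow> (k has_real_derivative D v) (at v within {0..\<epsilon>})"
    using assms unfolding C1_interval_def by blast
  moreover have "continuous_on {0..\<epsilon>} k" using D(2) by (rule DERIV_continuous_on)
  ultimately show thesis using that by blast
qed

lemma Icc_tendsto_right:
  fixes k :: "real \<Rightarrow> real"
  assumes "continuous_on {0..\<epsilon>} k" "0 < \<epsilon>"
  shows "(k \<longlongrightarrow> k 0) (at_right 0)"
  using assms unfolding continuous_on_def by (metis at_0_within_Icc atLeastAtMost_iff less_imp_le order_refl)

lemma C1_interval_strict:
  assumes "C1_interval \<epsilon> k" "0 < \<epsilon>"
  obtains K where "strict_deriv k (\<lambda>h. K * h) 0 {0..\<epsilon>}"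
proof -
  obtain D where D: "continuous_on {0..\<epsilon>} D" "\<And>v. v \<in> {0..\<epsilon>} \<Longrightarrow> (k has_real_derivative D v) (at v within {0..\<epsilon>})"
    using C1_interval_props[OF assms(1)] by metis
  have "strict_deriv k (\<lambda>h. D 0 * h) 0 {0..\<epsilon>}"
    by (rule strict_deriv_real) (use D assms(2) in \<open>auto simp: continuous_on_eq_continuous_within\<close>)
  then show thesis by (rule that)
qed

lemma C1_interval_mult_strict:
  assumes "C1_interval \<epsilon> k" "0 < \<epsilon>"
  shows "strict_deriv (\<lambda>v. v * k v) (\<lambda>h. k 0 * h) 0 {0..\<epsilon>}" "strict_deriv (\<lambda>v. v\<^sup>2 * k v) (\<lambda>h. 0) 0 {0..\<epsilon>}"
proof -
  obtain K where K: "strict_deriv k (\<lambda>h. K * h) 0 {0..\<epsilon>}" using C1_interval_strict[OF assms] .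
  have id: "strict_deriv (\<lambda>v::real. v) (\<lambda>h. h) 0 {0..\<epsilon>}" by (rule strict_deriv_bounded_linear[OF bounded_linear_ident])
  have 0: "0 \<in> {0..\<epsilon>}" using assms by simp
  have 1: "strict_deriv (\<lambda>v. v * k v) (\<lambda>h. 0 * (K * h) + h * k 0) 0 {0..\<epsilon>}"
    using strict_deriv_mult[OF id K 0] .
  show "strict_deriv (\<lambda>v. v * k v) (\<lambda>h. k 0 * h) 0 {0..\<epsilon>}"
    by (rule strict_deriv_eq_deriv[OF 1]) simp
  have "strict_deriv (\<lambda>v. v * (v * k v)) (\<lambda>h. 0 * (0 * (K * h) + h * k 0) + h * (0 * k 0)) 0 {0..\<epsilon>}"
    using strict_deriv_mult[OF id 1 0] .
  then have "strict_deriv (\<lambda>v. v * (v * k v)) (\<lambda>h. 0) 0 {0..\<epsilon>}"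
    by (rule strict_deriv_eq_deriv) simp
  then show "strict_deriv (\<lambda>v. v\<^sup>2 * k v) (\<lambda>h. 0) 0 {0..\<epsilon>}" by (simp add: power2_eq_square mult.assoc)
qed

lemma T_v_sub:
  assumes "0 < \<epsilon>" "C_upto 1 (T_dom \<epsilon>) f" "u < \<epsilon>" "v \<in> {0..b}" "b \<le> u"
  shows "((\<lambda>x. f (u, x)) has_real_derivative bpd (T_dom \<epsilon>) 0 1 f (u, v)) (at v within {0..b})"
  using T_curve[OF assms(1,3,2), of "{0..b}" v u 0 0 1] assms(4,5) by (simp add: T_dom_def)

context ahead_state
begin

lemma h'_tendsto: "(h' \<longlongrightarrow> 0) (at_right 0)"
proof -
  have "((\<lambda>w. h' w / w\<^sup>2 * w\<^sup>2) \<longlongrightarrow> \<Lambda> / (2 * \<kappa> * (cp0 - cm0)) * 0\<^sup>2) (at_right 0)"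
    by (rule tendsto_mult[OF h'_asym tendsto_power[OF tendsto_ident_at]])
  moreover have "\<forall>\<^sub>F w in at_right 0. h' w / w\<^sup>2 * w\<^sup>2 = h' w"
    using eventually_at_right_less[of 0] by eventually_elim simp
  ultimately show ?thesis using tendsto_cong by fastforce
qed

text \<open>The characteristic has slope 0 at the cusp point, so only the w-derivative of \<alpha>
  contributes. The curve lies in the boundary of the domain, hence
  \<open>strict_deriv_along_boundary\<close>.\<close>

lemma alpha_i_strict: "\<exists>u0>0. strict_deriv (alpha_i A) (\<lambda>k. aw0 * k) 0 {0..u0}"
proof -
  obtain u1 where u1: "0 < u1" "\<And>u. 0 < u \<Longrightarrow> u < u1 \<Longrightarrow> (h u, u) \<in> N \<and> 0 < h u"
    using eventually_conj[OF h_in_N h_pos] by (auto simp: eventually_at_right_field)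
  define u0 where "u0 = u1 / 2"
  have u0: "0 < u0" "u0 < u1" using u1(1) by (auto simp: u0_def)
  have hN: "(h u, u) \<in> N" "0 \<le> h u" if "u \<in> {0..u0}" for u
  proof -
    have "(h u, u) \<in> N \<and> 0 \<le> h u"
    proof (cases "u = 0")
      case True
      then show ?thesis using O_in_N by (simp add: h_0)
    next
      case False
      then show ?thesis using u1(2)[of u] u0 that by auto
    qed
    then show "(h u, u) \<in> N" "0 \<le> h u" by auto
  qed
  have "u0 < W" using hN(1)[of u0] u0 by (auto simp: N_eq)
  have "strict_deriv (\<lambda>u. a (h u, u)) (\<lambda>k. (D 1 0 a (h 0, 0) * h' 0 + D 0 1 a (h 0, 0) * 1) * k) 0 {0..u0}"
  proof (rule strict_deriv_along_boundary[where S = N and ?e1.0 = "-1" and ?e2.0 = 0 and ?\<delta>0.0 = W and ?\<gamma>1.0 = h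
        and ?\<gamma>2.0 = "\<lambda>s. s" and ?g1.0 = h' and ?g2.0 = "\<lambda>s. 1"])
    show "\<And>x. x \<in> interior N \<Longrightarrow> (a has_derivative (\<lambda>h. D 1 0 a x * fst h + D 0 1 a x * snd h)) (at x)"
      using D_deriv(3)[OF ahead(2)] by auto
    show "(h has_real_derivative h' s) (at s within {0..u0})" if "s \<in> {0..u0}" for s
    proof (rule DERIV_subset)
      show "(h has_real_derivative h' s) (at s within {0..<W})" using h_deriv(1)[of s] hN that by simp
    qed (use \<open>u0 < W\<close> in auto)
    show "continuous (at 0 within {0..u0}) h'"
      using h'_tendsto h'_0 u0 by (simp add: continuous_within at_0_within_Icc)
    fix s \<delta> :: real assume s: "s \<in> {0..u0}" "0 < \<delta>" "\<delta> < W"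
    show "(h s + \<delta> * - 1, s + \<delta> * 0) \<in> interior N"
      using shift_N[OF hN(1)[OF s(1)] s(2)] s(3) hN(2)[OF s(1)] by simp
  qed (use hN u0 ahead(1) f_cont[OF ahead(2)] D_cont[OF ahead(2)] in \<open>auto intro!: derivative_eq_intros\<close>)
  then have "strict_deriv (alpha_i A) (\<lambda>k. aw0 * k) 0 {0..u0}"
    by (simp add: h_0 h'_0) (simp add: alpha_i_def[abs_def] h_def)
  then show ?thesis using u0 by blast
qed

end

section \<open>Size of t on the triangle and the cubic coefficient of r - r0 - c_plus t\<close>

context cusp_solution
begin

text \<open>The combination with \<open>cmT\<close> is almost constant in u and known to be
  quadratic on the diagonal; the one with \<open>cpT\<close> is almost constant in v and known on
  the edge v = 0. Their difference is t times \<open>cpT - cmT\<close>, which is bounded away from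
  0, so t is quadratically small on the whole triangle.\<close>

lemma tf_quadratic: "\<exists>C>0. \<forall>\<^sub>F s in at_right 0. \<forall>x\<in>T_dom s. \<bar>tf x\<bar> \<le> C * s\<^sup>2"
proof -
  obtain B where B: "0 < B" "\<And>v. v \<in> {0..eps} \<Longrightarrow> \<bar>fh v\<bar> \<le> B \<and> \<bar>gh v\<bar> \<le> B"
  proof -
    have "continuous_on {0..eps} fh" "continuous_on {0..eps} gh"
      using C1_interval_props cusp_facts(2,3) by metis+
    then have bd: "bounded (fh ` {0..eps})" "bounded (gh ` {0..eps})"
      by (auto intro!: compact_imp_bounded compact_continuous_image)
    obtain B1 where b1: "\<forall>x\<in>fh ` {0..eps}. norm x \<le> B1" using bd(1) unfolding bounded_iff by blast
    obtain B2 where b2: "\<forall>x\<in>gh ` {0..eps}. norm x \<le> B2" using bd(2) unfolding bounded_iff by blast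
    show thesis
    proof (rule that[of "\<bar>B1\<bar> + \<bar>B2\<bar> + 1"])
      fix v assume "v \<in> {0..eps}"
      then have "\<bar>fh v\<bar> \<le> B1" "\<bar>gh v\<bar> \<le> B2" using b1 b2 by auto
      then show "\<bar>fh v\<bar> \<le> \<bar>B1\<bar> + \<bar>B2\<bar> + 1 \<and> \<bar>gh v\<bar> \<le> \<bar>B1\<bar> + \<bar>B2\<bar> + 1" by linarith
    qed simp
  qed
  define c0 where "c0 = cp0 - cm0"
  have c0: "0 < c0" and c0_eq: "cp0 = cm0 + c0" using cm0_less by (simp_all add: c0_def)
  obtain M where M: "0 < M" "\<forall>\<^sub>F s in at_right 0. \<forall>u u' v. (u, v) \<in> T_dom s \<longrightarrow> (u', v) \<in> T_dom s \<longrightarrow> \<bar>cmT (u, v) - cmT (u', v)\<bar> \<le> M * \<bar>u - u'\<bar>"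
    using cmT_u by blast
  define Bc where "Bc = \<bar>cm0\<bar> + c0"
  have Bc: "0 < Bc" using c0 by (simp add: Bc_def)
  define K where "K = 2 * (B + Bc * B) + 2 * c0"
  have K: "0 < K" using B(1) Bc c0 by (auto simp: K_def intro!: add_pos_pos mult_pos_pos)
  have c04: "0 < c0 / 4" using c0 by simp
  have sm: "0 < c0 / (4 * (2 * M + 1))" using c0 M by simp
  have hs: "\<forall>\<^sub>F u in at_right 0. \<bar>h u\<bar> \<le> u\<^sup>2"
    using tendstoD[OF h_small zero_less_one] eventually_at_right_less[of 0]
    by eventually_elim (simp add: divide_less_eq)
  have "\<forall>\<^sub>F s in at_right 0. \<forall>x\<in>T_dom s. \<bar>tf x\<bar> \<le> (4 * K / c0) * s\<^sup>2"
    using M(2) cpT_v[OF zero_less_one] cpT_near[OF c04] cmT_near[OF c04] eventually_at_right_all_le[OF hs]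
      eventually_at_right_real[OF eps] eventually_at_right_real[OF sm]
  proof eventually_elim
    case (elim s)
    have s: "0 < s" "s < eps" using elim by auto
    have sub: "T_dom s \<subseteq> TE" using s by (auto simp: T_dom_def)
    have "continuous_on (T_dom s) (\<lambda>x. \<bar>tf x\<bar>)"
      using T_cont(1)[OF sol_facts(1)] sub by (intro continuous_intros) (rule continuous_on_subset)
    moreover have "(0, 0) \<in> T_dom s" using s by (simp add: T_dom_def)
    then have "T_dom s \<noteq> {}" by blast
    ultimately obtain x0 where x0: "x0 \<in> T_dom s" "\<And>x. x \<in> T_dom s \<Longrightarrow> \<bar>tf x\<bar> \<le> \<bar>tf x0\<bar>"
      using continuous_attains_sup[OF T_dom_compact, of s] by blast
    define n where "n = \<bar>tf x0\<bar>"
    have n: "0 \<le> n" "\<And>x. x \<in> T_dom s \<Longrightarrow> \<bar>tf x\<bar> \<le> n" using x0(2) by (auto simp: n_def)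
    define P where "P x = rf x - r0 A - cmT x * tf x" for x
    define R where "R x = rf x - r0 A - cpT x * tf x" for x
    have Pb: "\<bar>P (u, v)\<bar> \<le> (B + Bc * B) * s\<^sup>2 + M * n * s" if uv: "(u, v) \<in> T_dom s" for u v
    proof -
      have uv': "0 \<le> v" "v \<le> u" "u \<le> s" using uv by (auto simp: T_dom_def)
      have seg: "(x, v) \<in> T_dom s" if "x \<in> {v..u}" for x using that uv' by (auto simp: T_dom_def)
      \<comment> \<open>The constant pair \<open>r0\<close>, 0 plays the second solution, which
        turns the comparison of two solutions into an estimate of a single one.\<close>
      have "\<bar>(rf (u, v) - r0 A - cmT (u, v) * (tf (u, v) - 0)) - (rf (v, v) - r0 A - cmT (v, v) * (tf (v, v) - 0))\<bar>
          \<le> M * n * u - M * n * v"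
      proof (rule transport_bound[where ?x1.0 = "\<lambda>x. rf (x, v)" and ?x2.0 = "\<lambda>x. r0 A" and ?t1.0 = "\<lambda>x. tf (x, v)" and ?t2.0 = "\<lambda>x. 0"
          and ?c1.0 = "\<lambda>x. cmT (x, v)" and ?c2.0 = "\<lambda>x. cmT (x, v)" and t1' = "\<lambda>x. Du tf (x, v)" and t2' = "\<lambda>x. 0" and L = M
          and G = "\<lambda>x. M * n * x" and G' = "\<lambda>x. M * n"])
        show "((\<lambda>x. tf (x, v)) has_real_derivative Du tf (x, v)) (at x within {v..u})" if "x \<in> {v..u}" for x
          by (rule T_u[OF eps sol_facts(1)]) (use that uv' s in auto)
        show "((\<lambda>x. rf (x, v)) has_real_derivative cmT (x, v) * Du tf (x, v)) (at x within {v..u})" if x: "x \<in> {v..u}" for x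
        proof -
          have "(x, v) \<in> TE" using seg[OF x] sub by blast
          moreover have "((\<lambda>x. rf (x, v)) has_real_derivative Du rf (x, v)) (at x within {v..u})"
            by (rule T_u[OF eps sol_facts(2)]) (use x uv' s in auto)
          ultimately show ?thesis using sol_facts(9)[of "(x, v)"] by (simp add: mult.commute)
        qed
        show "\<bar>cmT (x', v) - cmT (x, v)\<bar> \<le> M * \<bar>x' - x\<bar>" if "x \<in> {v..u}" "x' \<in> {v..u}" for x x'
          using elim(1) seg that by blast
        show "\<bar>cmT (x, v) - cmT (x, v)\<bar> * \<bar>0\<bar> + M * \<bar>tf (x, v) - 0\<bar> \<le> M * n" if "x \<in> {v..u}" for x
          using n(2)[OF seg[OF that]] M by simp
      qed (use uv' in \<open>auto intro!: derivative_eq_intros\<close>)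
      then have 1: "\<bar>P (u, v) - P (v, v)\<bar> \<le> M * n * (u - v)" by (simp add: P_def algebra_simps)
      have vE: "v \<in> {0..eps}" "(v, v) \<in> T_dom s" using uv' s by (auto simp: T_dom_def)
      have "\<bar>cmT (v, v) - cm0\<bar> < c0 / 4" using elim(4) vE(2) by blast
      then have "\<bar>cmT (v, v)\<bar> \<le> Bc" using c0 unfolding Bc_def by linarith
      then have "\<bar>P (v, v)\<bar> \<le> v\<^sup>2 * B + Bc * (v\<^sup>2 * B)"
      proof -
        have "P (v, v) = v\<^sup>2 * gh v - cmT (v, v) * (v\<^sup>2 * fh v)" unfolding P_def using cusp_facts(8,9)[OF vE(1)] by simp
        also have "\<bar>\<dots>\<bar> \<le> \<bar>v\<^sup>2 * gh v\<bar> + \<bar>cmT (v, v) * (v\<^sup>2 * fh v)\<bar>" by (rule abs_triangle_ineq4)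
        also have "\<dots> \<le> v\<^sup>2 * B + Bc * (v\<^sup>2 * B)"
          unfolding abs_mult using B(2)[OF vE(1)] \<open>\<bar>cmT (v, v)\<bar> \<le> Bc\<close> Bc by (intro add_mono mult_mono) auto
        finally show ?thesis .
      qed
      also have "\<dots> = (B + Bc * B) * v\<^sup>2" by (simp add: algebra_simps)
      also have "\<dots> \<le> (B + Bc * B) * s\<^sup>2" using uv' B Bc by (intro mult_left_mono power_mono) auto
      finally have 2: "\<bar>P (v, v)\<bar> \<le> (B + Bc * B) * s\<^sup>2" .
      have "M * n * (u - v) \<le> M * n * s" using uv' M n by (intro mult_left_mono) auto
      then show ?thesis using 1 2 by linarith
    qed
    have Rb: "\<bar>R (u, v)\<bar> \<le> (B + Bc * B) * s\<^sup>2 + M * n * s + 2 * c0 * s\<^sup>2 + n * s" if uv: "(u, v) \<in> T_dom s" for u v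
    proof -
      have uv': "0 \<le> v" "v \<le> u" "u \<le> s" using uv by (auto simp: T_dom_def)
      have seg: "(u, x) \<in> T_dom s" if "x \<in> {0..v}" for x using that uv' by (auto simp: T_dom_def)
      have "\<bar>(rf (u, v) - r0 A - cpT (u, v) * (tf (u, v) - 0)) - (rf (u, 0) - r0 A - cpT (u, 0) * (tf (u, 0) - 0))\<bar>
          \<le> 1 * n * v - 1 * n * 0"
      proof (rule transport_bound[where ?x1.0 = "\<lambda>x. rf (u, x)" and ?x2.0 = "\<lambda>x. r0 A" and ?t1.0 = "\<lambda>x. tf (u, x)" and ?t2.0 = "\<lambda>x. 0"
          and ?c1.0 = "\<lambda>x. cpT (u, x)" and ?c2.0 = "\<lambda>x. cpT (u, x)" and t1' = "\<lambda>x. Dv tf (u, x)" and t2' = "\<lambda>x. 0" and L = 1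
          and G = "\<lambda>x. 1 * n * x" and G' = "\<lambda>x. 1 * n"])
        show "((\<lambda>x. tf (u, x)) has_real_derivative Dv tf (u, x)) (at x within {0..v})" if "x \<in> {0..v}" for x
          using T_v_sub[OF eps sol_facts(1), of u x v] that uv' s by simp
        show "((\<lambda>x. rf (u, x)) has_real_derivative cpT (u, x) * Dv tf (u, x)) (at x within {0..v})" if x: "x \<in> {0..v}" for x
        proof -
          have "(u, x) \<in> TE" using seg[OF x] sub by blast
          moreover have "((\<lambda>x. rf (u, x)) has_real_derivative Dv rf (u, x)) (at x within {0..v})"
            using T_v_sub[OF eps sol_facts(2), of u x v] x uv' s by simp
          ultimately show ?thesis using sol_facts(8)[of "(u, x)"] by (simp add: mult.commute)
        qed
        show "\<bar>cpT (u, x') - cpT (u, x)\<bar> \<le> 1 * \<bar>x' - x\<bar>" if "x \<in> {0..v}" "x' \<in> {0..v}" for x x'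
          using elim(2) seg that by blast
        show "\<bar>cpT (u, x) - cpT (u, x)\<bar> * \<bar>0\<bar> + 1 * \<bar>tf (u, x) - 0\<bar> \<le> 1 * n" if "x \<in> {0..v}" for x
          using n(2)[OF seg[OF that]] by simp
      qed (use uv' in \<open>auto intro!: derivative_eq_intros\<close>)
      then have 1: "\<bar>R (u, v) - R (u, 0)\<bar> \<le> n * v" by (simp add: R_def)
      have u0: "(u, 0) \<in> T_dom s" "u \<in> {0..eps}" using uv' s by (auto simp: T_dom_def)
      have "\<bar>h u\<bar> \<le> u\<^sup>2" using elim(5) uv' by (cases "u = 0") (auto simp: h_0)
      also have "\<dots> \<le> s\<^sup>2" using uv' by (intro power_mono) auto
      finally have hu: "\<bar>h u\<bar> \<le> s\<^sup>2" .
      have "\<bar>cpT (u, 0) - cp0\<bar> < c0 / 4" "\<bar>cmT (u, 0) - cm0\<bar> < c0 / 4" using elim(3,4) u0(1) by auto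
      then have "\<bar>cpT (u, 0) - cmT (u, 0)\<bar> \<le> 2 * c0" using c0 c0_eq by linarith
      then have "\<bar>(cpT (u, 0) - cmT (u, 0)) * h u\<bar> \<le> 2 * c0 * s\<^sup>2"
        unfolding abs_mult using hu c0 by (intro mult_mono) auto
      moreover have "R (u, 0) = P (u, 0) - (cpT (u, 0) - cmT (u, 0)) * h u"
        using sol_facts(11)[OF u0(2)] by (simp add: R_def P_def algebra_simps)
      ultimately have 2: "\<bar>R (u, 0)\<bar> \<le> (B + Bc * B) * s\<^sup>2 + M * n * s + 2 * c0 * s\<^sup>2"
        using Pb[OF u0(1)] by linarith
      have "n * v \<le> n * s" using uv' n by (intro mult_left_mono) auto
      then show ?thesis using 1 2 by linarith
    qed
    have "c0 / 2 * n \<le> K * s\<^sup>2 + (2 * M + 1) * s * n"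
    proof -
      obtain u v where uv: "x0 = (u, v)" by (cases x0)
      have "\<bar>cpT x0 - cp0\<bar> < c0 / 4" "\<bar>cmT x0 - cm0\<bar> < c0 / 4" using elim(3,4) x0(1) by auto
      then have "c0 / 2 \<le> \<bar>cpT x0 - cmT x0\<bar>" using c0 c0_eq by linarith
      then have "c0 / 2 * n \<le> \<bar>cpT x0 - cmT x0\<bar> * n" using n by (intro mult_right_mono) auto
      also have "\<dots> = \<bar>P x0 - R x0\<bar>" unfolding n_def abs_mult[symmetric] P_def R_def by (simp add: algebra_simps)
      also have "\<dots> \<le> \<bar>P x0\<bar> + \<bar>R x0\<bar>" by (rule abs_triangle_ineq4)
      also have "\<dots> \<le> K * s\<^sup>2 + (2 * M + 1) * s * n"
        using Pb[of u v] Rb[of u v] x0(1) unfolding uv K_def by (simp add: algebra_simps)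
      finally show ?thesis .
    qed
    \<comment> \<open>The unknown maximum \<open>n\<close> occurs on the right with a factor
      \<open>s\<close> only, so for small \<open>s\<close> it is absorbed into the left-hand
      side.\<close>
    moreover have "(2 * M + 1) * s * n \<le> c0 / 4 * n"
      using elim(7) M c0 n by (intro mult_right_mono) (auto simp: field_simps)
    ultimately have "c0 / 4 * n \<le> K * s\<^sup>2" by linarith
    then have "n \<le> (4 * K / c0) * s\<^sup>2" using c0 by (simp add: field_simps)
    then show ?case using n(2) by force
  qed
  then show ?thesis using K c0 by (intro exI[of _ "4 * K / c0"]) auto
qed

lemma edge_deriv:
  assumes "C_upto 1 TE f" "0 < v" "v < eps"
  shows "((\<lambda>x. f (x, 0)) has_real_derivative Du f (v, 0)) (at v)"
    "((\<lambda>x. f (x, x)) has_real_derivative Du f (v, v) + Dv f (v, v)) (at v)"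
proof -
  define s where "s = (v + eps) / 2"
  have s: "v < s" "s < eps" using assms by (auto simp: s_def)
  have eq: "at v within {0..s} = at v" using assms s by (simp add: at_within_Icc_at)
  show "((\<lambda>x. f (x, 0)) has_real_derivative Du f (v, 0)) (at v)"
    using T_u[OF eps assms(1) s(2), of 0 v] assms s eq by simp
  show "((\<lambda>x. f (x, x)) has_real_derivative Du f (v, v) + Dv f (v, v)) (at v)"
    using T_diag[OF eps assms(1) s(2), of v] assms s eq by simp
qed

lemma Du_tf_edge: assumes "0 < v" "v < eps" shows "Du tf (v, 0) = h' v"
proof -
  have "(h has_real_derivative h' v) (at v)" using h_deriv(2)[of v] sol_facts(10)[of v] assms by simp
  moreover have "(h has_real_derivative Du tf (v, 0)) (at v)"
    by (rule has_field_derivative_transform_within_open[OF edge_deriv(1)[OF sol_facts(1) assms], of "{0<..<eps}"])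
      (use assms sol_facts(11) in auto)
  ultimately show ?thesis using DERIV_unique by blast
qed

text \<open>On the edge v = 0 the increments satisfy dr = c_minus dh, so the numerator behaves like
  (\<open>cm0\<close> - \<open>cp0\<close>) h. The cubic coefficient of h has
  \<open>cp0 - cm0\<close> in its denominator, and the speeds cancel.\<close>

lemma R_edge: "((\<lambda>v. (rf (v, 0) - r0 A - cpT (v, 0) * h v) / v ^ 3) \<longlongrightarrow> - \<Lambda> / (6 * \<kappa>)) (at_right 0)"
proof -
  define c0 where "c0 = cp0 - cm0"
  have c0: "0 < c0" using cm0_less by (simp add: c0_def)
  have cT: "((\<lambda>v. cpT (v, 0)) \<longlongrightarrow> cp0) (at_right 0)" "((\<lambda>v. cmT (v, 0)) \<longlongrightarrow> cm0) (at_right 0)"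
  proof -
    show "((\<lambda>v. cpT (v, 0)) \<longlongrightarrow> cp0) (at_right 0)"
    proof (rule tendstoI)
      fix e :: real assume "0 < e"
      from cpT_near[OF this] eventually_at_right_less[of 0] show "\<forall>\<^sub>F v in at_right 0. dist (cpT (v, 0)) cp0 < e"
        by eventually_elim (auto simp: T_dom_def dist_real_def)
    qed
    show "((\<lambda>v. cmT (v, 0)) \<longlongrightarrow> cm0) (at_right 0)"
    proof (rule tendstoI)
      fix e :: real assume "0 < e"
      from cmT_near[OF this] eventually_at_right_less[of 0] show "\<forall>\<^sub>F v in at_right 0. dist (cmT (v, 0)) cm0 < e"
        by eventually_elim (auto simp: T_dom_def dist_real_def)
    qed
  qed
  have "((\<lambda>v. (rf (v, 0) - r0 A) / v ^ 3) \<longlongrightarrow> \<Lambda> / (2 * \<kappa> * (cp0 - cm0)) * cm0 / 3) (at_right 0)"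
  proof (rule lhopital_right_0[where f' = "\<lambda>v. h' v * cmT (v, 0)" and g' = "\<lambda>v. 3 * v\<^sup>2"])
    have "((\<lambda>v. rf (v, 0) - r0 A) \<longlongrightarrow> rf (0, 0) - r0 A) (at_right 0)"
      by (intro tendsto_intros T_small_limit(2)[OF eps T_cont(1)[OF sol_facts(2)]])
    then show "((\<lambda>v. rf (v, 0) - r0 A) \<longlongrightarrow> 0) (at_right 0)" by (simp add: sol_facts)
    show "\<forall>\<^sub>F v in at_right 0. ((\<lambda>v. rf (v, 0) - r0 A) has_real_derivative h' v * cmT (v, 0)) (at v)"
      using eventually_at_right_real[OF eps]
    proof eventually_elim
      case (elim v)
      then have "(v, 0) \<in> TE" by (auto simp: T_dom_def)
      then have "Du rf (v, 0) = h' v * cmT (v, 0)" using sol_facts(9)[of "(v, 0)"] Du_tf_edge[of v] elim by simp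
      then show ?case using edge_deriv(1)[OF sol_facts(2), of v] elim by (auto intro!: derivative_eq_intros)
    qed
    have "((\<lambda>v. h' v / v\<^sup>2 * cmT (v, 0) / 3) \<longlongrightarrow> \<Lambda> / (2 * \<kappa> * (cp0 - cm0)) * cm0 / 3) (at_right 0)"
      by (rule tendsto_divide[OF tendsto_mult[OF h'_asym cT(2)] tendsto_const]) simp
    then show "((\<lambda>v. h' v * cmT (v, 0) / (3 * v\<^sup>2)) \<longlongrightarrow> \<Lambda> / (2 * \<kappa> * (cp0 - cm0)) * cm0 / 3) (at_right 0)"
      by (simp add: mult.commute mult.left_commute)
  qed (auto simp: eventually_at_filter intro!: always_eventually derivative_eq_intros tendsto_eq_intros)
  from tendsto_diff[OF this tendsto_mult[OF cT(1) h_asym]]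
  have "((\<lambda>v. (rf (v, 0) - r0 A) / v ^ 3 - cpT (v, 0) * (h v / v ^ 3)) \<longlongrightarrow>
      \<Lambda> / (2 * \<kappa> * c0) * cm0 / 3 - cp0 * (\<Lambda> / (6 * \<kappa> * c0))) (at_right 0)"
    unfolding c0_def .
  moreover have "\<Lambda> / (2 * \<kappa> * c0) * cm0 / 3 - cp0 * (\<Lambda> / (6 * \<kappa> * c0)) = - \<Lambda> / (6 * \<kappa>)"
  proof -
    have "\<Lambda> / (2 * \<kappa> * c0) * cm0 / 3 - cp0 * (\<Lambda> / (6 * \<kappa> * c0)) = (\<Lambda> * cm0 - \<Lambda> * cp0) / (6 * \<kappa> * c0)"
      by (simp add: diff_divide_distrib mult.commute)
    also have "\<Lambda> * cm0 - \<Lambda> * cp0 = - (\<Lambda> * c0)" by (simp add: c0_def algebra_simps)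
    finally have "\<Lambda> / (2 * \<kappa> * c0) * cm0 / 3 - cp0 * (\<Lambda> / (6 * \<kappa> * c0)) = - (\<Lambda> * c0) / (6 * \<kappa> * c0)" .
    then show ?thesis using c0 by simp
  qed
  ultimately show ?thesis by (simp add: diff_divide_distrib)
qed

text \<open>From the edge to the diagonal the numerator changes by at most the Lipschitz constant of
  \<open>cpT\<close> in v, times |t| of order v^2, times v. As that constant is arbitrarily small,
  the change is o(v^3) and the coefficient of \<open>R_edge\<close> persists.\<close>

lemma R_diag: "((\<lambda>v. (rf (v, v) - r0 A - cpT (v, v) * tf (v, v)) / v ^ 3) \<longlongrightarrow> - \<Lambda> / (6 * \<kappa>)) (at_right 0)"
proof -
  define R where "R x = rf x - r0 A - cpT x * tf x" for x
  obtain C where C: "0 < C" "\<forall>\<^sub>F s in at_right 0. \<forall>x\<in>T_dom s. \<bar>tf x\<bar> \<le> C * s\<^sup>2"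
    using tf_quadratic by blast
  have "((\<lambda>v. (R (v, v) - R (v, 0)) / v ^ 3) \<longlongrightarrow> 0) (at_right 0)"
  proof (rule tendstoI)
    fix e :: real assume e: "0 < e"
    define e1 where "e1 = e / (2 * C)"
    have e1: "0 < e1" "e1 * C = e / 2" using e C(1) by (auto simp: e1_def)
    show "\<forall>\<^sub>F v in at_right 0. dist ((R (v, v) - R (v, 0)) / v ^ 3) 0 < e"
      using C(2) cpT_v[OF e1(1)] eventually_at_right_real[OF eps]
    proof eventually_elim
      case (elim v)
      then have v: "0 < v" "v < eps" by auto
      have seg: "(v, x) \<in> T_dom v" "(v, x) \<in> TE" if "x \<in> {0..v}" for x using that v by (auto simp: T_dom_def)
      have "\<bar>(rf (v, v) - r0 A - cpT (v, v) * (tf (v, v) - 0)) - (rf (v, 0) - r0 A - cpT (v, 0) * (tf (v, 0) - 0))\<bar>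
          \<le> e1 * (C * v\<^sup>2) * v - e1 * (C * v\<^sup>2) * 0"
      proof (rule transport_bound[where ?x1.0 = "\<lambda>x. rf (v, x)" and ?x2.0 = "\<lambda>x. r0 A" and ?t1.0 = "\<lambda>x. tf (v, x)" and ?t2.0 = "\<lambda>x. 0"
          and ?c1.0 = "\<lambda>x. cpT (v, x)" and ?c2.0 = "\<lambda>x. cpT (v, x)" and t1' = "\<lambda>x. Dv tf (v, x)" and t2' = "\<lambda>x. 0" and L = e1
          and G = "\<lambda>x. e1 * (C * v\<^sup>2) * x" and G' = "\<lambda>x. e1 * (C * v\<^sup>2)"])
        show "((\<lambda>x. tf (v, x)) has_real_derivative Dv tf (v, x)) (at x within {0..v})" if "x \<in> {0..v}" for x
          by (rule T_v[OF eps sol_facts(1) v(2) that])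
        show "((\<lambda>x. rf (v, x)) has_real_derivative cpT (v, x) * Dv tf (v, x)) (at x within {0..v})" if x: "x \<in> {0..v}" for x
          using T_v[OF eps sol_facts(2) v(2) x] sol_facts(8)[OF seg(2)[OF x]] by (simp add: mult.commute)
        show "\<bar>cpT (v, x') - cpT (v, x)\<bar> \<le> e1 * \<bar>x' - x\<bar>" if "x \<in> {0..v}" "x' \<in> {0..v}" for x x'
          using elim(2) seg(1) that by blast
        show "\<bar>cpT (v, x) - cpT (v, x)\<bar> * \<bar>0\<bar> + e1 * \<bar>tf (v, x) - 0\<bar> \<le> e1 * (C * v\<^sup>2)" if "x \<in> {0..v}" for x
          using elim(1) seg(1)[OF that] e1 by simp
      qed (use v in \<open>auto intro!: derivative_eq_intros\<close>)
      then have "\<bar>R (v, v) - R (v, 0)\<bar> \<le> (e1 * C) * v ^ 3"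
        by (simp add: R_def power3_eq_cube power2_eq_square algebra_simps)
      then have "\<bar>R (v, v) - R (v, 0)\<bar> / v ^ 3 \<le> e / 2" using v e1(2) by (simp add: divide_le_eq)
      then have "\<bar>R (v, v) - R (v, 0)\<bar> / v ^ 3 < e" using e by linarith
      then show ?case using v by (simp add: dist_real_def)
    qed
  qed
  moreover have "((\<lambda>v. R (v, 0) / v ^ 3) \<longlongrightarrow> - \<Lambda> / (6 * \<kappa>)) (at_right 0)"
  proof (rule Lim_transform_eventually[OF R_edge])
    show "\<forall>\<^sub>F v in at_right 0. (rf (v, 0) - r0 A - cpT (v, 0) * h v) / v ^ 3 = R (v, 0) / v ^ 3"
      using eventually_at_right_real[OF eps] by eventually_elim (simp add: R_def sol_facts)
  qed
  ultimately have "((\<lambda>v. (R (v, v) - R (v, 0)) / v ^ 3 + R (v, 0) / v ^ 3) \<longlongrightarrow> 0 + - \<Lambda> / (6 * \<kappa>)) (at_right 0)"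
    by (rule tendsto_add)
  then show ?thesis
    by (simp only: add_divide_distrib[symmetric] diff_add_cancel add_0_left) (simp only: R_def)
qed

end

context cusp_solution
begin

definition "ft v = Du tf (v, v) + Dv tf (v, v)"
definition "gt v = Du rf (v, v) + Dv rf (v, v)"
definition "f0 = fh 0"
definition "y0 = yf 0"

lemma fh_tendsto: "(fh \<longlongrightarrow> f0) (at_right 0)" and yf_tendsto: "(yf \<longlongrightarrow> y0) (at_right 0)"
  unfolding f0_def y0_def using C1_interval_props[OF cusp_facts(2)] C1_interval_props[OF cusp_facts(1)] Icc_tendsto_right eps
  by metis+

lemma small_range: "\<forall>\<^sub>F v in at_right 0. 0 < v \<and> v < eps \<and> v \<in> {0..eps} \<and> v \<in> {0<..eps}"
  using eventually_at_right_real[OF eps] by eventually_elim auto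

lemma diag_deriv_eq:
  assumes "0 < v" "v < eps"
  shows "diag_deriv eps tf v = ft v" "diag_deriv eps rf v = gt v"
proof -
  have eq: "at v within {0..eps} = at v" using assms by (simp add: at_within_Icc_at)
  show "diag_deriv eps tf v = ft v" "diag_deriv eps rf v = gt v"
    using edge_deriv(2)[OF sol_facts(1) assms] edge_deriv(2)[OF sol_facts(2) assms]
    unfolding diag_deriv_def eq ft_def gt_def has_real_derivative_iff_has_vector_derivative
    by (auto intro: vector_derivative_at)
qed

definition "Vf v = diag_deriv eps rf v / diag_deriv eps tf v"

lemma gt_eq: assumes "0 < v" "v < eps" shows "gt v = Vf v * ft v" "ft v \<noteq> 0"
  using cusp_facts(12)[of v] diag_deriv_eq[OF assms] assms by (auto simp: Vf_def)

lemma ft_asym: "((\<lambda>v. ft v / v) \<longlongrightarrow> 2 * f0) (at_right 0)"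
proof -
  obtain K where K: "continuous_on {0..eps} K" "\<And>v. v \<in> {0..eps} \<Longrightarrow> (fh has_real_derivative K v) (at v within {0..eps})"
    using C1_interval_props[OF cusp_facts(2)] by metis
  have "((\<lambda>v. 2 * fh v + v * K v) \<longlongrightarrow> 2 * f0 + 0 * K 0) (at_right 0)"
    by (intro tendsto_intros fh_tendsto Icc_tendsto_right[OF K(1) eps])
  moreover have "\<forall>\<^sub>F v in at_right 0. 2 * fh v + v * K v = ft v / v"
    using small_range
  proof eventually_elim
    case (elim v)
    have "at v within {0..eps} = at v" using elim by (simp add: at_within_Icc_at)
    then have "(fh has_real_derivative K v) (at v)" using K(2)[of v] elim by simp
    then have "((\<lambda>v. v\<^sup>2 * fh v) has_real_derivative 2 * v * fh v + v\<^sup>2 * K v) (at v)"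
      by (auto intro!: derivative_eq_intros)
    moreover have "((\<lambda>v. v\<^sup>2 * fh v) has_real_derivative ft v) (at v)"
      unfolding ft_def
      by (rule has_field_derivative_transform_within_open[OF edge_deriv(2)[OF sol_facts(1)], of _ "{0<..<eps}"])
        (use elim cusp_facts(8) in auto)
    ultimately have "ft v = 2 * v * fh v + v\<^sup>2 * K v" using DERIV_unique by blast
    then show ?case using elim by (simp add: field_simps power2_eq_square)
  qed
  ultimately show ?thesis by (simp add: Lim_transform_eventually)
qed

lemma tf_diag_asym: "((\<lambda>v. tf (v, v) / v\<^sup>2) \<longlongrightarrow> f0) (at_right 0)"
  by (rule Lim_transform_eventually[OF fh_tendsto])
    (use small_range in \<open>eventually_elim, simp add: cusp_facts(8)\<close>)

lemma alpha_plus_strict: "\<exists>s>0. s < eps \<and> strict_deriv (\<lambda>v. af (v, v)) (\<lambda>k. aw0 * k) 0 {0..s}"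
proof -
  obtain u0 where u0: "0 < u0" "strict_deriv (alpha_i A) (\<lambda>k. aw0 * k) 0 {0..u0}" using alpha_i_strict by blast
  define s where "s = min u0 (eps / 2)"
  have s: "0 < s" "s \<le> u0" "s < eps" using u0 eps by (auto simp: s_def)
  have "strict_deriv (\<lambda>v. alpha_i A v + v\<^sup>2 * ah v) (\<lambda>k. aw0 * k + 0) 0 {0..s}"
    by (intro strict_deriv_add strict_deriv_mono[OF u0(2)] strict_deriv_mono[OF C1_interval_mult_strict(2)[OF cusp_facts(4) eps]])
      (use s in auto)
  then have "strict_deriv (\<lambda>v. af (v, v)) (\<lambda>k. aw0 * k + 0) 0 {0..s}"
    by (rule strict_deriv_cong[where r = 1]) (use cusp_facts(10) s in \<open>auto simp: algebra_simps\<close>)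
  then have "strict_deriv (\<lambda>v. af (v, v)) (\<lambda>k. aw0 * k) 0 {0..s}" by simp
  then show ?thesis using s by blast
qed

lemma beta_plus_strict: "s < eps \<Longrightarrow> strict_deriv (\<lambda>v. bf (v, v)) (\<lambda>k. 0) 0 {0..s}"
proof -
  assume s: "s < eps"
  have "strict_deriv (\<lambda>v. beta0 A + v\<^sup>2 * bh v) (\<lambda>k. 0 + 0) 0 {0..eps}"
    by (intro strict_deriv_add strict_deriv_const C1_interval_mult_strict(2)[OF cusp_facts(5) eps]) (use eps in auto)
  then have "strict_deriv (\<lambda>v. bf (v, v)) (\<lambda>k. 0 + 0) 0 {0..eps}"
    by (rule strict_deriv_cong[where r = 1]) (use cusp_facts(11) in \<open>auto simp: algebra_simps\<close>)
  then show ?thesis using s by (auto intro: strict_deriv_mono)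
qed

text \<open>Behind the shock \<alpha> moves at the rate \<open>aw0\<close> and \<beta> is stationary
  to first order, exactly as along w in the state ahead; so the slope is the same \<kappa>.\<close>

lemma cpT_diag_strict: "\<exists>s>0. s < eps \<and> strict_deriv (\<lambda>v. cpT (v, v)) (\<lambda>k. \<kappa> * k) 0 {0..s}"
proof -
  obtain s where s: "0 < s" "s < eps" "strict_deriv (\<lambda>v. af (v, v)) (\<lambda>k. aw0 * k) 0 {0..s}"
    using alpha_plus_strict by blast
  have U: "strict_deriv (\<lambda>v. (af (v, v), bf (v, v))) (\<lambda>k. (aw0 * k, 0)) 0 {0..s}"
    by (rule strict_deriv_Pair[OF s(3) beta_plus_strict[OF s(2)]])
  have "strict_deriv (\<lambda>v. c_plus F (fst (af (v, v), bf (v, v))) (snd (af (v, v), bf (v, v)))) (\<lambda>k. Dc (aw0 * k, 0)) 0 {0..s}"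
    by (rule strict_deriv_compose[OF _ U]) (use Dc s in \<open>simp_all only: af_0 sol_facts(14) atLeastAtMost_iff less_imp_le order_refl simp_thms\<close>)
  then have "strict_deriv (\<lambda>v. cpT (v, v)) (\<lambda>k. Dc (aw0 * k, 0)) 0 {0..s}" by (simp only: cpT_def fst_conv snd_conv)
  then have "strict_deriv (\<lambda>v. cpT (v, v)) (\<lambda>k. \<kappa> * k) 0 {0..s}"
    by (rule strict_deriv_eq_deriv) (subst Dc_eq, simp add: kappa_alpha)
  then show ?thesis using s by blast
qed

lemma cpT_0: "cpT (0, 0) = cp0" by (simp add: cpT_def cp0_def af_0 sol_facts)

lemma cpT_diag_asym: "((\<lambda>v. (cpT (v, v) - cp0) / v) \<longlongrightarrow> \<kappa>) (at_right 0)"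
proof -
  obtain s where "0 < s" "strict_deriv (\<lambda>v. cpT (v, v)) (\<lambda>k. \<kappa> * k) 0 {0..s}" using cpT_diag_strict by blast
  from strict_deriv_quotient[OF this(2,1)] show ?thesis by (simp only: cpT_0)
qed

subsection \<open>Leading coefficients\<close>

text \<open>Replacing \<open>cpT\<close> by its value at the corner changes r - r0 - c_plus t by
  (\<open>cpT\<close> - \<open>cp0\<close>) t, which is \<kappa> v times \<open>f0\<close> v^2 to
  leading order.\<close>

lemma leading_interior:
  "((\<lambda>v. (rf (v, v) - r0 A - cp0 * tf (v, v)) / v ^ 3) \<longlongrightarrow> - \<Lambda> / (6 * \<kappa>) + \<kappa> * f0) (at_right 0)"
proof -
  have "((\<lambda>v. (rf (v, v) - r0 A - cpT (v, v) * tf (v, v)) / v ^ 3 + (cpT (v, v) - cp0) / v * (tf (v, v) / v\<^sup>2)) \<longlongrightarrow>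
      - \<Lambda> / (6 * \<kappa>) + \<kappa> * f0) (at_right 0)"
    by (rule tendsto_add[OF R_diag tendsto_mult[OF cpT_diag_asym tf_diag_asym]])
  moreover have "\<forall>\<^sub>F v in at_right 0. (rf (v, v) - r0 A - cpT (v, v) * tf (v, v)) / v ^ 3 + (cpT (v, v) - cp0) / v * (tf (v, v) / v\<^sup>2)
      = (rf (v, v) - r0 A - cp0 * tf (v, v)) / v ^ 3"
    using eventually_at_right_less[of 0]
  proof eventually_elim
    case (elim v)
    have "(cpT (v, v) - cp0) / v * (tf (v, v) / v\<^sup>2) = (cpT (v, v) - cp0) * tf (v, v) / v ^ 3"
      by (simp add: power3_eq_cube power2_eq_square)
    then show ?case by (simp add: add_divide_distrib[symmetric] algebra_simps)
  qed
  ultimately show ?thesis by (rule Lim_transform_eventually)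
qed

text \<open>The same quantity, now from the motion of the shock: its derivative is (V -
  \<open>cp0\<close>) df/dv, of the form \<kappa>/2 (1 + \<open>y0\<close>) v times 2
  \<open>f0\<close> v, and integration contributes the 1/3.\<close>

lemma leading_speed:
  "((\<lambda>v. (rf (v, v) - r0 A - cp0 * tf (v, v)) / v ^ 3) \<longlongrightarrow> \<kappa> * (1 + y0) * f0 / 3) (at_right 0)"
proof (rule lhopital_right_0[where f' = "\<lambda>v. gt v - cp0 * ft v" and g' = "\<lambda>v. 3 * v\<^sup>2"])
  have "((\<lambda>v. rf (v, v) - r0 A - cp0 * tf (v, v)) \<longlongrightarrow> rf (0, 0) - r0 A - cp0 * tf (0, 0)) (at_right 0)"
    by (intro tendsto_intros T_small_limit(1)[OF eps T_cont(1)] sol_facts)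
  then show "((\<lambda>v. rf (v, v) - r0 A - cp0 * tf (v, v)) \<longlongrightarrow> 0) (at_right 0)" by (simp add: sol_facts(13) tf_0)
  show "\<forall>\<^sub>F v in at_right 0. ((\<lambda>v. rf (v, v) - r0 A - cp0 * tf (v, v)) has_real_derivative gt v - cp0 * ft v) (at v)"
    using small_range
  proof eventually_elim
    case (elim v)
    then show ?case
      using edge_deriv(2)[OF sol_facts(1), of v] edge_deriv(2)[OF sol_facts(2), of v] unfolding ft_def gt_def
      by (auto intro!: derivative_eq_intros)
  qed
  have "((\<lambda>v. (\<kappa> / 2 * (1 + yf v) + v * Vh v) * (ft v / v) / 3) \<longlongrightarrow> (\<kappa> / 2 * (1 + y0) + 0 * Vh 0) * (2 * f0) / 3) (at_right 0)"
    by (intro tendsto_intros yf_tendsto ft_asym Icc_tendsto_right[OF cusp_facts(6) eps]) simp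
  moreover have "\<forall>\<^sub>F v in at_right 0. (\<kappa> / 2 * (1 + yf v) + v * Vh v) * (ft v / v) / 3 = (gt v - cp0 * ft v) / (3 * v\<^sup>2)"
    using small_range
  proof eventually_elim
    case (elim v)
    have "Vf v - cp0 = v * (\<kappa> / 2 * (1 + yf v) + v * Vh v)"
      using cusp_facts(13)[of v] elim by (simp add: Vf_def power2_eq_square algebra_simps)
    then have "gt v - cp0 * ft v = v * (\<kappa> / 2 * (1 + yf v) + v * Vh v) * ft v"
      using gt_eq(1)[of v] elim by (simp add: left_diff_distrib[symmetric])
    then show ?case using elim by (simp add: power2_eq_square)
  qed
  ultimately have "((\<lambda>v. (gt v - cp0 * ft v) / (3 * v\<^sup>2)) \<longlongrightarrow> (\<kappa> / 2 * (1 + y0) + 0 * Vh 0) * (2 * f0) / 3) (at_right 0)"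
    by (rule Lim_transform_eventually)
  moreover have "(\<kappa> / 2 * (1 + y0) + 0 * Vh 0) * (2 * f0) / 3 = \<kappa> * (1 + y0) * f0 / 3" by simp
  ultimately show "((\<lambda>v. (gt v - cp0 * ft v) / (3 * v\<^sup>2)) \<longlongrightarrow> \<kappa> * (1 + y0) * f0 / 3) (at_right 0)"
    by (simp only:)
qed (auto simp: eventually_at_filter intro!: always_eventually derivative_eq_intros tendsto_eq_intros)

lemma y0_nonpos: "y0 \<le> 0"
proof (rule tendsto_upperbound[OF yf_tendsto])
  show "\<forall>\<^sub>F v in at_right 0. yf v \<le> 0"
    using small_range
  proof eventually_elim
    case (elim v)
    then have "v * yf v < 0" using cusp_facts(7)[of v] sol_facts(18)[of v] by simp
    then show ?case using elim by (simp add: mult_less_0_iff)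
  qed
qed simp

text \<open>Only the two expansions that do not evaluate the state ahead on the shock are compared
  at this point. Positivity of \<open>f0\<close> has to come first: it places the shock in the
  sliver above the axis t = 0, where the expansions of the state ahead hold.\<close>

lemma f0_eq: "f0 * (2 - y0) = \<Lambda> / (2 * \<kappa>\<^sup>2)" and f0_pos: "0 < f0"
proof -
  have "- \<Lambda> / (6 * \<kappa>) + \<kappa> * f0 = \<kappa> * (1 + y0) * f0 / 3"
    by (rule tendsto_unique[OF _ leading_interior leading_speed]) simp
  then have "\<kappa> * (f0 * (2 - y0)) / 3 = \<Lambda> / (6 * \<kappa>)" by (simp add: algebra_simps)
  then show 1: "f0 * (2 - y0) = \<Lambda> / (2 * \<kappa>\<^sup>2)" using ahead(11) by (simp add: field_simps power2_eq_square)
  have "0 < f0 * (2 - y0)" unfolding 1 using ahead by simp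
  then show "0 < f0" using y0_nonpos by (simp add: zero_less_mult_iff)
qed

lemma zf_left: "filterlim zf (at_left 0) (at_right 0)"
proof (rule filterlim_at_withinI)
  have "((\<lambda>v. v * yf v) \<longlongrightarrow> 0 * y0) (at_right 0)" by (intro tendsto_intros yf_tendsto)
  then show "(zf \<longlongrightarrow> 0) (at_right 0)"
    using Lim_transform_eventually[of "\<lambda>v. v * yf v" 0 "at_right 0" zf] small_range
    by (simp add: eventually_mono cusp_facts(7))
  show "\<forall>\<^sub>F v in at_right 0. zf v \<in> {..<0} - {0}"
    using small_range by eventually_elim (use sol_facts(18) in force)
qed

lemma shock_region: "\<forall>\<^sub>F v in at_right 0. 0 < tf (v, v) \<and> tf (v, v) < \<tau> (zf v) \<and> zf v < 0"
proof -
  have "\<forall>\<^sub>F v in at_right 0. 0 < fh v" using order_tendstoD(1)[OF fh_tendsto f0_pos] .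
  then show ?thesis using small_range
  proof eventually_elim
    case (elim v)
    then show ?case using sol_facts(18,19)[of v] cusp_facts(8)[of v] by (simp add: \<tau>_def)
  qed
qed

text \<open>By the identification equation r on the shock is \<open>r\<close> at (f, z). Going up
  from the axis adds (\<open>cp0\<close> + \<kappa> z) f up to o(v^3), and on the axis
  \<open>r_axis\<close> gives the term in z^3, with z of the form \<open>y0\<close> v.\<close>

lemma leading_ahead:
  "((\<lambda>v. (rf (v, v) - r0 A - cp0 * tf (v, v)) / v ^ 3) \<longlongrightarrow> \<kappa> * y0 * f0 - \<Lambda> / (6 * \<kappa>) * y0 ^ 3) (at_right 0)"
proof -
  have zv: "((\<lambda>v. zf v / v) \<longlongrightarrow> y0) (at_right 0)"
    by (rule Lim_transform_eventually[OF yf_tendsto]) (use small_range in \<open>eventually_elim, simp add: cusp_facts(7)\<close>)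
  have ax: "((\<lambda>w. (r (0, w) - r0 A) / w ^ 3) \<longlongrightarrow> - \<Lambda> / (6 * \<kappa>)) (at_left 0)"
    using r_axis by (simp add: filterlim_at_split)
  have 1: "((\<lambda>v. (r (0, zf v) - r0 A) / zf v ^ 3 * (zf v / v) ^ 3) \<longlongrightarrow> - \<Lambda> / (6 * \<kappa>) * y0 ^ 3) (at_right 0)"
    by (intro tendsto_mult tendsto_power zv filterlim_compose[OF ax zf_left])
  have 2: "((\<lambda>v. (r (tf (v, v), zf v) - r (0, zf v) - (cp0 + \<kappa> * zf v) * tf (v, v)) / v ^ 3) \<longlongrightarrow> 0) (at_right 0)"
  proof (rule tendstoI)
    fix e :: real assume e: "0 < e"
    define B where "B = (f0 + 1) * (\<bar>y0\<bar> + 1)"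
    have B: "0 < B" using f0_pos by (simp add: B_def)
    define e1 where "e1 = e / (2 * B)"
    have e1: "0 < e1" "e1 * B = e / 2" using e B by (auto simp: e1_def)
    have "\<forall>\<^sub>F v in at_right 0. \<bar>yf v\<bar> < \<bar>y0\<bar> + 1" by (rule order_tendstoD(2)[OF tendsto_rabs[OF yf_tendsto]]) simp
    moreover have "\<forall>\<^sub>F v in at_right 0. fh v < f0 + 1" by (rule order_tendstoD(2)[OF fh_tendsto]) simp
    ultimately show "\<forall>\<^sub>F v in at_right 0. dist ((r (tf (v, v), zf v) - r (0, zf v) - (cp0 + \<kappa> * zf v) * tf (v, v)) / v ^ 3) 0 < e"
      using eventually_compose_filterlim[OF near_cusp_cp[OF e1(1)] zf_left] eventually_compose_filterlim[OF int_left zf_left]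
        shock_region small_range
    proof eventually_elim
      case (elim v)
      let ?t = "tf (v, v)" and ?z = "zf v"
      have "\<exists>s>0. s < ?t \<and> r (?t, ?z) - r (0, ?z) = (?t - 0) * cp (s, ?z)"
      proof (rule MVT2)
        fix s assume s: "0 \<le> s" "s \<le> ?t"
        then have int: "(s, ?z) \<in> interior N" using elim by auto
        then show "((\<lambda>s. r (s, ?z)) has_real_derivative cp (s, ?z)) (at s)"
          using f_deriv(1)[OF ahead(4) int] ahead(6)[of "(s, ?z)"] interior_subset by (metis subsetD)
      qed (use elim in auto)
      then obtain s where s: "0 < s" "s < ?t" "r (?t, ?z) - r (0, ?z) = ?t * cp (s, ?z)" by auto
      have "\<bar>cp (s, ?z) - cp0 - \<kappa> * ?z\<bar> \<le> e1 * \<bar>?z\<bar>" using elim s by auto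
      then have "\<bar>?t * (cp (s, ?z) - cp0 - \<kappa> * ?z)\<bar> \<le> ?t * (e1 * \<bar>?z\<bar>)"
        using elim unfolding abs_mult by (intro mult_mono) auto
      also have "\<dots> = e1 * (fh v * \<bar>yf v\<bar>) * v ^ 3"
        using elim cusp_facts(7,8)[of v] by (simp add: abs_mult power3_eq_cube power2_eq_square)
      also have "\<dots> \<le> e1 * B * v ^ 3"
      proof -
        have "0 < v\<^sup>2 * fh v" using elim cusp_facts(8)[of v] by simp
        then have "0 < fh v" by (simp add: zero_less_mult_iff)
        then show ?thesis unfolding B_def using elim e1
          by (intro mult_right_mono mult_left_mono mult_mono) auto
      qed
      also have "\<dots> < e * v ^ 3" using e e1 elim by simp
      finally have "\<bar>?t * (cp (s, ?z) - cp0 - \<kappa> * ?z)\<bar> < e * v ^ 3" .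
      moreover have "r (?t, ?z) - r (0, ?z) - (cp0 + \<kappa> * ?z) * ?t = ?t * (cp (s, ?z) - cp0 - \<kappa> * ?z)"
        unfolding s(3) by (simp add: algebra_simps)
      ultimately show ?case using elim by (simp add: dist_real_def divide_less_eq)
    qed
  qed
  have 3: "((\<lambda>v. \<kappa> * (zf v / v) * (tf (v, v) / v\<^sup>2)) \<longlongrightarrow> \<kappa> * y0 * f0) (at_right 0)"
    by (intro tendsto_intros zv tf_diag_asym)
  have "((\<lambda>v. (r (tf (v, v), zf v) - r (0, zf v) - (cp0 + \<kappa> * zf v) * tf (v, v)) / v ^ 3 +
      (r (0, zf v) - r0 A) / zf v ^ 3 * (zf v / v) ^ 3 + \<kappa> * (zf v / v) * (tf (v, v) / v\<^sup>2)) \<longlongrightarrow>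
      0 + - \<Lambda> / (6 * \<kappa>) * y0 ^ 3 + \<kappa> * y0 * f0) (at_right 0)"
    by (intro tendsto_add 1 2 3)
  moreover have "\<forall>\<^sub>F v in at_right 0. (r (tf (v, v), zf v) - r (0, zf v) - (cp0 + \<kappa> * zf v) * tf (v, v)) / v ^ 3 +
      (r (0, zf v) - r0 A) / zf v ^ 3 * (zf v / v) ^ 3 + \<kappa> * (zf v / v) * (tf (v, v) / v\<^sup>2)
     = (rf (v, v) - r0 A - cp0 * tf (v, v)) / v ^ 3"
    using shock_region small_range
  proof eventually_elim
    case (elim v)
    have a1: "(r (0, zf v) - r0 A) / zf v ^ 3 * (zf v / v) ^ 3 = (r (0, zf v) - r0 A) / v ^ 3"
      using elim by (simp add: power_divide)
    have a2: "\<kappa> * (zf v / v) * (tf (v, v) / v\<^sup>2) = \<kappa> * zf v * tf (v, v) / v ^ 3"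
      by (simp add: power3_eq_cube power2_eq_square)
    have "rf (v, v) = r (tf (v, v), zf v)" using sol_facts(16)[of v] elim by simp
    then show ?case unfolding a1 a2 add_divide_distrib[symmetric] by (simp add: algebra_simps)
  qed
  ultimately have "((\<lambda>v. (rf (v, v) - r0 A - cp0 * tf (v, v)) / v ^ 3) \<longlongrightarrow> 0 + - \<Lambda> / (6 * \<kappa>) * y0 ^ 3 + \<kappa> * y0 * f0) (at_right 0)"
    by (rule Lim_transform_eventually)
  then show ?thesis by (simp add: algebra_simps)
qed

text \<open>The three expansions combine to \<open>(y0 - 1)\<^sup>3 (y0 + 1) = 0\<close>, and \<open>y0 \<le> 0\<close>.\<close>
lemma y0_eq: "y0 = -1" and f0_val: "f0 = \<Lambda> / (6 * \<kappa>\<^sup>2)"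
proof -
  have "\<kappa> * (1 + y0) * f0 / 3 = \<kappa> * y0 * f0 - \<Lambda> / (6 * \<kappa>) * y0 ^ 3"
    by (rule tendsto_unique[OF _ leading_speed leading_ahead]) simp
  moreover have "\<Lambda> / (6 * \<kappa>) = \<kappa> / 3 * (\<Lambda> / (2 * \<kappa>\<^sup>2))"
    using ahead(11) by (simp add: power2_eq_square)
  ultimately have "\<kappa> * (1 + y0) * f0 / 3 = \<kappa> * y0 * f0 - \<kappa> / 3 * (f0 * (2 - y0)) * y0 ^ 3"
    unfolding f0_eq by simp
  moreover have "\<kappa> * (1 + y0) * f0 / 3 = \<kappa> * f0 * ((1 + y0) / 3)"
    "\<kappa> * y0 * f0 - \<kappa> / 3 * (f0 * (2 - y0)) * y0 ^ 3 = \<kappa> * f0 * (y0 - (2 - y0) * y0 ^ 3 / 3)"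
    by (simp_all add: field_simps)
  ultimately have "\<kappa> * f0 * ((1 + y0) / 3) = \<kappa> * f0 * (y0 - (2 - y0) * y0 ^ 3 / 3)" by simp
  then have "(1 + y0) / 3 = y0 - (2 - y0) * y0 ^ 3 / 3" using ahead(11) f0_pos by simp
  then have "(y0 - 1) ^ 3 * (y0 + 1) = 0" by (simp add: field_simps power3_eq_cube)
  then have "y0 = 1 \<or> y0 = -1" by auto
  then show "y0 = -1" using y0_nonpos by auto
  then show "f0 = \<Lambda> / (6 * \<kappa>\<^sup>2)" using f0_eq by (simp add: field_simps)
qed

end

section \<open>The states adjacent to the shock and the shock speed\<close>

context ahead_state
begin

text \<open>The relativistic sum of two velocities below 1 is below 1. The shock speed tends to
  \<open>cp0\<close>, so this supplies the bound |V| < 1 on which \<open>jump_conditions\<close>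
  relies.\<close>

lemma char_speed_bound: "\<bar>cp0\<bar> < 1"
proof -
  define v e where "v = vel (alpha0 A) (beta0 A)" and "e = eta F (alpha0 A) (beta0 A)"
  have b: "0 < 1 + v * e" "0 < e" "e < 1" "-1 < v" "v < 1"
    using char_denoms[of "alpha0 A" "beta0 A"] U0_J hh vel_bounds by (auto simp: v_def e_def fluid_eqs)
  have "0 < (1 - v) * (1 - e)" "0 < (1 + v) * (1 + e)" using b by (auto intro!: mult_pos_pos)
  then have "v + e < 1 + v * e" "- (1 + v * e) < v + e" by (simp_all add: algebra_simps)
  then show ?thesis using b(1) unfolding cp0_def c_plus_def v_def[symmetric] e_def[symmetric]
    by (simp add: abs_less_iff divide_less_eq less_divide_eq minus_less_iff)
qed

lemma segment_mvt:
  assumes f: "smooth_upto N f"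
    and seg: "\<And>\<theta>. 0 \<le> \<theta> \<Longrightarrow> \<theta> \<le> 1 \<Longrightarrow> (t2 + \<theta> * (t1 - t2), w2 + \<theta> * (w1 - w2)) \<in> interior N"
  shows "\<exists>\<theta>. 0 \<le> \<theta> \<and> \<theta> \<le> 1 \<and> f (t1, w1) - f (t2, w2) =
    D 1 0 f (t2 + \<theta> * (t1 - t2), w2 + \<theta> * (w1 - w2)) * (t1 - t2) + D 0 1 f (t2 + \<theta> * (t1 - t2), w2 + \<theta> * (w1 - w2)) * (w1 - w2)"
proof -
  define \<gamma> where "\<gamma> \<theta> = (t2 + \<theta> * (t1 - t2), w2 + \<theta> * (w1 - w2))" for \<theta>
  have d: "((\<lambda>\<theta>. f (\<gamma> \<theta>)) has_real_derivative D 1 0 f (\<gamma> \<theta>) * (t1 - t2) + D 0 1 f (\<gamma> \<theta>) * (w1 - w2)) (at \<theta>)"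
    if "0 \<le> \<theta>" "\<theta> \<le> 1" for \<theta>
  proof -
    have g: "(\<gamma> has_derivative (\<lambda>k. (k * (t1 - t2), k * (w1 - w2)))) (at \<theta>)"
      unfolding \<gamma>_def by (auto intro!: derivative_eq_intros)
    have "(f has_derivative (\<lambda>k. D 1 0 f (\<gamma> \<theta>) * fst k + D 0 1 f (\<gamma> \<theta>) * snd k)) (at (\<gamma> \<theta>))"
      using D_deriv(3)[OF f] seg[OF that] by (simp add: \<gamma>_def)
    from has_derivative_compose[OF g this]
    have "((\<lambda>\<theta>. f (\<gamma> \<theta>)) has_derivative (\<lambda>k. D 1 0 f (\<gamma> \<theta>) * (k * (t1 - t2)) + D 0 1 f (\<gamma> \<theta>) * (k * (w1 - w2)))) (at \<theta>)"
      by simp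
    moreover have "(\<lambda>k. D 1 0 f (\<gamma> \<theta>) * (k * (t1 - t2)) + D 0 1 f (\<gamma> \<theta>) * (k * (w1 - w2))) =
        (*) (D 1 0 f (\<gamma> \<theta>) * (t1 - t2) + D 0 1 f (\<gamma> \<theta>) * (w1 - w2))"
      by (rule ext) (simp add: algebra_simps)
    ultimately show ?thesis by (simp only: has_field_derivative_def)
  qed
  have "\<exists>\<theta>>0. \<theta> < 1 \<and> f (\<gamma> 1) - f (\<gamma> 0) = (1 - 0) * (D 1 0 f (\<gamma> \<theta>) * (t1 - t2) + D 0 1 f (\<gamma> \<theta>) * (w1 - w2))"
    by (rule MVT2) (use d in auto)
  then obtain \<theta> where "0 < \<theta>" "\<theta> < 1" "f (\<gamma> 1) - f (\<gamma> 0) = D 1 0 f (\<gamma> \<theta>) * (t1 - t2) + D 0 1 f (\<gamma> \<theta>) * (w1 - w2)"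
    by auto
  then show ?thesis unfolding \<gamma>_def by (intro exI[of _ \<theta>]) simp
qed

end

text \<open>Since z is close to -v for both solutions, the window from -2v to 0 contains the two
  values of z and everything between them.\<close>

lemma eventually_left_scale:
  assumes "\<forall>\<^sub>F w in at_left (0::real). P w"
  shows "\<forall>\<^sub>F v in at_right 0. \<forall>w. - 2 * v \<le> w \<longrightarrow> w < 0 \<longrightarrow> P w"
proof -
  obtain b where b: "b < 0" "\<And>w. b < w \<Longrightarrow> w < 0 \<Longrightarrow> P w"
    using assms by (auto simp: eventually_at_left_field)
  have "0 < - b / 2" using b by simp
  from eventually_at_right_real[OF this] show ?thesis
    by eventually_elim (use b(2) in auto)
qed

lemma strict_deriv_at_right:
  fixes f :: "real \<Rightarrow> real"
  assumes "strict_deriv f (\<lambda>k. c * k) 0 {0..s}" "0 < s" "0 < e"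
  shows "\<forall>\<^sub>F v in at_right 0. \<forall>x\<in>{0..v}. \<forall>y\<in>{0..v}. \<bar>f x - f y - c * (x - y)\<bar> \<le> e * \<bar>x - y\<bar>"
proof -
  obtain d where d: "0 < d" "\<And>y z. y \<in> {0..s} \<Longrightarrow> z \<in> {0..s} \<Longrightarrow> norm (y - 0) < d \<Longrightarrow> norm (z - 0) < d \<Longrightarrow>
    norm (f y - f z - c * (y - z)) \<le> e * norm (y - z)"
    using strict_derivD[OF assms(1,3)] by metis
  have "0 < min s d" using d assms by simp
  from eventually_at_right_real[OF this] show ?thesis
    by eventually_elim (use d(2) in auto)
qed

context cusp_solution
begin

definition "Up v = (af (v, v), bf (v, v))"
definition "Um v = (a (tf (v, v), zf v), b (tf (v, v), zf v))"
text \<open>The speed computed from the two adjacent states, behind (\<open>Up\<close>) and ahead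
  (\<open>Um\<close>), as opposed to the quotient \<open>Vf\<close> computed from the motion. It is
  also meaningful at v = 0; \<open>shock_relations\<close> links it to the motion.\<close>

definition "Vs v = shock_speed (Up v) (Um v)"

lemma zf_0: "zf 0 = 0" using cusp_facts(7)[of 0] eps by simp

lemma Up_0: "Up 0 = U0" and Um_0: "Um 0 = U0"
  unfolding Up_def Um_def by (simp_all only: af_0 sol_facts(14) tf_0 zf_0) (simp add: alpha0_def beta0_def)

text \<open>On the shock f has derivative 0 at v = 0 and z has derivative \<open>y0\<close> = -1, so
  \<alpha> ahead moves with the rate opposite to that behind, while \<beta> is stationary because
  its w-derivative vanishes at the cusp point.\<close>

lemma minus_strict: "\<exists>s>0. s < eps \<and> strict_deriv (\<lambda>v. a (tf (v, v), zf v)) (\<lambda>k. - aw0 * k) 0 {0..s} \<and>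
    strict_deriv (\<lambda>v. b (tf (v, v), zf v)) (\<lambda>k. 0 * k) 0 {0..s}"
proof -
  obtain s1 where s1: "0 < s1" "\<And>v. 0 < v \<Longrightarrow> v < s1 \<Longrightarrow> 0 < tf (v, v) \<and> tf (v, v) < \<tau> (zf v) \<and> zf v < 0"
    using shock_region by (auto simp: eventually_at_right_field)
  define s where "s = min s1 eps / 2"
  have s: "0 < s" "s < s1" "s < eps" using s1(1) eps by (auto simp: s_def)
  have tf_nn: "0 \<le> tf (v, v)" if "v \<in> {0..s}" for v
    using s1(2)[of v] s that tf_0 by (cases "v = 0") auto
  have inN: "(tf (v, v), zf v) \<in> N" if "v \<in> {0..s}" for v using sol_facts(15)[of v] that s by auto
  obtain K where K: "continuous_on {0..eps} K" "\<And>v. v \<in> {0..eps} \<Longrightarrow> (yf has_real_derivative K v) (at v within {0..eps})"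
    "continuous_on {0..eps} yf"
    using C1_interval_props[OF cusp_facts(1)] by metis
  have zd: "(zf has_real_derivative yf v + v * K v) (at v within {0..s})" if v: "v \<in> {0..s}" for v
  proof -
    have "((\<lambda>v. v * yf v) has_real_derivative yf v + v * K v) (at v within {0..eps})"
      using K(2)[of v] v s by (auto intro!: derivative_eq_intros)
    then have "((\<lambda>v. v * yf v) has_real_derivative yf v + v * K v) (at v within {0..s})"
      by (rule DERIV_subset) (use s in auto)
    then show ?thesis
      by (rule has_field_derivative_transform_within[where d = 1]) (use v s cusp_facts(7) in auto)
  qed
  have td: "((\<lambda>v. tf (v, v)) has_real_derivative ft v) (at v within {0..s})" if v: "v \<in> {0..s}" for v
    unfolding ft_def by (rule T_diag[OF eps sol_facts(1) s(3) v])
  have cft: "continuous_on {0..s} ft"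
    unfolding ft_def using s
    by (intro continuous_intros continuous_on_compose2[OF T_cont(2)[OF sol_facts(1)]]
        continuous_on_compose2[OF T_cont(3)[OF sol_facts(1)]]) (auto simp: T_dom_def)
  have cz: "continuous_on {0..s} (\<lambda>v. yf v + v * K v)"
    using s by (intro continuous_intros continuous_on_subset[OF K(1)] continuous_on_subset[OF K(3)]) auto
  have main: "strict_deriv (\<lambda>v. f (tf (v, v), zf v))
      (\<lambda>k. (D 1 0 f (tf (0, 0), zf 0) * ft 0 + D 0 1 f (tf (0, 0), zf 0) * (yf 0 + 0 * K 0)) * k) 0 {0..s}"
    if f: "smooth_upto N f" for f
  proof (rule strict_deriv_along_boundary[where S = N and ?e1.0 = "-1" and ?e2.0 = 0 and ?\<delta>0.0 = W and ?\<gamma>1.0 = "\<lambda>v. tf (v, v)"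
        and ?\<gamma>2.0 = zf and ?g1.0 = ft and ?g2.0 = "\<lambda>v. yf v + v * K v"])
    show "\<And>x. x \<in> interior N \<Longrightarrow> (f has_derivative (\<lambda>h. D 1 0 f x * fst h + D 0 1 f x * snd h)) (at x)"
      using D_deriv(3)[OF f] by auto
    show "continuous (at 0 within {0..s}) ft" "continuous (at 0 within {0..s}) (\<lambda>v. yf v + v * K v)"
      using cft cz s(1) unfolding continuous_on_eq_continuous_within by auto
    fix v \<delta> :: real assume v: "v \<in> {0..s}" "0 < \<delta>" "\<delta> < W"
    show "(tf (v, v) + \<delta> * - 1, zf v + \<delta> * 0) \<in> interior N"
      using shift_N[OF inN[OF v(1)] v(2)] v(3) tf_nn[OF v(1)] by simp
  qed (use s inN td zd ahead(1) f_cont[OF f] D_cont[OF f] in auto)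
  have 0: "ft 0 = 0" "yf 0 = -1" using derivs_0 y0_eq by (simp_all add: ft_def y0_def)
  have "strict_deriv (\<lambda>v. a (tf (v, v), zf v)) (\<lambda>k. - aw0 * k) 0 {0..s}"
    by (rule strict_deriv_eq_deriv[OF main[OF ahead(2)]]) (simp add: 0 tf_0 zf_0)
  moreover have "strict_deriv (\<lambda>v. b (tf (v, v), zf v)) (\<lambda>k. 0 * k) 0 {0..s}"
    by (rule strict_deriv_eq_deriv[OF main[OF ahead(3)]]) (use bw0 in \<open>simp add: 0 tf_0 zf_0\<close>)
  ultimately show ?thesis using s by blast
qed

lemma shock_states_strict: "\<exists>s>0. s < eps \<and> strict_deriv (\<lambda>v. af (v, v)) (\<lambda>k. aw0 * k) 0 {0..s} \<and>
    strict_deriv (\<lambda>v. bf (v, v)) (\<lambda>k. 0 * k) 0 {0..s} \<and>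
    strict_deriv (\<lambda>v. a (tf (v, v), zf v)) (\<lambda>k. - aw0 * k) 0 {0..s} \<and>
    strict_deriv (\<lambda>v. b (tf (v, v), zf v)) (\<lambda>k. 0 * k) 0 {0..s}"
proof -
  obtain s1 where s1: "0 < s1" "s1 < eps" "strict_deriv (\<lambda>v. af (v, v)) (\<lambda>k. aw0 * k) 0 {0..s1}"
    using alpha_plus_strict by blast
  obtain s2 where s2: "0 < s2" "s2 < eps" "strict_deriv (\<lambda>v. a (tf (v, v), zf v)) (\<lambda>k. - aw0 * k) 0 {0..s2}"
    "strict_deriv (\<lambda>v. b (tf (v, v), zf v)) (\<lambda>k. 0 * k) 0 {0..s2}"
    using minus_strict by blast
  define s where "s = min s1 s2"
  have s: "0 < s" "s < eps" "{0..s} \<subseteq> {0..s1}" "{0..s} \<subseteq> {0..s2}" using s1 s2 by (auto simp: s_def)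
  have "strict_deriv (\<lambda>v. bf (v, v)) (\<lambda>k. 0 * k) 0 {0..s}" using beta_plus_strict[OF s(2)] by simp
  then show ?thesis using s strict_deriv_mono[OF s1(3) s(3)] strict_deriv_mono[OF s2(3) s(4)] strict_deriv_mono[OF s2(4) s(4)]
    by blast
qed

text \<open>To first order the two states move in opposite directions from the cusp state. The
  derivative of \<open>shock_speed\<close> depends on the sum of the two variations, which is zero.
  Hence V - \<open>cp0\<close> is o(v), whereas \<open>c_plus\<close> behind the shock exceeds
  \<open>cp0\<close> by about \<kappa> v.\<close>

lemma Vs_strict: "\<exists>s>0. s < eps \<and> strict_deriv Vs (\<lambda>k. 0 * k) 0 {0..s}"
proof -
  obtain s where s: "0 < s" "s < eps" and st: "strict_deriv (\<lambda>v. af (v, v)) (\<lambda>k. aw0 * k) 0 {0..s}"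
    "strict_deriv (\<lambda>v. bf (v, v)) (\<lambda>k. 0 * k) 0 {0..s}"
    "strict_deriv (\<lambda>v. a (tf (v, v), zf v)) (\<lambda>k. - aw0 * k) 0 {0..s}"
    "strict_deriv (\<lambda>v. b (tf (v, v), zf v)) (\<lambda>k. 0 * k) 0 {0..s}"
    using shock_states_strict by blast
  have UU: "strict_deriv (\<lambda>v. (Up v, Um v)) (\<lambda>k. ((aw0 * k, 0 * k), (- aw0 * k, 0 * k))) 0 {0..s}"
    unfolding Up_def Um_def by (intro strict_deriv_Pair st)
  have "strict_deriv (\<lambda>v. shock_speed (fst (Up v, Um v)) (snd (Up v, Um v)))
      (\<lambda>k. Dc (fst ((aw0 * k, 0 * k), (- aw0 * k, 0 * k)) + snd ((aw0 * k, 0 * k), (- aw0 * k, 0 * k))) / 2) 0 {0..s}"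
    by (rule strict_deriv_compose[OF _ UU])
      (use strict_deriv_shock_speed[OF U0_J Dc] s in \<open>simp_all only: Up_0 Um_0 atLeastAtMost_iff less_imp_le order_refl simp_thms\<close>)
  then have "strict_deriv Vs (\<lambda>k. Dc (fst ((aw0 * k, 0 * k), (- aw0 * k, 0 * k)) + snd ((aw0 * k, 0 * k), (- aw0 * k, 0 * k))) / 2) 0 {0..s}"
    by (simp only: Vs_def[abs_def] fst_conv snd_conv)
  then have "strict_deriv Vs (\<lambda>k. 0 * k) 0 {0..s}"
    by (rule strict_deriv_eq_deriv) (subst Dc_eq, simp)
  then show ?thesis using s by blast
qed

lemma Vs_0: "Vs 0 = cp0"
  unfolding Vs_def Up_0 Um_0 shock_speed_same[OF U0_J] by (simp add: cp0_def)

lemma Vs_lipschitz: "0 < e \<Longrightarrow> \<forall>\<^sub>F s in at_right 0. \<forall>x\<in>{0..s}. \<forall>y\<in>{0..s}. \<bar>Vs x - Vs y\<bar> \<le> e * \<bar>x - y\<bar>"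
  using Vs_strict strict_deriv_at_right[of Vs 0] by fastforce

lemma speed_gap: "\<forall>\<^sub>F v in at_right 0. 9 / 10 * \<kappa> * v \<le> cpT (v, v) - Vs v"
proof -
  have "((\<lambda>v. (Vs v - cp0) / v) \<longlongrightarrow> 0) (at_right 0)"
    using Vs_strict strict_deriv_quotient[of Vs 0] Vs_0 by fastforce
  from tendsto_diff[OF cpT_diag_asym this]
  have "((\<lambda>v. (cpT (v, v) - cp0) / v - (Vs v - cp0) / v) \<longlongrightarrow> \<kappa>) (at_right 0)" by simp
  moreover have "9 / 10 * \<kappa> < \<kappa>" using ahead(11) by simp
  ultimately have "\<forall>\<^sub>F v in at_right 0. 9 / 10 * \<kappa> < (cpT (v, v) - cp0) / v - (Vs v - cp0) / v"
    by (rule order_tendstoD(1))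
  then show ?thesis using eventually_at_right_less[of 0]
  proof eventually_elim
    case (elim v)
    have "(cpT (v, v) - cp0) / v - (Vs v - cp0) / v = (cpT (v, v) - Vs v) / v"
      by (simp add: diff_divide_distrib[symmetric])
    then show ?case using elim by (simp add: less_divide_eq)
  qed
qed

lemma states_bound: "\<exists>C>0. \<forall>\<^sub>F v in at_right 0. norm (Up v - U0) \<le> C * v \<and> norm (Um v - U0) \<le> C * v"
proof -
  obtain s where s: "0 < s" and st: "strict_deriv (\<lambda>v. af (v, v)) (\<lambda>k. aw0 * k) 0 {0..s}"
    "strict_deriv (\<lambda>v. bf (v, v)) (\<lambda>k. 0 * k) 0 {0..s}"
    "strict_deriv (\<lambda>v. a (tf (v, v), zf v)) (\<lambda>k. - aw0 * k) 0 {0..s}"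
    "strict_deriv (\<lambda>v. b (tf (v, v), zf v)) (\<lambda>k. 0 * k) 0 {0..s}"
    using shock_states_strict by blast
  have "strict_deriv (\<lambda>v. (Up v, Um v)) (\<lambda>k. ((aw0 * k, 0 * k), (- aw0 * k, 0 * k))) 0 {0..s}"
    unfolding Up_def Um_def by (intro strict_deriv_Pair st)
  then obtain d L where dL: "0 < d" "0 < L" "\<And>y z. y \<in> {0..s} \<Longrightarrow> z \<in> {0..s} \<Longrightarrow> norm (y - 0) < d \<Longrightarrow> norm (z - 0) < d \<Longrightarrow>
      norm ((Up y, Um y) - (Up z, Um z)) \<le> L * norm (y - z)"
    by (rule strict_deriv_lipschitz) metis
  have "0 < min s d" using s dL by simp
  from eventually_at_right_real[OF this]
  have "\<forall>\<^sub>F v in at_right 0. norm (Up v - U0) \<le> L * v \<and> norm (Um v - U0) \<le> L * v"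
  proof eventually_elim
    case (elim v)
    then have "norm (Up v - U0, Um v - U0) \<le> L * v"
      using dL(3)[of v 0] s dL(1) by (simp add: Up_0 Um_0)
    then show ?case using norm_fst_le[of "Up v - U0" "Um v - U0"] norm_snd_le[of "Um v - U0" "Up v - U0"] by simp
  qed
  then show ?thesis using dL(2) by blast
qed

lemma Vf_tendsto: "(Vf \<longlongrightarrow> cp0) (at_right 0)"
proof -
  have "((\<lambda>v. cp0 + \<kappa> / 2 * (1 + yf v) * v + v\<^sup>2 * Vh v) \<longlongrightarrow> cp0 + \<kappa> / 2 * (1 + y0) * 0 + 0\<^sup>2 * Vh 0) (at_right 0)"
    by (intro tendsto_intros yf_tendsto Icc_tendsto_right[OF cusp_facts(6) eps])
  moreover have "\<forall>\<^sub>F v in at_right 0. cp0 + \<kappa> / 2 * (1 + yf v) * v + v\<^sup>2 * Vh v = Vf v"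
    using small_range by eventually_elim (simp add: cusp_facts(13) Vf_def)
  ultimately have "(Vf \<longlongrightarrow> cp0 + \<kappa> / 2 * (1 + y0) * 0 + 0\<^sup>2 * Vh 0) (at_right 0)"
    by (rule Lim_transform_eventually)
  then show ?thesis by simp
qed

text \<open>What remains for \<open>jump_conditions\<close> is to check |V| < 1 and the sign
  hypothesis. The jump of \<alpha> is close to 2 \<open>aw0\<close> v and dominates that of \<beta>,
  which makes the jumps of \<alpha> + \<beta> and of \<alpha> - \<beta> have equal signs.\<close>

lemma shock_relations: "\<forall>\<^sub>F v in at_right 0. gt v = Vs v * ft v \<and>
    sinh ((fst (Up v) - snd (Up v) - (fst (Um v) - snd (Um v))) / 2) = (mean (Up v) - mean (Um v)) * K_jump (Up v) (Um v)"
proof -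
  obtain s where s: "0 < s" and st: "strict_deriv (\<lambda>v. af (v, v)) (\<lambda>k. aw0 * k) 0 {0..s}"
    "strict_deriv (\<lambda>v. bf (v, v)) (\<lambda>k. 0 * k) 0 {0..s}"
    "strict_deriv (\<lambda>v. a (tf (v, v), zf v)) (\<lambda>k. - aw0 * k) 0 {0..s}"
    "strict_deriv (\<lambda>v. b (tf (v, v), zf v)) (\<lambda>k. 0 * k) 0 {0..s}"
    using shock_states_strict by blast
  have "0 < \<bar>aw0\<bar> / 4" using aw0_nonzero by simp
  note ev = strict_deriv_at_right[OF st(1) s this] strict_deriv_at_right[OF st(2) s this]
    strict_deriv_at_right[OF st(3) s this] strict_deriv_at_right[OF st(4) s this]
  have "\<forall>\<^sub>F v in at_right 0. \<bar>Vf v\<bar> < 1"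
    by (rule order_tendstoD(2)[OF tendsto_rabs[OF Vf_tendsto] char_speed_bound])
  then show ?thesis using ev small_range
  proof eventually_elim
    case (elim v)
    then have v: "0 < v" "v < eps" "v \<in> {0..eps}" by auto
    have e0: "0 \<in> {0..v}" "v \<in> {0..v}" using v by auto
    define c where "c = \<bar>aw0\<bar> * v"
    have c: "0 < c" using v aw0_nonzero by (simp add: c_def)
    have q: "\<bar>aw0\<bar> / 4 * \<bar>v - 0\<bar> = c / 4" using v by (simp add: c_def)
    have b1: "\<bar>fst (Up v) - alpha0 A - aw0 * v\<bar> \<le> c / 4"
      using elim(2)[rule_format, OF e0(2,1)] q Up_0 by (simp add: Up_def)
    have b2: "\<bar>snd (Up v) - beta0 A\<bar> \<le> c / 4"
      using elim(3)[rule_format, OF e0(2,1)] q Up_0 by (simp add: Up_def)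
    have b3: "\<bar>fst (Um v) - alpha0 A + aw0 * v\<bar> \<le> c / 4"
      using elim(4)[rule_format, OF e0(2,1)] q Um_0 by (simp add: Um_def)
    have b4: "\<bar>snd (Um v) - beta0 A\<bar> \<le> c / 4"
      using elim(5)[rule_format, OF e0(2,1)] q Um_0 by (simp add: Um_def)
    define al be where "al = fst (Up v) - fst (Um v)" and "be = snd (Up v) - snd (Um v)"
    have "\<bar>al - 2 * (aw0 * v)\<bar> \<le> c / 2" using b1 b3 unfolding al_def by linarith
    moreover have "\<bar>aw0 * v\<bar> = c" using v by (simp add: c_def abs_mult)
    ultimately have al: "c < \<bar>al\<bar>" using c by linarith
    have be: "\<bar>be\<bar> \<le> c / 2" using b2 b4 unfolding be_def by linarith
    have "\<bar>be\<bar> < \<bar>al\<bar>" using al be c by linarith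
    then have "be\<^sup>2 < al\<^sup>2" using power_strict_mono[of "\<bar>be\<bar>" "\<bar>al\<bar>" 2] by simp
    \<comment> \<open>The two factors are half the sum and the difference of the jumps
      \<open>al\<close> and \<open>be\<close>.\<close>
    moreover have "(mean (Up v) - mean (Um v)) * (fst (Up v) - snd (Up v) - (fst (Um v) - snd (Um v))) = (al\<^sup>2 - be\<^sup>2) / 2"
      by (simp add: al_def be_def power2_eq_square field_simps)
    ultimately have sgn: "0 < (mean (Up v) - mean (Um v)) * (fst (Up v) - snd (Up v) - (fst (Um v) - snd (Um v)))" by simp
    have J: "mean (Up v) \<in> J" "mean (Um v) \<in> J"
    proof -
      have "(v, v) \<in> TE" using v by (simp add: T_dom_def)
      from sol_facts(5)[OF this] show "mean (Up v) \<in> J" by (simp add: Up_def admissible_def)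
      from ahead(5)[OF sol_facts(15)[OF v(3)]] show "mean (Um v) \<in> J" by (simp add: Um_def admissible_def)
    qed
    obtain V where V: "diag_deriv eps tf v * V = diag_deriv eps rf v"
      "jump (T_tt F) A tf af bf zf v * V = jump (T_tr F) A tf af bf zf v"
      "jump (T_tr F) A tf af bf zf v * V = jump (T_rr F) A tf af bf zf v"
      using sol_facts(17)[OF v(3)] by blast
    have VV: "V = Vf v"
      using V(1) cusp_facts(12)[of v] v unfolding Vf_def by (simp add: field_simps)
    have j: "jump T A tf af bf zf v = T (fst (Up v)) (snd (Up v)) - T (fst (Um v)) (snd (Um v))" for T
      by (simp add: jump_def Up_def Um_def)
    note jc = jump_conditions[OF J V(2,3)[unfolded j] _ sgn]
    have "\<bar>V\<bar> < 1" using VV elim(1) by simp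
    note jc = jc[OF this]
    have "gt v = Vs v * ft v" using gt_eq(1)[OF v(1,2)] VV jc(1) by (simp add: Vs_def)
    then show ?case using jc(2) by blast
  qed
qed

lemma ft_bound: "\<forall>\<^sub>F v in at_right 0. \<bar>ft v\<bar> \<le> 35 / 100 * \<Lambda> / \<kappa>\<^sup>2 * v"
proof -
  \<comment> \<open>The limit of \<open>ft v / v\<close> is 2 \<open>f0\<close>, that is 1/3 of
    \<Lambda> / \<kappa>^2; the constant 35/100 leaves a small margin.\<close>
  have "2 * f0 < 35 / 100 * \<Lambda> / \<kappa>\<^sup>2" unfolding f0_val using ahead by (simp add: field_simps)
  then have "\<bar>2 * f0\<bar> < 35 / 100 * \<Lambda> / \<kappa>\<^sup>2" using f0_pos by simp
  from order_tendstoD(2)[OF tendsto_rabs[OF ft_asym] this] eventually_at_right_less[of 0]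
  show ?thesis by eventually_elim (simp add: divide_less_eq abs_divide)
qed

end

section \<open>Two solutions\<close>

locale two_cusp_solutions = ahead_state F A +
  S1: cusp_solution F A eps tf1 rf1 af1 bf1 zf1 yf1 fh1 gh1 ah1 bh1 Vh1 +
  S2: cusp_solution F A eps tf2 rf2 af2 bf2 zf2 yf2 fh2 gh2 ah2 bh2 Vh2
  for F A eps tf1 rf1 af1 bf1 zf1 yf1 fh1 gh1 ah1 bh1 Vh1 tf2 rf2 af2 bf2 zf2 yf2 fh2 gh2 ah2 bh2 Vh2
begin

definition "dt x = tf1 x - tf2 x"
definition "dr x = rf1 x - rf2 x"
definition "da x = af1 x - af2 x"
definition "db x = bf1 x - bf2 x"
definition "dz v = zf1 v - zf2 v"
definition "dam v = a (tf1 (v, v), zf1 v) - a (tf2 (v, v), zf2 v)"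
definition "dbm v = b (tf1 (v, v), zf1 v) - b (tf2 (v, v), zf2 v)"
text \<open>Both combinations take the speed of the first solution, matching the role of
  \<open>c1\<close> in \<open>transport_bound\<close>: \<open>Rd\<close> is propagated in v,
  \<open>Pd\<close> in u.\<close>

definition "Rd x = dr x - S1.cpT x * dt x"
definition "Pd x = dr x - S1.cmT x * dt x"
text \<open>The bound \<open>n\<close> is common to all four unknowns, so that one number can be
  absorbed at the end of \<open>interior_bound\<close>.\<close>

definition "hyp s n \<longleftrightarrow> (\<forall>x\<in>T_dom s. \<bar>dt x\<bar> \<le> n \<and> \<bar>dr x\<bar> \<le> n \<and> \<bar>da x\<bar> \<le> n \<and> \<bar>db x\<bar> \<le> n)"

lemmas S_def = dt_def dr_def da_def db_def dz_def dam_def dbm_def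

lemma hyp_mono: "hyp s n \<Longrightarrow> v \<le> s \<Longrightarrow> hyp v n"
  unfolding hyp_def by (force simp: T_dom_def)

lemma d_0: "dt (0, 0) = 0" "dr (0, 0) = 0" "da (0, 0) = 0" "db (0, 0) = 0"
  by (simp_all only: S_def S1.tf_0 S2.tf_0 S1.af_0 S2.af_0 S1.sol_facts(13,14) S2.sol_facts(13,14) diff_self)

lemma G_diff:
  fixes G :: "(real \<times> real) \<times> real \<Rightarrow> real"
  assumes G: "strict_diff G ((alpha0 A, beta0 A), r0 A) UNIV"
  shows "\<exists>L>0. \<forall>\<^sub>F s in at_right 0. \<forall>n. hyp s n \<longrightarrow> (\<forall>x\<in>T_dom s. \<bar>G (S1.Q x) - G (S2.Q x)\<bar> \<le> L * n)"
proof -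
  obtain d L where dL: "0 < d" "0 < L" "\<And>y z. norm (y - ((alpha0 A, beta0 A), r0 A)) < d \<Longrightarrow> norm (z - ((alpha0 A, beta0 A), r0 A)) < d \<Longrightarrow> norm (G y - G z) \<le> L * norm (y - z)"
    using strict_diff_lipschitz[OF G] by (metis UNIV_I)
  have "\<forall>\<^sub>F s in at_right 0. \<forall>n. hyp s n \<longrightarrow> (\<forall>x\<in>T_dom s. \<bar>G (S1.Q x) - G (S2.Q x)\<bar> \<le> (3 * L) * n)"
    using S1.Q_near[OF dL(1)] S2.Q_near[OF dL(1)]
  proof eventually_elim
    case (elim s)
    show ?case
    proof (intro allI impI ballI)
      fix n x assume n: "hyp s n" and x: "x \<in> T_dom s"
      have "norm (S1.Q x - S2.Q x) \<le> norm (da x, db x) + \<bar>dr x\<bar>"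
        unfolding S1.Q_def S2.Q_def S_def using norm_Pair_le[of "(af1 x - af2 x, bf1 x - bf2 x)" "rf1 x - rf2 x"] by simp
      also have "\<dots> \<le> \<bar>da x\<bar> + \<bar>db x\<bar> + \<bar>dr x\<bar>" using norm_Pair_le[of "da x" "db x"] by simp
      also have "\<dots> \<le> 3 * n" using n x unfolding hyp_def by fastforce
      finally have "L * norm (S1.Q x - S2.Q x) \<le> L * (3 * n)" using dL(2) by (intro mult_left_mono) auto
      moreover have "\<bar>G (S1.Q x) - G (S2.Q x)\<bar> \<le> L * norm (S1.Q x - S2.Q x)" using dL(3) elim x by auto
      ultimately show "\<bar>G (S1.Q x) - G (S2.Q x)\<bar> \<le> (3 * L) * n" by simp
    qed
  qed
  then show ?thesis using dL(2) by (intro exI[of _ "3 * L"]) simp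
qed

lemmas G_diff' = G_diff[unfolded S1.Q_def S2.Q_def]
lemmas cpT_diff = G_diff'[OF S1.strict_diff_G(1), unfolded fst_conv snd_conv, folded S1.cpT_def S2.cpT_def]
lemmas cmT_diff = G_diff'[OF S1.strict_diff_G(2), unfolded fst_conv snd_conv, folded S1.cmT_def S2.cmT_def]
lemmas AT_diff = G_diff'[OF S1.strict_diff_G(3), unfolded fst_conv snd_conv, folded S1.AT_def S2.AT_def]
lemmas BT_diff = G_diff'[OF S1.strict_diff_G(4), unfolded fst_conv snd_conv, folded S1.BT_def S2.BT_def]

text \<open>The combination is followed from the corner along the edge v = 0 and then upwards in v.
  On the edge both solutions have t = h, so \<Delta>t vanishes there and the Lipschitz constant in
  u, which is not small, multiplies zero. All other factors are small: the derivatives of t near the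
  corner and the variation of \<open>cpT\<close> in v.\<close>

lemma Rd_small:
  assumes e: "0 < e"
  shows "\<forall>\<^sub>F s in at_right 0. \<forall>n. hyp s n \<longrightarrow> (\<forall>u v. (u, v) \<in> T_dom s \<longrightarrow> \<bar>Rd (u, v)\<bar> \<le> e * n * u)"
proof -
  obtain L1 where L1: "0 < L1" "\<forall>\<^sub>F s in at_right 0. \<forall>n. hyp s n \<longrightarrow> (\<forall>x\<in>T_dom s. \<bar>S1.cpT x - S2.cpT x\<bar> \<le> L1 * n)"
    using cpT_diff by blast
  obtain L2 where L2: "0 < L2" "\<forall>\<^sub>F s in at_right 0. \<forall>n. hyp s n \<longrightarrow> (\<forall>x\<in>T_dom s. \<bar>S1.cmT x - S2.cmT x\<bar> \<le> L2 * n)"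
    using cmT_diff by blast
  obtain M where M: "0 < M" "\<forall>\<^sub>F s in at_right 0. \<forall>u u' v. (u, v) \<in> T_dom s \<longrightarrow> (u', v) \<in> T_dom s \<longrightarrow> \<bar>S1.cmT (u, v) - S1.cmT (u', v)\<bar> \<le> M * \<bar>u - u'\<bar>"
    using S1.cmT_u by blast
  define e1 where "e1 = e / (L1 + L2 + 1)"
  have e1: "0 < e1" "(L1 + L2 + 1) * e1 = e" using e L1(1) L2(1) by (auto simp: e1_def)
  show ?thesis
    using L1(2) L2(2) M(2) S1.cpT_v[OF e1(1)] T_small[OF S1.eps S2.T_cont(2)[OF S2.sol_facts(1)] e1(1)]
      T_small[OF S1.eps S2.T_cont(3)[OF S2.sol_facts(1)] e1(1)] eventually_at_right_real[OF S1.eps]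
  proof eventually_elim
    case (elim s)
    show ?case
    proof (intro allI impI)
      fix n u v assume n: "hyp s n" and uv: "(u, v) \<in> T_dom s"
      have uv': "0 \<le> v" "v \<le> u" "u \<le> s" "u < eps" using uv elim by (auto simp: T_dom_def)
      have "(0, 0) \<in> T_dom s" using elim by (simp add: T_dom_def)
      then have n0: "0 \<le> n" using n unfolding hyp_def by force
      have seg: "(x, 0) \<in> T_dom s" "(x, 0) \<in> T_dom eps" if "x \<in> {0..u}" for x using that uv' by (auto simp: T_dom_def)
      have seg2: "(u, x) \<in> T_dom s" "(u, x) \<in> T_dom eps" if "x \<in> {0..v}" for x using that uv' by (auto simp: T_dom_def)
      have edge: "tf1 (x, 0) = tf2 (x, 0)" if "x \<in> {0..u}" for x
        using S1.sol_facts(11)[of x] S2.sol_facts(11)[of x] that uv' by simp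
      have "\<bar>(rf1 (u, 0) - rf2 (u, 0) - S1.cmT (u, 0) * (tf1 (u, 0) - tf2 (u, 0))) -
          (rf1 (0, 0) - rf2 (0, 0) - S1.cmT (0, 0) * (tf1 (0, 0) - tf2 (0, 0)))\<bar> \<le> L2 * n * e1 * u - L2 * n * e1 * 0"
      proof (rule transport_bound[where ?x1.0 = "\<lambda>x. rf1 (x, 0)" and ?x2.0 = "\<lambda>x. rf2 (x, 0)" and ?t1.0 = "\<lambda>x. tf1 (x, 0)" and ?t2.0 = "\<lambda>x. tf2 (x, 0)"
          and ?c1.0 = "\<lambda>x. S1.cmT (x, 0)" and ?c2.0 = "\<lambda>x. S2.cmT (x, 0)" and t1' = "\<lambda>x. S1.Du tf1 (x, 0)" and t2' = "\<lambda>x. S2.Du tf2 (x, 0)" and L = M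
          and G = "\<lambda>x. L2 * n * e1 * x" and G' = "\<lambda>x. L2 * n * e1"])
        fix x assume x: "x \<in> {0..u}"
        show "((\<lambda>x. tf1 (x, 0)) has_real_derivative S1.Du tf1 (x, 0)) (at x within {0..u})"
          by (rule T_u[OF S1.eps S1.sol_facts(1) uv'(4) _ x]) simp
        show "((\<lambda>x. tf2 (x, 0)) has_real_derivative S2.Du tf2 (x, 0)) (at x within {0..u})"
          by (rule T_u[OF S1.eps S2.sol_facts(1) uv'(4) _ x]) simp
        show "((\<lambda>x. rf1 (x, 0)) has_real_derivative S1.cmT (x, 0) * S1.Du tf1 (x, 0)) (at x within {0..u})"
          using T_u[OF S1.eps S1.sol_facts(2) uv'(4) _ x] S1.sol_facts(9)[OF seg(2)[OF x]] by (simp add: mult.commute)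
        show "((\<lambda>x. rf2 (x, 0)) has_real_derivative S2.cmT (x, 0) * S2.Du tf2 (x, 0)) (at x within {0..u})"
          using T_u[OF S1.eps S2.sol_facts(2) uv'(4) _ x] S2.sol_facts(9)[OF seg(2)[OF x]] by (simp add: mult.commute)
        have "\<bar>S2.Du tf2 (x, 0)\<bar> < e1" using elim(5) seg(1)[OF x] S2.derivs_0(1) by auto
        then show "\<bar>S1.cmT (x, 0) - S2.cmT (x, 0)\<bar> * \<bar>S2.Du tf2 (x, 0)\<bar> + M * \<bar>tf1 (x, 0) - tf2 (x, 0)\<bar> \<le> L2 * n * e1"
          using elim(2) n seg(1)[OF x] edge[OF x] L2(1) n0 by (auto intro!: mult_mono)
      next
        fix x x' assume "x \<in> {0..u}" "x' \<in> {0..u}"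
        then show "\<bar>S1.cmT (x', 0) - S1.cmT (x, 0)\<bar> \<le> M * \<bar>x' - x\<bar>" using elim(3) seg(1) by blast
      qed (use uv' in \<open>auto intro!: derivative_eq_intros\<close>)
      then have 1: "\<bar>Rd (u, 0)\<bar> \<le> L2 * e1 * n * u"
        using edge[of u] edge[of 0] uv' d_0(2) by (simp add: Rd_def S_def mult_ac)
      have "\<bar>(rf1 (u, v) - rf2 (u, v) - S1.cpT (u, v) * (tf1 (u, v) - tf2 (u, v))) -
          (rf1 (u, 0) - rf2 (u, 0) - S1.cpT (u, 0) * (tf1 (u, 0) - tf2 (u, 0)))\<bar> \<le> (L1 * n * e1 + e1 * n) * v - (L1 * n * e1 + e1 * n) * 0"
      proof (rule transport_bound[where ?x1.0 = "\<lambda>x. rf1 (u, x)" and ?x2.0 = "\<lambda>x. rf2 (u, x)" and ?t1.0 = "\<lambda>x. tf1 (u, x)" and ?t2.0 = "\<lambda>x. tf2 (u, x)"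
          and ?c1.0 = "\<lambda>x. S1.cpT (u, x)" and ?c2.0 = "\<lambda>x. S2.cpT (u, x)" and t1' = "\<lambda>x. S1.Dv tf1 (u, x)" and t2' = "\<lambda>x. S2.Dv tf2 (u, x)" and L = e1
          and G = "\<lambda>x. (L1 * n * e1 + e1 * n) * x" and G' = "\<lambda>x. L1 * n * e1 + e1 * n"])
        fix x assume x: "x \<in> {0..v}"
        note tv = T_v_sub[OF S1.eps _ uv'(4) x uv'(2)]
        show "((\<lambda>x. tf1 (u, x)) has_real_derivative S1.Dv tf1 (u, x)) (at x within {0..v})" by (rule tv[OF S1.sol_facts(1)])
        show "((\<lambda>x. tf2 (u, x)) has_real_derivative S2.Dv tf2 (u, x)) (at x within {0..v})" by (rule tv[OF S2.sol_facts(1)])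
        show "((\<lambda>x. rf1 (u, x)) has_real_derivative S1.cpT (u, x) * S1.Dv tf1 (u, x)) (at x within {0..v})"
          using tv[OF S1.sol_facts(2)] S1.sol_facts(8)[OF seg2(2)[OF x]] by (simp add: mult.commute)
        show "((\<lambda>x. rf2 (u, x)) has_real_derivative S2.cpT (u, x) * S2.Dv tf2 (u, x)) (at x within {0..v})"
          using tv[OF S2.sol_facts(2)] S2.sol_facts(8)[OF seg2(2)[OF x]] by (simp add: mult.commute)
        have "\<bar>S2.Dv tf2 (u, x)\<bar> < e1" using elim(6) seg2(1)[OF x] S2.derivs_0(2) by auto
        moreover have "\<bar>tf1 (u, x) - tf2 (u, x)\<bar> \<le> n" using n seg2(1)[OF x] unfolding hyp_def dt_def by blast
        moreover have "\<bar>S1.cpT (u, x) - S2.cpT (u, x)\<bar> \<le> L1 * n" using elim(1) n seg2(1)[OF x] by blast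
        ultimately show "\<bar>S1.cpT (u, x) - S2.cpT (u, x)\<bar> * \<bar>S2.Dv tf2 (u, x)\<bar> + e1 * \<bar>tf1 (u, x) - tf2 (u, x)\<bar> \<le> L1 * n * e1 + e1 * n"
          using e1(1) L1(1) n0 by (intro add_mono mult_mono) auto
      next
        fix x x' assume "x \<in> {0..v}" "x' \<in> {0..v}"
        then show "\<bar>S1.cpT (u, x') - S1.cpT (u, x)\<bar> \<le> e1 * \<bar>x' - x\<bar>" using elim(4) seg2(1) by blast
      qed (use uv' in \<open>auto intro!: derivative_eq_intros\<close>)
      then have "\<bar>Rd (u, v) - Rd (u, 0)\<bar> \<le> (L1 * n * e1 + e1 * n) * v"
        by (simp add: Rd_def S_def)
      also have "\<dots> \<le> (L1 * n * e1 + e1 * n) * u" using uv' e1(1) L1(1) n0 by (intro mult_left_mono) auto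
      finally have 2: "\<bar>Rd (u, v) - Rd (u, 0)\<bar> \<le> (L1 * n * e1 + e1 * n) * u" .
      have "L2 * e1 * n * u + (L1 * n * e1 + e1 * n) * u = ((L1 + L2 + 1) * e1) * n * u" by (simp add: algebra_simps)
      then show "\<bar>Rd (u, v)\<bar> \<le> e * n * u" using 1 2 unfolding e1(2) by linarith
    qed
  qed
qed

subsection \<open>The states on the two sides of the shock\<close>

lemma coeffs_eq: "S1.f0 = \<Lambda> / (6 * \<kappa>\<^sup>2)" "S2.f0 = \<Lambda> / (6 * \<kappa>\<^sup>2)"
  by (rule S1.f0_val S2.f0_val)+

definition "tseg v \<theta> = tf2 (v, v) + \<theta> * (tf1 (v, v) - tf2 (v, v))"
definition "wseg v \<theta> = zf2 v + \<theta> * (zf1 v - zf2 v)"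

text \<open>The domain is not assumed convex, yet the segment between the two shock points stays
  inside: t is below 7/40 and z within 1/40 of -v at both ends, in the natural units, and these
  bounds are convex, while the boundary lies above 19/40 of w^2 in those units. The limits behind
  the constants are 1/6 for t and 1/2 for the boundary.\<close>

lemma segment_region:
  "\<forall>\<^sub>F v in at_right 0. 0 < v \<and> (\<forall>\<theta>. 0 \<le> \<theta> \<longrightarrow> \<theta> \<le> 1 \<longrightarrow> (tseg v \<theta>, wseg v \<theta>) \<in> interior N \<and> 0 \<le> tseg v \<theta> \<and> tseg v \<theta> < \<tau> (wseg v \<theta>) \<and>
      - 2 * v \<le> wseg v \<theta> \<and> wseg v \<theta> < 0 \<and> \<bar>wseg v \<theta> + v\<bar> \<le> v / 40 \<and> \<Lambda> / \<kappa>\<^sup>2 * v\<^sup>2 / 4 \<le> \<tau> (wseg v \<theta>) - tseg v \<theta>)"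
proof -
  define c where "c = \<Lambda> / \<kappa>\<^sup>2"
  have c: "0 < c" using ahead by (simp add: c_def)
  have tf: "\<forall>\<^sub>F v in at_right 0. tf (v, v) / v\<^sup>2 < 7 / 40 * c" if "((\<lambda>v. tf (v, v) / v\<^sup>2) \<longlongrightarrow> \<Lambda> / (6 * \<kappa>\<^sup>2)) (at_right 0)" for tf :: "real \<times> real \<Rightarrow> real"
    by (rule order_tendstoD(2)[OF that]) (use c in \<open>simp add: c_def\<close>)
  have y: "\<forall>\<^sub>F v in at_right 0. \<bar>yf v + 1\<bar> < 1 / 40" if "(yf \<longlongrightarrow> -1) (at_right 0)" for yf :: "real \<Rightarrow> real"
    using tendstoD[OF that, of "1 / 40"] by (simp add: dist_real_def)
  have "19 / 40 * c < \<Lambda> / (2 * \<kappa>\<^sup>2)" using c by (simp add: c_def)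
  from order_tendstoD(1)[OF tau_left this]
  have tau: "\<forall>\<^sub>F v in at_right 0. \<forall>w. - 2 * v \<le> w \<longrightarrow> w < 0 \<longrightarrow> 19 / 40 * c < \<tau> w / w\<^sup>2"
    by (rule eventually_left_scale)
  show ?thesis
    using tf[OF S1.tf_diag_asym[unfolded coeffs_eq]] tf[OF S2.tf_diag_asym[unfolded coeffs_eq]]
      y[OF S1.yf_tendsto[unfolded S1.y0_eq]] y[OF S2.yf_tendsto[unfolded S2.y0_eq]] tau
      S1.shock_region S2.shock_region S1.small_range eventually_left_scale[OF int_left]
  proof eventually_elim
    case (elim v)
    have v: "0 < v" "v \<in> {0..eps}" using elim by auto
    have z: "\<bar>zf1 v + v\<bar> \<le> v / 40" "\<bar>zf2 v + v\<bar> \<le> v / 40"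
    proof -
      have "zf1 v + v = v * (yf1 v + 1)" "zf2 v + v = v * (yf2 v + 1)"
        using S1.cusp_facts(7)[OF v(2)] S2.cusp_facts(7)[OF v(2)] by (simp_all add: algebra_simps)
      then show "\<bar>zf1 v + v\<bar> \<le> v / 40" "\<bar>zf2 v + v\<bar> \<le> v / 40"
        using elim(3,4) v mult_left_mono[of "\<bar>yf1 v + 1\<bar>" "1 / 40" v] mult_left_mono[of "\<bar>yf2 v + 1\<bar>" "1 / 40" v]
        by (simp_all add: abs_mult)
    qed
    have t: "tf1 (v, v) \<le> 7 / 40 * c * v\<^sup>2" "tf2 (v, v) \<le> 7 / 40 * c * v\<^sup>2"
      using elim(1,2) v by (simp_all add: divide_less_eq)
    show ?case
    proof (intro conjI allI impI v)
      fix \<theta> :: real assume \<theta>: "0 \<le> \<theta>" "\<theta> \<le> 1"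
      have te: "tseg v \<theta> = (1 - \<theta>) * tf2 (v, v) + \<theta> * tf1 (v, v)" by (simp add: tseg_def algebra_simps)
      have we: "wseg v \<theta> + v = (1 - \<theta>) * (zf2 v + v) + \<theta> * (zf1 v + v)" by (simp add: wseg_def algebra_simps)
      show t0: "0 \<le> tseg v \<theta>" unfolding te using \<theta> elim by (intro add_nonneg_nonneg mult_nonneg_nonneg) auto
      have "tseg v \<theta> \<le> (1 - \<theta>) * (7 / 40 * c * v\<^sup>2) + \<theta> * (7 / 40 * c * v\<^sup>2)"
        unfolding te using \<theta> t by (intro add_mono mult_left_mono) auto
      moreover have cvx: "(1 - \<theta>) * k + \<theta> * k = k" for k by (simp add: algebra_simps)
      ultimately have t1: "tseg v \<theta> \<le> 7 / 40 * c * v\<^sup>2" by (simp only:)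
      have "\<bar>wseg v \<theta> + v\<bar> \<le> \<bar>(1 - \<theta>) * (zf2 v + v)\<bar> + \<bar>\<theta> * (zf1 v + v)\<bar>" unfolding we by (rule abs_triangle_ineq)
      also have "\<dots> \<le> (1 - \<theta>) * (v / 40) + \<theta> * (v / 40)"
        unfolding abs_mult using \<theta> z by (intro add_mono mult_mono) auto
      finally show w: "\<bar>wseg v \<theta> + v\<bar> \<le> v / 40" by (simp only: cvx)
      then show w2: "- 2 * v \<le> wseg v \<theta>" "wseg v \<theta> < 0" using v by linarith+
      have "39 / 40 * v \<le> - wseg v \<theta>" using w v by linarith
      then have "(39 / 40 * v)\<^sup>2 \<le> (- wseg v \<theta>)\<^sup>2" using v by (intro power_mono) auto
      then have "(39 / 40)\<^sup>2 * v\<^sup>2 \<le> (wseg v \<theta>)\<^sup>2" by (simp only: power_mult_distrib power2_minus)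
      then have "19 / 40 * c * ((39 / 40)\<^sup>2 * v\<^sup>2) \<le> 19 / 40 * c * (wseg v \<theta>)\<^sup>2" using c by (intro mult_left_mono) auto
      moreover have "19 / 40 * c * (wseg v \<theta>)\<^sup>2 < \<tau> (wseg v \<theta>)" using elim(5) w2 by (simp add: less_divide_eq)
      moreover have "0 < c * v\<^sup>2" using c v by simp
      \<comment> \<open>Numerically 19/40 times (39/40)^2 minus 7/40 exceeds 1/4; in the limit the
        gap is 1/2 - 1/6 = 1/3.\<close>
      ultimately have gap: "c * v\<^sup>2 / 4 < \<tau> (wseg v \<theta>) - tseg v \<theta>"
        using t1 by (simp add: power2_eq_square)
      then show "\<Lambda> / \<kappa>\<^sup>2 * v\<^sup>2 / 4 \<le> \<tau> (wseg v \<theta>) - tseg v \<theta>" by (simp add: c_def)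
      show tl: "tseg v \<theta> < \<tau> (wseg v \<theta>)" using gap \<open>0 < c * v\<^sup>2\<close> by linarith
      show "(tseg v \<theta>, wseg v \<theta>) \<in> interior N" using elim(9) w2 t0 tl by blast
    qed
  qed
qed

lemma shock_mvt:
  assumes f: "smooth_upto N f" and v: "\<forall>\<theta>. 0 \<le> \<theta> \<longrightarrow> \<theta> \<le> 1 \<longrightarrow> (tseg v \<theta>, wseg v \<theta>) \<in> interior N"
  obtains \<theta> where "0 \<le> \<theta>" "\<theta> \<le> 1" "f (tf1 (v, v), zf1 v) - f (tf2 (v, v), zf2 v) =
    D 1 0 f (tseg v \<theta>, wseg v \<theta>) * dt (v, v) + D 0 1 f (tseg v \<theta>, wseg v \<theta>) * dz v"
  using segment_mvt[OF f, of "tf2 (v, v)" "tf1 (v, v)" "zf2 v" "zf1 v"] v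
  unfolding tseg_def wseg_def S_def by blast

lemma rw_segment: "\<forall>\<^sub>F v in at_right 0. \<forall>\<theta>. 0 \<le> \<theta> \<longrightarrow> \<theta> \<le> 1 \<longrightarrow>
    \<bar>D 0 1 r (tseg v \<theta>, wseg v \<theta>) + \<kappa> * (\<tau> (wseg v \<theta>) - tseg v \<theta>)\<bar> \<le> \<kappa> / 100 * (\<tau> (wseg v \<theta>) - tseg v \<theta>)"
proof -
  have "0 < \<kappa> / 100" using ahead by simp
  from eventually_left_scale[OF rw_vertical(2)[OF this]] segment_region show ?thesis
    by eventually_elim blast
qed

text \<open>Subtracting the identification equations gives (dr/dw) \<Delta>z =
  (\<open>c_plus\<close> behind - \<open>cp\<close> at \<xi>) \<Delta>t + \<open>Rd\<close> for some
  \<xi> on the segment. The speeds are about \<open>cp0\<close> + \<kappa> v and \<open>cp0\<close>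
  - \<kappa> v, so their difference is at most 83/40 \<kappa> v, and |dr/dw| is at least 99/400 of
  \<Lambda> / \<kappa> v^2. The quotients 83/40 : 99/400 and 400/99 are below 9 and 5.\<close>

lemma dz_bound: "\<forall>\<^sub>F v in at_right 0. \<bar>dz v\<bar> \<le> 9 * \<kappa>\<^sup>2 / \<Lambda> * \<bar>dt (v, v)\<bar> / v + 5 * \<kappa> / \<Lambda> * \<bar>Rd (v, v)\<bar> / v\<^sup>2"
proof -
  have k80: "0 < \<kappa> / 80" using ahead by simp
  have "\<forall>\<^sub>F v in at_right 0. dist ((S1.cpT (v, v) - cp0) / v) \<kappa> < \<kappa> / 40"
    using S1.cpT_diag_asym by (rule tendstoD) (use ahead in simp)
  then show ?thesis
    using segment_region rw_segment eventually_left_scale[OF near_cusp_cp[OF k80]] S1.small_range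
  proof eventually_elim
    case (elim v)
    have v: "0 < v" "v \<in> {0..eps}" using elim by auto
    obtain \<theta> where \<theta>: "0 \<le> \<theta>" "\<theta> \<le> 1" "r (tf1 (v, v), zf1 v) - r (tf2 (v, v), zf2 v) =
      D 1 0 r (tseg v \<theta>, wseg v \<theta>) * dt (v, v) + D 0 1 r (tseg v \<theta>, wseg v \<theta>) * dz v"
      using shock_mvt[OF ahead(4), of v] elim(2) by blast
    define \<xi> where "\<xi> = (tseg v \<theta>, wseg v \<theta>)"
    define w where "w = wseg v \<theta>"
    have reg: "\<xi> \<in> interior N" "0 \<le> tseg v \<theta>" "tseg v \<theta> < \<tau> w" "- 2 * v \<le> w" "w < 0" "\<bar>w + v\<bar> \<le> v / 40"
      "\<Lambda> / \<kappa>\<^sup>2 * v\<^sup>2 / 4 \<le> \<tau> w - tseg v \<theta>"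
      using elim(2) \<theta>(1,2) unfolding \<xi>_def w_def by blast+
    have "\<xi> \<in> N" using reg(1) interior_subset by blast
    then have "dr (v, v) = cp \<xi> * dt (v, v) + D 0 1 r \<xi> * dz v"
      using \<theta>(3) S1.sol_facts(16)[OF v(2)] S2.sol_facts(16)[OF v(2)] ahead(6)[of \<xi>] unfolding \<xi>_def dr_def by simp
    then have eq: "D 0 1 r \<xi> * dz v = (S1.cpT (v, v) - cp \<xi>) * dt (v, v) + Rd (v, v)"
      by (simp add: Rd_def algebra_simps)
    have "\<bar>cp \<xi> - cp0 - \<kappa> * w\<bar> \<le> \<kappa> / 80 * \<bar>w\<bar>" using elim(4) reg unfolding \<xi>_def w_def by blast
    also have "\<dots> \<le> \<kappa> / 80 * (2 * v)" using reg k80 by (intro mult_left_mono) auto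
    finally have c1: "\<bar>cp \<xi> - cp0 - \<kappa> * w\<bar> \<le> \<kappa> * v / 40" by (simp add: mult.commute)
    have c2: "\<bar>S1.cpT (v, v) - cp0 - \<kappa> * v\<bar> \<le> \<kappa> * v / 40"
    proof -
      have "S1.cpT (v, v) - cp0 - \<kappa> * v = ((S1.cpT (v, v) - cp0) / v - \<kappa>) * v" using v by (simp add: field_simps)
      also have "\<bar>\<dots>\<bar> \<le> \<kappa> / 40 * v" unfolding abs_mult using elim(1) v ahead(11) by (intro mult_mono) (auto simp: dist_real_def)
      finally show ?thesis by simp
    qed
    have "0 \<le> \<kappa> * (v - w)" using reg(5) v ahead(11) by (intro mult_nonneg_nonneg) auto
    then have "\<bar>\<kappa> * v - \<kappa> * w\<bar> = \<kappa> * (v - w)" by (simp only: right_diff_distrib abs_of_nonneg)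
    also have "\<dots> \<le> \<kappa> * (81 / 40 * v)"
    proof (rule mult_left_mono)
      show "v - w \<le> 81 / 40 * v" using reg(6) v by linarith
    qed (use ahead(11) in simp)
    finally have "\<bar>\<kappa> * v - \<kappa> * w\<bar> \<le> \<kappa> * v * 81 / 40" by simp
    then have cc: "\<bar>S1.cpT (v, v) - cp \<xi>\<bar> \<le> \<kappa> * v * 83 / 40" using c1 c2 by linarith
    define g where "g = \<tau> w - tseg v \<theta>"
    have "\<bar>D 0 1 r \<xi> + \<kappa> * g\<bar> \<le> \<kappa> / 100 * g" using elim(3) \<theta>(1,2) unfolding \<xi>_def w_def g_def by blast
    moreover have "\<kappa> / 100 * g = \<kappa> * g / 100" by simp
    ultimately have rw: "\<kappa> * g * 99 / 100 \<le> \<bar>D 0 1 r \<xi>\<bar>" by linarith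
    have "\<kappa> * (\<Lambda> / \<kappa>\<^sup>2 * v\<^sup>2 / 4) \<le> \<kappa> * g" using reg(7) ahead(11) unfolding g_def by (intro mult_left_mono) auto
    moreover have "\<kappa> * (\<Lambda> / \<kappa>\<^sup>2 * v\<^sup>2 / 4) = \<Lambda> / \<kappa> * v\<^sup>2 / 4" using ahead(11) by (simp add: power2_eq_square)
    ultimately have "99 / 100 * (\<Lambda> / \<kappa> * v\<^sup>2 / 4) \<le> 99 / 100 * (\<kappa> * g)" by simp
    then have rw2: "\<Lambda> / \<kappa> * v\<^sup>2 * (99 / 400) \<le> \<bar>D 0 1 r \<xi>\<bar>" using rw by simp
    have "\<Lambda> / \<kappa> * v\<^sup>2 * (99 / 400) * \<bar>dz v\<bar> \<le> \<bar>D 0 1 r \<xi>\<bar> * \<bar>dz v\<bar>" using rw2 by (intro mult_right_mono) auto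
    also have "\<dots> = \<bar>(S1.cpT (v, v) - cp \<xi>) * dt (v, v) + Rd (v, v)\<bar>" using eq by (simp add: abs_mult[symmetric])
    also have "\<dots> \<le> \<bar>S1.cpT (v, v) - cp \<xi>\<bar> * \<bar>dt (v, v)\<bar> + \<bar>Rd (v, v)\<bar>" unfolding abs_mult[symmetric] by (rule abs_triangle_ineq)
    also have "\<dots> \<le> \<kappa> * v * 83 / 40 * \<bar>dt (v, v)\<bar> + \<bar>Rd (v, v)\<bar>" using cc by (intro add_mono mult_right_mono) auto
    finally have main: "\<Lambda> / \<kappa> * v\<^sup>2 * (99 / 400) * \<bar>dz v\<bar> \<le> \<kappa> * v * 83 / 40 * \<bar>dt (v, v)\<bar> + \<bar>Rd (v, v)\<bar>" .
    have pos: "0 < \<Lambda> / \<kappa> * v\<^sup>2 * (99 / 400)" using ahead v by simp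
    have "\<kappa> * v * 83 / 40 * \<bar>dt (v, v)\<bar> + \<bar>Rd (v, v)\<bar> \<le>
      \<Lambda> / \<kappa> * v\<^sup>2 * (99 / 400) * (9 * \<kappa>\<^sup>2 / \<Lambda> * \<bar>dt (v, v)\<bar> / v + 5 * \<kappa> / \<Lambda> * \<bar>Rd (v, v)\<bar> / v\<^sup>2)"
    proof -
      have e1: "\<Lambda> / \<kappa> * v\<^sup>2 * (99 / 400) * (9 * \<kappa>\<^sup>2 / \<Lambda> * \<bar>dt (v, v)\<bar> / v) = (\<kappa> * v * \<bar>dt (v, v)\<bar>) * (891 / 400)"
        using ahead(11,12) v by (simp add: power2_eq_square)
      have e2: "\<Lambda> / \<kappa> * v\<^sup>2 * (99 / 400) * (5 * \<kappa> / \<Lambda> * \<bar>Rd (v, v)\<bar> / v\<^sup>2) = \<bar>Rd (v, v)\<bar> * (495 / 400)"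
        using ahead(11,12) v by (simp add: power2_eq_square)
      have "0 \<le> \<kappa> * v * \<bar>dt (v, v)\<bar>" using ahead(11) v by simp
      moreover have "\<kappa> * v * 83 / 40 * \<bar>dt (v, v)\<bar> = (\<kappa> * v * \<bar>dt (v, v)\<bar>) * (83 / 40)" by simp
      ultimately show ?thesis unfolding distrib_left e1 e2 by (simp add: abs_ge_zero)
    qed
    with main have "\<Lambda> / \<kappa> * v\<^sup>2 * (99 / 400) * \<bar>dz v\<bar> \<le>
      \<Lambda> / \<kappa> * v\<^sup>2 * (99 / 400) * (9 * \<kappa>\<^sup>2 / \<Lambda> * \<bar>dt (v, v)\<bar> / v + 5 * \<kappa> / \<Lambda> * \<bar>Rd (v, v)\<bar> / v\<^sup>2)" by linarith
    then show ?case using pos by (simp only: mult_le_cancel_left_pos)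
  qed
qed

text \<open>On the segment the w-derivative of \<alpha> is as close to \<open>aw0\<close> as
  desired, while its t-derivative is merely bounded; therefore one \<open>C\<close> serves all
  \<open>e\<close>.\<close>

lemma dam_bound: "\<exists>C>0. \<forall>e>0. \<forall>\<^sub>F v in at_right 0. \<bar>dam v - aw0 * dz v\<bar> \<le> e * \<bar>dz v\<bar> + C * \<bar>dt (v, v)\<bar>"
proof -
  define C where "C = \<bar>D 1 0 a O2\<bar> + 1"
  have "\<forall>\<^sub>F v in at_right 0. \<bar>dam v - aw0 * dz v\<bar> \<le> e * \<bar>dz v\<bar> + C * \<bar>dt (v, v)\<bar>" if e: "0 < e" for e
  proof -
    have "\<forall>\<^sub>F x in FN. \<bar>D 1 0 a x\<bar> < C"
      by (rule order_tendstoD(2)[OF tendsto_rabs[OF D_tendsto[OF ahead(2)]]]) (simp add: C_def)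
    moreover have "\<forall>\<^sub>F x in FN. dist (D 0 1 a x) aw0 < e" by (rule tendstoD[OF D_tendsto[OF ahead(2)] e])
    ultimately have "\<forall>\<^sub>F x in FN. \<bar>D 1 0 a x\<bar> < C \<and> dist (D 0 1 a x) aw0 < e" by (rule eventually_conj)
    from eventually_left_scale[OF near_left[OF this]] segment_region show ?thesis
    proof eventually_elim
      case (elim v)
      obtain \<theta> where \<theta>: "0 \<le> \<theta>" "\<theta> \<le> 1" "dam v =
        D 1 0 a (tseg v \<theta>, wseg v \<theta>) * dt (v, v) + D 0 1 a (tseg v \<theta>, wseg v \<theta>) * dz v"
        using shock_mvt[OF ahead(2), of v] elim(2) unfolding dam_def by blast
      define \<xi> where "\<xi> = (tseg v \<theta>, wseg v \<theta>)"
      have b: "\<bar>D 1 0 a \<xi>\<bar> < C" "dist (D 0 1 a \<xi>) aw0 < e"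
        using elim \<theta>(1,2) unfolding \<xi>_def by (meson less_imp_le)+
      have "dam v - aw0 * dz v = (D 0 1 a \<xi> - aw0) * dz v + D 1 0 a \<xi> * dt (v, v)"
        using \<theta>(3) unfolding \<xi>_def by (simp add: algebra_simps)
      also have "\<bar>\<dots>\<bar> \<le> \<bar>D 0 1 a \<xi> - aw0\<bar> * \<bar>dz v\<bar> + \<bar>D 1 0 a \<xi>\<bar> * \<bar>dt (v, v)\<bar>"
        unfolding abs_mult[symmetric] by (rule abs_triangle_ineq)
      also have "\<dots> \<le> e * \<bar>dz v\<bar> + C * \<bar>dt (v, v)\<bar>"
        using b by (intro add_mono mult_right_mono) (auto simp: dist_real_def)
      finally show ?case .
    qed
  qed
  moreover have "0 < C" by (simp add: C_def)
  ultimately show ?thesis by blast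
qed

text \<open>By \<open>bw_bound\<close> the w-derivative of \<beta> is controlled by that of
  \<open>r\<close>, which on the segment is of order v^2. Since \<Delta>z may be as large as
  \<Delta>t / v, this factor is what prevents a loss in \<beta>.\<close>

lemma dbm_bound: "\<exists>C>0. \<forall>\<^sub>F v in at_right 0. \<bar>dbm v\<bar> \<le> C * v\<^sup>2 * \<bar>dz v\<bar> + C * \<bar>dt (v, v)\<bar>"
proof -
  obtain B where B: "0 < B" "\<forall>\<^sub>F x in FN. \<bar>D 0 1 b x\<bar> \<le> B * \<bar>D 0 1 r x\<bar>" using bw_bound by blast
  define C1 where "C1 = \<bar>D 1 0 b O2\<bar> + 1"
  define C2 where "C2 = B * (2 * \<kappa> * (\<Lambda> / \<kappa>\<^sup>2 * 4))"
  have C: "0 < C1" "0 < C2" using B(1) ahead(11,12) by (auto simp: C1_def C2_def)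
  have "\<forall>\<^sub>F x in FN. \<bar>D 1 0 b x\<bar> < C1"
    by (rule order_tendstoD(2)[OF tendsto_rabs[OF D_tendsto[OF ahead(3)]]]) (simp add: C1_def)
  from eventually_conj[OF this B(2)] have ev: "\<forall>\<^sub>F x in FN. \<bar>D 1 0 b x\<bar> < C1 \<and> \<bar>D 0 1 b x\<bar> \<le> B * \<bar>D 0 1 r x\<bar>" .
  have "\<Lambda> / (2 * \<kappa>\<^sup>2) < \<Lambda> / \<kappa>\<^sup>2" using ahead by (simp add: field_simps)
  from order_tendstoD(2)[OF tau_left this]
  have tau: "\<forall>\<^sub>F v in at_right 0. \<forall>w. - 2 * v \<le> w \<longrightarrow> w < 0 \<longrightarrow> \<tau> w / w\<^sup>2 < \<Lambda> / \<kappa>\<^sup>2"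
    by (rule eventually_left_scale)
  from eventually_left_scale[OF near_left[OF ev]] segment_region rw_segment tau
  have "\<forall>\<^sub>F v in at_right 0. \<bar>dbm v\<bar> \<le> C2 * v\<^sup>2 * \<bar>dz v\<bar> + C1 * \<bar>dt (v, v)\<bar>"
  proof eventually_elim
    case (elim v)
    obtain \<theta> where \<theta>: "0 \<le> \<theta>" "\<theta> \<le> 1" "dbm v =
      D 1 0 b (tseg v \<theta>, wseg v \<theta>) * dt (v, v) + D 0 1 b (tseg v \<theta>, wseg v \<theta>) * dz v"
      using shock_mvt[OF ahead(3), of v] elim(2) unfolding dbm_def by blast
    define \<xi> where "\<xi> = (tseg v \<theta>, wseg v \<theta>)"
    define w where "w = wseg v \<theta>"
    define g where "g = \<tau> w - tseg v \<theta>"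
    have reg: "0 \<le> tseg v \<theta>" "tseg v \<theta> < \<tau> w" "- 2 * v \<le> w" "w < 0"
      using elim(2) \<theta>(1,2) unfolding w_def by blast+
    have b: "\<bar>D 1 0 b \<xi>\<bar> < C1" "\<bar>D 0 1 b \<xi>\<bar> \<le> B * \<bar>D 0 1 r \<xi>\<bar>"
      using elim(1) reg unfolding \<xi>_def w_def by (meson less_imp_le)+
    have "\<bar>D 0 1 r \<xi> + \<kappa> * g\<bar> \<le> \<kappa> / 100 * g" using elim(3) \<theta>(1,2) unfolding \<xi>_def w_def g_def by blast
    moreover have "\<kappa> / 100 * g = \<kappa> * g / 100" by simp
    moreover have "0 \<le> \<kappa> * g" using reg ahead(11) by (simp add: g_def)
    ultimately have "\<bar>D 0 1 r \<xi>\<bar> \<le> 2 * (\<kappa> * g)" by linarith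
    also have "\<dots> \<le> 2 * (\<kappa> * (\<Lambda> / \<kappa>\<^sup>2 * (4 * v\<^sup>2)))"
    proof (intro mult_left_mono)
      have "g \<le> \<tau> w" using reg by (simp add: g_def)
      also have "\<dots> \<le> \<Lambda> / \<kappa>\<^sup>2 * w\<^sup>2" using elim(4) reg by (simp add: divide_less_eq less_imp_le)
      also have "\<dots> \<le> \<Lambda> / \<kappa>\<^sup>2 * (4 * v\<^sup>2)"
      proof (intro mult_left_mono)
        have "(- w)\<^sup>2 \<le> (2 * v)\<^sup>2" using reg by (intro power_mono) auto
        then show "w\<^sup>2 \<le> 4 * v\<^sup>2" by (simp add: power_mult_distrib)
      qed (use ahead in simp)
      finally show "g \<le> \<Lambda> / \<kappa>\<^sup>2 * (4 * v\<^sup>2)" .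
    qed (use ahead(11) in auto)
    finally have "B * \<bar>D 0 1 r \<xi>\<bar> \<le> B * (2 * (\<kappa> * (\<Lambda> / \<kappa>\<^sup>2 * (4 * v\<^sup>2))))" using B(1) by (intro mult_left_mono) auto
    then have bw: "\<bar>D 0 1 b \<xi>\<bar> \<le> C2 * v\<^sup>2" using b(2) by (simp add: C2_def)
    have "\<bar>dbm v\<bar> \<le> \<bar>D 1 0 b \<xi>\<bar> * \<bar>dt (v, v)\<bar> + \<bar>D 0 1 b \<xi>\<bar> * \<bar>dz v\<bar>"
      unfolding \<theta>(3) \<xi>_def[symmetric] abs_mult[symmetric] by (rule abs_triangle_ineq)
    also have "\<dots> \<le> C1 * \<bar>dt (v, v)\<bar> + C2 * v\<^sup>2 * \<bar>dz v\<bar>"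
      using b(1) bw by (intro add_mono mult_right_mono) auto
    finally show ?case by simp
  qed
  then have "\<forall>\<^sub>F v in at_right 0. \<bar>dbm v\<bar> \<le> (C1 + C2) * v\<^sup>2 * \<bar>dz v\<bar> + (C1 + C2) * \<bar>dt (v, v)\<bar>"
  proof eventually_elim
    case (elim v)
    have "C2 * v\<^sup>2 * \<bar>dz v\<bar> + C1 * \<bar>dt (v, v)\<bar> \<le> (C1 + C2) * v\<^sup>2 * \<bar>dz v\<bar> + (C1 + C2) * \<bar>dt (v, v)\<bar>"
      using C by (intro add_mono mult_right_mono) auto
    then show ?case using elim by linarith
  qed
  then show ?thesis using C by (intro exI[of _ "C1 + C2"]) auto
qed

definition "dS v = \<bar>da (v, v)\<bar> + \<bar>db (v, v)\<bar> + \<bar>dam v\<bar> + \<bar>dbm v\<bar>"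

lemma dS_norm: "norm ((S1.Up v, S1.Um v) - (S2.Up v, S2.Um v)) \<le> dS v"
proof -
  have "(S1.Up v, S1.Um v) - (S2.Up v, S2.Um v) = ((da (v, v), db (v, v)), (dam v, dbm v))"
    by (simp add: S1.Up_def S2.Up_def S1.Um_def S2.Um_def S_def)
  then show ?thesis
    using norm_Pair_le[of "(da (v, v), db (v, v))" "(dam v, dbm v)"] norm_Pair_le[of "da (v, v)" "db (v, v)"]
      norm_Pair_le[of "dam v" "dbm v"] by (simp add: dS_def)
qed

lemma pair_components:
  fixes X Y :: "real \<times> real"
  assumes "norm (X - Y) \<le> c"
  shows "\<bar>fst X - fst Y\<bar> \<le> c" "\<bar>snd X - snd Y\<bar> \<le> c"
proof -
  have "X - Y = (fst X - fst Y, snd X - snd Y)" by (simp add: prod_eq_iff)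
  then have "norm (fst X - fst Y, snd X - snd Y) \<le> c" using assms by simp
  then show "\<bar>fst X - fst Y\<bar> \<le> c" "\<bar>snd X - snd Y\<bar> \<le> c"
    using order_trans[OF norm_fst_le[of "fst X - fst Y" "snd X - snd Y"]]
      order_trans[OF norm_snd_le[of "snd X - snd Y" "fst X - fst Y"]] by simp_all
qed

text \<open>The jump of \<beta> is x - \<theta>, where x and \<theta> are half the sum and half the
  difference of the jumps of \<alpha> and \<beta>. The shock relation sinh \<theta> = x K, with K =
  1 + O(v) and \<theta> = O(v), makes this difference nearly vanish, and its variation gains a
  factor v over that of the states.\<close>

lemma beta_jump: "\<exists>C>0. \<forall>\<^sub>F v in at_right 0. \<bar>db (v, v) - dbm v\<bar> \<le> C * v * dS v"
proof -
  obtain d L where dL: "0 < d" "0 < L" "\<And>y z. norm (y - (U0, U0)) < d \<Longrightarrow> norm (z - (U0, U0)) < d \<Longrightarrow>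
      norm (K_jump (fst y) (snd y) - K_jump (fst z) (snd z)) \<le> L * norm (y - z)"
    using strict_diff_lipschitz[OF strict_diff_jump(1)[OF U0_J]] by (metis UNIV_I)
  have "strict_deriv cosh (\<lambda>h. sinh 0 * h) (0::real) UNIV"
    by (rule strict_deriv_realI[of UNIV]) (auto intro!: derivative_eq_intros continuous_intros)
  then obtain d' L' where dL': "0 < d'" "0 < L'" "\<And>y z. norm (y - 0) < d' \<Longrightarrow> norm (z - 0) < d' \<Longrightarrow> norm (cosh y - cosh (z::real)) \<le> L' * norm (y - z)"
    by (rule strict_deriv_lipschitz) (metis UNIV_I)
  obtain C1 where C1: "0 < C1" "\<forall>\<^sub>F v in at_right 0. norm (S1.Up v - U0) \<le> C1 * v \<and> norm (S1.Um v - U0) \<le> C1 * v"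
    using S1.states_bound by blast
  obtain C2 where C2: "0 < C2" "\<forall>\<^sub>F v in at_right 0. norm (S2.Up v - U0) \<le> C2 * v \<and> norm (S2.Um v - U0) \<le> C2 * v"
    using S2.states_bound by blast
  define C where "C = C1 + C2"
  have C: "0 < C" "C1 \<le> C" "C2 \<le> C" using C1(1) C2(1) by (auto simp: C_def)
  have dpos: "0 < min d d' / (3 * C)" using dL(1) dL'(1) C by simp
  have "\<forall>\<^sub>F v in at_right 0. \<bar>db (v, v) - dbm v\<bar> \<le> (4 * C * L + 2 * C * L') * v * dS v"
    using C1(2) C2(2) S1.shock_relations S2.shock_relations eventually_at_right_real[OF dpos]
  proof eventually_elim
    case (elim v)
    have v: "0 < v" "3 * C * v < d" "3 * C * v < d'" using elim(5) C by (auto simp: field_simps)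
    have sc: "C1 * v \<le> C * v" "C2 * v \<le> C * v" using C v by (auto intro: mult_right_mono)
    have n1: "norm (S1.Up v - U0) \<le> C * v" "norm (S1.Um v - U0) \<le> C * v"
      and n2: "norm (S2.Up v - U0) \<le> C * v" "norm (S2.Um v - U0) \<le> C * v"
      using elim(1,2) sc by linarith+
    note p1 = pair_components[OF n1(1)] pair_components[OF n1(2)] and p2 = pair_components[OF n2(1)] pair_components[OF n2(2)]
    have nn1: "norm ((S1.Up v, S1.Um v) - (U0, U0)) \<le> 2 * C * v"
      using norm_Pair_le[of "S1.Up v - U0" "S1.Um v - U0"] n1 by simp
    have nn2: "norm ((S2.Up v, S2.Um v) - (U0, U0)) \<le> 2 * C * v"
      using norm_Pair_le[of "S2.Up v - U0" "S2.Um v - U0"] n2 by simp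
    have Cv: "0 < C * v" using C v by simp
    define \<theta>1 x1 K1 where "\<theta>1 = (fst (S1.Up v) - snd (S1.Up v) - (fst (S1.Um v) - snd (S1.Um v))) / 2"
      and "x1 = mean (S1.Up v) - mean (S1.Um v)" and "K1 = K_jump (S1.Up v) (S1.Um v)"
    define \<theta>2 x2 K2 where "\<theta>2 = (fst (S2.Up v) - snd (S2.Up v) - (fst (S2.Um v) - snd (S2.Um v))) / 2"
      and "x2 = mean (S2.Up v) - mean (S2.Um v)" and "K2 = K_jump (S2.Up v) (S2.Um v)"
    have rel: "sinh \<theta>1 = x1 * K1" "sinh \<theta>2 = x2 * K2"
      using elim(3,4) unfolding \<theta>1_def x1_def K1_def \<theta>2_def x2_def K2_def by blast+
    have comp: "fst (S1.Up v) - fst (S2.Up v) = da (v, v)" "snd (S1.Up v) - snd (S2.Up v) = db (v, v)"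
      "fst (S1.Um v) - fst (S2.Um v) = dam v" "snd (S1.Um v) - snd (S2.Um v) = dbm v"
      by (simp_all add: S1.Up_def S2.Up_def S1.Um_def S2.Um_def S_def)
    have dx: "x1 - x2 = (da (v, v) + db (v, v) - dam v - dbm v) / 2"
      unfolding x1_def x2_def comp[symmetric] by (simp add: field_simps)
    have dth: "\<theta>1 - \<theta>2 = (da (v, v) - db (v, v) - dam v + dbm v) / 2"
      unfolding \<theta>1_def \<theta>2_def comp[symmetric] by (simp add: field_simps)
    have jmp: "db (v, v) - dbm v = (x1 - x2) - (\<theta>1 - \<theta>2)" unfolding dx dth by (simp add: field_simps)
    have bx: "\<bar>x1 - x2\<bar> \<le> dS v" "\<bar>\<theta>1 - \<theta>2\<bar> \<le> dS v"
      unfolding dx dth dS_def by (auto simp: abs_le_iff)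
    have th: "\<bar>\<theta>1\<bar> \<le> 2 * C * v" "\<bar>\<theta>2\<bar> \<le> 2 * C * v" and x2b: "\<bar>x2\<bar> \<le> 2 * C * v"
    proof -
      have "2 * \<theta>1 = (fst (S1.Up v) - fst U0) - (snd (S1.Up v) - snd U0) - (fst (S1.Um v) - fst U0) + (snd (S1.Um v) - snd U0)"
        by (simp add: \<theta>1_def)
      then show "\<bar>\<theta>1\<bar> \<le> 2 * C * v" using p1 by linarith
      have "2 * \<theta>2 = (fst (S2.Up v) - fst U0) - (snd (S2.Up v) - snd U0) - (fst (S2.Um v) - fst U0) + (snd (S2.Um v) - snd U0)"
        by (simp add: \<theta>2_def)
      then show "\<bar>\<theta>2\<bar> \<le> 2 * C * v" using p2 by linarith
      have "2 * x2 = (fst (S2.Up v) - fst U0) + (snd (S2.Up v) - snd U0) - (fst (S2.Um v) - fst U0) - (snd (S2.Um v) - snd U0)"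
        by (simp add: x2_def field_simps)
      then show "\<bar>x2\<bar> \<le> 2 * C * v" using p2 by linarith
    qed
    have K1b: "\<bar>K1 - 1\<bar> \<le> L * (2 * C * v)"
    proof -
      have "norm (K_jump (fst (S1.Up v, S1.Um v)) (snd (S1.Up v, S1.Um v)) - K_jump (fst (U0, U0)) (snd (U0, U0))) \<le> L * norm ((S1.Up v, S1.Um v) - (U0, U0))"
        using nn1 v(2) Cv dL(1) by (intro dL(3)) auto
      also have "\<dots> \<le> L * (2 * C * v)" using nn1 dL(2) by (intro mult_left_mono) auto
      finally show ?thesis using K_jump_same[OF U0_J] by (simp add: K1_def)
    qed
    have dK: "\<bar>K1 - K2\<bar> \<le> L * dS v"
    proof -
      have "norm (K_jump (fst (S1.Up v, S1.Um v)) (snd (S1.Up v, S1.Um v)) - K_jump (fst (S2.Up v, S2.Um v)) (snd (S2.Up v, S2.Um v)))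
          \<le> L * norm ((S1.Up v, S1.Um v) - (S2.Up v, S2.Um v))"
        using nn1 nn2 v(2) Cv by (intro dL(3)) auto
      also have "\<dots> \<le> L * dS v" using dS_norm dL(2) by (intro mult_left_mono) auto
      finally show ?thesis by (simp add: K1_def K2_def)
    qed
    have E: "\<bar>(sinh \<theta>1 - \<theta>1) - (sinh \<theta>2 - \<theta>2)\<bar> \<le> L' * (2 * C * v) * \<bar>\<theta>1 - \<theta>2\<bar>"
    proof (rule mvt_bound[where a = "- (2 * C * v)" and b = "2 * C * v" and f' = "\<lambda>x. cosh x - 1"])
      show "((\<lambda>x. sinh x - x) has_real_derivative cosh x - 1) (at x within {- (2 * C * v)..2 * C * v})" for x
        by (auto intro!: derivative_eq_intros)
      fix x assume x: "x \<in> {- (2 * C * v)..2 * C * v}"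
      then have "\<bar>x\<bar> \<le> 2 * C * v" by auto
      then have "norm (cosh x - cosh 0) \<le> L' * norm (x - 0)" using v(3) Cv dL'(1) by (intro dL'(3)) auto
      also have "\<dots> \<le> L' * (2 * C * v)" using \<open>\<bar>x\<bar> \<le> 2 * C * v\<close> dL'(2) by (intro mult_left_mono) auto
      finally show "\<bar>cosh x - 1\<bar> \<le> L' * (2 * C * v)" by simp
    qed (use th in auto)
    \<comment> \<open>From sinh \<theta> = x K one has x - \<theta> = (1 - K) x + (sinh \<theta> -
      \<theta>); the difference of the two solutions is arranged so that every term contains a small
      factor.\<close>
    have "db (v, v) - dbm v = (1 - K1) * (x1 - x2) - x2 * (K1 - K2) + ((sinh \<theta>1 - \<theta>1) - (sinh \<theta>2 - \<theta>2))"
      unfolding jmp rel by (simp add: algebra_simps)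
    also have "\<bar>\<dots>\<bar> \<le> \<bar>(1 - K1) * (x1 - x2)\<bar> + \<bar>x2 * (K1 - K2)\<bar> + \<bar>(sinh \<theta>1 - \<theta>1) - (sinh \<theta>2 - \<theta>2)\<bar>"
      by linarith
    also have "\<dots> \<le> L * (2 * C * v) * dS v + 2 * C * v * (L * dS v) + L' * (2 * C * v) * dS v"
    proof (intro add_mono)
      show "\<bar>(1 - K1) * (x1 - x2)\<bar> \<le> L * (2 * C * v) * dS v"
        unfolding abs_mult using K1b bx dL(2) Cv by (intro mult_mono) (auto simp: abs_minus_commute)
      show "\<bar>x2 * (K1 - K2)\<bar> \<le> 2 * C * v * (L * dS v)"
        unfolding abs_mult using x2b dK Cv by (intro mult_mono) auto
      have "L' * (2 * C * v) * \<bar>\<theta>1 - \<theta>2\<bar> \<le> L' * (2 * C * v) * dS v"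
        using bx dL'(2) Cv by (intro mult_left_mono) auto
      then show "\<bar>(sinh \<theta>1 - \<theta>1) - (sinh \<theta>2 - \<theta>2)\<bar> \<le> L' * (2 * C * v) * dS v" using E by linarith
    qed
    also have "\<dots> = (4 * C * L + 2 * C * L') * v * dS v" by (simp add: algebra_simps)
    finally show ?case .
  qed
  moreover have "0 < 4 * C * L + 2 * C * L'" using C dL(2) dL'(2) by (simp add: add_pos_pos)
  ultimately show ?thesis by blast
qed

end

context two_cusp_solutions
begin

lemma hyp_nonneg: "hyp s n \<Longrightarrow> 0 < s \<Longrightarrow> 0 \<le> n"
  unfolding hyp_def by (force simp: T_dom_def)

text \<open>On the diagonal \<beta> is not prescribed but determined by the jump. Its difference is
  that of \<beta> ahead, small by \<open>dbm_bound\<close>, plus that of the jump, small by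
  \<open>beta_jump\<close>. The constant of the m-term is independent of \<open>e\<close>, so the
  share of \<open>n\<close> can be made small without enlarging it.\<close>

lemma db_diag: "\<exists>C>0. \<forall>e>0. \<forall>\<^sub>F v in at_right 0. \<forall>n m. hyp v n \<longrightarrow> \<bar>dt (v, v)\<bar> \<le> m * v\<^sup>2 \<longrightarrow> \<bar>db (v, v)\<bar> \<le> C * m * v\<^sup>2 + e * n"
proof -
  obtain Ca where Ca: "0 < Ca" "\<And>e. 0 < e \<Longrightarrow> \<forall>\<^sub>F v in at_right 0. \<bar>dam v - aw0 * dz v\<bar> \<le> e * \<bar>dz v\<bar> + Ca * \<bar>dt (v, v)\<bar>"
    using dam_bound by blast
  obtain Cb where Cb: "0 < Cb" "\<forall>\<^sub>F v in at_right 0. \<bar>dbm v\<bar> \<le> Cb * v\<^sup>2 * \<bar>dz v\<bar> + Cb * \<bar>dt (v, v)\<bar>"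
    using dbm_bound by blast
  obtain Cj where Cj: "0 < Cj" "\<forall>\<^sub>F v in at_right 0. \<bar>db (v, v) - dbm v\<bar> \<le> Cj * v * dS v"
    using beta_jump by blast
  define Z where "Z = 9 * \<kappa>\<^sup>2 / \<Lambda> + 5 * \<kappa> / \<Lambda>"
  have Z: "0 < Z" using ahead by (simp add: Z_def add_pos_pos)
  define B where "B = Cb + Cj * (\<bar>aw0\<bar> + 1 + Cb)"
  have B: "0 < B" using Cb(1) Cj(1) by (simp add: B_def add_pos_nonneg)
  define C where "C = B * Z + Cb + Cj * (Ca + Cb)"
  have C: "0 < C" using B Z Cb(1) Cj(1) Ca(1) by (simp add: C_def add_pos_pos)
  have "\<forall>\<^sub>F v in at_right 0. \<forall>n m. hyp v n \<longrightarrow> \<bar>dt (v, v)\<bar> \<le> m * v\<^sup>2 \<longrightarrow> \<bar>db (v, v)\<bar> \<le> C * m * v\<^sup>2 + e * n" if e: "0 < e" for e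
  proof -
    define e1 where "e1 = e / (2 * B * Z)"
    have e1: "0 < e1" "B * Z * e1 = e / 2" using e B Z by (auto simp: e1_def)
    have e2: "0 < e / (4 * Cj)" using e Cj by simp
    show ?thesis
      using Ca(2)[OF zero_less_one] Cb(2) Cj(2) dz_bound Rd_small[OF e1(1)]
        eventually_at_right_real[OF zero_less_one] eventually_at_right_real[OF e2]
    proof eventually_elim
      case (elim v)
      show ?case
      proof (intro allI impI)
        fix n m assume n: "hyp v n" and m: "\<bar>dt (v, v)\<bar> \<le> m * v\<^sup>2"
        have v: "0 < v" "v < 1" "Cj * v \<le> e / 4" using elim(6,7) Cj(1) by (auto simp: field_simps)
        have n0: "0 \<le> n" using hyp_nonneg[OF n v(1)] .
        have "0 \<le> m * v\<^sup>2" using m by (rule order_trans[OF abs_ge_zero])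
        then have m0: "0 \<le> m" using v(1) by (simp add: zero_le_mult_iff)
        have "(v, v) \<in> T_dom v" using v by (simp add: T_dom_def)
        then have Rv: "\<bar>Rd (v, v)\<bar> \<le> e1 * n * v" and nn: "\<bar>da (v, v)\<bar> \<le> n" "\<bar>db (v, v)\<bar> \<le> n"
          using elim(5) n unfolding hyp_def by auto
        define z where "z = \<bar>dz v\<bar>"
        have "z \<le> 9 * \<kappa>\<^sup>2 / \<Lambda> * \<bar>dt (v, v)\<bar> / v + 5 * \<kappa> / \<Lambda> * \<bar>Rd (v, v)\<bar> / v\<^sup>2" unfolding z_def by (rule elim(4))
        also have "\<dots> \<le> 9 * \<kappa>\<^sup>2 / \<Lambda> * (m * v\<^sup>2) / v + 5 * \<kappa> / \<Lambda> * (e1 * n * v) / v\<^sup>2"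
          using m Rv ahead(11,12) v by (intro add_mono divide_right_mono mult_left_mono) auto
        also have "\<dots> = 9 * \<kappa>\<^sup>2 / \<Lambda> * (m * v) + 5 * \<kappa> / \<Lambda> * (e1 * n / v)"
          using v by (simp add: power2_eq_square)
        also have "\<dots> \<le> Z * (m * v) + Z * (e1 * n / v)"
          unfolding Z_def using ahead(11,12) m0 n0 e1 v by (intro add_mono mult_right_mono) auto
        \<comment> \<open>|\<Delta>z| alone is bounded only by m v + \<open>e1\<close> n / v, which
          is singular, but in the final estimate it always comes with a factor v.\<close>
        finally have "v * z \<le> v * (Z * (m * v) + Z * (e1 * n / v))" using v by (intro mult_left_mono) auto
        also have "\<dots> = Z * m * v\<^sup>2 + Z * e1 * n" using v by (simp add: field_simps power2_eq_square)
        finally have vz: "v * z \<le> Z * m * v\<^sup>2 + Z * e1 * n" .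
        have z0: "0 \<le> z" by (simp add: z_def)
        define t where "t = \<bar>dt (v, v)\<bar>"
        have t: "0 \<le> t" "t \<le> m * v\<^sup>2" using m by (auto simp: t_def)
        have vsq: "v\<^sup>2 \<le> v" "v\<^sup>2 \<le> 1" using v by (auto simp: power2_eq_square mult_le_one mult_left_le)
        have "Cb * v\<^sup>2 * z \<le> Cb * (v * z)" using vsq Cb(1) z0 by (simp add: mult_right_mono)
        then have bm: "\<bar>dbm v\<bar> \<le> Cb * (v * z) + Cb * t" using elim(2) unfolding z_def t_def by linarith
        have am: "\<bar>dam v\<bar> \<le> (\<bar>aw0\<bar> + 1) * z + Ca * t"
        proof -
          have "\<bar>dam v\<bar> \<le> \<bar>aw0 * dz v\<bar> + \<bar>dam v - aw0 * dz v\<bar>" by linarith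
          then show ?thesis using elim(1) unfolding z_def t_def by (simp add: abs_mult algebra_simps)
        qed
        have "Cb * v\<^sup>2 * z \<le> Cb * z" using vsq Cb(1) z0 mult_right_mono[of "v\<^sup>2" 1 "Cb * z"] by (simp add: mult_ac)
        then have bm': "\<bar>dbm v\<bar> \<le> Cb * z + Cb * t" using elim(2) unfolding z_def t_def by linarith
        have "dS v \<le> n + n + ((\<bar>aw0\<bar> + 1) * z + Ca * t) + (Cb * z + Cb * t)"
          unfolding dS_def using nn am bm' by linarith
        then have "Cj * v * dS v \<le> Cj * v * (n + n + ((\<bar>aw0\<bar> + 1) * z + Ca * t) + (Cb * z + Cb * t))"
          using Cj(1) v by (intro mult_left_mono) auto
        also have "\<dots> = 2 * (Cj * v) * n + Cj * (\<bar>aw0\<bar> + 1 + Cb) * (v * z) + Cj * (Ca + Cb) * (v * t)"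
          by (simp add: algebra_simps)
        also have "\<dots> \<le> 2 * (e / 4) * n + Cj * (\<bar>aw0\<bar> + 1 + Cb) * (v * z) + Cj * (Ca + Cb) * t"
        proof (intro add_mono mult_right_mono mult_left_mono order_refl)
          show "v * t \<le> t" using v t mult_right_mono[of v 1 t] by simp
        qed (use v n0 z0 Cj(1) Ca(1) Cb(1) in auto)
        finally have j: "Cj * v * dS v \<le> e / 2 * n + Cj * (\<bar>aw0\<bar> + 1 + Cb) * (v * z) + Cj * (Ca + Cb) * t" by simp
        have "\<bar>db (v, v)\<bar> \<le> Cb * (v * z) + Cb * t + (e / 2 * n + Cj * (\<bar>aw0\<bar> + 1 + Cb) * (v * z) + Cj * (Ca + Cb) * t)"
          using elim(3) bm j by linarith
        also have "\<dots> = B * (v * z) + (Cb + Cj * (Ca + Cb)) * t + e / 2 * n" by (simp add: B_def algebra_simps)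
        also have "\<dots> \<le> B * (Z * m * v\<^sup>2 + Z * e1 * n) + (Cb + Cj * (Ca + Cb)) * (m * v\<^sup>2) + e / 2 * n"
          using vz t B Ca(1) Cb(1) Cj(1) by (intro add_mono mult_left_mono order_refl) auto
        also have "\<dots> = C * m * v\<^sup>2 + (B * Z * e1) * n + e / 2 * n" by (simp add: C_def algebra_simps)
        finally show "\<bar>db (v, v)\<bar> \<le> C * m * v\<^sup>2 + e * n" unfolding e1(2) by simp
      qed
    qed
  qed
  then show ?thesis using C by blast
qed

subsection \<open>The difference in the interior is controlled by the difference of the shock curves\<close>

text \<open>All differences at a maximum point are bounded by constants times m s^2 + n s, apart
  from a share n / 4 from \<open>db_diag\<close>. Here n is the maximum itself, so for small s the
  terms in n are absorbed. The equations for r are read as in \<open>tf_quadratic\<close>, with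
  \<Delta>t recovered from \<open>Pd\<close> and \<open>Rd\<close>.\<close>

lemma interior_bound:
  "\<exists>C>0. \<forall>\<^sub>F s in at_right 0. \<forall>m. (\<forall>v. 0 < v \<longrightarrow> v \<le> s \<longrightarrow> \<bar>dt (v, v)\<bar> \<le> m * v\<^sup>2) \<longrightarrow> hyp s (C * m * s\<^sup>2)"
proof -
  obtain Cd where Cd: "0 < Cd" "\<And>e. 0 < e \<Longrightarrow> \<forall>\<^sub>F v in at_right 0. \<forall>n m. hyp v n \<longrightarrow> \<bar>dt (v, v)\<bar> \<le> m * v\<^sup>2 \<longrightarrow> \<bar>db (v, v)\<bar> \<le> Cd * m * v\<^sup>2 + e * n"
    using db_diag by blast
  obtain Lm where Lm: "0 < Lm" "\<forall>\<^sub>F s in at_right 0. \<forall>n. hyp s n \<longrightarrow> (\<forall>x\<in>T_dom s. \<bar>S1.cmT x - S2.cmT x\<bar> \<le> Lm * n)"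
    using cmT_diff by blast
  obtain La where La: "0 < La" "\<forall>\<^sub>F s in at_right 0. \<forall>n. hyp s n \<longrightarrow> (\<forall>x\<in>T_dom s. \<bar>S1.AT x - S2.AT x\<bar> \<le> La * n)"
    using AT_diff by blast
  obtain Lb where Lb: "0 < Lb" "\<forall>\<^sub>F s in at_right 0. \<forall>n. hyp s n \<longrightarrow> (\<forall>x\<in>T_dom s. \<bar>S1.BT x - S2.BT x\<bar> \<le> Lb * n)"
    using BT_diff by blast
  obtain M where M: "0 < M" "\<forall>\<^sub>F s in at_right 0. \<forall>u u' v. (u, v) \<in> T_dom s \<longrightarrow> (u', v) \<in> T_dom s \<longrightarrow> \<bar>S1.cmT (u, v) - S1.cmT (u', v)\<bar> \<le> M * \<bar>u - u'\<bar>"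
    using S1.cmT_u by blast
  obtain Mb where Mb: "0 < Mb" "\<forall>\<^sub>F s in at_right 0. \<forall>u u' v. (u, v) \<in> T_dom s \<longrightarrow> (u', v) \<in> T_dom s \<longrightarrow> \<bar>S1.BT (u, v) - S1.BT (u', v)\<bar> \<le> Mb * \<bar>u - u'\<bar>"
    using S1.BT_u by blast
  define c0 where "c0 = cp0 - cm0"
  have c0: "0 < c0" and c0_eq: "cp0 = cm0 + c0" using cm0_less by (simp_all add: c0_def)
  have c04: "0 < c0 / 4" using c0 by simp
  define A0 B0 where "A0 = A_tilde F (alpha0 A) (beta0 A) (r0 A)" and "B0 = B_tilde F (alpha0 A) (beta0 A) (r0 A)"
  define K1 where "K1 = 2 * (2 + 2 * c0 + Lm + M) / c0"
  define K2 where "K2 = 1 + (\<bar>cp0\<bar> + c0) * K1"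
  define K3 where "K3 = (\<bar>A0\<bar> + 1) * K1 + (La + 1)"
  define K4 where "K4 = Cd + 2 * ((\<bar>B0\<bar> + 1) * K1) + (Lb + Mb)"
  define K where "K = K1 + K2 + K3 + K4"
  have K1: "0 < K1" using c0 Lm(1) M(1) by (simp add: K1_def add_pos_pos)
  have K2: "0 < K2" using K1 c0 by (simp add: K2_def add_pos_nonneg)
  have K3: "0 < K3" using K1 La(1) by (simp add: K3_def add_nonneg_pos)
  have K4: "0 < K4" using K1 Lb(1) Mb(1) Cd(1) by (simp add: K4_def add_pos_pos add_pos_nonneg)
  have K: "0 < K" using K1 K2 K3 K4 by (simp add: K_def)
  have quarter: "0 < (1/4::real)" by simp
  have sm: "0 < 1 / (4 * K)" using K by simp
  note near = S1.cpT_near[OF c04] S1.cmT_near[OF c04]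
    S1.G_near[OF S1.strict_diff_G(3) zero_less_one, unfolded S1.Q_def fst_conv snd_conv, folded S1.AT_def A0_def]
    S1.G_near[OF S1.strict_diff_G(4) zero_less_one, unfolded S1.Q_def fst_conv snd_conv, folded S1.BT_def B0_def]
  have "\<forall>\<^sub>F s in at_right 0. \<forall>m. (\<forall>v. 0 < v \<longrightarrow> v \<le> s \<longrightarrow> \<bar>dt (v, v)\<bar> \<le> m * v\<^sup>2) \<longrightarrow> hyp s (2 * K * m * s\<^sup>2)"
    using eventually_at_right_all_le[OF Cd(2)[OF quarter]] Lm(2) La(2) Lb(2) M(2) Mb(2) near Rd_small[OF zero_less_one]
      S1.AT_v[OF zero_less_one] T_small[OF S1.eps S2.T_cont(2)[OF S2.sol_facts(1)] zero_less_one]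
      T_small[OF S1.eps S2.T_cont(3)[OF S2.sol_facts(1)] zero_less_one]
      eventually_at_right_real[OF S1.eps] eventually_at_right_real[OF sm]
  proof eventually_elim
    case (elim s)
    have s: "0 < s" "s < eps" "K * s \<le> 1 / 4" using elim(15,16) K by (auto simp: field_simps)
    have sub: "T_dom s \<subseteq> T_dom eps" using s by (auto simp: T_dom_def)
    show ?case
    proof (intro allI impI)
      fix m assume m: "\<forall>v. 0 < v \<longrightarrow> v \<le> s \<longrightarrow> \<bar>dt (v, v)\<bar> \<le> m * v\<^sup>2"
      have "0 \<le> m * s\<^sup>2" using m s(1) by (meson abs_ge_zero order_refl order_trans)
      then have m0: "0 \<le> m" using s(1) by (simp add: zero_le_mult_iff)
      \<comment> \<open>The sum of the four differences is maximized, so that a single point carries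
        a bound for all of them on the whole triangle.\<close>
      define f where "f x = \<bar>dt x\<bar> + \<bar>dr x\<bar> + \<bar>da x\<bar> + \<bar>db x\<bar>" for x
      have "continuous_on (T_dom eps) f"
        unfolding f_def S_def
        by (intro continuous_intros S1.T_cont(1) S2.T_cont(1) S1.sol_facts(1-4) S2.sol_facts(1-4))
      then have "continuous_on (T_dom s) f" using sub by (rule continuous_on_subset)
      moreover have "(0, 0) \<in> T_dom s" using s by (simp add: T_dom_def)
      then have "T_dom s \<noteq> {}" by blast
      ultimately obtain x0 where x0: "x0 \<in> T_dom s" "\<And>x. x \<in> T_dom s \<Longrightarrow> f x \<le> f x0"
        using continuous_attains_sup[OF T_dom_compact, of s f] by blast
      define n where "n = f x0"
      have n: "hyp s n" unfolding hyp_def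
      proof
        fix x assume "x \<in> T_dom s"
        then have "f x \<le> n" using x0(2) by (simp add: n_def)
        then show "\<bar>dt x\<bar> \<le> n \<and> \<bar>dr x\<bar> \<le> n \<and> \<bar>da x\<bar> \<le> n \<and> \<bar>db x\<bar> \<le> n" unfolding f_def by linarith
      qed
      have n0: "0 \<le> n" using hyp_nonneg[OF n s(1)] .
      define P where "P = m * s\<^sup>2"
      define Z where "Z = P + n * s"
      have P: "0 \<le> P" using m0 by (simp add: P_def)
      have Z: "0 \<le> Z" "n * s \<le> Z" "P \<le> Z" using P n0 s by (auto simp: Z_def)
      obtain u v where uv: "x0 = (u, v)" by (cases x0)
      have uv': "0 \<le> v" "v \<le> u" "u \<le> s" "u < eps" using x0(1) s unfolding uv by (auto simp: T_dom_def)
      have T: "(u, v) \<in> T_dom s" "(v, v) \<in> T_dom s" "(u, 0) \<in> T_dom s" using uv' by (auto simp: T_dom_def)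
      have hseg: "(x, v) \<in> T_dom s" "(x, v) \<in> T_dom eps" if "x \<in> {v..u}" for x using that uv' by (auto simp: T_dom_def)
      have vseg: "(u, x) \<in> T_dom s" "(u, x) \<in> T_dom eps" if "x \<in> {0..v}" for x using that uv' by (auto simp: T_dom_def)
      have Du2: "\<bar>S2.Du tf2 x\<bar> \<le> 1" "\<bar>S2.Dv tf2 x\<bar> \<le> 1" if "x \<in> T_dom s" for x
        using elim(13,14) that S2.derivs_0(1,2) by (simp_all add: less_imp_le)
      have dtn: "\<bar>tf1 x - tf2 x\<bar> \<le> n" if "x \<in> T_dom s" for x using n that unfolding hyp_def dt_def by blast
      have su: "k * n * (u - v) \<le> k * Z" "k * n * v \<le> k * Z" if "0 \<le> k" for k
      proof -
        have "n * (u - v) \<le> n * s" "n * v \<le> n * s" using uv' n0 by (auto intro: mult_left_mono)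
        then have "n * (u - v) \<le> Z" "n * v \<le> Z" using Z by linarith+
        then show "k * n * (u - v) \<le> k * Z" "k * n * v \<le> k * Z" using that by (auto simp: mult.assoc intro: mult_left_mono)
      qed
      \<comment> \<open>The horizontal transport starts on the diagonal and is needed twice, for r
        with the speed \<open>cmT\<close> and for \<beta> with the source \<open>BT\<close>.\<close>
      have hor: "\<bar>(x1 (u, v) - x2 (u, v) - c1 (u, v) * dt (u, v)) - (x1 (v, v) - x2 (v, v) - c1 (v, v) * dt (v, v))\<bar> \<le> (L + M') * Z"
        if C: "C_upto 1 (T_dom eps) x1" "C_upto 1 (T_dom eps) x2" and L: "0 < L" "0 < M'"
          and d: "\<And>x. x \<in> T_dom eps \<Longrightarrow> S1.Du x1 x = S1.Du tf1 x * c1 x" "\<And>x. x \<in> T_dom eps \<Longrightarrow> S2.Du x2 x = S2.Du tf2 x * c2 x"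
          and c: "\<And>x. x \<in> T_dom s \<Longrightarrow> \<bar>c1 x - c2 x\<bar> \<le> L * n"
          and l: "\<And>x x' v. (x, v) \<in> T_dom s \<Longrightarrow> (x', v) \<in> T_dom s \<Longrightarrow> \<bar>c1 (x, v) - c1 (x', v)\<bar> \<le> M' * \<bar>x - x'\<bar>" for x1 x2 c1 c2 L M'
      proof -
        have "\<bar>(x1 (u, v) - x2 (u, v) - c1 (u, v) * (tf1 (u, v) - tf2 (u, v))) - (x1 (v, v) - x2 (v, v) - c1 (v, v) * (tf1 (v, v) - tf2 (v, v)))\<bar>
           \<le> (L + M') * n * u - (L + M') * n * v"
        proof (rule transport_bound[where ?x1.0 = "\<lambda>x. x1 (x, v)" and ?x2.0 = "\<lambda>x. x2 (x, v)" and ?t1.0 = "\<lambda>x. tf1 (x, v)" and ?t2.0 = "\<lambda>x. tf2 (x, v)"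
          and ?c1.0 = "\<lambda>x. c1 (x, v)" and ?c2.0 = "\<lambda>x. c2 (x, v)" and t1' = "\<lambda>x. S1.Du tf1 (x, v)" and t2' = "\<lambda>x. S2.Du tf2 (x, v)" and L = M'
          and G = "\<lambda>x. (L + M') * n * x" and G' = "\<lambda>x. (L + M') * n"])
          fix x assume x: "x \<in> {v..u}"
          note tu = T_u[OF S1.eps _ uv'(4,1) x]
          show "((\<lambda>x. tf1 (x, v)) has_real_derivative S1.Du tf1 (x, v)) (at x within {v..u})" by (rule tu[OF S1.sol_facts(1)])
          show "((\<lambda>x. tf2 (x, v)) has_real_derivative S2.Du tf2 (x, v)) (at x within {v..u})" by (rule tu[OF S2.sol_facts(1)])
          show "((\<lambda>x. x1 (x, v)) has_real_derivative c1 (x, v) * S1.Du tf1 (x, v)) (at x within {v..u})"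
            using tu[OF C(1)] d(1)[OF hseg(2)[OF x]] by (simp add: mult.commute)
          show "((\<lambda>x. x2 (x, v)) has_real_derivative c2 (x, v) * S2.Du tf2 (x, v)) (at x within {v..u})"
            using tu[OF C(2)] d(2)[OF hseg(2)[OF x]] by (simp add: mult.commute)
          have "\<bar>c1 (x, v) - c2 (x, v)\<bar> * \<bar>S2.Du tf2 (x, v)\<bar> \<le> (L * n) * 1"
            using c[OF hseg(1)[OF x]] Du2(1)[OF hseg(1)[OF x]] L n0 by (intro mult_mono) auto
          moreover have "M' * \<bar>tf1 (x, v) - tf2 (x, v)\<bar> \<le> M' * n" using dtn[OF hseg(1)[OF x]] L by (intro mult_left_mono) auto
          ultimately show "\<bar>c1 (x, v) - c2 (x, v)\<bar> * \<bar>S2.Du tf2 (x, v)\<bar> + M' * \<bar>tf1 (x, v) - tf2 (x, v)\<bar> \<le> (L + M') * n"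
            by (simp add: algebra_simps)
        next
          fix x x' assume "x \<in> {v..u}" "x' \<in> {v..u}"
          then show "\<bar>c1 (x', v) - c1 (x, v)\<bar> \<le> M' * \<bar>x' - x\<bar>" using l hseg(1) by blast
        qed (use uv' in \<open>auto intro!: derivative_eq_intros\<close>)
        moreover have "(L + M') * n * u - (L + M') * n * v \<le> (L + M') * Z"
          using su(1)[of "L + M'"] L by (simp add: right_diff_distrib)
        ultimately show ?thesis by (simp add: dt_def)
      qed
      have R: "\<bar>Rd (u, v)\<bar> \<le> Z" "\<bar>Rd (v, v)\<bar> \<le> Z"
      proof -
        have "\<bar>Rd (u, v)\<bar> \<le> 1 * n * u" "\<bar>Rd (v, v)\<bar> \<le> 1 * n * v" using elim(11) n T by blast+
        moreover have "n * u \<le> n * s" "n * v \<le> n * s" using uv' n0 by (auto intro: mult_left_mono)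
        ultimately show "\<bar>Rd (u, v)\<bar> \<le> Z" "\<bar>Rd (v, v)\<bar> \<le> Z" using Z by linarith+
      qed
      have dtd: "\<bar>dt (v, v)\<bar> \<le> m * v\<^sup>2"
        using m uv' d_0 by (cases "v = 0") auto
      also have "\<dots> \<le> P" unfolding P_def using m0 uv' by (intro mult_left_mono power_mono) auto
      finally have dtd': "\<bar>dt (v, v)\<bar> \<le> Z" using Z by linarith
      have cc: "\<bar>S1.cpT x - cp0\<bar> < c0 / 4" "\<bar>S1.cmT x - cm0\<bar> < c0 / 4" if "x \<in> T_dom s" for x
        using elim(7,8) that by auto
      have "\<bar>S1.cpT (v, v) - S1.cmT (v, v)\<bar> \<le> 2 * c0" using cc[OF T(2)] c0 c0_eq by linarith
      then have "\<bar>(S1.cpT (v, v) - S1.cmT (v, v)) * dt (v, v)\<bar> \<le> 2 * c0 * Z"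
        unfolding abs_mult using dtd' c0 by (intro mult_mono) auto
      moreover have "Pd (v, v) = Rd (v, v) + (S1.cpT (v, v) - S1.cmT (v, v)) * dt (v, v)"
        by (simp add: Pd_def Rd_def algebra_simps)
      ultimately have Pv: "\<bar>Pd (v, v)\<bar> \<le> Z + 2 * c0 * Z" using R(2) by linarith
      have "\<bar>(rf1 (u, v) - rf2 (u, v) - S1.cmT (u, v) * dt (u, v)) - (rf1 (v, v) - rf2 (v, v) - S1.cmT (v, v) * dt (v, v))\<bar> \<le> (Lm + M) * Z"
        by (rule hor[OF S1.sol_facts(2) S2.sol_facts(2) Lm(1) M(1) S1.sol_facts(9) S2.sol_facts(9)])
          (use elim(2,5) n in auto)
      then have "\<bar>Pd (u, v)\<bar> \<le> Z + 2 * c0 * Z + (Lm + M) * Z" using Pv unfolding Pd_def dr_def by linarith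
      moreover have "(S1.cpT (u, v) - S1.cmT (u, v)) * dt (u, v) = Pd (u, v) - Rd (u, v)"
        by (simp add: Pd_def Rd_def algebra_simps)
      ultimately have "\<bar>S1.cpT (u, v) - S1.cmT (u, v)\<bar> * \<bar>dt (u, v)\<bar> \<le> (2 + 2 * c0 + Lm + M) * Z"
        using R(1) unfolding abs_mult[symmetric] by (simp add: algebra_simps)
      moreover have "c0 / 2 * \<bar>dt (u, v)\<bar> \<le> \<bar>S1.cpT (u, v) - S1.cmT (u, v)\<bar> * \<bar>dt (u, v)\<bar>"
      proof (intro mult_right_mono)
        show "c0 / 2 \<le> \<bar>S1.cpT (u, v) - S1.cmT (u, v)\<bar>" using cc[OF T(1)] c0_eq by linarith
      qed simp
      ultimately have "c0 / 2 * \<bar>dt (u, v)\<bar> \<le> (2 + 2 * c0 + Lm + M) * Z" by linarith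
      then have b1: "\<bar>dt (u, v)\<bar> \<le> K1 * Z" using c0 by (simp add: K1_def field_simps)
      have "\<bar>S1.cpT (u, v)\<bar> \<le> \<bar>cp0\<bar> + c0" using cc(1)[OF T(1)] c0 by linarith
      then have "\<bar>S1.cpT (u, v) * dt (u, v)\<bar> \<le> (\<bar>cp0\<bar> + c0) * (K1 * Z)"
        unfolding abs_mult using b1 c0 by (intro mult_mono) auto
      moreover have "dr (u, v) = Rd (u, v) + S1.cpT (u, v) * dt (u, v)" by (simp add: Rd_def)
      ultimately have b2: "\<bar>dr (u, v)\<bar> \<le> K2 * Z" using R(1) by (simp add: K2_def algebra_simps)
      have "\<bar>(af1 (u, v) - af2 (u, v) - S1.AT (u, v) * (tf1 (u, v) - tf2 (u, v))) - (af1 (u, 0) - af2 (u, 0) - S1.AT (u, 0) * (tf1 (u, 0) - tf2 (u, 0)))\<bar>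
           \<le> (La + 1) * n * v - (La + 1) * n * 0"
      proof (rule transport_bound[where ?x1.0 = "\<lambda>x. af1 (u, x)" and ?x2.0 = "\<lambda>x. af2 (u, x)" and ?t1.0 = "\<lambda>x. tf1 (u, x)" and ?t2.0 = "\<lambda>x. tf2 (u, x)"
          and ?c1.0 = "\<lambda>x. S1.AT (u, x)" and ?c2.0 = "\<lambda>x. S2.AT (u, x)" and t1' = "\<lambda>x. S1.Dv tf1 (u, x)" and t2' = "\<lambda>x. S2.Dv tf2 (u, x)" and L = 1
          and G = "\<lambda>x. (La + 1) * n * x" and G' = "\<lambda>x. (La + 1) * n"])
        fix x assume x: "x \<in> {0..v}"
        note tv = T_v_sub[OF S1.eps _ uv'(4) x uv'(2)]
        show "((\<lambda>x. tf1 (u, x)) has_real_derivative S1.Dv tf1 (u, x)) (at x within {0..v})" by (rule tv[OF S1.sol_facts(1)])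
        show "((\<lambda>x. tf2 (u, x)) has_real_derivative S2.Dv tf2 (u, x)) (at x within {0..v})" by (rule tv[OF S2.sol_facts(1)])
        show "((\<lambda>x. af1 (u, x)) has_real_derivative S1.AT (u, x) * S1.Dv tf1 (u, x)) (at x within {0..v})"
          using tv[OF S1.sol_facts(3)] S1.sol_facts(6)[OF vseg(2)[OF x]] by (simp add: mult.commute)
        show "((\<lambda>x. af2 (u, x)) has_real_derivative S2.AT (u, x) * S2.Dv tf2 (u, x)) (at x within {0..v})"
          using tv[OF S2.sol_facts(3)] S2.sol_facts(6)[OF vseg(2)[OF x]] by (simp add: mult.commute)
        have "\<bar>S1.AT (u, x) - S2.AT (u, x)\<bar> * \<bar>S2.Dv tf2 (u, x)\<bar> \<le> (La * n) * 1"
          using elim(3) n Du2(2)[OF vseg(1)[OF x]] vseg(1)[OF x] La(1) n0 by (intro mult_mono) auto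
        then show "\<bar>S1.AT (u, x) - S2.AT (u, x)\<bar> * \<bar>S2.Dv tf2 (u, x)\<bar> + 1 * \<bar>tf1 (u, x) - tf2 (u, x)\<bar> \<le> (La + 1) * n"
          using dtn[OF vseg(1)[OF x]] by (simp add: algebra_simps)
      next
        fix x x' assume "x \<in> {0..v}" "x' \<in> {0..v}"
        then show "\<bar>S1.AT (u, x') - S1.AT (u, x)\<bar> \<le> 1 * \<bar>x' - x\<bar>" using elim(12) vseg(1) by blast
      qed (use uv' in \<open>auto intro!: derivative_eq_intros\<close>)
      moreover have "af1 (u, 0) = af2 (u, 0)" "tf1 (u, 0) = tf2 (u, 0)"
        using S1.sol_facts(11,12)[of u] S2.sol_facts(11,12)[of u] uv' by simp_all
      ultimately have a1: "\<bar>da (u, v) - S1.AT (u, v) * dt (u, v)\<bar> \<le> (La + 1) * Z"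
        using order_trans[OF _ su(2)[of "La + 1"]] La(1) by (simp add: S_def)
      have "\<bar>S1.AT (u, v) - A0\<bar> < 1" using elim(9) T(1) by auto
      then have "\<bar>S1.AT (u, v)\<bar> \<le> \<bar>A0\<bar> + 1" by linarith
      then have "\<bar>S1.AT (u, v) * dt (u, v)\<bar> \<le> (\<bar>A0\<bar> + 1) * (K1 * Z)"
        unfolding abs_mult using b1 by (intro mult_mono) auto
      then have "\<bar>da (u, v)\<bar> \<le> (\<bar>A0\<bar> + 1) * (K1 * Z) + (La + 1) * Z" using a1 by linarith
      also have "\<dots> = K3 * Z" by (simp add: K3_def algebra_simps)
      finally have b3: "\<bar>da (u, v)\<bar> \<le> K3 * Z" .
      have h4: "\<bar>(bf1 (u, v) - bf2 (u, v) - S1.BT (u, v) * dt (u, v)) - (bf1 (v, v) - bf2 (v, v) - S1.BT (v, v) * dt (v, v))\<bar> \<le> (Lb + Mb) * Z"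
        by (rule hor[OF S1.sol_facts(4) S2.sol_facts(4) Lb(1) Mb(1) S1.sol_facts(7) S2.sol_facts(7)])
          (use elim(4,6) n in auto)
      have BB: "\<bar>S1.BT x\<bar> \<le> \<bar>B0\<bar> + 1" if "x \<in> T_dom s" for x
      proof -
        have "\<bar>S1.BT x - B0\<bar> < 1" using elim(10) that by auto
        then show ?thesis by linarith
      qed
      have K1Z: "\<bar>dt (v, v)\<bar> \<le> K1 * Z"
      proof -
        have "1 \<le> K1" using c0 Lm(1) M(1) by (simp add: K1_def field_simps)
        then have "1 * Z \<le> K1 * Z" using Z by (intro mult_right_mono) auto
        then show ?thesis using dtd' by linarith
      qed
      have Bd: "\<bar>S1.BT (u, v) * dt (u, v)\<bar> \<le> (\<bar>B0\<bar> + 1) * (K1 * Z)" "\<bar>S1.BT (v, v) * dt (v, v)\<bar> \<le> (\<bar>B0\<bar> + 1) * (K1 * Z)"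
        unfolding abs_mult using b1 K1Z BB[OF T(1)] BB[OF T(2)] by (auto intro!: mult_mono)
      have dbd: "\<bar>db (v, v)\<bar> \<le> Cd * Z + 1 / 4 * n"
      proof (cases "v = 0")
        case True
        then show ?thesis using d_0 Cd(1) Z n0 by simp
      next
        case False
        then have "0 < v" "v \<le> s" using uv' by auto
        then have "\<bar>db (v, v)\<bar> \<le> Cd * m * v\<^sup>2 + 1 / 4 * n"
          using elim(1) hyp_mono[OF n \<open>v \<le> s\<close>] dtd by blast
        moreover have "Cd * m * v\<^sup>2 \<le> Cd * m * s\<^sup>2" using uv' Cd(1) m0 by (intro mult_left_mono power_mono) auto
        moreover have "Cd * m * s\<^sup>2 \<le> Cd * Z" unfolding mult.assoc P_def[symmetric] using Z Cd(1) by (intro mult_left_mono) auto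
        ultimately show ?thesis by linarith
      qed
      have "\<bar>db (u, v)\<bar> \<le> (Cd * Z + 1 / 4 * n) + 2 * ((\<bar>B0\<bar> + 1) * (K1 * Z)) + (Lb + Mb) * Z"
        using h4 Bd dbd unfolding db_def by linarith
      also have "\<dots> = K4 * Z + 1 / 4 * n" by (simp add: K4_def algebra_simps)
      finally have b4: "\<bar>db (u, v)\<bar> \<le> K4 * Z + 1 / 4 * n" .
      have "n \<le> K1 * Z + K2 * Z + K3 * Z + (K4 * Z + 1 / 4 * n)"
        unfolding n_def uv f_def using b1 b2 b3 b4 by (simp add: n_def uv f_def)
      also have "\<dots> = K * Z + 1 / 4 * n" by (simp add: K_def algebra_simps)
      \<comment> \<open>Half of \<open>n\<close> is absorbed: one quarter comes from \<beta> on the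
        diagonal, one quarter from K s \<le> 1/4. This is where the factor 2 in the final constant
        comes from.\<close>
      also have "K * Z = K * P + (K * s) * n" by (simp add: Z_def algebra_simps)
      also have "\<dots> \<le> K * P + 1 / 4 * n" using s(3) n0 by (intro add_left_mono mult_right_mono) auto
      finally have "n \<le> 2 * (K * P)" by simp
      then have "n \<le> 2 * K * m * s\<^sup>2" by (simp add: P_def)
      then show "hyp s (2 * K * m * s\<^sup>2)" using n unfolding hyp_def by fastforce
    qed
  qed
  then show ?thesis using K by (intro exI[of _ "2 * K"]) auto
qed

subsection \<open>The contraction\<close>

text \<open>By \<open>strict_deriv_shock_speed\<close> the variation of V is half of
  \<open>Dc\<close> applied to the sum of the variations of the two states. The dominant part is
  that of \<alpha> ahead, \<open>aw0\<close> \<Delta>z, and \<open>Dc (1, 0)\<close> times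
  \<open>aw0\<close> is \<kappa>; hence the leading constant 1/2.\<close>

lemma speed_difference:
  "\<exists>C>0. \<forall>\<^sub>F v in at_right 0. \<bar>S1.Vs v - S2.Vs v\<bar> \<le> 6 / 10 * \<kappa> * \<bar>dz v\<bar> + C * (\<bar>dt (v, v)\<bar> + \<bar>da (v, v)\<bar> + \<bar>db (v, v)\<bar>)"
proof -
  define p q where "p = \<bar>Dc (1, 0)\<bar>" and "q = \<bar>Dc (0, 1)\<bar>"
  have pq: "0 \<le> p" "0 \<le> q" by (auto simp: p_def q_def)
  have paw: "p * \<bar>aw0\<bar> = \<kappa>" using arg_cong[OF kappa_alpha, of abs] ahead(11) by (simp add: p_def abs_mult)
  obtain Ca where Ca: "0 < Ca" "\<And>e. 0 < e \<Longrightarrow> \<forall>\<^sub>F v in at_right 0. \<bar>dam v - aw0 * dz v\<bar> \<le> e * \<bar>dz v\<bar> + Ca * \<bar>dt (v, v)\<bar>"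
    using dam_bound by blast
  obtain Cb where Cb: "0 < Cb" "\<forall>\<^sub>F v in at_right 0. \<bar>dbm v\<bar> \<le> Cb * v\<^sup>2 * \<bar>dz v\<bar> + Cb * \<bar>dt (v, v)\<bar>"
    using dbm_bound by blast
  define e where "e = min 1 (\<kappa> / (20 * (p + 1)))"
  have e: "0 < e" "e \<le> 1" "p * e \<le> \<kappa> / 20"
  proof -
    show "0 < e" "e \<le> 1" using ahead(11) pq by (auto simp: e_def)
    have "p * e \<le> (p + 1) * (\<kappa> / (20 * (p + 1)))" using pq ahead(11) by (intro mult_mono) (auto simp: e_def)
    also have "\<dots> = \<kappa> / 20" using pq add_nonneg_pos[OF pq(1) zero_less_one] by (simp only: times_divide_eq_right) (simp add: divide_simps)
    finally show "p * e \<le> \<kappa> / 20" .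
  qed
  define e' where "e' = \<kappa> / (40 * (\<bar>aw0\<bar> + 2))"
  have e': "0 < e'" "e' * (\<bar>aw0\<bar> + 2) = \<kappa> / 40"
  proof -
    have "0 < \<bar>aw0\<bar> + 2" by linarith
    then show "0 < e'" "e' * (\<bar>aw0\<bar> + 2) = \<kappa> / 40"
      using ahead(11) unfolding e'_def by (simp_all only: zero_less_divide_iff) (simp_all add: divide_simps)
  qed
  obtain d where d: "0 < d" "\<And>y z. norm (y - (U0, U0)) < d \<Longrightarrow> norm (z - (U0, U0)) < d \<Longrightarrow>
      norm (shock_speed (fst y) (snd y) - shock_speed (fst z) (snd z) - Dc (fst (y - z) + snd (y - z)) / 2) \<le> e' * norm (y - z)"
    using strict_derivD[OF strict_deriv_shock_speed[OF U0_J Dc] e'(1)] by (metis UNIV_I)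
  obtain C1 where C1: "0 < C1" "\<forall>\<^sub>F v in at_right 0. norm (S1.Up v - U0) \<le> C1 * v \<and> norm (S1.Um v - U0) \<le> C1 * v"
    using S1.states_bound by blast
  obtain C2 where C2: "0 < C2" "\<forall>\<^sub>F v in at_right 0. norm (S2.Up v - U0) \<le> C2 * v \<and> norm (S2.Um v - U0) \<le> C2 * v"
    using S2.states_bound by blast
  have d1: "0 < d / (2 * C1)" "0 < d / (2 * C2)" using d(1) C1(1) C2(1) by auto
  have sm: "0 < min 1 (min (1 / Cb) (\<kappa> / (20 * (q * Cb + 1))))" using Cb(1) ahead(11) pq by (simp add: add_nonneg_pos)
  define C where "C = p * (1 + Ca) + q * (1 + Cb) + e' * (1 + Ca + Cb)"
  have C: "0 < C" using e'(1) Ca(1) Cb(1) pq by (simp add: C_def add_nonneg_pos)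
  have "\<forall>\<^sub>F v in at_right 0. \<bar>S1.Vs v - S2.Vs v\<bar> \<le> 6 / 10 * \<kappa> * \<bar>dz v\<bar> + C * (\<bar>dt (v, v)\<bar> + \<bar>da (v, v)\<bar> + \<bar>db (v, v)\<bar>)"
    using Ca(2)[OF e(1)] Cb(2) C1(2) C2(2) eventually_at_right_real[OF d1(1)] eventually_at_right_real[OF d1(2)] eventually_at_right_real[OF sm]
  proof eventually_elim
    case (elim v)
    have v: "0 < v" "v < 1" "v < 1 / Cb" "v < \<kappa> / (20 * (q * Cb + 1))" using elim(7) by auto
    have vsq: "v\<^sup>2 \<le> v" using v by (simp add: power2_eq_square mult_left_le)
    have n1: "norm ((S1.Up v, S1.Um v) - (U0, U0)) < d"
    proof -
      have "norm ((S1.Up v, S1.Um v) - (U0, U0)) \<le> 2 * C1 * v"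
        using norm_Pair_le[of "S1.Up v - U0" "S1.Um v - U0"] elim(3) by simp
      also have "\<dots> < d" using elim(5) C1(1) by (simp add: field_simps)
      finally show ?thesis .
    qed
    have n2: "norm ((S2.Up v, S2.Um v) - (U0, U0)) < d"
    proof -
      have "norm ((S2.Up v, S2.Um v) - (U0, U0)) \<le> 2 * C2 * v"
        using norm_Pair_le[of "S2.Up v - U0" "S2.Um v - U0"] elim(4) by simp
      also have "\<dots> < d" using elim(6) C2(1) by (simp add: field_simps)
      finally show ?thesis .
    qed
    define z t where "z = \<bar>dz v\<bar>" and "t = \<bar>dt (v, v)\<bar>"
    define x y where "x = \<bar>da (v, v)\<bar>" and "y = \<bar>db (v, v)\<bar>"
    have nn: "0 \<le> z" "0 \<le> t" "0 \<le> x" "0 \<le> y" by (auto simp: z_def t_def x_def y_def)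
    have am: "\<bar>dam v\<bar> \<le> (\<bar>aw0\<bar> + e) * z + Ca * t"
    proof -
      have "\<bar>dam v\<bar> \<le> \<bar>aw0 * dz v\<bar> + \<bar>dam v - aw0 * dz v\<bar>" by linarith
      then show ?thesis using elim(1) unfolding z_def t_def by (simp add: abs_mult algebra_simps)
    qed
    have bm: "\<bar>dbm v\<bar> \<le> Cb * v\<^sup>2 * z + Cb * t" using elim(2) unfolding z_def t_def by simp
    have "Cb * v\<^sup>2 \<le> Cb * v" using vsq Cb(1) by simp
    also have "\<dots> \<le> 1" using v Cb(1) by (simp add: field_simps)
    finally have cb1: "Cb * v\<^sup>2 \<le> 1" .
    have "q * (Cb * v\<^sup>2) \<le> (q * Cb + 1) * v"
    proof -
      have "q * (Cb * v\<^sup>2) \<le> q * (Cb * v)" using vsq Cb(1) pq by (intro mult_left_mono) auto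
      then show ?thesis using v by (simp add: algebra_simps)
    qed
    also have "\<dots> \<le> \<kappa> / 20"
    proof -
      have "0 < 20 * (q * Cb + 1)" using pq Cb(1) by (simp add: add_nonneg_pos)
      with v(4) have "v * (20 * (q * Cb + 1)) < \<kappa>" by (simp only: pos_less_divide_eq)
      then show ?thesis by (simp add: algebra_simps)
    qed
    finally have qb: "q * (Cb * v\<^sup>2) \<le> \<kappa> / 20" .
    have dif: "fst ((S1.Up v, S1.Um v) - (S2.Up v, S2.Um v)) + snd ((S1.Up v, S1.Um v) - (S2.Up v, S2.Um v)) = (da (v, v) + dam v, db (v, v) + dbm v)"
      by (simp add: S1.Up_def S2.Up_def S1.Um_def S2.Um_def S_def)
    have "norm (S1.Vs v - S2.Vs v - Dc (da (v, v) + dam v, db (v, v) + dbm v) / 2) \<le> e' * norm ((S1.Up v, S1.Um v) - (S2.Up v, S2.Um v))"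
      using d(2)[OF n1 n2] unfolding dif by (simp add: S1.Vs_def S2.Vs_def)
    also have "\<dots> \<le> e' * dS v" using dS_norm e'(1) by (intro mult_left_mono) auto
    finally have main: "\<bar>S1.Vs v - S2.Vs v - Dc (da (v, v) + dam v, db (v, v) + dbm v) / 2\<bar> \<le> e' * dS v" by simp
    have "\<bar>Dc (da (v, v) + dam v, db (v, v) + dbm v)\<bar> = \<bar>Dc (1, 0) * (da (v, v) + dam v) + Dc (0, 1) * (db (v, v) + dbm v)\<bar>"
      by (subst Dc_eq) simp
    also have "\<dots> \<le> p * \<bar>da (v, v) + dam v\<bar> + q * \<bar>db (v, v) + dbm v\<bar>"
      unfolding p_def q_def abs_mult[symmetric] by (rule abs_triangle_ineq)
    also have "\<dots> \<le> p * (x + ((\<bar>aw0\<bar> + e) * z + Ca * t)) + q * (y + (Cb * v\<^sup>2 * z + Cb * t))"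
    proof (intro add_mono mult_left_mono pq)
      show "\<bar>da (v, v) + dam v\<bar> \<le> x + ((\<bar>aw0\<bar> + e) * z + Ca * t)" using am unfolding x_def by linarith
      show "\<bar>db (v, v) + dbm v\<bar> \<le> y + (Cb * v\<^sup>2 * z + Cb * t)" using bm unfolding y_def by linarith
    qed
    also have "\<dots> = (p * \<bar>aw0\<bar> + p * e + q * (Cb * v\<^sup>2)) * z + p * x + q * y + (p * Ca + q * Cb) * t"
      by (simp add: algebra_simps)
    also have "\<dots> \<le> (\<kappa> + \<kappa> / 20 + \<kappa> / 20) * z + p * x + q * y + (p * Ca + q * Cb) * t"
      unfolding paw using e(3) qb nn by (intro add_mono mult_right_mono order_refl) auto
    finally have D: "\<bar>Dc (da (v, v) + dam v, db (v, v) + dbm v)\<bar> \<le> (\<kappa> + \<kappa> / 20 + \<kappa> / 20) * z + p * x + q * y + (p * Ca + q * Cb) * t" .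
    have "dS v \<le> x + y + ((\<bar>aw0\<bar> + 1) * z + Ca * t) + (1 * z + Cb * t)"
    proof -
      have "(\<bar>aw0\<bar> + e) * z \<le> (\<bar>aw0\<bar> + 1) * z" "Cb * v\<^sup>2 * z \<le> 1 * z"
        using e nn cb1 by (intro mult_right_mono; simp)+
      then show ?thesis unfolding dS_def x_def y_def using am bm by linarith
    qed
    then have "e' * dS v \<le> e' * (x + y + ((\<bar>aw0\<bar> + 1) * z + Ca * t) + (1 * z + Cb * t))" using e'(1) by (intro mult_left_mono) auto
    also have "\<dots> = (e' * (\<bar>aw0\<bar> + 2)) * z + e' * x + e' * y + e' * (Ca + Cb) * t" by (simp add: algebra_simps)
    finally have S: "e' * dS v \<le> \<kappa> / 40 * z + e' * x + e' * y + e' * (Ca + Cb) * t" unfolding e'(2) .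
    have "\<bar>S1.Vs v - S2.Vs v\<bar> \<le> \<bar>Dc (da (v, v) + dam v, db (v, v) + dbm v)\<bar> / 2 + e' * dS v" using main by linarith
    also have "\<dots> \<le> ((\<kappa> + \<kappa> / 20 + \<kappa> / 20) * z + p * x + q * y + (p * Ca + q * Cb) * t) / 2 + (\<kappa> / 40 * z + e' * x + e' * y + e' * (Ca + Cb) * t)"
      using D S by (intro add_mono divide_right_mono) auto
    \<comment> \<open>The coefficient is (1 + 1/20 + 1/20) / 2 + 1/40: the leading 1/2, the errors
      of \<alpha> and \<beta> ahead, and the strict remainder.\<close>
    also have "\<dots> = 23 / 40 * (\<kappa> * z) + (p / 2 + e') * x + (q / 2 + e') * y + ((p * Ca + q * Cb) / 2 + e' * (Ca + Cb)) * t"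
      by (simp add: field_simps)
    also have "\<dots> \<le> 6 / 10 * (\<kappa> * z) + C * x + C * y + C * t"
    proof (intro add_mono mult_right_mono nn)
      have "0 \<le> p * Ca" "0 \<le> q * Cb" "0 \<le> e' * Ca" "0 \<le> e' * Cb" using pq Ca(1) Cb(1) e'(1) by auto
      moreover have "C = p + p * Ca + q + q * Cb + e' + e' * Ca + e' * Cb" by (simp add: C_def algebra_simps)
      moreover have "(p * Ca + q * Cb) / 2 + e' * (Ca + Cb) = 1 / 2 * (p * Ca) + 1 / 2 * (q * Cb) + e' * Ca + e' * Cb"
        by (simp add: algebra_simps add_divide_distrib)
      ultimately show "p / 2 + e' \<le> C" "q / 2 + e' \<le> C" "(p * Ca + q * Cb) / 2 + e' * (Ca + Cb) \<le> C"
        using pq e'(1) by auto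
    qed (use ahead(11) nn in auto)
    finally show ?case unfolding z_def x_def y_def t_def by (simp add: algebra_simps)
  qed
  then show ?thesis using C by blast
qed

text \<open>
  The leading constants are \<open>6\<close> in place of \<open>9\<close> in \<open>dz_bound\<close>, \<open>1/2\<close> in place of \<open>6/10\<close> in \<open>speed_difference\<close>
  and \<open>1/3\<close> in place of \<open>9/10\<close> here; the difference leaves room for the error terms.
\<close>
lemma contraction:
  "\<forall>\<^sub>F s in at_right 0. \<forall>m. (\<forall>v. 0 < v \<longrightarrow> v \<le> s \<longrightarrow> \<bar>dt (v, v)\<bar> \<le> m * v\<^sup>2) \<longrightarrow>
     (\<forall>v. 0 < v \<longrightarrow> v \<le> s \<longrightarrow> \<bar>dt (v, v)\<bar> \<le> 9 / 10 * m * v\<^sup>2)"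
proof -
  obtain Cn where Cn: "0 < Cn" "\<forall>\<^sub>F s in at_right 0. \<forall>m. (\<forall>v. 0 < v \<longrightarrow> v \<le> s \<longrightarrow> \<bar>dt (v, v)\<bar> \<le> m * v\<^sup>2) \<longrightarrow> hyp s (Cn * m * s\<^sup>2)"
    using interior_bound by blast
  obtain Cv where Cv: "0 < Cv" "\<forall>\<^sub>F v in at_right 0. \<bar>S1.Vs v - S2.Vs v\<bar> \<le> 6 / 10 * \<kappa> * \<bar>dz v\<bar> + Cv * (\<bar>dt (v, v)\<bar> + \<bar>da (v, v)\<bar> + \<bar>db (v, v)\<bar>)"
    using speed_difference by blast
  \<comment> \<open>Since the interior differences are bounded by \<open>Cn\<close> m v^2, this
    choice makes |\<open>Rd\<close>| at most \<kappa>/100 m v^3 on the diagonal.\<close>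
  define e where "e = \<kappa> / (100 * Cn)"
  have e: "0 < e" "e * Cn = \<kappa> / 100" using Cn(1) ahead(11) by (auto simp: e_def)
  define c where "c = \<kappa> ^ 3 / \<Lambda>"
  have c: "0 < c" using ahead by (simp add: c_def)
  have k20: "0 < \<kappa> / 20" using ahead by simp
  have sm: "0 < c / (50 * (Cv * (1 + 2 * Cn)))" using c Cv(1) Cn(1) by simp
  have small_v: "\<forall>\<^sub>F v in at_right 0. 0 < v \<and> v < c / (50 * (Cv * (1 + 2 * Cn)))"
    using eventually_at_right_real[OF sm] by eventually_elim auto
  show ?thesis
    using eventually_at_right_all_le[OF Cn(2)] eventually_at_right_all_le[OF Cv(2)] eventually_at_right_all_le[OF dz_bound]
      eventually_at_right_all_le[OF Rd_small[OF e(1)]] eventually_at_right_all_le[OF S2.ft_bound]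
      eventually_at_right_all_le[OF S1.shock_relations] eventually_at_right_all_le[OF S2.shock_relations]
      eventually_at_right_all_le[OF S1.speed_gap] S1.Vs_lipschitz[OF k20] eventually_at_right_all_le[OF small_v]
      eventually_at_right_real[OF S1.eps]
  proof eventually_elim
    case (elim s)
    have s: "0 < s" "s < eps" using elim(11) by auto
    show ?case
    proof (rule allI, rule impI)
      fix m assume m: "\<forall>v. 0 < v \<longrightarrow> v \<le> s \<longrightarrow> \<bar>dt (v, v)\<bar> \<le> m * v\<^sup>2"
      have "0 \<le> m * s\<^sup>2" using m s(1) by (meson abs_ge_zero order_refl order_trans)
      then have m0: "0 \<le> m" using s(1) by (simp add: zero_le_mult_iff)
      have R: "\<bar>Rd (v, v)\<bar> \<le> \<kappa> / 100 * m * v ^ 3" and hn: "hyp v (Cn * m * v\<^sup>2)" if v: "0 < v" "v \<le> s" for v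
      proof -
        show hn: "hyp v (Cn * m * v\<^sup>2)" using elim(1) m v by (meson order_trans)
        have "(v, v) \<in> T_dom v" using v by (simp add: T_dom_def)
        then have "\<bar>Rd (v, v)\<bar> \<le> e * (Cn * m * v\<^sup>2) * v" using elim(4) v hn by blast
        also have "\<dots> = (e * Cn) * m * v ^ 3" by (simp add: power3_eq_cube power2_eq_square)
        finally show "\<bar>Rd (v, v)\<bar> \<le> \<kappa> / 100 * m * v ^ 3" unfolding e(2) .
      qed
      \<comment> \<open>This is the integrand in the transport along the shock. Numerically 9 +
        5/100 = 181/20 bounds \<Delta>z, 6/10 of that plus 1/50 is below 55/10, and 55/10 times
        35/100 plus 1/20 is below 2, all in units of \<kappa>, \<Lambda>, m and powers of v.\<close>
      have speed: "\<bar>S1.Vs v - S2.Vs v\<bar> * \<bar>S2.ft v\<bar> + \<kappa> / 20 * \<bar>dt (v, v)\<bar> \<le> 2 * \<kappa> * m * v\<^sup>2" if v: "0 < v" "v \<le> s" for v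
      proof -
        have t: "\<bar>dt (v, v)\<bar> \<le> m * v\<^sup>2" using m v by blast
        have "(v, v) \<in> T_dom v" using v by (simp add: T_dom_def)
        then have ab: "\<bar>da (v, v)\<bar> \<le> Cn * m * v\<^sup>2" "\<bar>db (v, v)\<bar> \<le> Cn * m * v\<^sup>2" using hn[OF v] unfolding hyp_def by auto
        have "\<bar>dz v\<bar> \<le> 9 * \<kappa>\<^sup>2 / \<Lambda> * \<bar>dt (v, v)\<bar> / v + 5 * \<kappa> / \<Lambda> * \<bar>Rd (v, v)\<bar> / v\<^sup>2" using elim(3) v by blast
        also have "\<dots> \<le> 9 * \<kappa>\<^sup>2 / \<Lambda> * (m * v\<^sup>2) / v + 5 * \<kappa> / \<Lambda> * (\<kappa> / 100 * m * v ^ 3) / v\<^sup>2"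
          using t R[OF v] ahead(11,12) v by (intro add_mono divide_right_mono mult_left_mono) auto
        also have "\<dots> = (181 / 20) * (\<kappa>\<^sup>2 / \<Lambda>) * m * v"
          using v ahead(12) by (simp add: power2_eq_square power3_eq_cube field_simps)
        finally have "\<kappa> * \<bar>dz v\<bar> \<le> \<kappa> * ((181 / 20) * (\<kappa>\<^sup>2 / \<Lambda>) * m * v)" using ahead(11) by (intro mult_left_mono) auto
        also have "\<dots> = 181 / 20 * (c * m * v)" by (simp add: c_def power2_eq_square power3_eq_cube)
        finally have z: "\<kappa> * \<bar>dz v\<bar> \<le> 181 / 20 * (c * m * v)" .
        \<comment> \<open>These contributions are of order m v^2, one power of v smaller than
          \<Delta>z, so they cost only a small fraction for small v.\<close>
        have "Cv * (\<bar>dt (v, v)\<bar> + \<bar>da (v, v)\<bar> + \<bar>db (v, v)\<bar>) \<le> Cv * (m * v\<^sup>2 + Cn * m * v\<^sup>2 + Cn * m * v\<^sup>2)"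
          using t ab Cv(1) by (intro mult_left_mono add_mono) auto
        also have "\<dots> = (Cv * (1 + 2 * Cn) * v) * (m * v)" by (simp add: algebra_simps power2_eq_square)
        also have "\<dots> \<le> (c / 50) * (m * v)"
        proof (intro mult_right_mono)
          have "v < c / (50 * (Cv * (1 + 2 * Cn)))" using elim(10) v by blast
          then show "Cv * (1 + 2 * Cn) * v \<le> c / 50" using Cv(1) Cn(1) by (simp add: pos_less_divide_eq mult_ac)
        qed (use m0 v in auto)
        finally have r: "Cv * (\<bar>dt (v, v)\<bar> + \<bar>da (v, v)\<bar> + \<bar>db (v, v)\<bar>) \<le> 1 / 50 * (c * m * v)" by simp
        have "\<bar>S1.Vs v - S2.Vs v\<bar> \<le> 6 / 10 * \<kappa> * \<bar>dz v\<bar> + Cv * (\<bar>dt (v, v)\<bar> + \<bar>da (v, v)\<bar> + \<bar>db (v, v)\<bar>)" using elim(2) v by blast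
        moreover have "6 / 10 * \<kappa> * \<bar>dz v\<bar> = 6 / 10 * (\<kappa> * \<bar>dz v\<bar>)" by simp
        moreover have "0 \<le> c * m * v" using c m0 v by simp
        ultimately have V: "\<bar>S1.Vs v - S2.Vs v\<bar> \<le> 55 / 10 * (c * m * v)" using z r by linarith
        have "\<bar>S1.Vs v - S2.Vs v\<bar> * \<bar>S2.ft v\<bar> \<le> (55 / 10 * (c * m * v)) * (35 / 100 * \<Lambda> / \<kappa>\<^sup>2 * v)"
        proof (intro mult_mono V)
          show "\<bar>S2.ft v\<bar> \<le> 35 / 100 * \<Lambda> / \<kappa>\<^sup>2 * v" using elim(5) v by blast
        qed (use \<open>0 \<le> c * m * v\<close> in auto)
        also have "\<dots> = 1925 / 1000 * (\<kappa> * m * v\<^sup>2)"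
          using ahead(11,12) by (simp add: c_def power2_eq_square power3_eq_cube)
        finally have 1: "\<bar>S1.Vs v - S2.Vs v\<bar> * \<bar>S2.ft v\<bar> \<le> 1925 / 1000 * (\<kappa> * m * v\<^sup>2)" .
        have "\<kappa> / 20 * \<bar>dt (v, v)\<bar> \<le> \<kappa> / 20 * (m * v\<^sup>2)" using t ahead(11) by (intro mult_left_mono) auto
        also have "\<dots> = 50 / 1000 * (\<kappa> * m * v\<^sup>2)" by simp
        finally have 2: "\<kappa> / 20 * \<bar>dt (v, v)\<bar> \<le> 50 / 1000 * (\<kappa> * m * v\<^sup>2)" .
        have "0 \<le> \<kappa> * m * v\<^sup>2" using ahead(11) m0 by simp
        moreover have "2 * \<kappa> * m * v\<^sup>2 = 2 * (\<kappa> * m * v\<^sup>2)" by simp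
        ultimately show ?thesis using 1 2 by linarith
      qed
      show "\<forall>v. 0 < v \<longrightarrow> v \<le> s \<longrightarrow> \<bar>dt (v, v)\<bar> \<le> 9 / 10 * m * v\<^sup>2"
      proof (intro allI impI)
        fix v assume v: "0 < v" "v \<le> s"
        have veps: "v < eps" using v s by simp
        have ft0: "S1.ft 0 = 0" "S2.ft 0 = 0" using S1.derivs_0 S2.derivs_0 by (simp_all add: S1.ft_def S2.ft_def)
        have gt0: "S1.gt 0 = 0" "S2.gt 0 = 0"
        proof -
          have "(0, 0) \<in> T_dom eps" using S1.eps by (simp add: T_dom_def)
          then show "S1.gt 0 = 0" "S2.gt 0 = 0"
            using S1.derivs_0 S2.derivs_0 S1.sol_facts(9)[of "(0, 0)"] S2.sol_facts(9)[of "(0, 0)"]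
            by (simp_all add: S1.gt_def S2.gt_def)
        qed
        have "\<bar>(rf1 (v, v) - rf2 (v, v) - S1.Vs v * (tf1 (v, v) - tf2 (v, v))) - (rf1 (0, 0) - rf2 (0, 0) - S1.Vs 0 * (tf1 (0, 0) - tf2 (0, 0)))\<bar>
           \<le> 2 / 3 * \<kappa> * m * v ^ 3 - 2 / 3 * \<kappa> * m * 0 ^ 3"
        proof (rule transport_bound[where ?x1.0 = "\<lambda>x. rf1 (x, x)" and ?x2.0 = "\<lambda>x. rf2 (x, x)" and ?t1.0 = "\<lambda>x. tf1 (x, x)" and ?t2.0 = "\<lambda>x. tf2 (x, x)"
          and ?c1.0 = "S1.Vs" and ?c2.0 = "S2.Vs" and t1' = "S1.ft" and t2' = "S2.ft" and L = "\<kappa> / 20"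
          and G = "\<lambda>x. 2 / 3 * \<kappa> * m * x ^ 3" and G' = "\<lambda>x. 2 * \<kappa> * m * x\<^sup>2"])
          fix x assume x: "x \<in> {0..v}"
          note td = T_diag[OF S1.eps _ veps x]
          show "((\<lambda>x. tf1 (x, x)) has_real_derivative S1.ft x) (at x within {0..v})" unfolding S1.ft_def by (rule td[OF S1.sol_facts(1)])
          show "((\<lambda>x. tf2 (x, x)) has_real_derivative S2.ft x) (at x within {0..v})" unfolding S2.ft_def by (rule td[OF S2.sol_facts(1)])
          have g: "S1.gt x = S1.Vs x * S1.ft x" "S2.gt x = S2.Vs x * S2.ft x"
            using elim(6,7) x v ft0 gt0 by (cases "x = 0"; simp)+
          show "((\<lambda>x. rf1 (x, x)) has_real_derivative S1.Vs x * S1.ft x) (at x within {0..v})"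
            unfolding g[symmetric] S1.gt_def by (rule td[OF S1.sol_facts(2)])
          show "((\<lambda>x. rf2 (x, x)) has_real_derivative S2.Vs x * S2.ft x) (at x within {0..v})"
            unfolding g[symmetric] S2.gt_def by (rule td[OF S2.sol_facts(2)])
          show "((\<lambda>x. 2 / 3 * \<kappa> * m * x ^ 3) has_real_derivative 2 * \<kappa> * m * x\<^sup>2) (at x within {0..v})"
            by (auto intro!: derivative_eq_intros)
          show "\<bar>S1.Vs x - S2.Vs x\<bar> * \<bar>S2.ft x\<bar> + \<kappa> / 20 * \<bar>tf1 (x, x) - tf2 (x, x)\<bar> \<le> 2 * \<kappa> * m * x\<^sup>2"
            using speed[of x] x v ft0 S1.tf_0 S2.tf_0 unfolding dt_def by (cases "x = 0") auto
        next
          fix x x' assume "x \<in> {0..v}" "x' \<in> {0..v}"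
          then show "\<bar>S1.Vs x' - S1.Vs x\<bar> \<le> \<kappa> / 20 * \<bar>x' - x\<bar>" using elim(9) v by simp
        qed (use v in auto)
        then have phi: "\<bar>dr (v, v) - S1.Vs v * dt (v, v)\<bar> \<le> 2 / 3 * (\<kappa> * m * v ^ 3)"
          using d_0 unfolding dr_def dt_def by simp
        \<comment> \<open>\<Delta>r is known in two ways: up to \<open>Rd\<close> it is
          \<open>c_plus\<close> \<Delta>t by the interior, and up to the integral just estimated it
          is V \<Delta>t by the shock. Eliminating it isolates \<Delta>t with the factor
          \<open>c_plus\<close> - V, which is about \<kappa> v.\<close>
        have "(S1.cpT (v, v) - S1.Vs v) * dt (v, v) = (dr (v, v) - S1.Vs v * dt (v, v)) - Rd (v, v)"
          by (simp add: Rd_def algebra_simps)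
        moreover have "\<kappa> / 100 * m * v ^ 3 = 1 / 100 * (\<kappa> * m * v ^ 3)" by simp
        ultimately have 1: "\<bar>(S1.cpT (v, v) - S1.Vs v) * dt (v, v)\<bar> \<le> 68 / 100 * (\<kappa> * m * v ^ 3)"
          using phi R[OF v] by linarith
        have "9 / 10 * \<kappa> * v \<le> \<bar>S1.cpT (v, v) - S1.Vs v\<bar>" using elim(8) v by (meson abs_ge_self order_trans)
        then have "9 / 10 * \<kappa> * v * \<bar>dt (v, v)\<bar> \<le> 68 / 100 * (\<kappa> * m * v ^ 3)"
          using 1 unfolding abs_mult by (meson abs_ge_zero mult_right_mono order_trans)
        \<comment> \<open>The actual factor is 68/90, made up of 2/3 + 1/100 and division by 9/10
          from \<open>speed_gap\<close>; any number below 1 would do.\<close>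
        also have "\<dots> \<le> 9 / 10 * \<kappa> * v * (9 / 10 * m * v\<^sup>2)"
        proof -
          have "9 / 10 * \<kappa> * v * (9 / 10 * m * v\<^sup>2) = 81 / 100 * (\<kappa> * m * v ^ 3)" by (simp add: power2_eq_square power3_eq_cube)
          moreover have "0 \<le> \<kappa> * m * v ^ 3" using ahead(11) m0 v by simp
          ultimately show ?thesis by linarith
        qed
        finally show "\<bar>dt (v, v)\<bar> \<le> 9 / 10 * m * v\<^sup>2"
          using ahead(11) v by (simp only: mult_le_cancel_left_pos mult_pos_pos)
      qed
    qed
  qed
qed

text \<open>The best constant m is the maximum of |\<open>fh1\<close> - \<open>fh2\<close>|,
  attained at some \<open>v0\<close>. If \<open>v0\<close> = 0 it vanishes because both leading
  coefficients are \<Lambda> / (6 \<kappa>^2); if \<open>v0\<close> > 0 the contraction gives m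
  \<le> 9/10 m. With m = 0 the interior differences vanish by \<open>interior_bound\<close>, and
  then \<Delta>z by \<open>dz_bound\<close>.\<close>

lemma uniqueness:
  "\<exists>\<epsilon>0. 0 < \<epsilon>0 \<and> \<epsilon>0 \<le> eps \<and> (\<forall>x\<in>T_dom \<epsilon>0. tf1 x = tf2 x \<and> rf1 x = rf2 x \<and> af1 x = af2 x \<and> bf1 x = bf2 x) \<and>
     (\<forall>v\<in>{0..\<epsilon>0}. zf1 v = zf2 v)"
proof -
  obtain Cn where Cn: "0 < Cn" "\<forall>\<^sub>F s in at_right 0. \<forall>m. (\<forall>v. 0 < v \<longrightarrow> v \<le> s \<longrightarrow> \<bar>dt (v, v)\<bar> \<le> m * v\<^sup>2) \<longrightarrow> hyp s (Cn * m * s\<^sup>2)"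
    using interior_bound by blast
  have "\<forall>\<^sub>F s in at_right 0. 0 < s \<and> s \<le> eps \<and> hyp s 0 \<and> (\<forall>v. 0 < v \<longrightarrow> v \<le> s \<longrightarrow> dz v = 0)"
    using contraction Cn(2) eventually_at_right_all_le[OF dz_bound] eventually_at_right_real[OF S1.eps]
  proof eventually_elim
    case (elim s)
    have s: "0 < s" "s < eps" using elim(4) by auto
    have dtv: "dt (v, v) = v\<^sup>2 * (fh1 v - fh2 v)" if "v \<in> {0..eps}" for v
      using S1.cusp_facts(8)[OF that] S2.cusp_facts(8)[OF that] by (simp add: dt_def algebra_simps)
    have "continuous_on {0..eps} fh1" "continuous_on {0..eps} fh2"
      using C1_interval_props S1.cusp_facts(2) S2.cusp_facts(2) by metis+
    then have "continuous_on {0..s} (\<lambda>v. \<bar>fh1 v - fh2 v\<bar>)"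
      using s by (intro continuous_intros continuous_on_subset[of "{0..eps}" _ "{0..s}"]) auto
    then obtain v0 where v0: "v0 \<in> {0..s}" "\<And>v. v \<in> {0..s} \<Longrightarrow> \<bar>fh1 v - fh2 v\<bar> \<le> \<bar>fh1 v0 - fh2 v0\<bar>"
      using continuous_attains_sup[OF compact_Icc, of 0 s "\<lambda>v. \<bar>fh1 v - fh2 v\<bar>"] s by auto
    define m where "m = \<bar>fh1 v0 - fh2 v0\<bar>"
    have m: "\<bar>dt (v, v)\<bar> \<le> m * v\<^sup>2" if "0 < v" "v \<le> s" for v
    proof -
      have "v\<^sup>2 * \<bar>fh1 v - fh2 v\<bar> \<le> v\<^sup>2 * m" unfolding m_def using v0(2)[of v] that by (intro mult_left_mono) auto
      then show ?thesis using dtv[of v] that s by (simp add: abs_mult mult.commute)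
    qed
    have "m = 0"
    proof (cases "v0 = 0")
      case True
      then show ?thesis using coeffs_eq by (simp add: m_def S1.f0_def S2.f0_def)
    next
      case False
      then have v: "0 < v0" "v0 \<le> s" using v0(1) by auto
      have "\<bar>dt (v0, v0)\<bar> \<le> 9 / 10 * m * v0\<^sup>2" using elim(1) m v by blast
      moreover have "\<bar>dt (v0, v0)\<bar> = m * v0\<^sup>2" using dtv[of v0] v s by (simp add: m_def abs_mult mult.commute)
      ultimately have "m * v0\<^sup>2 \<le> 9 / 10 * m * v0\<^sup>2" by linarith
      then have "m * v0\<^sup>2 \<le> 9 / 10 * m * v0\<^sup>2" "0 < v0\<^sup>2" using v by simp_all
      then have "m \<le> 9 / 10 * m" by (simp only: mult_le_cancel_right_pos)
      moreover have "0 \<le> m" by (simp add: m_def)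
      ultimately show ?thesis by linarith
    qed
    have h0: "hyp s 0" using elim(2)[rule_format, of m] m \<open>m = 0\<close> by simp
    moreover have "dz v = 0" if "0 < v" "v \<le> s" for v
    proof -
      have "(v, v) \<in> T_dom s" using that by (simp add: T_dom_def)
      then have "dt (v, v) = 0" "dr (v, v) = 0" using h0 unfolding hyp_def by auto
      then have "\<bar>dz v\<bar> \<le> 0" using elim(3)[rule_format, OF that] by (simp add: Rd_def)
      then show ?thesis by simp
    qed
    ultimately show ?case using s by auto
  qed
  then obtain s where s: "0 < s" "s \<le> eps" "hyp s 0" "\<And>v. 0 < v \<Longrightarrow> v \<le> s \<Longrightarrow> dz v = 0"
    using eventually_happens'[OF trivial_limit_at_right_real] by blast
  have "tf1 x = tf2 x \<and> rf1 x = rf2 x \<and> af1 x = af2 x \<and> bf1 x = bf2 x" if "x \<in> T_dom s" for x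
    using s(3) that unfolding hyp_def S_def by auto
  moreover have "zf1 v = zf2 v" if "v \<in> {0..s}" for v
    using s(4)[of v] that S1.zf_0 S2.zf_0 by (cases "v = 0") (auto simp: dz_def)
  ultimately show ?thesis using s(1,2) by blast
qed

end

theorem theorem6p1:
  fixes F :: fluid and A :: ahead and \<epsilon> :: real
    and t1 r1 \<alpha>1 \<beta>1 t2 r2 \<alpha>2 \<beta>2 :: "real \<times> real \<Rightarrow> real"
    and z1 y1 fh1 gh1 \<alpha>h1 \<beta>h1 Vh1 z2 y2 fh2 gh2 \<alpha>h2 \<beta>h2 Vh2 :: "real \<Rightarrow> real"
  assumes "barotropic F"
    and "state_ahead F A"
    and "0 < \<epsilon>"
    and "fb_solution F A \<epsilon> t1 r1 \<alpha>1 \<beta>1 z1"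
    and "fb_solution F A \<epsilon> t2 r2 \<alpha>2 \<beta>2 z2"
    and "cusp_expansion F A \<epsilon> t1 r1 \<alpha>1 \<beta>1 z1 y1 fh1 gh1 \<alpha>h1 \<beta>h1 Vh1"
    and "cusp_expansion F A \<epsilon> t2 r2 \<alpha>2 \<beta>2 z2 y2 fh2 gh2 \<alpha>h2 \<beta>h2 Vh2"
  shows "\<exists>\<epsilon>0. 0 < \<epsilon>0 \<and> \<epsilon>0 \<le> \<epsilon> \<and>
    (\<forall>x\<in>T_dom \<epsilon>0. t1 x = t2 x \<and> r1 x = r2 x \<and> \<alpha>1 x = \<alpha>2 x \<and> \<beta>1 x = \<beta>2 x) \<and>
    (\<forall>v\<in>{0..\<epsilon>0}. z1 v = z2 v)"
proof -
  interpret two_cusp_solutions F A \<epsilon> t1 r1 \<alpha>1 \<beta>1 z1 y1 fh1 gh1 \<alpha>h1 \<beta>h1 Vh1 t2 r2 \<alpha>2 \<beta>2 z2 y2 fh2 gh2 \<alpha>h2 \<beta>h2 Vh2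
    by unfold_locales (use assms in auto)
  show ?thesis by (rule uniqueness)
qed

end
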